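(* Let $n,k\in\mathbb{N}$, $\epsilon\ge0$, and let $U:\mathbb{R}^{nk}\to\mathbb{R}$ be the mean-field potential $$U(x)=\sum_{i=1}^n\Big(V(x^i)+\frac{\epsilon}{n}\sum_{\ell=1,\ell\ne i}^nW(x^i-x^\ell)\Big),\quad x=(x^1,\dots,x^n),\ x^i\in\mathbb{R}^k,$$ where $V,W\in C^3(\mathbb{R}^k)$ satisfy: $V$ has a local minimum at $0$ and $V(0)=0$; $L=\sup\|D^2V\|<\infty$, $\tilde L=\sup\|D^2W\|<\infty$, $L_H=\sup\|D^3V\|<\infty$, $\tilde L_H=\sup\|D^3W\|<\infty$; and there are $\mathcal R\in[0,\infty)$, $K\in(0,\infty)$ with $(a-b)\cdot(\nabla V(a)-\nabla V(b))\ge K|a-b|^2$ for all $a,b\in\mathbb{R}^k$ with $|a-b|\ge\mathcal R$. Let $T>0$ and $h_1\ge0$ satisfy $$L(T+h_1)^2\le\tfrac35\min\Big(\tfrac{3K}{10L},\tfrac14,\tfrac{3K}{256\cdot5\cdot2^6L\mathcal R^2(L+K)}\Big),\qquad h_1\le\frac{KT}{525L+235K},$$ $$|\epsilon|\tilde L<\min\Big(\tfrac K6,\ \tfrac12\big(\tfrac{K}{36\cdot149}\big)^2\big(T+8\mathcal R\sqrt{\tfrac{L+K}{K}}\big)^2\exp\big(-40\tfrac{\mathcal R}{T}\sqrt{\tfrac{L+K}{K}}\big)\Big),$$ and let $h\in(0,h_1]$ satisfy $T/h\in\mathbb{N}$ and $(L+4\epsilon\tilde L)(T^2+Th)\le1/6$.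 Let $\tilde\pi$ be the unadjusted Hamiltonian Monte Carlo transition kernel for $U$ with duration $T$ and step size $h$, and $\tilde\mu$ its unique invariant probability measure. Set $$M=\exp\Big(\tfrac52\big(1+\tfrac{4\mathcal R}{T}\sqrt{\tfrac{L+K}{K}}\big)\Big),\qquad c=\tfrac{KT^2}{156}\exp\Big(-10\tfrac{\mathcal R}{T}\sqrt{\tfrac{L+K}{K}}\Big),$$ and $t_{\mathrm{mix}}(\varepsilon,\nu):=\inf\{m\ge0:\mathrm{TV}(\tilde\mu,\nu\tilde\pi^m)\le\varepsilon\}$. Then for any $\varepsilon>0$ and any probability measure $\nu$ on $\mathbb{R}^{nk}$, $$t_{\mathrm{mix}}(\varepsilon,\nu)\ \le\ 2+\frac1c\,\log\left(\frac{3\left(T^{-2}+34\,k\,(L_H+8\epsilon\tilde L_H)^2\,T^4\right)^{1/2}M\,W^1_{\ell_1}(\tilde\mu,\nu)}{2\varepsilon}\right).$$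
   Context: $|\cdot|$ is the Euclidean norm and $\|\cdot\|$ the operator norm of a multilinear form. If $\mathcal R=0$, a fraction with $\mathcal R^2$ in the denominator is read as $+\infty$. Velocity Verlet for $U$ on $\mathbb{R}^d$, $d=nk$: for $h>0$ let $\lfloor t\rfloor_h=\max\{s\in h\mathbb{Z}:s\le t\}$ and $\lceil t\rceil_h=\min\{s\in h\mathbb{Z}:s\ge t\}$. For $(x,v)\in\mathbb{R}^{2d}$, $(\tilde q_t(x,v),\tilde v_t(x,v))_{t\ge0}$ is the continuous, piecewise differentiable solution of $$\tfrac{d}{dt}\tilde q_t=\tilde v_{\lfloor t\rfloor_h}-(t-\lfloor t\rfloor_h)\nabla U(\tilde q_{\lfloor t\rfloor_h}),\qquad \tfrac{d}{dt}\tilde v_t=-\tfrac12\left(\nabla U(\tilde q_{\lfloor t\rfloor_h})+\nabla U(\tilde q_{\lceil t\rceil_h})\right)$$ with $(\tilde q_0,\tilde v_0)=(x,v)$. The unadjusted HMC (uHMC) kernel with duration $T$ and step size $h$ is $\tilde\pi(x,A)=P[\tilde q_T(x,\xi)\in A]$ with $\xi\sim\mathcal N(0,I_d)$. For a probability measure $\nu$, $\nu\tilde\pi(A)=\int\nu(dx)\tilde\pi(x,A)$, and $\tilde\pi^m$ is the $m$-fold composition. $\mathrm{TV}(\nu,\eta)=\sup_A|\nu(A)-\eta(A)|$ over Borel sets $A$. $W^1_{\ell_1}(\nu,\eta)=\inf E[\ell_1(X,Y)]$ over all couplings $(X,Y)$ of $\nu,\eta$ (possibly $+\infty$), with $\ell_1(x,y)=\sum_{i=1}^n|x^i-y^i|$.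 Known from earlier work (Bou-Rabee and Schuh 2020), under the stated conditions on $V,W,T,\epsilon,h_1$ and for $h\in[0,h_1]$: $W^1_{\ell_1}(\nu\tilde\pi^m,\eta\tilde\pi^m)\le Me^{-cm}W^1_{\ell_1}(\nu,\eta)$ for all probability measures $\nu,\eta$ on $\mathbb{R}^{nk}$ and all $m\ge0$, with the constants $M$ and $c$ of the claim; in particular $\tilde\pi$ has a unique invariant probability measure.
   Formalization: The bound proved is the maximum of 1 and the printed right-hand side: as printed the claim fails when the logarithm is very negative (e.g. ν equal to the invariant measure, large ε, or a singular ν with tiny Wasserstein distance), since then the right-hand side is below t_mix. *)

theory Defs
  imports "HOL-Probability.Probability"
begin

definition Dbl :: "('a::real_normed_vector \<Rightarrow> 'b::real_normed_vector) \<Rightarrow> 'a \<Rightarrow> 'a \<Rightarrow>\<^sub>L 'b"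
  where "Dbl f x = Blinfun (frechet_derivative f (at x))"

text \<open>Higher derivatives are iterated, so \<^term>\<open>Dbl (Dbl f) x\<close> has type
  \<^typ>\<open>'a::real_normed_vector \<Rightarrow>\<^sub>L 'a \<Rightarrow>\<^sub>L real\<close>; the norm of such a nested bounded linear map
  is the operator norm of the corresponding multilinear form.\<close>

definition C3 :: "('a::real_normed_vector \<Rightarrow> real) \<Rightarrow> bool"
  where "C3 f \<longleftrightarrow> (\<forall>x. f differentiable at x) \<and> (\<forall>x. Dbl f differentiable at x) \<and>
    (\<forall>x. Dbl (Dbl f) differentiable at x) \<and> continuous_on UNIV (Dbl (Dbl (Dbl f)))"

definition grad :: "('a::real_inner \<Rightarrow> real) \<Rightarrow> 'a \<Rightarrow> 'a"
  where "grad f x = (THE D. GDERIV f x :> D)"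

definition mean_field_potential ::
  "real \<Rightarrow> (real^'k \<Rightarrow> real) \<Rightarrow> (real^'k \<Rightarrow> real) \<Rightarrow> (real^'k)^'n \<Rightarrow> real"
  where "mean_field_potential \<epsilon> V W x =
    (\<Sum>i\<in>UNIV. V (x$i) + \<epsilon> / real CARD('n) * (\<Sum>l\<in>UNIV - {i}. W (x$i - x$l)))"

definition grid_floor :: "real \<Rightarrow> real \<Rightarrow> real"
  where "grid_floor h t = h * of_int \<lfloor>t / h\<rfloor>"

definition grid_ceiling :: "real \<Rightarrow> real \<Rightarrow> real"
  where "grid_ceiling h t = h * of_int \<lceil>t / h\<rceil>"

text \<open>Being piecewise differentiable means that the differential equation holds off the grid.\<close>

definition verlet_solution ::
  "('a::euclidean_space \<Rightarrow> real) \<Rightarrow> real \<Rightarrow> 'a \<Rightarrow> 'a \<Rightarrow> (real \<Rightarrow> 'a) \<Rightarrow> (real \<Rightarrow> 'a) \<Rightarrow> bool"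
  where "verlet_solution U h x v q p \<longleftrightarrow>
    continuous_on {0..} q \<and> continuous_on {0..} p \<and> q 0 = x \<and> p 0 = v \<and>
    (\<forall>t>0. t / h \<notin> \<int> \<longrightarrow>
      (q has_vector_derivative
        (p (grid_floor h t) - (t - grid_floor h t) *\<^sub>R grad U (q (grid_floor h t)))) (at t) \<and>
      (p has_vector_derivative
        (- (1/2) *\<^sub>R (grad U (q (grid_floor h t)) + grad U (q (grid_ceiling h t))))) (at t))"

text \<open>A solution is unique on \<open>t \<ge> 0\<close> only, hence the description of its value at time \<open>t\<close>
  rather than of the solution as a function on the whole line.\<close>

definition verlet_position ::
  "('a::euclidean_space \<Rightarrow> real) \<Rightarrow> real \<Rightarrow> 'a \<Rightarrow> 'a \<Rightarrow> real \<Rightarrow> 'a"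
  where "verlet_position U h x v t = (THE y. \<exists>q p. verlet_solution U h x v q p \<and> y = q t)"

definition std_gaussian :: "'a::euclidean_space measure"
  where "std_gaussian = density lborel (\<lambda>v. ennreal (\<Prod>b\<in>Basis. std_normal_density (v \<bullet> b)))"

definition uhmc_kernel :: "('a::euclidean_space \<Rightarrow> real) \<Rightarrow> real \<Rightarrow> real \<Rightarrow> 'a \<Rightarrow> 'a measure"
  where "uhmc_kernel U T h x = distr std_gaussian borel (\<lambda>\<xi>. verlet_position U h x \<xi> T)"

primrec kernel_power ::
  "('a::topological_space \<Rightarrow> 'a measure) \<Rightarrow> nat \<Rightarrow> 'a \<Rightarrow> 'a measure"
  where
    "kernel_power \<kappa> 0 = (\<lambda>x. return borel x)"
  | "kernel_power \<kappa> (Suc m) = (\<lambda>x. kernel_power \<kappa> m x \<bind> \<kappa>)"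

definition borel_prob :: "'a::topological_space measure \<Rightarrow> bool"
  where "borel_prob \<nu> \<longleftrightarrow> prob_space \<nu> \<and> sets \<nu> = sets borel"

definition invariant_prob :: "('a::topological_space \<Rightarrow> 'a measure) \<Rightarrow> 'a measure \<Rightarrow> bool"
  where "invariant_prob \<kappa> \<mu> \<longleftrightarrow> borel_prob \<mu> \<and> \<mu> \<bind> \<kappa> = \<mu>"

definition TV :: "'a::topological_space measure \<Rightarrow> 'a measure \<Rightarrow> real"
  where "TV \<nu> \<eta> = (SUP A\<in>sets borel. \<bar>measure \<nu> A - measure \<eta> A\<bar>)"

definition couplings ::
  "'a::topological_space measure \<Rightarrow> 'a measure \<Rightarrow> ('a \<times> 'a) measure set"
  where "couplings \<nu> \<eta> = {\<gamma>. prob_space \<gamma> \<and> sets \<gamma> = sets (borel \<Otimes>\<^sub>M borel) \<and>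
    distr \<gamma> borel fst = \<nu> \<and> distr \<gamma> borel snd = \<eta>}"

definition l1_dist :: "('b::real_normed_vector)^'n \<Rightarrow> 'b^'n \<Rightarrow> real"
  where "l1_dist x y = (\<Sum>i\<in>UNIV. norm (x$i - y$i))"

definition W1 :: "((real^'k)^'n) measure \<Rightarrow> ((real^'k)^'n) measure \<Rightarrow> ennreal"
  where "W1 \<nu> \<eta> = (INF \<gamma>\<in>couplings \<nu> \<eta>. \<integral>\<^sup>+ (x, y). ennreal (l1_dist x y) \<partial>\<gamma>)"

text \<open>The infimum over an empty set of times is \<open>\<infinity>\<close>.\<close>

definition t_mix ::
  "('a::topological_space \<Rightarrow> 'a measure) \<Rightarrow> 'a measure \<Rightarrow> real \<Rightarrow> 'a measure \<Rightarrow> enat"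
  where "t_mix \<kappa> \<mu> \<delta> \<nu> = Inf {enat m |m. TV \<mu> (\<nu> \<bind> kernel_power \<kappa> m) \<le> \<delta>}"

definition ln_ext :: "ennreal \<Rightarrow> ereal"
  where "ln_ext a = (if a = 0 then -\<infinity> else if a = \<top> then \<infinity> else ereal (ln (enn2real a)))"

end

theory Submission
  imports Defs
begin

text \<open>
  Write \<open>P \<phi>(x) = E \<phi>(q(x, \<xi>))\<close> for the action of the kernel on bounded functions. Only the easy half of
  Kantorovich duality is used: if \<open>P\<close> maps indicators to functions that are Lipschitz for \<open>\<ell>\<^sub>1\<close>
  and contracts the Lipschitz constant with respect to a cost equivalent to \<open>\<ell>\<^sub>1\<close>, then integrating
  \<open>P\<^sup>m P 1\<^sub>A(x) - P\<^sup>m P 1\<^sub>A(y)\<close> against an arbitrary coupling of \<open>\<mu>\<close> and \<open>\<nu>\<close> gives the bound.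

  Regularisation: the derivative of \<open>E f(q(x + s z, \<xi>))\<close> in \<open>s\<close> is \<open>E f(q) \<delta>u\<close>, where the velocity field
  \<open>u\<close> compensates the shift \<open>z\<close> (a discrete Jacobi field vanishing at the final time) and \<open>\<delta>\<close> is the
  Gaussian divergence; moreover \<open>E (\<delta>u)\<^sup>2 = E |u|\<^sup>2 + E tr (Du Du)\<close>.

  Contraction: the cost \<open>\<Sum>\<^sub>i f(|x\<^sup>i - y\<^sup>i|)\<close> is additive, so it suffices to move one particle.
  If it is moved far, equal velocities and the convexity of \<open>V\<close> contract; otherwise a reflection
  coupling of its velocity does, because \<open>f\<close> is concave. All other effects, including those of the
  interaction, are of lower order and are controlled by a discrete Volterra inequality.\<close>

section \<open>Gaussian measures\<close>

text \<open>What shapes the proof is that no constant may depend on the number n of particles. The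
  divergence of \<open>u\<close> has n k terms, and bounding it term by term would cost a power of
  n; its second moment involves only the norm of \<open>u\<close> and the trace of Du Du, and the
  factor 1/n in the interaction keeps the Hilbert-Schmidt norm of Du of order sqrt k times
  \<open>l1 z\<close>. The potential is C3, so \<open>u\<close> is only C1; the second moment
  formula therefore has to be obtained without second derivatives of \<open>u\<close>. On the side
  of test functions a coupling is needed only for one pair of starting points and one step, as an
  identity between Gaussian integrals; no measurable family of couplings is ever composed. Of m + 1
  steps one is spent on regularisation, at the price of a factor 1/\<beta> = M for passing from
  \<open>l1\<close> to the concave cost, and m on contraction. The extra step and the rounding of m
  produce the summand 2, and the extra step alone the maximum with 1. The recurring factor 12/11
  solves s = 1 + s/12, which is the Volterra inequality under \<Lambda> T^2 \<le> 1/6.\<close>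

lemma nn_integral_lborel_shift:
  fixes g :: "'a::euclidean_space \<Rightarrow> ennreal"
  assumes [measurable]: "g \<in> borel_measurable borel"
  shows "(\<integral>\<^sup>+y. g (y + c) \<partial>lborel) = (\<integral>\<^sup>+y. g y \<partial>lborel)"
proof -
  have "(\<integral>\<^sup>+y. g y \<partial>lborel) = (\<integral>\<^sup>+y. g y \<partial>distr lborel borel ((+) c))"
    by (simp add: lborel_distr_plus)
  also have "\<dots> = (\<integral>\<^sup>+y. g (c + y) \<partial>lborel)"
    by (rule nn_integral_distr) auto
  finally show ?thesis by (simp add: add.commute)
qed

text \<open>Fubini and translation invariance give \<open>\<lambda>(B) \<lambda>(f\<inverse> A) = \<lambda>(A) \<lambda>(B)\<close> for the unit ball \<open>B\<close>.\<close>

lemma lborel_distr_linear_involution: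
  fixes f :: "'a::euclidean_space \<Rightarrow> 'a"
  assumes lin: "linear f" and inv: "\<And>x. f (f x) = x" and nrm: "\<And>x. norm (f x) = norm x"
  shows "distr lborel borel f = lborel"
proof (rule measure_eqI)
  have fc: "continuous_on UNIV f"
    by (rule linear_continuous_on) (use lin linear_conv_bounded_linear in auto)
  have fm[measurable]: "f \<in> borel_measurable borel"
    using fc by (rule borel_measurable_continuous_onI)
  define B :: "'a set" where "B = ball 0 1"
  have Bm[measurable]: "B \<in> sets borel" by (simp add: B_def)
  have fB: "- f x \<in> B \<longleftrightarrow> x \<in> B" for x by (simp add: B_def nrm)
  fix A assume "A \<in> sets (distr lborel borel f)"
  then have A[measurable]: "A \<in> sets borel" by simp
  have "emeasure lborel B * emeasure (distr lborel borel f) A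
      = (\<integral>\<^sup>+x. (\<integral>\<^sup>+y. indicator A (f x) * indicator B y \<partial>lborel) \<partial>lborel)"
  proof -
    have "emeasure (distr lborel borel f) A = (\<integral>\<^sup>+x. indicator A x \<partial>distr lborel borel f)"
      by simp
    also have "\<dots> = (\<integral>\<^sup>+x. indicator A (f x) \<partial>lborel)"
      by (subst nn_integral_distr) auto
    finally show ?thesis
      by (simp add: nn_integral_cmult nn_integral_multc mult.commute)
  qed
  also have "\<dots> = (\<integral>\<^sup>+x. (\<integral>\<^sup>+y. indicator A (f x) * indicator B (y - f x) \<partial>lborel) \<partial>lborel)"
  proof (rule nn_integral_cong)
    fix x
    show "(\<integral>\<^sup>+y. indicator A (f x) * indicator B y \<partial>lborel)
      = (\<integral>\<^sup>+y. indicator A (f x) * indicator B (y - f x) \<partial>lborel)"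
      using nn_integral_lborel_shift[of "\<lambda>y. indicator A (f x) * indicator B y" "- f x"] by simp
  qed
  also have "\<dots> = (\<integral>\<^sup>+y. (\<integral>\<^sup>+x. indicator A (f x) * indicator B (y - f x) \<partial>lborel) \<partial>lborel)"
    by (rule lborel_pair.Fubini'[symmetric]) (simp add: split_beta')
  also have "\<dots> = (\<integral>\<^sup>+y. (\<integral>\<^sup>+x. indicator A (f x + y) * indicator B x \<partial>lborel) \<partial>lborel)"
  proof (rule nn_integral_cong)
    fix y
    \<comment> \<open>Translation by \<open>f y\<close> is the right substitution: f (x + f y) = f x
      + y because f is an involution. The second factor becomes the condition that - f x lies in B,
      which for a centred ball and an isometry means that x does.\<close>
    have "(\<integral>\<^sup>+x. indicator A (f x) * indicator B (y - f x) \<partial>lborel)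
        = (\<integral>\<^sup>+x. indicator A (f (x + f y)) * indicator B (y - f (x + f y)) \<partial>lborel)"
      by (rule nn_integral_lborel_shift[symmetric, of "\<lambda>x. indicator A (f x) * indicator B (y - f x)"]) simp
    also have "\<dots> = (\<integral>\<^sup>+x. indicator A (f x + y) * indicator B x \<partial>lborel)"
      by (intro nn_integral_cong) (simp add: linear_add[OF lin] inv indicator_def fB)
    finally show "(\<integral>\<^sup>+x. indicator A (f x) * indicator B (y - f x) \<partial>lborel) =
      (\<integral>\<^sup>+x. indicator A (f x + y) * indicator B x \<partial>lborel)" .
  qed
  also have "\<dots> = (\<integral>\<^sup>+x. (\<integral>\<^sup>+y. indicator A (f x + y) * indicator B x \<partial>lborel) \<partial>lborel)"
    by (rule lborel_pair.Fubini') (simp add: split_beta')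
  also have "\<dots> = (\<integral>\<^sup>+x. emeasure lborel A * indicator B x \<partial>lborel)"
  proof (rule nn_integral_cong)
    fix x
    have "(\<integral>\<^sup>+y. indicator A (y + f x) \<partial>lborel) = emeasure lborel A"
      using nn_integral_lborel_shift[of "indicator A" "f x"] by simp
    then show "(\<integral>\<^sup>+y. indicator A (f x + y) * indicator B x \<partial>lborel) = emeasure lborel A * indicator B x"
      by (simp add: nn_integral_multc add.commute)
  qed
  also have "\<dots> = emeasure lborel B * emeasure lborel A"
    by (subst nn_integral_cmult) (simp_all add: mult.commute)
  finally have eq: "emeasure lborel B * emeasure (distr lborel borel f) A
    = emeasure lborel B * emeasure lborel A" .
  have "emeasure lborel B \<noteq> \<infinity>"
    using emeasure_bounded_finite[of B] by (simp add: B_def)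
  moreover have "emeasure lborel B \<noteq> 0"
    using content_ball_pos[of 1 "0::'a"] by (auto simp: B_def measure_def)
  ultimately show "emeasure (distr lborel borel f) A = emeasure lborel A"
    using eq by (simp add: ennreal_mult_cancel_left)
qed simp

section \<open>Invariance of Lebesgue measure under hyperplane reflections\<close>

definition reflect :: "'a::euclidean_space \<Rightarrow> 'a \<Rightarrow> 'a"
  where "reflect e x = x - (2 * (x \<bullet> e)) *\<^sub>R e"

lemma reflect_linear: "linear (reflect e)"
  by (rule linearI) (auto simp: reflect_def algebra_simps)

lemma reflect_reflect: "norm e = 1 \<Longrightarrow> reflect e (reflect e x) = x"
  by (simp add: reflect_def algebra_simps norm_eq_1)

lemma norm_reflect: 
  assumes "norm e = 1" shows "norm (reflect e x) = norm x"
proof -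
  have "reflect e x \<bullet> reflect e x = x \<bullet> x"
    using assms by (simp add: reflect_def algebra_simps norm_eq_1 inner_commute)
  then show ?thesis by (simp add: norm_eq_sqrt_inner)
qed

lemma measurable_reflect[measurable]: "reflect e \<in> borel_measurable borel"
  unfolding reflect_def by measurable

lemma lborel_reflect: "norm e = 1 \<Longrightarrow> distr lborel borel (reflect e) = lborel"
  by (rule lborel_distr_linear_involution)
    (simp_all add: reflect_linear reflect_reflect norm_reflect)

section \<open>Density, exponential moments and symmetries of the standard Gaussian\<close>

abbreviation gauss_density :: "'a::euclidean_space \<Rightarrow> real"
  where "gauss_density v \<equiv> (\<Prod>b\<in>Basis. std_normal_density (v \<bullet> b))"

lemma gauss_density_eq:
  fixes v :: "'a::euclidean_space"
  shows "gauss_density v = (1 / sqrt (2 * pi)) ^ DIM('a) * exp (- (v \<bullet> v) / 2)"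
proof -
  have "(\<Prod>b\<in>(Basis::'a set). exp (- (v \<bullet> b)\<^sup>2 / 2)) = exp (\<Sum>b\<in>Basis. - (v \<bullet> b)\<^sup>2 / 2)"
    by (simp add: exp_sum)
  also have "(\<Sum>b\<in>Basis. - (v \<bullet> b)\<^sup>2 / 2) = - (v \<bullet> v) / 2"
    by (subst euclidean_inner) (simp add: sum_negf sum_divide_distrib power2_eq_square)
  finally show ?thesis
    by (simp add: std_normal_density_def prod.distrib power_one_over prod_dividef)
qed

lemma gauss_density_pos: "gauss_density v > 0"
  by (simp add: gauss_density_eq)

lemma gauss_density_nonneg[simp]: "gauss_density v \<ge> 0"
  using gauss_density_pos[of v] by simp

lemma sets_std_gaussian[simp, measurable_cong]: "sets std_gaussian = sets borel"
  by (simp add: std_gaussian_def)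

lemma space_std_gaussian[simp]: "space std_gaussian = UNIV"
  by (simp add: std_gaussian_def)

lemma nn_integral_std_gaussian:
  assumes [measurable]: "F \<in> borel_measurable borel"
  shows "(\<integral>\<^sup>+v. F v \<partial>std_gaussian) = (\<integral>\<^sup>+v. ennreal (gauss_density v) * F v \<partial>lborel)"
  unfolding std_gaussian_def by (subst nn_integral_density) auto

lemma nn_integral_std_gaussian_prod:
  fixes f :: "'a::euclidean_space \<Rightarrow> real \<Rightarrow> real"
  assumes [measurable]: "\<And>b. b \<in> Basis \<Longrightarrow> f b \<in> borel_measurable borel"
    and nn: "\<And>b x. b \<in> Basis \<Longrightarrow> 0 \<le> f b x"
  shows "(\<integral>\<^sup>+v. ennreal (\<Prod>b\<in>Basis. f b (v \<bullet> b)) \<partial>std_gaussian)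
    = (\<Prod>b\<in>Basis. \<integral>\<^sup>+x. ennreal (std_normal_density x * f b x) \<partial>lborel)"
proof -
  have "(\<integral>\<^sup>+v. ennreal (\<Prod>b\<in>Basis. f b (v \<bullet> b)) \<partial>std_gaussian)
    = (\<integral>\<^sup>+v. (\<Prod>b\<in>Basis. ennreal (std_normal_density (v \<bullet> b) * f b (v \<bullet> b))) \<partial>lborel)"
    by (subst nn_integral_std_gaussian)
      (auto intro!: nn_integral_cong simp: ennreal_mult[symmetric] prod_nonneg nn prod_ennreal prod.distrib)
  also have "\<dots> = (\<Prod>b\<in>Basis. \<integral>\<^sup>+x. ennreal (std_normal_density x * f b x) \<partial>lborel)"
    by (subst nn_integral_lborel_prod) auto
  finally show ?thesis .
qed

lemma nn_integral_std_normal: "(\<integral>\<^sup>+x. ennreal (std_normal_density x) \<partial>lborel) = 1"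
proof -
  interpret prob_space "density lborel std_normal_density"
    by (rule prob_space_normal_density) simp
  show ?thesis using emeasure_space_1 by (simp add: emeasure_density)
qed

interpretation std_gaussian: prob_space "std_gaussian :: 'a::euclidean_space measure"
proof
  have "emeasure (std_gaussian :: 'a measure) (space std_gaussian) = (\<integral>\<^sup>+(v::'a). ennreal (\<Prod>b\<in>(Basis::'a set). 1) \<partial>std_gaussian)"
    by simp
  also have "\<dots> = 1"
    by (subst nn_integral_std_gaussian_prod) (auto simp: nn_integral_std_normal)
  finally show "emeasure (std_gaussian :: 'a measure) (space std_gaussian) = 1" .
qed

text \<open>Completing the square turns exp (d x) times the standard density into exp (d^2/2) times
  the density centred at d, and exp (c \<bar>x\<bar>) is at most the sum of the exponentials for d =
  c and d = - c.\<close>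

lemma nn_integral_exp_abs_std_normal:
  "(\<integral>\<^sup>+x. ennreal (std_normal_density x * exp (c * \<bar>x\<bar>)) \<partial>lborel) < \<infinity>"
proof -
  have le: "std_normal_density x * exp (c * \<bar>x\<bar>) \<le>
      exp (c\<^sup>2/2) * (normal_density c 1 x + normal_density (-c) 1 x)" for x
  proof -
    have 1: "std_normal_density x * exp (d * x) = exp (d\<^sup>2/2) * normal_density d 1 x" for d
    proof -
      have "- (x\<^sup>2/2) + d * x = d\<^sup>2/2 - (x-d)\<^sup>2/2"
        by (simp add: power2_eq_square field_simps)
      then have "exp (- (x\<^sup>2/2)) * exp (d * x) = exp (d\<^sup>2/2) * exp (- ((x-d)\<^sup>2/2))"
        by (simp flip: exp_add)
      then show ?thesis by (simp add: normal_density_def)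
    qed
    have "exp (c * \<bar>x\<bar>) \<le> exp (c * x) + exp ((-c) * x)"
      by (cases "x \<ge> 0") auto
    then have "std_normal_density x * exp (c * \<bar>x\<bar>) \<le> std_normal_density x * (exp (c * x) + exp ((-c) * x))"
      by (intro mult_left_mono) auto
    also have "\<dots> = exp (c\<^sup>2/2) * (normal_density c 1 x + normal_density (-c) 1 x)"
      using 1[of c] 1[of "-c"] by (simp add: algebra_simps)
    finally show ?thesis .
  qed
  have n1: "(\<integral>\<^sup>+x. ennreal (normal_density d 1 x) \<partial>lborel) = 1" for d
  proof -
    interpret prob_space "density lborel (normal_density d 1)"
      by (rule prob_space_normal_density) simp
    show ?thesis using emeasure_space_1 by (simp add: emeasure_density)
  qed
  have "(\<integral>\<^sup>+x. ennreal (std_normal_density x * exp (c * \<bar>x\<bar>)) \<partial>lborel)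
      \<le> (\<integral>\<^sup>+x. ennreal (exp (c\<^sup>2/2)) * (ennreal (normal_density c 1 x) + ennreal (normal_density (-c) 1 x)) \<partial>lborel)"
    by (intro nn_integral_mono) (use le in \<open>simp add: ennreal_mult[symmetric] ennreal_plus[symmetric] del: ennreal_plus\<close>)
  also have "\<dots> = ennreal (exp (c\<^sup>2/2)) * (1 + 1)"
    by (simp add: nn_integral_cmult nn_integral_add n1)
  also have "\<dots> < \<infinity>" by (simp add: ennreal_mult_less_top)
  finally show ?thesis .
qed

lemma integrable_std_gaussian_exp_norm:
  "integrable std_gaussian (\<lambda>v::'a::euclidean_space. exp (c * norm v))"
proof -
  have le: "exp (c * norm v) \<le> (\<Prod>b\<in>Basis. exp (\<bar>c\<bar> * \<bar>v \<bullet> b\<bar>))" for v :: 'a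
  proof -
    have "c * norm v \<le> \<bar>c\<bar> * (\<Sum>b\<in>Basis. \<bar>v \<bullet> b\<bar>)"
      by (intro mult_mono norm_le_l1) auto
    then show ?thesis
      by (simp flip: exp_sum add: sum_distrib_left)
  qed
  have "(\<integral>\<^sup>+(v::'a). ennreal (exp (c * norm v)) \<partial>std_gaussian) \<le>
      (\<integral>\<^sup>+(v::'a). ennreal (\<Prod>b\<in>Basis. exp (\<bar>c\<bar> * \<bar>v \<bullet> b\<bar>)) \<partial>std_gaussian)"
    by (rule nn_integral_mono, rule ennreal_leI, rule le)
  also have "\<dots> < \<infinity>"
    by (subst nn_integral_std_gaussian_prod[where f="\<lambda>b x. exp (\<bar>c\<bar> * \<bar>x\<bar>)"])
      (use nn_integral_exp_abs_std_normal[of "\<bar>c\<bar>"] in \<open>auto simp: ennreal_prod_eq_top less_top[symmetric] power_eq_top_ennreal\<close>)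
  finally show ?thesis
    by (intro integrableI_bounded) auto
qed

text \<open>At most exponential growth in the norm is the integrability class used throughout: it is
  stable under products, translations and the Cameron-Martin weights below.\<close>

lemma integrable_std_gaussian_exp_bound:
  fixes F :: "'a::euclidean_space \<Rightarrow> real"
  assumes [measurable]: "F \<in> borel_measurable borel" and "\<And>v. \<bar>F v\<bar> \<le> C * exp (c * norm v)"
  shows "integrable std_gaussian F"
proof (rule Bochner_Integration.integrable_bound)
  show "integrable std_gaussian (\<lambda>v::'a. C * exp (c * norm v))"
    by (intro integrable_mult_right integrable_std_gaussian_exp_norm)
  show "AE x in std_gaussian. norm (F x) \<le> norm (C * exp (c * norm x))"
    using assms(2) by (intro AE_I2) (metis abs_ge_self order_trans real_norm_def)
qed simp

text \<open>Cameron-Martin formula: the weight is the ratio of the Gaussian densities at v + w and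
  at v.\<close>

lemma integral_std_gaussian_shift:
  fixes F :: "'a::euclidean_space \<Rightarrow> real"
  assumes [measurable]: "F \<in> borel_measurable borel"
  shows "(\<integral>v. F (v + w) * exp (- (v \<bullet> w) - (w \<bullet> w) / 2) \<partial>std_gaussian) = (\<integral>v. F v \<partial>std_gaussian)"
proof -
  have *: "gauss_density v * exp (- (v \<bullet> w) - (w \<bullet> w) / 2) = gauss_density (v + w)" for v :: 'a
  proof -
    have "exp (- (v \<bullet> v) / 2) * exp (- (v \<bullet> w) - (w \<bullet> w) / 2) = exp (- ((v + w) \<bullet> (v + w)) / 2)"
      unfolding exp_add[symmetric]
      by (rule arg_cong[where f=exp]) (simp add: inner_add_left inner_add_right inner_commute[of w v] field_simps)
    then show ?thesis unfolding gauss_density_eq by (simp add: algebra_simps)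
  qed
  have "(\<integral>v. F (v + w) * exp (- (v \<bullet> w) - (w \<bullet> w) / 2) \<partial>std_gaussian)
      = (\<integral>v. gauss_density v * (F (v + w) * exp (- (v \<bullet> w) - (w \<bullet> w) / 2)) \<partial>lborel)"
    unfolding std_gaussian_def by (subst integral_density) auto
  also have "\<dots> = (\<integral>v. gauss_density (w + v) * F (w + v) \<partial>lborel)"
    by (intro Bochner_Integration.integral_cong refl)
      (simp add: *[symmetric] add.commute mult.assoc mult.left_commute)
  also have "\<dots> = (\<integral>v. gauss_density v * F v \<partial>distr lborel borel ((+) w))"
    by (subst integral_distr) auto
  also have "\<dots> = (\<integral>v. gauss_density v * F v \<partial>lborel)"
    by (simp add: lborel_distr_plus)
  also have "\<dots> = (\<integral>v. F v \<partial>std_gaussian)"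
    unfolding std_gaussian_def by (subst integral_density) auto
  finally show ?thesis .
qed

lemma distr_std_gaussian_reflect:
  fixes e :: "'a::euclidean_space"
  assumes e: "norm e = 1"
  shows "distr std_gaussian borel (reflect e) = std_gaussian"
proof (rule measure_eqI)
  fix A assume "A \<in> sets (distr std_gaussian borel (reflect e))"
  then have A[measurable]: "A \<in> sets borel" by simp
  have d: "gauss_density (reflect e v) = gauss_density v" for v
    using norm_reflect[OF e, of v] by (simp add: gauss_density_eq norm_eq_sqrt_inner)
  have "emeasure (distr std_gaussian borel (reflect e)) A = (\<integral>\<^sup>+v. indicator A (reflect e v) \<partial>std_gaussian)"
    by (subst nn_integral_indicator[symmetric], simp, subst nn_integral_distr) auto
  also have "\<dots> = (\<integral>\<^sup>+v. ennreal (gauss_density (reflect e v)) * indicator A (reflect e v) \<partial>lborel)"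
    by (simp add: nn_integral_std_gaussian d)
  also have "\<dots> = (\<integral>\<^sup>+v. ennreal (gauss_density v) * indicator A v \<partial>distr lborel borel (reflect e))"
    by (subst nn_integral_distr) auto
  also have "\<dots> = emeasure std_gaussian A"
    by (simp add: lborel_reflect[OF e] nn_integral_std_gaussian[symmetric])
  finally show "emeasure (distr std_gaussian borel (reflect e)) A = emeasure std_gaussian A" .
qed simp

lemma integral_std_gaussian_reflect:
  fixes F :: "'a::euclidean_space \<Rightarrow> real"
  assumes "norm e = 1" and [measurable]: "F \<in> borel_measurable borel"
  shows "(\<integral>v. F (reflect e v) \<partial>std_gaussian) = (\<integral>v. F v \<partial>std_gaussian)"
  by (subst (2) distr_std_gaussian_reflect[OF assms(1), symmetric]) (simp add: integral_distr)

lemma distr_std_gaussian_inner_Basis: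
  fixes b :: "'a::euclidean_space"
  assumes b: "b \<in> Basis"
  shows "distr std_gaussian borel (\<lambda>v. v \<bullet> b) = density lborel (\<lambda>x. ennreal (std_normal_density x))"
proof (rule measure_eqI)
  fix A assume "A \<in> sets (distr std_gaussian borel (\<lambda>v. v \<bullet> b))"
  then have A[measurable]: "A \<in> sets borel" by simp
  let ?f = "\<lambda>b' x. if b' = b then indicator A x else (1::real)"
  have "(\<Prod>b'\<in>Basis. ?f b' (v \<bullet> b')) = indicator A (v \<bullet> b)" for v :: 'a
    using b by (simp add: prod.If_cases Int_absorb1)
  then have "emeasure (distr std_gaussian borel (\<lambda>v. v \<bullet> b)) A
      = (\<integral>\<^sup>+v. ennreal (\<Prod>b'\<in>Basis. ?f b' (v \<bullet> b')) \<partial>std_gaussian)"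
    by (subst nn_integral_indicator[symmetric], simp, subst nn_integral_distr)
      (auto intro!: nn_integral_cong simp: indicator_def)
  also have "\<dots> = (\<Prod>b'\<in>Basis. \<integral>\<^sup>+x. ennreal (std_normal_density x * ?f b' x) \<partial>lborel)"
    by (rule nn_integral_std_gaussian_prod) auto
  also have "\<dots> = (\<Prod>b'\<in>Basis. if b' = b then \<integral>\<^sup>+x. ennreal (std_normal_density x * indicator A x) \<partial>lborel else 1)"
    by (intro prod.cong refl) (simp add: nn_integral_std_normal)
  also have "\<dots> = (\<integral>\<^sup>+x. ennreal (std_normal_density x * indicator A x) \<partial>lborel)"
    using b by (simp add: prod.If_cases Int_absorb1)
  also have "\<dots> = emeasure (density lborel (\<lambda>x. ennreal (std_normal_density x))) A"
    by (subst emeasure_density) (auto intro!: nn_integral_cong simp: indicator_def)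
  finally show "emeasure (distr std_gaussian borel (\<lambda>v. v \<bullet> b)) A =
    emeasure (density lborel (\<lambda>x. ennreal (std_normal_density x))) A" .
qed simp

lemma distr_std_gaussian_inner:
  fixes e :: "'a::euclidean_space"
  assumes e: "norm e = 1"
  shows "distr std_gaussian borel (\<lambda>v. v \<bullet> e) = density lborel (\<lambda>x. ennreal (std_normal_density x))"
proof -
  obtain b :: 'a where b: "b \<in> Basis" using nonempty_Basis by blast
  show ?thesis
  proof (cases "b = e")
    case True
    then show ?thesis using distr_std_gaussian_inner_Basis[OF b] by simp
  next
    case False
    \<comment> \<open>The reflection along b - e exchanges the unit vectors b and e and preserves
      the Gaussian, which reduces the direction e to a basis vector.\<close>
    define w where "w = (1 / norm (b - e)) *\<^sub>R (b - e)"
    have w: "norm w = 1" using False by (simp add: w_def)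
    have bb: "b \<bullet> b = 1" "e \<bullet> e = 1" using b e by (auto simp: norm_eq_1)
    have n: "(norm (b - e))\<^sup>2 = 2 - 2 * (b \<bullet> e)"
      by (simp add: power2_norm_eq_inner inner_diff_left inner_diff_right bb inner_commute)
    have "reflect w v \<bullet> e = v \<bullet> b" for v
    proof -
      have "reflect w v \<bullet> e = v \<bullet> e - 2 * (v \<bullet> (b - e)) * ((b - e) \<bullet> e) / (norm (b - e))\<^sup>2"
        by (simp add: reflect_def w_def inner_diff_left power2_eq_square)
      also have "(b - e) \<bullet> e = - (norm (b - e))\<^sup>2 / 2"
        by (simp add: n bb inner_diff_left)
      also have "v \<bullet> e - 2 * (v \<bullet> (b - e)) * (- (norm (b - e))\<^sup>2 / 2) / (norm (b - e))\<^sup>2 = v \<bullet> b"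
        using False by (simp add: field_simps inner_diff_right)
      finally show ?thesis .
    qed
    then have "(\<lambda>v. v \<bullet> b) = (\<lambda>v. v \<bullet> e) \<circ> reflect w" by auto
    then have "distr std_gaussian borel (\<lambda>v. v \<bullet> b)
        = distr (distr std_gaussian borel (reflect w)) borel (\<lambda>v. v \<bullet> e)"
      by (subst distr_distr) auto
    then show ?thesis
      by (simp add: distr_std_gaussian_reflect[OF w] distr_std_gaussian_inner_Basis[OF b])
  qed
qed

lemma integral_std_gaussian_inner:
  fixes F :: "real \<Rightarrow> real"
  assumes e: "norm e = 1" and [measurable]: "F \<in> borel_measurable borel"
  shows "(\<integral>v. F (v \<bullet> e) \<partial>std_gaussian) = (\<integral>x. std_normal_density x * F x \<partial>lborel)"
proof -
  have "(\<integral>v. F (v \<bullet> e) \<partial>std_gaussian) = (\<integral>x. F x \<partial>distr std_gaussian borel (\<lambda>v. v \<bullet> e))"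
    by (subst integral_distr) auto
  also have "\<dots> = (\<integral>x. std_normal_density x * F x \<partial>lborel)"
    unfolding distr_std_gaussian_inner[OF e] by (subst integral_density) auto
  finally show ?thesis .
qed

section \<open>Gaussian integration by parts and the second moment of a divergence\<close>

definition shift_quot :: "real \<Rightarrow> 'a::euclidean_space \<Rightarrow> 'a \<Rightarrow> real"
  where "shift_quot t a v = (exp (t * (v \<bullet> a) - t\<^sup>2 * (a \<bullet> a) / 2) - 1) / t"

lemma shift_quot_measurable[measurable]: "shift_quot t a \<in> borel_measurable borel"
  unfolding shift_quot_def by measurable

lemma abs_exp_minus_1_le: "\<bar>exp y - 1\<bar> \<le> \<bar>y\<bar> * exp \<bar>y\<bar>" for y :: real
proof (cases "y \<ge> 0")
  case True
  have "exp (-y) \<ge> 1 - y" using exp_ge_add_one_self[of "-y"] by linarith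
  then have "exp y * (1 - y) \<le> exp y * exp (-y)" by (intro mult_left_mono) auto
  then have "exp y - 1 \<le> y * exp y" by (simp add: exp_minus field_simps)
  then show ?thesis using True by simp
next
  case False
  have "1 - exp y \<le> - y" using exp_ge_add_one_self[of y] by linarith
  also have "\<dots> \<le> - y * exp (-y)" using False by simp
  finally show ?thesis using False by simp
qed

lemma shift_exponent_bound:
  fixes v a :: "'a::euclidean_space"
  assumes "0 < t" "t \<le> 1"
  shows "\<bar>t * (v \<bullet> a) - t\<^sup>2 * (a \<bullet> a) / 2\<bar> \<le> t * (norm a * norm v + (norm a)\<^sup>2)"
proof -
  have "\<bar>t * (v \<bullet> a) - t\<^sup>2 * (a \<bullet> a) / 2\<bar> \<le> t * \<bar>v \<bullet> a\<bar> + t\<^sup>2 * (a \<bullet> a) / 2"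
    using assms by (simp add: abs_mult order_trans[OF abs_triangle_ineq4])
  also have "\<bar>v \<bullet> a\<bar> \<le> norm a * norm v" using Cauchy_Schwarz_ineq2[of v a] by (simp add: mult.commute)
  also have "t\<^sup>2 * (a \<bullet> a) / 2 \<le> t * (norm a)\<^sup>2"
  proof -
    have "t\<^sup>2 \<le> t" using assms by (simp add: power2_eq_square mult_left_le)
    then have "t\<^sup>2 * (a \<bullet> a) \<le> t * (a \<bullet> a)" by (intro mult_right_mono) auto
    also have "\<dots> = t * (norm a)\<^sup>2" by (simp add: power2_norm_eq_inner)
    finally show ?thesis using assms(1) zero_le_power2[of "norm a"] mult_nonneg_nonneg[of t "(norm a)\<^sup>2"] by linarith
  qed
  finally show ?thesis using assms by (simp add: algebra_simps)
qed

text \<open>\<open>shift_quot\<close> is the difference quotient at 0 of the Cameron-Martin density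
  for the translation by t a. The bounds are uniform in 0 < t \<le> 1, as dominated convergence
  requires when t tends to 0.\<close>

lemma shift_quot_bound:
  fixes v a :: "'a::euclidean_space"
  assumes t: "0 < t" "t \<le> 1"
  shows "\<bar>shift_quot t a v\<bar> \<le> exp (2 * (norm a * norm v + (norm a)\<^sup>2))"
    and "exp (t * (v \<bullet> a) - t\<^sup>2 * (a \<bullet> a) / 2) \<le> exp (2 * (norm a * norm v + (norm a)\<^sup>2))"
proof -
  define y where "y = t * (v \<bullet> a) - t\<^sup>2 * (a \<bullet> a) / 2"
  define B where "B = norm a * norm v + (norm a)\<^sup>2"
  have B0: "B \<ge> 0" by (simp add: B_def)
  have yB: "\<bar>y\<bar> \<le> t * B" using shift_exponent_bound[OF t] by (simp add: y_def B_def)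
  have tB: "t * B \<le> B" using t B0 by (simp add: mult_left_le_one_le)
  have "\<bar>exp y - 1\<bar> \<le> \<bar>y\<bar> * exp \<bar>y\<bar>" by (rule abs_exp_minus_1_le)
  also have "\<dots> \<le> (t * B) * exp B" using yB tB by (intro mult_mono) auto
  also have "\<dots> \<le> t * (exp B * exp B)"
  proof -
    have "B \<le> exp B" using exp_ge_add_one_self[of B] by linarith
    then show ?thesis using t by (simp add: mult.assoc)
  qed
  finally have "\<bar>exp y - 1\<bar> / t \<le> exp B * exp B" using t by (simp add: field_simps)
  then show "\<bar>shift_quot t a v\<bar> \<le> exp (2 * (norm a * norm v + (norm a)\<^sup>2))"
    unfolding shift_quot_def y_def[symmetric] B_def[symmetric]
    using t by (simp add: exp_add[symmetric])
  have "y \<le> 2 * B" using yB tB B0 by linarith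
  then show "exp (t * (v \<bullet> a) - t\<^sup>2 * (a \<bullet> a) / 2) \<le> exp (2 * (norm a * norm v + (norm a)\<^sup>2))"
    by (simp add: y_def B_def)
qed

text \<open>Dominated convergence is used along one fixed null sequence; it lies in (0, 1], where
  the uniform bounds hold.\<close>

definition tseq :: "nat \<Rightarrow> real" where "tseq n = 1 / real (Suc n)"

lemma tseq_bounds: "0 < tseq n" "tseq n \<le> 1"
  by (auto simp: tseq_def)

lemma tseq_tendsto: "filterlim tseq (at 0) sequentially"
  unfolding filterlim_at using LIMSEQ_inverse_real_of_nat
  by (auto simp: tseq_def[abs_def] inverse_eq_divide eventually_sequentially)

lemma has_real_derivative_tseq:
  assumes "(f has_real_derivative D) (at 0)"
  shows "(\<lambda>n. (f (tseq n) - f 0) / tseq n) \<longlonglongrightarrow> D"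
proof -
  have "((\<lambda>h. (f (0 + h) - f 0) / h) \<longlongrightarrow> D) (at 0)"
    using assms by (simp add: DERIV_def)
  from filterlim_compose[OF this tseq_tendsto] show ?thesis by simp
qed

lemma shift_quot_tendsto: "(\<lambda>n. shift_quot (tseq n) a v) \<longlonglongrightarrow> v \<bullet> a"
proof -
  have "((\<lambda>t. exp (t * (v \<bullet> a) - t\<^sup>2 * (a \<bullet> a) / 2)) has_real_derivative (v \<bullet> a)) (at 0)"
    by (auto intro!: derivative_eq_intros)
  from has_real_derivative_tseq[OF this] show ?thesis by (simp add: shift_quot_def)
qed

lemma integral_std_gaussian_translate:
  fixes F :: "'a::euclidean_space \<Rightarrow> real"
  assumes [measurable]: "F \<in> borel_measurable borel"
  shows "(\<integral>v. F (v + t *\<^sub>R a) \<partial>std_gaussian)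
    = (\<integral>v. F v * exp (t * (v \<bullet> a) - t\<^sup>2 * (a \<bullet> a) / 2) \<partial>std_gaussian)"
proof -
  let ?w = "t *\<^sub>R a"
  have "(\<integral>v. F v * exp (v \<bullet> ?w - ?w \<bullet> ?w / 2) \<partial>std_gaussian)
      = (\<integral>v. (F (v + ?w) * exp ((v + ?w) \<bullet> ?w - ?w \<bullet> ?w / 2)) * exp (- (v \<bullet> ?w) - (?w \<bullet> ?w) / 2) \<partial>std_gaussian)"
    by (rule integral_std_gaussian_shift[symmetric]) simp
  also have "\<dots> = (\<integral>v. F (v + ?w) \<partial>std_gaussian)"
  proof (intro Bochner_Integration.integral_cong refl)
    fix v
    have "exp ((v + ?w) \<bullet> ?w - ?w \<bullet> ?w / 2) * exp (- (v \<bullet> ?w) - (?w \<bullet> ?w) / 2) = 1"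
      unfolding exp_add[symmetric] inner_add_left by simp
    then show "F (v + ?w) * exp ((v + ?w) \<bullet> ?w - ?w \<bullet> ?w / 2) * exp (- (v \<bullet> ?w) - (?w \<bullet> ?w) / 2) = F (v + ?w)"
      by (simp only: mult.assoc mult_1_right)
  qed
  finally show ?thesis by (simp add: power2_eq_square mult.assoc)
qed

lemma exp_bound_shift:
  fixes F :: "'a::euclidean_space \<Rightarrow> real"
  assumes F: "\<And>v. \<bar>F v\<bar> \<le> C * exp (c * norm v)" and c: "c \<ge> 0" and t: "\<bar>t\<bar> \<le> 1"
  shows "\<bar>F (v + t *\<^sub>R a)\<bar> \<le> (C * exp (c * norm a)) * exp (c * norm v)"
proof -
  have C: "C \<ge> 0" using F[of 0] by (simp add: order_trans[OF abs_ge_zero])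
  have "norm (v + t *\<^sub>R a) \<le> norm v + \<bar>t\<bar> * norm a"
    by (metis norm_scaleR norm_triangle_ineq)
  also have "\<dots> \<le> norm v + norm a" using t by (simp add: mult_left_le_one_le)
  finally have "c * norm (v + t *\<^sub>R a) \<le> c * (norm v + norm a)" using c by (rule mult_left_mono)
  then have "C * exp (c * norm (v + t *\<^sub>R a)) \<le> C * exp (c * (norm v + norm a))"
    using C by (intro mult_left_mono) auto
  then show ?thesis using F[of "v + t *\<^sub>R a"] by (simp add: algebra_simps exp_add)
qed

text \<open>The mean of the difference quotient of F along a is computed in two ways. The mean value
  theorem dominates it and yields the mean of F'. Moving the translation onto the Gaussian yields
  the mean of F times \<open>shift_quot\<close>, which tends to the mean of F (v \<bullet>
  a).\<close>

lemma gauss_ibp: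
  fixes F F' :: "'a::euclidean_space \<Rightarrow> real"
  assumes [measurable]: "F \<in> borel_measurable borel" "F' \<in> borel_measurable borel"
    and deriv: "\<And>v t. ((\<lambda>t. F (v + t *\<^sub>R a)) has_real_derivative F' (v + t *\<^sub>R a)) (at t)"
    and F: "\<And>v. \<bar>F v\<bar> \<le> C * exp (c * norm v)" and F': "\<And>v. \<bar>F' v\<bar> \<le> C * exp (c * norm v)"
    and c: "c \<ge> 0"
  shows "(\<integral>v. F' v \<partial>std_gaussian) = (\<integral>v. F v * (v \<bullet> a) \<partial>std_gaussian)"
proof (rule LIMSEQ_unique)
  let ?C = "C * exp (c * norm a)"
  let ?D = "\<lambda>n v. (F (v + tseq n *\<^sub>R a) - F v) / tseq n"
  show "(\<lambda>n. \<integral>v. ?D n v \<partial>std_gaussian) \<longlonglongrightarrow> (\<integral>v. F' v \<partial>std_gaussian)"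
  proof (rule integral_dominated_convergence)
    show "integrable std_gaussian (\<lambda>v::'a. ?C * exp (c * norm v))"
      by (intro integrable_mult_right integrable_std_gaussian_exp_norm)
    show "AE v in std_gaussian. (\<lambda>n. ?D n v) \<longlonglongrightarrow> F' v"
    proof (rule AE_I2)
      fix v
      have "((\<lambda>t. F (v + t *\<^sub>R a)) has_real_derivative F' v) (at 0)" using deriv[of v 0] by simp
      from has_real_derivative_tseq[OF this] show "(\<lambda>n. ?D n v) \<longlonglongrightarrow> F' v" by simp
    qed
    show "AE v in std_gaussian. norm (?D n v) \<le> ?C * exp (c * norm v)" for n
    proof (rule AE_I2)
      fix v
      have "\<exists>z. z > 0 \<and> z < tseq n \<and> F (v + tseq n *\<^sub>R a) - F (v + 0 *\<^sub>R a) = (tseq n - 0) * F' (v + z *\<^sub>R a)"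
        by (rule MVT2) (auto simp: tseq_bounds intro: deriv)
      then obtain z where z: "0 < z" "z < tseq n" "?D n v = F' (v + z *\<^sub>R a)"
        using tseq_bounds[of n] by (auto simp: field_simps)
      then have "\<bar>z\<bar> \<le> 1" using tseq_bounds[of n] by auto
      then show "norm (?D n v) \<le> ?C * exp (c * norm v)"
        unfolding z(3) real_norm_def by (rule exp_bound_shift[OF F' c])
    qed
  qed auto
  have Fi: "integrable std_gaussian F" by (rule integrable_std_gaussian_exp_bound[OF _ F]) simp
  have eq: "(\<integral>v. ?D n v \<partial>std_gaussian) = (\<integral>v. F v * shift_quot (tseq n) a v \<partial>std_gaussian)" for n
  proof -
    have i1: "integrable std_gaussian (\<lambda>v. F (v + tseq n *\<^sub>R a))"
      using tseq_bounds[of n]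
      by (intro integrable_std_gaussian_exp_bound[where C="?C" and c=c] exp_bound_shift[OF F c]) auto
    have i2: "integrable std_gaussian (\<lambda>v. F v * exp (tseq n * (v \<bullet> a) - (tseq n)\<^sup>2 * (a \<bullet> a) / 2))"
    proof (rule integrable_std_gaussian_exp_bound)
      fix v
      have "\<bar>F v\<bar> * exp (tseq n * (v \<bullet> a) - (tseq n)\<^sup>2 * (a \<bullet> a) / 2)
        \<le> (C * exp (c * norm v)) * exp (2 * (norm a * norm v + (norm a)\<^sup>2))"
        by (intro mult_mono F shift_quot_bound tseq_bounds) (use F[of v] in auto)
      then show "\<bar>F v * exp (tseq n * (v \<bullet> a) - (tseq n)\<^sup>2 * (a \<bullet> a) / 2)\<bar>
        \<le> (C * exp (2 * (norm a)\<^sup>2)) * exp ((c + 2 * norm a) * norm v)"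
        by (simp add: abs_mult algebra_simps exp_add)
    qed simp
    have "(\<integral>v. ?D n v \<partial>std_gaussian) = ((\<integral>v. F (v + tseq n *\<^sub>R a) \<partial>std_gaussian) - (\<integral>v. F v \<partial>std_gaussian)) / tseq n"
      using i1 Fi by simp
    also have "\<dots> = (\<integral>v. (F v * exp (tseq n * (v \<bullet> a) - (tseq n)\<^sup>2 * (a \<bullet> a) / 2) - F v) / tseq n \<partial>std_gaussian)"
      using i2 Fi by (simp add: integral_std_gaussian_translate)
    also have "\<dots> = (\<integral>v. F v * shift_quot (tseq n) a v \<partial>std_gaussian)"
      by (intro Bochner_Integration.integral_cong refl) (simp add: shift_quot_def algebra_simps diff_divide_distrib)
    finally show ?thesis .
  qed
  have "(\<lambda>n. \<integral>v. F v * shift_quot (tseq n) a v \<partial>std_gaussian) \<longlonglongrightarrow> (\<integral>v. F v * (v \<bullet> a) \<partial>std_gaussian)"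
  proof (rule integral_dominated_convergence)
    show "integrable std_gaussian (\<lambda>v::'a. (C * exp (2 * (norm a)\<^sup>2)) * exp ((c + 2 * norm a) * norm v))"
      by (intro integrable_mult_right integrable_std_gaussian_exp_norm)
    show "AE v in std_gaussian. (\<lambda>n. F v * shift_quot (tseq n) a v) \<longlonglongrightarrow> F v * (v \<bullet> a)"
      by (intro AE_I2 tendsto_intros shift_quot_tendsto)
    show "AE v in std_gaussian. norm (F v * shift_quot (tseq n) a v) \<le> (C * exp (2 * (norm a)\<^sup>2)) * exp ((c + 2 * norm a) * norm v)" for n
    proof (rule AE_I2)
      fix v
      have "\<bar>F v\<bar> * \<bar>shift_quot (tseq n) a v\<bar> \<le> (C * exp (c * norm v)) * exp (2 * (norm a * norm v + (norm a)\<^sup>2))"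
        by (intro mult_mono F shift_quot_bound tseq_bounds) (use F[of v] in auto)
      then show "norm (F v * shift_quot (tseq n) a v) \<le> (C * exp (2 * (norm a)\<^sup>2)) * exp ((c + 2 * norm a) * norm v)"
        by (simp add: abs_mult algebra_simps exp_add)
    qed
  qed auto
  then show "(\<lambda>n. \<integral>v. ?D n v \<partial>std_gaussian) \<longlonglongrightarrow> (\<integral>v. F v * (v \<bullet> a) \<partial>std_gaussian)"
    by (simp only: eq)
qed

text \<open>Polarised second moment of the Gaussian divergence, for the fields u a and w b. Two
  classical integrations by parts would differentiate w twice, while only first derivatives are
  available. The derivative along a is therefore kept as a difference quotient until integration by
  parts along b has removed the difference quotient of \<open>wb\<close>.\<close>

lemma gauss_div_pairing:
  fixes u w :: "'a::euclidean_space \<Rightarrow> real"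
  assumes [measurable]: "u \<in> borel_measurable borel" "w \<in> borel_measurable borel"
    "ua \<in> borel_measurable borel" "ub \<in> borel_measurable borel"
    "wa \<in> borel_measurable borel" "wb \<in> borel_measurable borel"
    and dua: "\<And>v t. ((\<lambda>t. u (v + t *\<^sub>R a)) has_real_derivative ua (v + t *\<^sub>R a)) (at t)"
    and dub: "\<And>v t. ((\<lambda>t. u (v + t *\<^sub>R b)) has_real_derivative ub (v + t *\<^sub>R b)) (at t)"
    and dwa: "\<And>v t. ((\<lambda>t. w (v + t *\<^sub>R a)) has_real_derivative wa (v + t *\<^sub>R a)) (at t)"
    and dwb: "\<And>v t. ((\<lambda>t. w (v + t *\<^sub>R b)) has_real_derivative wb (v + t *\<^sub>R b)) (at t)"
    and C: "\<And>v. \<bar>u v\<bar> \<le> C" "\<And>v. \<bar>w v\<bar> \<le> C" "\<And>v. \<bar>ua v\<bar> \<le> C" "\<And>v. \<bar>ub v\<bar> \<le> C"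
      "\<And>v. \<bar>wa v\<bar> \<le> C" "\<And>v. \<bar>wb v\<bar> \<le> C"
  shows "(\<integral>v. (u v * (v \<bullet> a) - ua v) * (w v * (v \<bullet> b) - wb v) \<partial>std_gaussian)
    = (a \<bullet> b) * (\<integral>v. u v * w v \<partial>std_gaussian) + (\<integral>v. ub v * wa v \<partial>std_gaussian)"
proof -
  have C0: "C \<ge> 0" using C(1)[of 0] by (simp add: order_trans[OF abs_ge_zero])
  define g where "g v = w v * (v \<bullet> b) - wb v" for v
  have g_m[measurable]: "g \<in> borel_measurable borel" unfolding g_def by measurable
  have g: "\<bar>g v\<bar> \<le> C * exp (norm b * norm v)" for v
  proof -
    have "\<bar>g v\<bar> \<le> \<bar>w v\<bar> * \<bar>v \<bullet> b\<bar> + \<bar>wb v\<bar>" by (simp add: g_def abs_mult[symmetric])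
    also have "\<dots> \<le> C * (norm b * norm v) + C"
      using Cauchy_Schwarz_ineq2[of v b] C0
      by (intro add_mono mult_mono C) (auto simp: mult.commute)
    also have "\<dots> = C * (1 + norm b * norm v)" by (simp add: algebra_simps)
    also have "\<dots> \<le> C * exp (norm b * norm v)"
      using C0 by (intro mult_left_mono exp_ge_add_one_self)
    finally show ?thesis .
  qed
  define E where "E n v = exp (tseq n * (v \<bullet> a) - (tseq n)\<^sup>2 * (a \<bullet> a) / 2)" for n v
  have E_m[measurable]: "E n \<in> borel_measurable borel" for n unfolding E_def by measurable
  have E_bound: "\<bar>E n v\<bar> \<le> exp (2 * (norm a * norm v + (norm a)\<^sup>2))" for n v
    using shift_quot_bound(2)[OF tseq_bounds[of n], of v a] by (simp add: E_def)
  have E_quot: "E n v = 1 + tseq n * shift_quot (tseq n) a v" for n v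
    using tseq_bounds[of n] by (simp add: E_def shift_quot_def)
  \<comment> \<open>The adjoint, with respect to the Gaussian, of the forward difference quotient
    along a; as n grows it tends to the divergence u (v \<bullet> a) - ua.\<close>
  define du where "du n v = u v * shift_quot (tseq n) a v
      - ((u (v + tseq n *\<^sub>R (-a)) - u v) / - tseq n) * E n v" for n v
  have du_m[measurable]: "du n \<in> borel_measurable borel" for n unfolding du_def by measurable
  have du_eq: "du n v = (u (v - tseq n *\<^sub>R a) * E n v - u v) / tseq n" for n v
    using tseq_bounds[of n] by (simp add: du_def E_quot field_simps)
  have qu: "\<bar>(u (v + t *\<^sub>R (-a)) - u v) / - t\<bar> \<le> C" if t: "t > 0" for t v
  proof -
    have "\<exists>z. z > -t \<and> z < 0 \<and> u (v + 0 *\<^sub>R a) - u (v + (-t) *\<^sub>R a) = (0 - - t) * ua (v + z *\<^sub>R a)"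
      by (rule MVT2) (auto simp: t intro: dua)
    then obtain z where "u v - u (v + (-t) *\<^sub>R a) = t * ua (v + z *\<^sub>R a)" by auto
    then have "(u (v + t *\<^sub>R (-a)) - u v) / - t = ua (v + z *\<^sub>R a)" using t by (simp add: field_simps)
    then show ?thesis using C(3) by simp
  qed
  have qw: "\<bar>(w (v + t *\<^sub>R a) - w v) / t\<bar> \<le> C" if t: "t > 0" for t v
  proof -
    have "\<exists>z. z > 0 \<and> z < t \<and> w (v + t *\<^sub>R a) - w (v + 0 *\<^sub>R a) = (t - 0) * wa (v + z *\<^sub>R a)"
      by (rule MVT2) (auto simp: t intro: dwa)
    then obtain z where "w (v + t *\<^sub>R a) - w v = t * wa (v + z *\<^sub>R a)" by auto
    then have "(w (v + t *\<^sub>R a) - w v) / t = wa (v + z *\<^sub>R a)" using t by (simp add: field_simps)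
    then show ?thesis using C(5) by simp
  qed
  let ?B = "\<lambda>v::'a. exp (2 * (norm a * norm v + (norm a)\<^sup>2))"
  have du_bound: "\<bar>du n v\<bar> \<le> 2 * C * ?B v" for n v
  proof -
    have "\<bar>du n v\<bar> \<le> \<bar>u v * shift_quot (tseq n) a v\<bar> + \<bar>((u (v + tseq n *\<^sub>R (-a)) - u v) / - tseq n) * E n v\<bar>"
      unfolding du_def by (rule abs_triangle_ineq4)
    also have "\<dots> \<le> C * ?B v + C * ?B v"
      unfolding abs_mult using C0
      by (intro add_mono mult_mono C qu shift_quot_bound(1) E_bound tseq_bounds) auto
    finally show ?thesis by simp
  qed
  have dom: "2 * C * ?B v * (C * exp (norm b * norm v))
      = (2 * C * C * exp (2 * (norm a)\<^sup>2)) * exp ((2 * norm a + norm b) * norm v)" for v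
    by (simp add: algebra_simps exp_add)
  have lim1: "(\<lambda>n. \<integral>v. du n v * g v \<partial>std_gaussian)
      \<longlonglongrightarrow> (\<integral>v. (u v * (v \<bullet> a) - ua v) * g v \<partial>std_gaussian)"
  proof (rule integral_dominated_convergence)
    show "integrable std_gaussian (\<lambda>v::'a. 2 * C * ?B v * (C * exp (norm b * norm v)))"
      unfolding dom by (intro integrable_mult_right integrable_std_gaussian_exp_norm)
    show "AE v in std_gaussian. norm (du n v * g v) \<le> 2 * C * ?B v * (C * exp (norm b * norm v))" for n
      unfolding real_norm_def abs_mult using C0 by (intro AE_I2 mult_mono du_bound g) auto
    show "AE v in std_gaussian. (\<lambda>n. du n v * g v) \<longlonglongrightarrow> (u v * (v \<bullet> a) - ua v) * g v"
    proof (rule AE_I2)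
      fix v
      have "((\<lambda>t. u (v + t *\<^sub>R a)) has_real_derivative ua v) (at (0::real))" using dua[of v 0] by simp
      then have "((\<lambda>t. u (v + (-t) *\<^sub>R a)) has_real_derivative - ua v) (at (0::real))"
        using DERIV_mirror[of "\<lambda>t. u (v + t *\<^sub>R a)" "ua v" "0::real"] by simp
      from tendsto_minus[OF has_real_derivative_tseq[OF this]]
      have l1: "(\<lambda>n. (u (v + tseq n *\<^sub>R (-a)) - u v) / - tseq n) \<longlonglongrightarrow> ua v" by simp
      have "tseq \<longlonglongrightarrow> 0" using tseq_tendsto by (simp add: filterlim_at)
      then have "(\<lambda>n. 1 + tseq n * shift_quot (tseq n) a v) \<longlonglongrightarrow> 1 + 0 * (v \<bullet> a)"
        by (intro tendsto_intros shift_quot_tendsto)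
      then have l2: "(\<lambda>n. E n v) \<longlonglongrightarrow> 1" by (simp add: E_quot)
      have "(\<lambda>n. du n v * g v) \<longlonglongrightarrow> (u v * (v \<bullet> a) - ua v * 1) * g v"
        unfolding du_def by (intro tendsto_intros shift_quot_tendsto l1 l2)
      then show "(\<lambda>n. du n v * g v) \<longlonglongrightarrow> (u v * (v \<bullet> a) - ua v) * g v" by simp
    qed
  qed auto
  have bdd_int: "integrable std_gaussian F" if [measurable]: "F \<in> borel_measurable borel"
    and "\<And>v. \<bar>F v\<bar> \<le> B" for F :: "'a \<Rightarrow> real" and B
    by (rule integrable_std_gaussian_exp_bound[where C=B and c=0]) (use that in auto)
  have eq: "(\<integral>v. du n v * g v \<partial>std_gaussian)
      = (a \<bullet> b) * (\<integral>v. u v * w (v + tseq n *\<^sub>R a) \<partial>std_gaussian)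
        + (\<integral>v. ub v * ((w (v + tseq n *\<^sub>R a) - w v) / tseq n) \<partial>std_gaussian)" for n
  proof -
    let ?t = "tseq n"
    have t: "?t > 0" "?t \<le> 1" by (rule tseq_bounds)+
    define Dw where "Dw v = (w (v + ?t *\<^sub>R a) - w v) / ?t" for v
    define Dwb where "Dwb v = (wb (v + ?t *\<^sub>R a) - wb v) / ?t" for v
    have Dw_m[measurable]: "Dw \<in> borel_measurable borel" "Dwb \<in> borel_measurable borel"
      unfolding Dw_def Dwb_def by measurable
    have Dw_b: "\<bar>Dw v\<bar> \<le> C" for v using qw[OF t(1)] by (simp add: Dw_def)
    \<comment> \<open>This bound degenerates as n grows, which is harmless because
      \<open>Dwb\<close> cancels for each fixed n.\<close>
    have Dwb_b: "\<bar>Dwb v\<bar> \<le> 2 * C / ?t" for v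
    proof -
      have "\<bar>wb (v + ?t *\<^sub>R a) - wb v\<bar> \<le> 2 * C" using C(6)[of v] C(6)[of "v + ?t *\<^sub>R a"] by linarith
      then show ?thesis using t by (simp add: Dwb_def divide_right_mono)
    qed
    have i1: "integrable std_gaussian (\<lambda>v. u (v - ?t *\<^sub>R a) * g v * E n v)"
    proof (rule integrable_std_gaussian_exp_bound)
      fix v
      have "\<bar>u (v - ?t *\<^sub>R a) * g v * E n v\<bar> \<le> C * (C * exp (norm b * norm v)) * ?B v"
        unfolding abs_mult using C0 by (intro mult_mono C g E_bound) auto
      also have "\<dots> = (C * C * exp (2 * (norm a)\<^sup>2)) * exp ((2 * norm a + norm b) * norm v)"
        by (simp add: algebra_simps exp_add)
      finally show "\<bar>u (v - ?t *\<^sub>R a) * g v * E n v\<bar> \<le> \<dots>" .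
    qed simp
    have i2: "integrable std_gaussian (\<lambda>v. u v * g v)"
    proof (rule integrable_std_gaussian_exp_bound)
      fix v
      show "\<bar>u v * g v\<bar> \<le> (C * C) * exp (norm b * norm v)"
        unfolding abs_mult mult.assoc using C0 by (intro mult_mono C g) auto
    qed simp
    have i3: "integrable std_gaussian (\<lambda>v. u v * g (v + ?t *\<^sub>R a))"
    proof (rule integrable_std_gaussian_exp_bound)
      fix v
      have "\<bar>u v * g (v + ?t *\<^sub>R a)\<bar> \<le> C * ((C * exp (norm b * norm a)) * exp (norm b * norm v))"
        unfolding abs_mult using C0 t
        by (intro mult_mono C exp_bound_shift[OF g]) auto
      then show "\<bar>u v * g (v + ?t *\<^sub>R a)\<bar> \<le> (C * C * exp (norm b * norm a)) * exp (norm b * norm v)"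
        by (simp add: mult.assoc)
    qed simp
    have "(\<integral>v. du n v * g v \<partial>std_gaussian)
        = (\<integral>v. (u (v - ?t *\<^sub>R a) * g v * E n v - u v * g v) / ?t \<partial>std_gaussian)"
      by (intro Bochner_Integration.integral_cong refl) (simp add: du_eq field_simps)
    also have "\<dots> = ((\<integral>v. u (v - ?t *\<^sub>R a) * g v * E n v \<partial>std_gaussian) - (\<integral>v. u v * g v \<partial>std_gaussian)) / ?t"
      using i1 i2 by simp
    also have "(\<integral>v. u (v - ?t *\<^sub>R a) * g v * E n v \<partial>std_gaussian)
        = (\<integral>v. u v * g (v + ?t *\<^sub>R a) \<partial>std_gaussian)"
      using integral_std_gaussian_translate[of "\<lambda>v. u (v - ?t *\<^sub>R a) * g v" ?t a]
      by (simp add: E_def)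
    also have "((\<integral>v. u v * g (v + ?t *\<^sub>R a) \<partial>std_gaussian) - (\<integral>v. u v * g v \<partial>std_gaussian)) / ?t
        = (\<integral>v. (u v * g (v + ?t *\<^sub>R a) - u v * g v) / ?t \<partial>std_gaussian)"
      using i3 i2 by simp
    also have "\<dots> = (\<integral>v. (a \<bullet> b) * (u v * w (v + ?t *\<^sub>R a)) + (u v * Dw v * (v \<bullet> b) - u v * Dwb v) \<partial>std_gaussian)"
      using t by (intro Bochner_Integration.integral_cong refl)
        (simp add: g_def Dw_def Dwb_def inner_add_left field_simps)
    also have "\<dots> = (a \<bullet> b) * (\<integral>v. u v * w (v + ?t *\<^sub>R a) \<partial>std_gaussian)
        + ((\<integral>v. u v * Dw v * (v \<bullet> b) \<partial>std_gaussian) - (\<integral>v. u v * Dwb v \<partial>std_gaussian))"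
    proof -
      have "integrable std_gaussian (\<lambda>v. u v * w (v + ?t *\<^sub>R a))"
        by (rule bdd_int[where B="C * C"]) (auto simp: abs_mult C0 intro!: mult_mono C)
      moreover have "integrable std_gaussian (\<lambda>v. u v * Dwb v)"
        by (rule bdd_int[where B="C * (2 * C / ?t)"]) (auto simp: abs_mult C0 simp del: times_divide_eq_right intro!: mult_mono C Dwb_b)
      moreover have "integrable std_gaussian (\<lambda>v. u v * Dw v * (v \<bullet> b))"
      proof (rule integrable_std_gaussian_exp_bound)
        fix v
        have "\<bar>v \<bullet> b\<bar> \<le> exp (norm b * norm v)"
          using Cauchy_Schwarz_ineq2[of v b] exp_ge_add_one_self[of "norm b * norm v"]
          unfolding mult.commute[of "norm b"] by linarith
        then show "\<bar>u v * Dw v * (v \<bullet> b)\<bar> \<le> (C * C) * exp (norm b * norm v)"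
          unfolding abs_mult using C0 by (intro mult_mono C Dw_b) auto
      qed simp
      ultimately show ?thesis by simp
    qed
    \<comment> \<open>Integration by parts along b produces \<open>u v * Dwb v\<close> once more,
      and it cancels the term that came from the difference quotient of \<open>g\<close>.\<close>
    also have "(\<integral>v. u v * Dw v * (v \<bullet> b) \<partial>std_gaussian) = (\<integral>v. ub v * Dw v + u v * Dwb v \<partial>std_gaussian)"
    proof (rule gauss_ibp[symmetric, where c=0 and C="C * C + C * (2 * C / ?t)"])
      fix v s
      have dw: "((\<lambda>s. Dw (v + s *\<^sub>R b)) has_real_derivative Dwb (v + s *\<^sub>R b)) (at s)"
      proof -
        have "((\<lambda>s. w ((v + ?t *\<^sub>R a) + s *\<^sub>R b)) has_real_derivative wb ((v + ?t *\<^sub>R a) + s *\<^sub>R b)) (at s)"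
          by (rule dwb)
        then have "((\<lambda>s. (w ((v + ?t *\<^sub>R a) + s *\<^sub>R b) - w (v + s *\<^sub>R b)) / ?t) has_real_derivative
          (wb ((v + ?t *\<^sub>R a) + s *\<^sub>R b) - wb (v + s *\<^sub>R b)) / ?t) (at s)"
          by (intro DERIV_cdivide DERIV_diff dwb)
        then show ?thesis by (simp add: Dw_def[abs_def] Dwb_def add.commute add.left_commute)
      qed
      show "((\<lambda>s. u (v + s *\<^sub>R b) * Dw (v + s *\<^sub>R b)) has_real_derivative
        ub (v + s *\<^sub>R b) * Dw (v + s *\<^sub>R b) + u (v + s *\<^sub>R b) * Dwb (v + s *\<^sub>R b)) (at s)"
        using DERIV_mult[OF dub dw] by (simp add: mult.commute)
    next
      fix v
      have p: "\<bar>u v * Dw v\<bar> \<le> C * C" "\<bar>ub v * Dw v\<bar> \<le> C * C"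
        unfolding abs_mult using C0 by (auto intro!: mult_mono C Dw_b)
      have q: "\<bar>u v * Dwb v\<bar> \<le> C * (2 * C / ?t)"
        unfolding abs_mult using C0 by (intro mult_mono C Dwb_b) auto
      show "\<bar>u v * Dw v\<bar> \<le> (C * C + C * (2 * C / ?t)) * exp (0 * norm v)"
        using p(1) q abs_ge_zero[of "u v * Dwb v"] by (simp del: times_divide_eq_right)
      show "\<bar>ub v * Dw v + u v * Dwb v\<bar> \<le> (C * C + C * (2 * C / ?t)) * exp (0 * norm v)"
        using p(2) q by (simp del: times_divide_eq_right)
    qed auto
    also have "\<dots> = (\<integral>v. ub v * Dw v \<partial>std_gaussian) + (\<integral>v. u v * Dwb v \<partial>std_gaussian)"
    proof -
      have "integrable std_gaussian (\<lambda>v. ub v * Dw v)"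
        by (rule bdd_int[where B="C * C"]) (auto simp: abs_mult C0 intro!: mult_mono C Dw_b)
      moreover have "integrable std_gaussian (\<lambda>v. u v * Dwb v)"
        by (rule bdd_int[where B="C * (2 * C / ?t)"]) (auto simp: abs_mult C0 simp del: times_divide_eq_right intro!: mult_mono C Dwb_b)
      ultimately show ?thesis by simp
    qed
    finally show ?thesis by (simp add: Dw_def)
  qed
  have lim2: "(\<lambda>n. \<integral>v. u v * w (v + tseq n *\<^sub>R a) \<partial>std_gaussian) \<longlonglongrightarrow> (\<integral>v. u v * w v \<partial>std_gaussian)"
  proof (rule integral_dominated_convergence)
    show "integrable std_gaussian (\<lambda>v::'a. C * C)" by (rule bdd_int[where B="C * C"]) (auto simp: C0)
    show "AE v in std_gaussian. norm (u v * w (v + tseq n *\<^sub>R a)) \<le> C * C" for n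
      by (auto simp: abs_mult C0 intro!: mult_mono C)
    show "AE v in std_gaussian. (\<lambda>n. u v * w (v + tseq n *\<^sub>R a)) \<longlonglongrightarrow> u v * w v"
    proof (rule AE_I2)
      fix v
      have "isCont (\<lambda>t. w (v + t *\<^sub>R a)) 0" using dwa[of v 0] by (rule DERIV_isCont)
      then have "((\<lambda>t. w (v + t *\<^sub>R a)) \<longlongrightarrow> w v) (at 0)" by (simp add: isCont_def)
      from filterlim_compose[OF this tseq_tendsto]
      show "(\<lambda>n. u v * w (v + tseq n *\<^sub>R a)) \<longlonglongrightarrow> u v * w v" by (intro tendsto_intros)
    qed
  qed auto
  have lim3: "(\<lambda>n. \<integral>v. ub v * ((w (v + tseq n *\<^sub>R a) - w v) / tseq n) \<partial>std_gaussian)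
      \<longlonglongrightarrow> (\<integral>v. ub v * wa v \<partial>std_gaussian)"
  proof (rule integral_dominated_convergence)
    show "integrable std_gaussian (\<lambda>v::'a. C * C)" by (rule bdd_int[where B="C * C"]) (auto simp: C0)
    show "AE v in std_gaussian. norm (ub v * ((w (v + tseq n *\<^sub>R a) - w v) / tseq n)) \<le> C * C" for n
      unfolding real_norm_def abs_mult using C0
      by (intro AE_I2 mult_mono C qw tseq_bounds) auto
    show "AE v in std_gaussian. (\<lambda>n. ub v * ((w (v + tseq n *\<^sub>R a) - w v) / tseq n)) \<longlonglongrightarrow> ub v * wa v"
    proof (rule AE_I2)
      fix v
      have "((\<lambda>t. w (v + t *\<^sub>R a)) has_real_derivative wa v) (at 0)" using dwa[of v 0] by simp
      from has_real_derivative_tseq[OF this]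
      show "(\<lambda>n. ub v * ((w (v + tseq n *\<^sub>R a) - w v) / tseq n)) \<longlonglongrightarrow> ub v * wa v"
        by (intro tendsto_intros) simp
    qed
  qed auto
  have "(\<lambda>n. \<integral>v. du n v * g v \<partial>std_gaussian)
      \<longlonglongrightarrow> (a \<bullet> b) * (\<integral>v. u v * w v \<partial>std_gaussian) + (\<integral>v. ub v * wa v \<partial>std_gaussian)"
    unfolding eq by (intro tendsto_intros lim2 lim3)
  from LIMSEQ_unique[OF lim1 this] show ?thesis by (simp add: g_def)
qed

lemma std_gaussian_UNIV[simp]: "measure (std_gaussian :: 'a::euclidean_space measure) UNIV = 1"
  using std_gaussian.prob_space by simp

section \<open>Reflection coupling of Gaussian velocities\<close>

text \<open>The coupling moves \<open>v\<close> to \<open>v + a e\<close> with the maximal admissible probability \<open>1 - refl_weight\<close>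
  and reflects it otherwise; it is only ever used through this splitting of Gaussian integrals.\<close>

definition refl_weight :: "real \<Rightarrow> 'a::euclidean_space \<Rightarrow> 'a \<Rightarrow> real"
  where "refl_weight a e v = max 0 (1 - exp (- a * (v \<bullet> e) - a\<^sup>2 / 2))"

lemma refl_weight_measurable[measurable]: "refl_weight a e \<in> borel_measurable borel"
  unfolding refl_weight_def by measurable

lemma refl_weight_bounds: "0 \<le> refl_weight a e v" "refl_weight a e v \<le> 1"
  by (auto simp: refl_weight_def)

lemma one_minus_refl_weight: "1 - refl_weight a e v = min 1 (exp (- a * (v \<bullet> e) - a\<^sup>2 / 2))"
  by (auto simp: refl_weight_def)

text \<open>If two free flights start at distance T a along e with velocities v and
  \<open>reflect e v\<close>, then T (a + 2 (v \<bullet> e)) is their signed distance at time T.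
  Reflection thus happens only when they do not cross.\<close>

lemma refl_weight_support:
  assumes "a > 0" "refl_weight a e v \<noteq> 0" shows "a + 2 * (v \<bullet> e) > 0"
proof -
  have "- a * (v \<bullet> e) - a\<^sup>2 / 2 < 0" using assms(2) by (auto simp: refl_weight_def max_def split: if_splits)
  then have "0 < a * (a + 2 * (v \<bullet> e))" by (simp add: power2_eq_square algebra_simps)
  then show ?thesis using assms(1) by (simp add: zero_less_mult_iff)
qed

text \<open>Let y = exp (a (v \<bullet> e) - a^2/2) be the density of the Gaussian shifted by a e
  relative to the centred one. The shifted branch carries the share min 1 y and the reflected branch
  the remaining max 0 (1 - y); together they restore the Gaussian.\<close>

lemma reflection_coupling:
  fixes F :: "'a::euclidean_space \<Rightarrow> real"
  assumes e: "norm e = 1" and [measurable]: "F \<in> borel_measurable borel"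
    and F: "\<And>v. \<bar>F v\<bar> \<le> C * exp (c * norm v)"
  shows "(\<integral>v. F v \<partial>std_gaussian) = (\<integral>v. F (v + a *\<^sub>R e) * (1 - refl_weight a e v) \<partial>std_gaussian)
    + (\<integral>v. F (reflect e v) * refl_weight a e v \<partial>std_gaussian)"
proof -
  define y where "y v = exp (a * (v \<bullet> e) - a\<^sup>2 / 2)" for v
  have [measurable]: "y \<in> borel_measurable borel" unfolding y_def by measurable
  have ee: "e \<bullet> e = 1" using e by (simp add: norm_eq_1)
  have dominated: "integrable std_gaussian (\<lambda>v. F v * g v)"
    if [measurable]: "g \<in> borel_measurable borel" and g: "\<And>v. \<bar>g v\<bar> \<le> 1" for g
  proof (rule Bochner_Integration.integrable_bound)
    show "integrable std_gaussian F" by (rule integrable_std_gaussian_exp_bound[OF _ F]) simp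
    show "AE v in std_gaussian. norm (F v * g v) \<le> norm (F v)"
      using g by (auto simp: abs_mult intro!: mult_left_le)
  qed simp
  have "(\<integral>v. F (v + a *\<^sub>R e) * (1 - refl_weight a e v) \<partial>std_gaussian)
      = (\<integral>v. (F (v + a *\<^sub>R e) * min 1 (y (v + a *\<^sub>R e))) * exp (- (v \<bullet> (a *\<^sub>R e)) - ((a *\<^sub>R e) \<bullet> (a *\<^sub>R e)) / 2) \<partial>std_gaussian)"
  proof (intro Bochner_Integration.integral_cong refl)
    fix v
    define k where "k = exp (- a * (v \<bullet> e) - a\<^sup>2 / 2)"
    have k: "k > 0" by (simp add: k_def)
    \<comment> \<open>The density ratio at the shifted point is the reciprocal of \<open>k\<close>,
      so the Cameron-Martin weight turns min 1 y into min 1 k.\<close>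
    have yk: "y (v + a *\<^sub>R e) * k = 1"
      unfolding y_def k_def exp_add[symmetric] by (simp add: inner_add_left ee power2_eq_square algebra_simps)
    have "1 - refl_weight a e v = min 1 k" by (simp only: one_minus_refl_weight k_def)
    also have "\<dots> = min 1 (y (v + a *\<^sub>R e)) * k"
      using yk k by (simp add: min_mult_distrib_right min.commute)
    finally show "F (v + a *\<^sub>R e) * (1 - refl_weight a e v) = F (v + a *\<^sub>R e) * min 1 (y (v + a *\<^sub>R e)) *
        exp (- (v \<bullet> (a *\<^sub>R e)) - ((a *\<^sub>R e) \<bullet> (a *\<^sub>R e)) / 2)"
      by (simp add: k_def ee power2_eq_square)
  qed
  also have "\<dots> = (\<integral>v. F v * min 1 (y v) \<partial>std_gaussian)"
    by (rule integral_std_gaussian_shift) simp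
  finally have 1: "(\<integral>v. F (v + a *\<^sub>R e) * (1 - refl_weight a e v) \<partial>std_gaussian)
    = (\<integral>v. F v * min 1 (y v) \<partial>std_gaussian)" .
  have "(\<integral>v. F (reflect e v) * refl_weight a e v \<partial>std_gaussian)
      = (\<integral>v. F (reflect e v) * max 0 (1 - y (reflect e v)) \<partial>std_gaussian)"
    by (intro Bochner_Integration.integral_cong refl)
      (simp add: refl_weight_def y_def reflect_def inner_diff_left ee)
  also have "\<dots> = (\<integral>v. F v * max 0 (1 - y v) \<partial>std_gaussian)"
    by (rule integral_std_gaussian_reflect[OF e]) simp
  finally have 2: "(\<integral>v. F (reflect e v) * refl_weight a e v \<partial>std_gaussian) = (\<integral>v. F v * max 0 (1 - y v) \<partial>std_gaussian)" .
  have ypos: "y v > 0" for v by (simp add: y_def)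
  have "(\<integral>v. F v \<partial>std_gaussian) = (\<integral>v. F v * min 1 (y v) + F v * max 0 (1 - y v) \<partial>std_gaussian)"
    by (intro Bochner_Integration.integral_cong refl) (auto simp: min_def max_def algebra_simps)
  also have "\<dots> = (\<integral>v. F v * min 1 (y v) \<partial>std_gaussian) + (\<integral>v. F v * max 0 (1 - y v) \<partial>std_gaussian)"
    by (intro Bochner_Integration.integral_add dominated) (auto simp: abs_if min_def max_def less_imp_le[OF ypos] not_less dest: less_imp_le intro: order_trans[OF _ less_imp_le[OF ypos]] )
  finally show ?thesis using 1 2 by simp
qed

section \<open>One-dimensional moments and the gain of the coupling at short distance\<close>

lemma abs_inner_unit_le:
  fixes v e :: "'a::euclidean_space"
  assumes "norm e = 1" shows "\<bar>v \<bullet> e\<bar> \<le> exp (1 * norm v)"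
proof -
  have "\<bar>v \<bullet> e\<bar> \<le> norm v" using Cauchy_Schwarz_ineq2[of v e] assms by simp
  also have "\<dots> \<le> exp (norm v)" using exp_ge_add_one_self[of "norm v"] by linarith
  finally show ?thesis by simp
qed

lemma std_gaussian_inner_moments:
  fixes e :: "'a::euclidean_space"
  assumes e: "norm e = 1"
  shows "(\<integral>v. v \<bullet> e \<partial>std_gaussian) = 0" "(\<integral>v. (v \<bullet> e)\<^sup>2 \<partial>std_gaussian) = 1"
    "(\<integral>v. \<bar>v \<bullet> e\<bar> \<partial>std_gaussian) = sqrt (2 / pi)"
    "(\<integral>v. \<bar>v \<bullet> e\<bar> ^ 3 \<partial>std_gaussian) = 2 * sqrt (2 / pi)"
proof -
  show "(\<integral>v. v \<bullet> e \<partial>std_gaussian) = 0"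
    using integral_std_gaussian_inner[OF e, of "\<lambda>x. x"] integral_std_normal_moment_odd[of 0] by simp
  show "(\<integral>v. (v \<bullet> e)\<^sup>2 \<partial>std_gaussian) = 1"
    using integral_std_gaussian_inner[OF e, of "\<lambda>x. x\<^sup>2"] integral_std_normal_moment_even[of 1] by simp
  show "(\<integral>v. \<bar>v \<bullet> e\<bar> \<partial>std_gaussian) = sqrt (2 / pi)"
    using integral_std_gaussian_inner[OF e, of "\<lambda>x. \<bar>x\<bar>"] integral_std_normal_moment_abs_odd[of 0] by simp
  show "(\<integral>v. \<bar>v \<bullet> e\<bar> ^ 3 \<partial>std_gaussian) = 2 * sqrt (2 / pi)"
    using integral_std_gaussian_inner[OF e, of "\<lambda>x. \<bar>x\<bar> ^ 3"] integral_std_normal_moment_abs_odd[of 1]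
    by (simp add: numeral_3_eq_3)
qed

lemma integrable_inner_power:
  fixes e :: "'a::euclidean_space"
  assumes e: "norm e = 1"
  shows "integrable std_gaussian (\<lambda>v. \<bar>v \<bullet> e\<bar> ^ n)" "integrable std_gaussian (\<lambda>v. (v \<bullet> e) ^ n)"
proof -
  have "\<bar>v \<bullet> e\<bar> ^ n \<le> 1 * exp (real n * norm v)" for v
    using power_mono[OF abs_inner_unit_le[OF e, of v], of n] by (simp add: exp_of_nat_mult)
  then show "integrable std_gaussian (\<lambda>v. \<bar>v \<bullet> e\<bar> ^ n)" "integrable std_gaussian (\<lambda>v. (v \<bullet> e) ^ n)"
    by (auto intro!: integrable_std_gaussian_exp_bound[where C=1 and c="real n"] simp: power_abs)
qed

text \<open>A rearrangement of exp (- t) \<ge> (2 - t) / (2 + t), the first diagonal Pade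
  approximant.\<close>

lemma exp_minus_pade:
  fixes t :: real assumes "t \<ge> 0" shows "exp (- t) - 1 + t \<ge> t\<^sup>2 / (2 + t)"
proof -
  have "(\<lambda>t. (2 + t) * exp (-t) - (2 - t)) 0 \<le> (\<lambda>t. (2 + t) * exp (-t) - (2 - t)) t"
  proof (rule DERIV_nonneg_imp_nondecreasing[OF assms])
    fix x :: real assume x: "0 \<le> x" "x \<le> t"
    have "((\<lambda>t. (2 + t) * exp (-t) - (2 - t)) has_real_derivative (1 - (1 + x) * exp (-x))) (at x)"
      by (auto intro!: derivative_eq_intros simp: algebra_simps)
    moreover have "(1 + x) * exp (-x) \<le> exp x * exp (-x)"
      by (intro mult_right_mono exp_ge_add_one_self) auto
    then have "1 - (1 + x) * exp (-x) \<ge> 0" by (simp add: exp_minus)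
    ultimately show "\<exists>y. ((\<lambda>t. (2 + t) * exp (-t) - (2 - t)) has_real_derivative y) (at x) \<and> 0 \<le> y" by blast
  qed
  then have "(2 + t) * exp (-t) \<ge> 2 - t" by simp
  then have "(2 + t) * (exp (-t) - 1 + t) \<ge> t\<^sup>2" by (simp add: algebra_simps power2_eq_square)
  then show ?thesis using assms by (simp add: pos_divide_le_eq mult.commute)
qed

text \<open>Comes from 1 - exp (- s) \<ge> s / (1 + s) at s = a z. The product form separates a from
  the Gaussian variable, so that only one integral, independent of a, has to be estimated
  later.\<close>

lemma refl_weight_lower:
  assumes a: "a > 0" and z: "v \<bullet> e \<ge> 0"
  shows "refl_weight a e v \<ge> min 1 a * ((v \<bullet> e) / (1 + v \<bullet> e))"
proof -
  define z where "z = v \<bullet> e"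
  have z0: "z \<ge> 0" using z by (simp add: z_def)
  have az: "a * z \<ge> 0" using a z0 by simp
  have "exp (- (a * z)) \<le> 1 / (1 + a * z)"
    using exp_ge_add_one_self[of "a * z"] az by (simp add: exp_minus field_simps)
  then have "1 - exp (- (a * z)) \<ge> (a * z) / (1 + a * z)" using az by (simp add: field_simps)
  moreover have "exp (- a * z - a\<^sup>2 / 2) \<le> exp (- (a * z))" by simp
  ultimately have "refl_weight a e v \<ge> (a * z) / (1 + a * z)"
    unfolding refl_weight_def z_def[symmetric] by linarith
  moreover have "(a * z) / (1 + a * z) \<ge> min 1 a * (z / (1 + z))"
  proof (cases "a \<le> 1")
    case True
    have "a * z / (1 + z) \<le> a * z / (1 + a * z)"
      using a z0 True az by (intro divide_left_mono mult_pos_pos add_pos_nonneg) (auto simp: mult_left_le_one_le)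
    then show ?thesis using True by simp
  next
    case False
    have "z \<le> a * z" using False z0 mult_right_mono[of 1 a z] by simp
    then have "z / (1 + z) \<le> a * z / (1 + a * z)" using z0 az by (simp add: field_simps)
    then show ?thesis using False by simp
  qed
  ultimately show ?thesis by (simp add: z_def)
qed

text \<open>The cubic is chosen because its half-line Gaussian moments are explicit.\<close>

lemma psi_lower:
  assumes a: "a > 0" and z: "v \<bullet> e \<ge> 0"
  shows "(exp (- 2 * (v \<bullet> e)) - 1 + 2 * (v \<bullet> e)) * refl_weight a e v
    \<ge> min 1 a * (- (1/10) * (v \<bullet> e) + (69/100) * (v \<bullet> e)\<^sup>2 - (1/10) * (v \<bullet> e) ^ 3)"
proof -
  define z where "z = v \<bullet> e"
  have z0: "z \<ge> 0" using z by (simp add: z_def)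
  have "(2 * z)\<^sup>2 / (2 + 2 * z) = 2 * z\<^sup>2 / (1 + z)"
    using z0 by (simp add: field_simps power2_eq_square)
  then have p: "2 * z\<^sup>2 / (1 + z) \<le> exp (- 2 * z) - 1 + 2 * z"
    using exp_minus_pade[of "2 * z"] z0 by simp
  have "(1 + z)\<^sup>2 * (- (1/10) * z + (69/100) * z\<^sup>2 - (1/10) * z ^ 3) \<le> 2 * z ^ 3"
  proof -
    \<comment> \<open>A sum-of-squares certificate: up to the factor z the difference is a
      nonnegative combination of two squares.\<close>
    have "2 * z ^ 3 - (1 + z)\<^sup>2 * (- (1/10) * z + (69/100) * z\<^sup>2 - (1/10) * z ^ 3)
      = z * ((1/10) * (z\<^sup>2 - (245/100) * z + 1)\<^sup>2 + (79/4000) * z\<^sup>2)"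
      by algebra
    also have "\<dots> \<ge> 0" using z0 by simp
    finally show ?thesis by simp
  qed
  then have "- (1/10) * z + (69/100) * z\<^sup>2 - (1/10) * z ^ 3 \<le> 2 * z ^ 3 / (1 + z)\<^sup>2"
    using z0 by (simp add: pos_le_divide_eq mult.commute)
  also have "\<dots> = 2 * z\<^sup>2 / (1 + z) * (z / (1 + z))"
    by (simp add: power2_eq_square power3_eq_cube)
  finally have "min 1 a * (- (1/10) * z + (69/100) * z\<^sup>2 - (1/10) * z ^ 3)
    \<le> min 1 a * (2 * z\<^sup>2 / (1 + z) * (z / (1 + z)))"
    using a by (intro mult_left_mono) auto
  also have "\<dots> = (2 * z\<^sup>2 / (1 + z)) * (min 1 a * (z / (1 + z)))" by simp
  also have "\<dots> \<le> (exp (- 2 * z) - 1 + 2 * z) * refl_weight a e v"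
  proof (rule mult_mono[OF p])
    show "min 1 a * (z / (1 + z)) \<le> refl_weight a e v"
      using refl_weight_lower[OF a z] by (simp add: z_def)
    show "0 \<le> exp (- 2 * z) - 1 + 2 * z" using exp_ge_add_one_self[of "- 2 * z"] by linarith
    show "0 \<le> min 1 a * (z / (1 + z))" using a z0 by simp
  qed
  finally show ?thesis by (simp add: z_def)
qed

text \<open>After multiplication by \<open>exp a\<close> the gain of the coupling is \<open>(exp a - 1 - a) (1 - p) + \<Psi>\<close>; both
  summands are nonnegative, and they absorb the error terms.\<close>

lemma near_arith:
  fixes a p X \<theta> \<beta> \<tau> c E \<Psi> F :: real
  assumes a: "a > 0" and p: "0 \<le> p" "p \<le> 1" "p \<le> a" and X: "X \<ge> 0"
    and Psi: "\<Psi> = X - p + a * (1 - p)" "\<Psi> \<ge> (21/100) * min 1 a"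
    and th: "0 \<le> \<theta>" "\<theta> \<le> 1/12" "\<theta> * a \<le> 1/40"
    and be: "0 \<le> \<beta>" "\<beta> \<le> 1/12" "E * \<beta> * a \<le> (1/8) * min 1 a"
    and E: "E = exp a"
    and small: "2 * E * \<tau> * a + E * c * F \<le> (3/1000) * min 1 a"
    and F: "F = (1 - \<beta>) * (1 - exp (- a)) + \<beta> * a"
  shows "\<theta> * a * (1 - p) + (1 - \<beta>) * (p - exp (- a) * X) + \<beta> * a
     + (1 - \<beta>) * exp (- a) * (\<theta> * (a * X + p / 2)) + (\<beta> * \<theta> + \<tau>) * (2 * a) \<le> (1 - c) * F"
proof -
  define m where "m = min 1 a"
  have m: "0 < m" "m \<le> 1" "m \<le> a" "p \<le> m" using a p by (auto simp: m_def)
  have E0: "E > 0" by (simp add: E)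
  have Ei: "exp (- a) = 1 / E" by (simp add: E exp_minus inverse_eq_divide)
  have EE: "E \<ge> 1 + a + a\<^sup>2 / 2" unfolding E using a by (intro exp_lower_Taylor_quadratic) auto
  define Q where "Q = (E - 1 - a) * (1 - p)"
  have a2: "0 \<le> a\<^sup>2" by simp
  have Q0: "Q \<ge> 0" unfolding Q_def using EE p a2 by (intro mult_nonneg_nonneg) linarith+
  \<comment> \<open>For a \<le> 1 the term is compared with E - 1 - a \<ge> a^2/2, its linear part
    going into m/12. For a > 1 the bound \<theta> a \<le> 1/40 is enough, because E - 1 - a is then
    a fixed fraction of E.\<close>
  have t1: "\<theta> * a * E * (1 - p) \<le> (11/12) * Q + (1/12) * m"
  proof (cases "a \<le> 1")
    case True
    have "E \<le> 1 + a + a\<^sup>2" unfolding E using True a by (intro exp_bound) auto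
    then have "a * E \<le> a * (1 + a + a\<^sup>2)" using a by (intro mult_left_mono) auto
    moreover have "a * a\<^sup>2 \<le> 1 * a\<^sup>2" using True by (intro mult_right_mono) auto
    ultimately have "a * E \<le> a + 2 * a\<^sup>2" by (simp add: algebra_simps power2_eq_square)
    then have "\<theta> * (a * E) \<le> (1/12) * (a + 2 * a\<^sup>2)" using th a E0 by (intro mult_mono) auto
    also have "\<dots> \<le> (11/12) * (a\<^sup>2 / 2) + (1/12) * a" using a2 by (simp add: field_simps)
    also have "\<dots> \<le> (11/12) * (E - 1 - a) + (1/12) * a"
      using EE by (intro add_mono mult_left_mono) auto
    finally have "\<theta> * (a * E) \<le> (11/12) * (E - 1 - a) + (1/12) * a" .
    then have "\<theta> * (a * E) * (1 - p) \<le> ((11/12) * (E - 1 - a) + (1/12) * a) * (1 - p)"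
      using p by (intro mult_right_mono) auto
    also have "\<dots> = (11/12) * Q + (1/12) * (a * (1 - p))" unfolding Q_def by algebra
    also have "\<dots> \<le> (11/12) * Q + (1/12) * a" using p a by simp
    finally show ?thesis using True by (simp add: m_def mult.assoc)
  next
    case False
    have "(1/40) * E \<le> (11/12) * (E - 1 - a)"
    proof -
      have "a \<le> a\<^sup>2" using False by (simp add: power2_eq_square)
      then have "1 + a + a / 2 \<le> 1 + a + a\<^sup>2 / 2" by simp
      then have "1 + a + a / 2 \<le> E" using EE by (rule order_trans)
      then show ?thesis using False by (simp add: field_simps)
    qed
    moreover have "\<theta> * a * E \<le> (1/40) * E" using th E0 by (intro mult_right_mono) auto
    ultimately have "\<theta> * a * E \<le> (11/12) * (E - 1 - a)" by (metis order_trans)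
    then have "\<theta> * a * E * (1 - p) \<le> (11/12) * (E - 1 - a) * (1 - p)"
      using p by (intro mult_right_mono) auto
    then have "\<theta> * a * E * (1 - p) \<le> (11/12) * Q" by (simp only: Q_def mult.assoc)
    then show ?thesis using m by linarith
  qed
  have t2: "\<theta> * (a * X + p / 2) \<le> \<Psi> / 40 + m / 15"
  proof -
    have "a * (1 - p) \<ge> 0" using a p by simp
    then have "X \<le> \<Psi> + p" using Psi by simp
    moreover have "(\<theta> * a) * X \<le> (1/40) * X" using th X by (intro mult_right_mono) auto
    moreover have "\<theta> * p \<le> (1/12) * p" using th p by (intro mult_right_mono) auto
    moreover have "\<theta> * (a * X + p / 2) = (\<theta> * a) * X + (\<theta> * p) / 2" by (simp add: algebra_simps)
    moreover have "x + y / 2 \<le> (1/40) * (\<Psi> + p) + p / 24"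
      if "X \<le> \<Psi> + p" "x \<le> (1/40) * X" "y \<le> (1/12) * p" for x y
      using that by (simp add: field_simps)
    ultimately have "\<theta> * (a * X + p / 2) \<le> (1/40) * (\<Psi> + p) + p / 24" by metis
    also have "\<dots> = \<Psi> / 40 + p / 15" by (simp add: field_simps)
    also have "\<dots> \<le> \<Psi> / 40 + m / 15" using m by simp
    finally show ?thesis .
  qed
  have t2': "(1 - \<beta>) * (\<theta> * (a * X + p / 2)) \<le> \<Psi> / 40 + m / 15"
  proof -
    have "0 \<le> \<theta> * (a * X + p / 2)" using th a X p by simp
    then have "(1 - \<beta>) * (\<theta> * (a * X + p / 2)) \<le> 1 * (\<theta> * (a * X + p / 2))"
      using be by (intro mult_right_mono) auto
    then show ?thesis using t2 by simp
  qed
  have t3: "2 * E * \<beta> * \<theta> * a \<le> m / 48"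
  proof -
    have "\<theta> * (E * \<beta> * a) \<le> (1/12) * ((1/8) * m)"
      by (rule mult_mono) (use th be E0 a in \<open>simp_all only: m_def, auto\<close>)
    then show ?thesis by (simp add: mult_ac)
  qed
  have t4: "(11/12) * (Q + \<Psi>) \<le> (1 - \<beta>) * (Q + \<Psi>)"
    using be Q0 Psi(2) m by (intro mult_right_mono) (auto simp: m_def)
  have "E * (\<theta> * a * (1 - p) + (1 - \<beta>) * (p - exp (- a) * X) + \<beta> * a
     + (1 - \<beta>) * exp (- a) * (\<theta> * (a * X + p / 2)) + (\<beta> * \<theta> + \<tau>) * (2 * a) - (1 - c) * F)
    = \<theta> * a * E * (1 - p) + (1 - \<beta>) * (\<theta> * (a * X + p / 2)) + 2 * E * \<beta> * \<theta> * a
      + (2 * E * \<tau> * a + E * c * F) - (1 - \<beta>) * (Q + \<Psi>)"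
  proof -
    have "E * (1 / E) = 1" using E0 by simp
    then show ?thesis unfolding Ei F Q_def Psi(1) by algebra
  qed
  also have "\<dots> \<le> 0"
  proof -
    \<comment> \<open>The errors add up to 11/12 Q + \<Psi>/40 + (1/12 + 1/15 + 1/48 + 3/1000) m.
      Against them stands 11/12 (Q + \<Psi>), and (11/12 - 1/40) 21/100, about 0.187, exceeds the
      bracket, about 0.174.\<close>
    have "x1 + x2 + x3 + x4 - x5 \<le> 0" if "x1 \<le> (11/12) * Q + (1/12) * m" "x2 \<le> \<Psi> / 40 + m / 15"
      "x3 \<le> m / 48" "x4 \<le> (3/1000) * m" "(11/12) * (Q + \<Psi>) \<le> x5" for x1 x2 x3 x4 x5
      using that Psi(2)[folded m_def] m(1) by simp
    then show ?thesis using t1 t2' t3 small[folded m_def] t4 by blast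
  qed
  finally show ?thesis using E0 by (simp add: mult_le_0_iff)
qed

lemma exp_one_ge: "exp 1 \<ge> (8/3::real)"
proof -
  have "(1 + 1/4 + (1/4)\<^sup>2/2) ^ 4 \<le> exp (1/4::real) ^ 4"
    by (intro power_mono exp_lower_Taylor_quadratic) auto
  also have "\<dots> = exp 1" by (simp flip: exp_of_nat_mult)
  finally show ?thesis by (simp add: power2_eq_square power4_eq_xxxx)
qed

lemma exp_five_halves_ge: "exp (5/2) \<ge> (12::real)"
proof -
  have "(1 + 1/8 + (1/8)\<^sup>2/2) ^ 20 \<le> exp (1/8::real) ^ 20"
    by (intro power_mono exp_lower_Taylor_quadratic) auto
  also have "\<dots> = exp (5/2)" by (simp flip: exp_of_nat_mult)
  finally have "(145/128::real) ^ 20 \<le> exp (5/2)" by (simp add: power2_eq_square)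
  moreover have "(12::real) \<le> (145/128) ^ 20" by (simp add: power_divide)
  ultimately show ?thesis by linarith
qed

text \<open>The maximum of the left side is 4/e, below 3/2. The rate 1/4 is the surplus of the
  exponent 5/4 in the small parameters over the factor exp a by which the near estimate is
  multiplied.\<close>

lemma mult_exp_minus_quarter_le:
  fixes a :: real assumes "a > 0" shows "a * exp (- a / 4) \<le> (3/2) * min 1 a"
proof -
  have "exp 1 * (a / 4) \<le> exp 1 * exp (a / 4 - 1)"
    using exp_ge_add_one_self[of "a / 4 - 1"] by (intro mult_left_mono) auto
  also have "\<dots> = exp (a / 4)" by (simp flip: exp_add)
  finally have "exp 1 * (a / 4) \<le> exp (a / 4)" .
  moreover have "(8/3) * (a / 4) \<le> exp 1 * (a / 4)" using exp_one_ge assms by (intro mult_right_mono) auto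
  ultimately have "(2/3) * a \<le> exp (a / 4)" by simp
  then have "a * exp (- a / 4) \<le> 3/2" by (simp add: exp_minus field_simps)
  moreover have "a * exp (- a / 4) \<le> a * 1" using assms by (intro mult_left_mono) auto
  ultimately show ?thesis
  proof (cases "a \<ge> 1")
    case False
    have "exp (- a / 4) \<le> 1" using assms by simp
    then have "exp (- a / 4) \<le> 3/2" by linarith
    then have "a * exp (- a / 4) \<le> a * (3/2)" using assms by (intro mult_left_mono) auto
    then show ?thesis using False by (simp add: mult.commute)
  qed simp
qed

lemma sqrt_two_div_pi_le: "sqrt (2 / pi) \<le> 5/6"
proof (rule real_le_lsqrt)
  show "2 / pi \<le> (5/6)\<^sup>2" using pi_gt3 by (simp add: field_simps power2_eq_square)
qed auto

text \<open>The mean identity is \<open>reflection_coupling\<close> for F v = v \<bullet> e, whose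
  Gaussian mean vanishes. The last item bounds what the convexity of exp leaves over once the
  first-order terms have cancelled by that identity.\<close>

lemma refl_weight_integrals:
  fixes e :: "'a::euclidean_space"
  assumes e: "norm e = 1" and a: "a > 0"
  shows integrable_refl_weight: "integrable std_gaussian (refl_weight a e)"
    and integrable_inner_refl_weight: "integrable std_gaussian (\<lambda>v. (v \<bullet> e) * refl_weight a e v)"
    and integrable_exp_refl_weight: "integrable std_gaussian (\<lambda>v. exp (- 2 * (v \<bullet> e)) * refl_weight a e v)"
    and refl_weight_mean: "2 * (\<integral>v. (v \<bullet> e) * refl_weight a e v \<partial>std_gaussian)
      = a * (1 - (\<integral>v. refl_weight a e v \<partial>std_gaussian))"
    and refl_weight_mass: "(\<integral>v. refl_weight a e v \<partial>std_gaussian) \<in> {0..min 1 a}"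
    and refl_weight_psi: "(\<integral>v. (exp (- 2 * (v \<bullet> e)) - 1 + 2 * (v \<bullet> e)) * refl_weight a e v \<partial>std_gaussian)
      \<ge> (21/100) * min 1 a"
proof -
  let ?w = "refl_weight a e"
  have bnd: "integrable std_gaussian F" if [measurable]: "F \<in> borel_measurable borel"
    and "\<And>v. \<bar>F v\<bar> \<le> B" for F :: "'a \<Rightarrow> real" and B
    by (rule integrable_std_gaussian_exp_bound[where C=B and c=0]) (use that in auto)
  show w: "integrable std_gaussian ?w"
    by (rule bnd[where B=1]) (auto simp: refl_weight_bounds abs_le_iff order_trans[OF _ refl_weight_bounds(1)])
  have lin: "integrable std_gaussian (\<lambda>v. (v \<bullet> e) * F v)" if [measurable]: "F \<in> borel_measurable borel"
    and F: "\<And>v. \<bar>F v\<bar> \<le> 1" for F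
  proof (rule integrable_std_gaussian_exp_bound[where C=1 and c=1])
    fix v
    have "\<bar>v \<bullet> e\<bar> * \<bar>F v\<bar> \<le> exp (1 * norm v) * 1"
      by (intro mult_mono abs_inner_unit_le e F) auto
    then show "\<bar>(v \<bullet> e) * F v\<bar> \<le> 1 * exp (1 * norm v)" by (simp add: abs_mult)
  qed simp
  show zw: "integrable std_gaussian (\<lambda>v. (v \<bullet> e) * ?w v)"
    by (rule lin) (auto simp: refl_weight_bounds abs_le_iff order_trans[OF _ refl_weight_bounds(1)])
  show xw: "integrable std_gaussian (\<lambda>v. exp (- 2 * (v \<bullet> e)) * ?w v)"
  proof (rule bnd[where B="exp a"])
    fix v
    show "\<bar>exp (- 2 * (v \<bullet> e)) * ?w v\<bar> \<le> exp a"
    proof (cases "?w v = 0")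
      case False
      then have "- 2 * (v \<bullet> e) \<le> a" using refl_weight_support[OF a] by force
      then have "exp (- 2 * (v \<bullet> e)) * ?w v \<le> exp a * 1"
        by (intro mult_mono) (auto simp: refl_weight_bounds)
      then show ?thesis by (simp add: abs_mult refl_weight_bounds)
    qed simp
  qed simp
  have ee: "e \<bullet> e = 1" using e by (simp add: norm_eq_1)
  have z: "integrable std_gaussian (\<lambda>v. v \<bullet> e)" using lin[of "\<lambda>_. 1"] by simp
  have "(\<integral>v. v \<bullet> e \<partial>std_gaussian) = (\<integral>v. ((v + a *\<^sub>R e) \<bullet> e) * (1 - ?w v) \<partial>std_gaussian)
    + (\<integral>v. (reflect e v \<bullet> e) * ?w v \<partial>std_gaussian)"
    by (rule reflection_coupling[OF e, where C=1 and c=1]) (use abs_inner_unit_le[OF e] in auto)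
  also have "(\<integral>v. ((v + a *\<^sub>R e) \<bullet> e) * (1 - ?w v) \<partial>std_gaussian)
      = (\<integral>v. (v \<bullet> e) + a - (v \<bullet> e) * ?w v - a * ?w v \<partial>std_gaussian)"
    by (intro Bochner_Integration.integral_cong refl) (simp add: inner_add_left ee algebra_simps)
  also have "\<dots> = 0 + a - (\<integral>v. (v \<bullet> e) * ?w v \<partial>std_gaussian) - a * (\<integral>v. ?w v \<partial>std_gaussian)"
    using z w zw by (simp add: std_gaussian_inner_moments[OF e])
  also have "(\<integral>v. (reflect e v \<bullet> e) * ?w v \<partial>std_gaussian) = (\<integral>v. - ((v \<bullet> e) * ?w v) \<partial>std_gaussian)"
    by (intro Bochner_Integration.integral_cong refl) (simp add: reflect_def inner_diff_left ee)
  finally show "2 * (\<integral>v. (v \<bullet> e) * ?w v \<partial>std_gaussian) = a * (1 - (\<integral>v. ?w v \<partial>std_gaussian))"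
    by (simp add: std_gaussian_inner_moments[OF e] algebra_simps)
  have "(\<integral>v. ?w v \<partial>std_gaussian) \<ge> 0"
    by (intro Bochner_Integration.integral_nonneg refl_weight_bounds)
  moreover have "(\<integral>v. ?w v \<partial>std_gaussian) \<le> (\<integral>(v::'a). 1 \<partial>std_gaussian)"
    using w by (intro integral_mono) (auto simp: refl_weight_bounds)
  moreover have "(\<integral>v. ?w v \<partial>std_gaussian) \<le> a" if a1: "a \<le> 1"
  proof -
    have i2: "integrable std_gaussian (\<lambda>v. (v \<bullet> e)\<^sup>2)" by (rule integrable_inner_power[OF e])
    \<comment> \<open>For a \<le> 1 the positive part of z + 1/2 is dominated by (z + 3/2)^2/4,
      whose Gaussian mean 13/16 is below 1.\<close>
    have "(\<integral>v. ?w v \<partial>std_gaussian) \<le> (\<integral>v. a * ((v \<bullet> e)\<^sup>2 + 3 * (v \<bullet> e) + 9/4) / 4 \<partial>std_gaussian)"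
    proof (rule integral_mono[OF w])
      show "integrable std_gaussian (\<lambda>v. a * ((v \<bullet> e)\<^sup>2 + 3 * (v \<bullet> e) + 9/4) / 4)"
        using i2 z by simp
      fix v
      have "1 - exp (- a * (v \<bullet> e) - a\<^sup>2 / 2) \<le> a * (v \<bullet> e) + a\<^sup>2 / 2"
        using exp_ge_add_one_self[of "- a * (v \<bullet> e) - a\<^sup>2 / 2"] by linarith
      also have "\<dots> \<le> a * (v \<bullet> e + 1/2)" using a a1 by (simp add: power2_eq_square algebra_simps mult_left_le)
      also have "\<dots> \<le> a * ((v \<bullet> e + 3/2)\<^sup>2 / 4)"
      proof -
        have "(v \<bullet> e + 3/2)\<^sup>2 / 4 - (v \<bullet> e + 1/2) = (v \<bullet> e - 1/2)\<^sup>2 / 4"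
          by (simp add: power2_eq_square field_simps)
        then have "v \<bullet> e + 1/2 \<le> (v \<bullet> e + 3/2)\<^sup>2 / 4" by (metis diff_ge_0_iff_ge divide_nonneg_nonneg zero_le_numeral zero_le_power2)
        then show ?thesis using a by (intro mult_left_mono) auto
      qed
      finally have "1 - exp (- a * (v \<bullet> e) - a\<^sup>2 / 2) \<le> a * ((v \<bullet> e + 3/2)\<^sup>2 / 4)" .
      moreover have "0 \<le> a * ((v \<bullet> e + 3/2)\<^sup>2 / 4)" using a by simp
      ultimately have "?w v \<le> a * ((v \<bullet> e + 3/2)\<^sup>2 / 4)" unfolding refl_weight_def by (rule max.boundedI[rotated])
      then show "?w v \<le> a * ((v \<bullet> e)\<^sup>2 + 3 * (v \<bullet> e) + 9/4) / 4"
        by (simp add: power2_eq_square algebra_simps)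
    qed
    also have "\<dots> = a * (1 + 3 * 0 + 9/4) / 4"
      using i2 z by (simp add: std_gaussian_inner_moments[OF e])
    also have "\<dots> \<le> a" using a by simp
    finally show ?thesis .
  qed
  ultimately show "(\<integral>v. ?w v \<partial>std_gaussian) \<in> {0..min 1 a}" by (auto simp: min_def)
  define q where "q x = - (1/10) * x + (69/100) * x\<^sup>2 - (1/10) * x ^ 3" for x :: real
  \<comment> \<open>By symmetry the half-line integral is half the integral of q at \<bar>v
    \<bullet> e\<bar>, hence at least (69/100 - 3/10 5/6) / 2 = 22/100.\<close>
  define H where "H x = (if x > 0 then q x else 0)" for x :: real
  have H_m[measurable]: "H \<in> borel_measurable borel" unfolding H_def q_def by measurable
  have qi: "integrable std_gaussian (\<lambda>v. q \<bar>v \<bullet> e\<bar>)"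
    using integrable_inner_power(1)[OF e, of 1] integrable_inner_power(1)[OF e, of 2] integrable_inner_power(1)[OF e, of 3]
    unfolding q_def by (intro Bochner_Integration.integrable_add Bochner_Integration.integrable_diff integrable_mult_right) auto
  have Hi: "integrable std_gaussian (\<lambda>v. H (v \<bullet> e))"
    by (rule Bochner_Integration.integrable_bound[OF qi]) (measurable, auto simp: H_def)
  have Hi': "integrable std_gaussian (\<lambda>v. H (- (v \<bullet> e)))"
    by (rule Bochner_Integration.integrable_bound[OF qi]) (measurable, auto simp: H_def)
  have "(\<integral>v. H (- (v \<bullet> e)) \<partial>std_gaussian) = (\<integral>v. H (reflect e v \<bullet> e) \<partial>std_gaussian)"
    by (intro Bochner_Integration.integral_cong refl) (simp add: reflect_def inner_diff_left ee)
  also have "\<dots> = (\<integral>v. H (v \<bullet> e) \<partial>std_gaussian)"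
    by (rule integral_std_gaussian_reflect[OF e, of "\<lambda>v. H (v \<bullet> e)"]) simp
  finally have "2 * (\<integral>v. H (v \<bullet> e) \<partial>std_gaussian) = (\<integral>v. H (v \<bullet> e) + H (- (v \<bullet> e)) \<partial>std_gaussian)"
    using Hi Hi' by simp
  also have "\<dots> = (\<integral>v. q \<bar>v \<bullet> e\<bar> \<partial>std_gaussian)"
    by (intro Bochner_Integration.integral_cong refl) (auto simp: H_def abs_if q_def)
  also have "\<dots> = - (1/10) * sqrt (2 / pi) + 69/100 - (1/10) * (2 * sqrt (2 / pi))"
    unfolding q_def
    using integrable_inner_power(1)[OF e, of 1] integrable_inner_power(1)[OF e, of 2] integrable_inner_power(1)[OF e, of 3]
    by (simp add: std_gaussian_inner_moments[OF e])
  finally have Hint: "(\<integral>v. H (v \<bullet> e) \<partial>std_gaussian) \<ge> 21/100" using sqrt_two_div_pi_le by linarith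
  have "(21/100) * min 1 a \<le> min 1 a * (\<integral>v. H (v \<bullet> e) \<partial>std_gaussian)"
    using Hint a by (subst mult.commute) (intro mult_left_mono, auto)
  also have "\<dots> = (\<integral>v. min 1 a * H (v \<bullet> e) \<partial>std_gaussian)" by simp
  also have "\<dots> \<le> (\<integral>v. (exp (- 2 * (v \<bullet> e)) - 1 + 2 * (v \<bullet> e)) * ?w v \<partial>std_gaussian)"
  proof (rule integral_mono)
    have "integrable std_gaussian (\<lambda>v. exp (- 2 * (v \<bullet> e)) * ?w v - ?w v + 2 * ((v \<bullet> e) * ?w v))"
      using w zw xw by simp
    then show "integrable std_gaussian (\<lambda>v. (exp (- 2 * (v \<bullet> e)) - 1 + 2 * (v \<bullet> e)) * ?w v)"
      by (simp add: algebra_simps)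
    fix v
    show "min 1 a * H (v \<bullet> e) \<le> (exp (- 2 * (v \<bullet> e)) - 1 + 2 * (v \<bullet> e)) * ?w v"
    proof (cases "v \<bullet> e > 0")
      case True
      then show ?thesis using psi_lower[OF a, of v e] by (simp add: H_def q_def)
    next
      case False
      have "exp (- 2 * (v \<bullet> e)) - 1 + 2 * (v \<bullet> e) \<ge> 0"
        using exp_ge_add_one_self[of "- 2 * (v \<bullet> e)"] by linarith
      then show ?thesis using False by (simp add: H_def refl_weight_bounds)
    qed
  qed (use Hi in simp)
  finally show "(\<integral>v. (exp (- 2 * (v \<bullet> e)) - 1 + 2 * (v \<bullet> e)) * ?w v \<partial>std_gaussian) \<ge> (21/100) * min 1 a" .
qed

text \<open>The one-dimensional core of the near case: a is the distance in units of T, \<theta> the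
  relative deviation from free flight, \<tau> the share of the other particles. The shifted branch
  leaves only the deviation. The reflected branch has distance a + 2 (v \<bullet> e), and its
  deviation is priced by the slope of the concave cost there.\<close>

lemma near_expectation:
  fixes e :: "'a::euclidean_space" and a \<beta> \<theta> \<tau> c :: real
  assumes e: "norm e = 1" and a: "a > 0"
    and th: "0 \<le> \<theta>" "\<theta> \<le> 1/12" "\<theta> * a \<le> 1/40"
    and be: "0 \<le> \<beta>" "\<beta> \<le> exp (- 5/2 - 5/4 * a)"
    and c: "0 \<le> c" "c \<le> exp (- 5/4 * a) / 1000"
    and tau: "0 \<le> \<tau>" "\<tau> \<le> exp (- 5/4 * a) / 10000"
    and F: "\<And>r. F r = (1 - \<beta>) * (1 - exp (- r)) + \<beta> * r"
    and G: "integrable std_gaussian G"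
    and G_le: "\<And>v. G v \<le> (1 - refl_weight a e v) * (\<theta> * a) + refl_weight a e v *
        (F (a + 2 * (v \<bullet> e)) + ((1 - \<beta>) * exp (- (a + 2 * (v \<bullet> e))) + \<beta>) * (\<theta> * (a + 2 * max 0 (v \<bullet> e)))
          + \<tau> * (a + 2 * max 0 (v \<bullet> e)))"
  shows "(\<integral>v. G v \<partial>std_gaussian) \<le> (1 - c) * F a"
proof -
  let ?w = "refl_weight a e"
  define X where "X = (\<integral>v. exp (- 2 * (v \<bullet> e)) * ?w v \<partial>std_gaussian)"
  define p where "p = (\<integral>v. ?w v \<partial>std_gaussian)"
  define Z where "Z = (\<integral>v. (v \<bullet> e) * ?w v \<partial>std_gaussian)"
  note ints = integrable_refl_weight[OF e a] integrable_inner_refl_weight[OF e a] integrable_exp_refl_weight[OF e a]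
  have be12: "\<beta> \<le> 1/12"
  proof -
    have "\<beta> \<le> exp (- (5/2))" by (rule order_trans[OF be(2)]) (use a in simp)
    also have "\<dots> \<le> 1/12" using exp_five_halves_ge by (simp add: exp_minus field_simps)
    finally show ?thesis .
  qed
  let ?J = "\<lambda>v. (\<theta> * a) - (\<theta> * a) * ?w v + (1 - \<beta>) * ?w v - ((1 - \<beta>) * exp (- a)) * (exp (- 2 * (v \<bullet> e)) * ?w v)
      + (\<beta> * a) * ?w v + (2 * \<beta>) * ((v \<bullet> e) * ?w v)
      + ((1 - \<beta>) * exp (- a) * \<theta> * a) * (exp (- 2 * (v \<bullet> e)) * ?w v) + ((1 - \<beta>) * exp (- a) * \<theta> / 2) * ?w v
      + ((\<beta> * \<theta> + \<tau>) * 2 * a) * ?w v + ((\<beta> * \<theta> + \<tau>) * 2) * ((v \<bullet> e) * ?w v)"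
  have "(\<integral>v. G v \<partial>std_gaussian) \<le> (\<integral>v. ?J v \<partial>std_gaussian)"
  proof (rule integral_mono[OF G])
    show "integrable std_gaussian ?J"
      using ints by (intro Bochner_Integration.integrable_add Bochner_Integration.integrable_diff integrable_mult_right) auto
    fix v
    define z where "z = v \<bullet> e"
    define w where "w = ?w v"
    have w0: "w \<ge> 0" by (simp add: w_def refl_weight_bounds)
    have ez: "exp (- (a + 2 * z)) = exp (- a) * exp (- 2 * z)" by (simp flip: exp_add)
    \<comment> \<open>Where the weight is nonzero, a + 2 z > 0, so the expression with the maximum
      is at most 2 (a + z). The bound is linear in z and its integral is known from the mean
      identity.\<close>
    have m1: "w * (a + 2 * max 0 z) \<le> w * (2 * a + 2 * z)"
    proof (cases "w = 0")
      case False
      then have "a + 2 * z > 0" using refl_weight_support[OF a] by (auto simp: w_def z_def)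
      then show ?thesis using w0 a by (intro mult_left_mono) auto
    qed simp
    have m2: "exp (- 2 * z) * (a + 2 * max 0 z) \<le> exp (- 2 * z) * a + 1/2"
    proof -
      have "exp (- 2 * z) * (2 * max 0 z) \<le> 1/2"
      proof (cases "z > 0")
        case True
        have "exp (2 * z) \<ge> 1 + 2 * z + (2 * z)\<^sup>2 / 2" using True by (intro exp_lower_Taylor_quadratic) simp
        moreover have "1 + 2 * z + (2 * z)\<^sup>2 / 2 - 4 * z = (1 - z)\<^sup>2 + z\<^sup>2" by algebra
        ultimately have "exp (2 * z) \<ge> 4 * z" by (smt (verit) zero_le_power2)
        then show ?thesis using True by (simp add: exp_minus field_simps)
      qed simp
      then show ?thesis by (simp add: distrib_left)
    qed
    have k: "0 \<le> (1 - \<beta>) * exp (- a) * \<theta> * w" using be be12 th w0 by simp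
    have "G v \<le> (1 - w) * (\<theta> * a) + w * (F (a + 2 * z) + ((1 - \<beta>) * exp (- (a + 2 * z)) + \<beta>) * (\<theta> * (a + 2 * max 0 z))
          + \<tau> * (a + 2 * max 0 z))" using G_le[of v] by (simp add: w_def z_def)
    also have "\<dots> = (1 - w) * (\<theta> * a) + w * F (a + 2 * z)
       + ((1 - \<beta>) * exp (- a) * \<theta> * w) * (exp (- 2 * z) * (a + 2 * max 0 z)) + (\<beta> * \<theta> + \<tau>) * (w * (a + 2 * max 0 z))"
      unfolding ez by algebra
    also have "\<dots> \<le> (1 - w) * (\<theta> * a) + w * F (a + 2 * z)
       + ((1 - \<beta>) * exp (- a) * \<theta> * w) * (exp (- 2 * z) * a + 1/2) + (\<beta> * \<theta> + \<tau>) * (w * (2 * a + 2 * z))"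
      using be th tau by (intro add_mono mult_left_mono[OF m2 k] mult_left_mono[OF m1]) auto
    also have "\<dots> = ?J v" unfolding F ez z_def[symmetric] w_def[symmetric]
      by (simp add: algebra_simps add_divide_distrib diff_divide_distrib)
    finally show "G v \<le> ?J v" .
  qed
  also have "\<dots> = \<theta> * a - \<theta> * a * p + (1 - \<beta>) * p - ((1 - \<beta>) * exp (- a)) * X + \<beta> * a * p + 2 * \<beta> * Z
     + ((1 - \<beta>) * exp (- a) * \<theta> * a) * X + ((1 - \<beta>) * exp (- a) * \<theta> / 2) * p
     + ((\<beta> * \<theta> + \<tau>) * 2 * a) * p + ((\<beta> * \<theta> + \<tau>) * 2) * Z"
    using ints unfolding X_def p_def Z_def by simp
  also have "\<dots> = \<theta> * a * (1 - p) + (1 - \<beta>) * (p - exp (- a) * X) + \<beta> * a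
     + (1 - \<beta>) * exp (- a) * (\<theta> * (a * X + p / 2)) + (\<beta> * \<theta> + \<tau>) * (a * p + a)"
  proof -
    have Z: "2 * Z = a * (1 - p)" unfolding Z_def p_def by (rule refl_weight_mean[OF e a])
    show ?thesis using Z by algebra
  qed
  also have "\<dots> \<le> \<theta> * a * (1 - p) + (1 - \<beta>) * (p - exp (- a) * X) + \<beta> * a
     + (1 - \<beta>) * exp (- a) * (\<theta> * (a * X + p / 2)) + (\<beta> * \<theta> + \<tau>) * (2 * a)"
  proof -
    have "p \<le> 1" using refl_weight_mass[OF e a] by (simp add: p_def)
    then have "a * p + a \<le> 2 * a" using a by simp
    then show ?thesis using be th tau by (intro add_left_mono mult_left_mono) auto
  qed
  also have "\<dots> \<le> (1 - c) * F a"
  proof (rule near_arith)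
    show "0 \<le> p" "p \<le> 1" "p \<le> a" using refl_weight_mass[OF e a] by (auto simp: p_def)
    show "X \<ge> 0" unfolding X_def by (intro Bochner_Integration.integral_nonneg) (simp add: refl_weight_bounds)
    have "(\<integral>v. (exp (- 2 * (v \<bullet> e)) - 1 + 2 * (v \<bullet> e)) * ?w v \<partial>std_gaussian)
        = (\<integral>v. exp (- 2 * (v \<bullet> e)) * ?w v - ?w v + 2 * ((v \<bullet> e) * ?w v) \<partial>std_gaussian)"
      by (intro Bochner_Integration.integral_cong refl) (simp add: algebra_simps)
    also have "\<dots> = X - p + 2 * Z" using ints unfolding X_def p_def Z_def by simp
    also have "2 * Z = a * (1 - p)" unfolding Z_def p_def by (rule refl_weight_mean[OF e a])
    finally show "X - p + a * (1 - p) \<ge> (21/100) * min 1 a" using refl_weight_psi[OF e a] by simp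
    have Ea: "exp a * exp (- 5/4 * a) * a = a * exp (- a / 4)" by (simp flip: exp_add)
    have "exp a * \<beta> * a \<le> exp a * exp (- 5/2 - 5/4 * a) * a"
      using be a by (intro mult_right_mono mult_left_mono) auto
    also have "\<dots> = exp (- (5/2)) * (a * exp (- a / 4))"
    proof -
      have "exp (- 5/2 - 5/4 * a) = exp (- (5/2)) * exp (- 5/4 * a)" by (simp flip: exp_add)
      then have "exp a * exp (- 5/2 - 5/4 * a) * a = exp (- (5/2)) * (exp a * exp (- 5/4 * a) * a)"
        by (simp only: mult_ac)
      then show ?thesis by (simp only: Ea)
    qed
    also have "\<dots> \<le> (1/12) * ((3/2) * min 1 a)"
    proof (rule mult_mono)
      show "exp (- (5/2)) \<le> (1/12::real)" using exp_five_halves_ge by (simp add: exp_minus field_simps)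
    qed (use mult_exp_minus_quarter_le[OF a] a in auto)
    finally show "exp a * \<beta> * a \<le> (1/8) * min 1 a" by simp
    have e1: "1 - exp (- a) \<le> a" using exp_ge_add_one_self[of "- a"] by linarith
    have "F a \<le> (1 - \<beta>) * a + \<beta> * a" unfolding F using be be12 e1 by (intro add_mono mult_left_mono) auto
    then have Fa: "F a \<le> a" by (simp add: algebra_simps)
    have F0: "0 \<le> F a" unfolding F using be be12 a by (intro add_nonneg_nonneg mult_nonneg_nonneg) auto
    have "exp a * c * F a \<le> exp a * (exp (- 5/4 * a) / 1000) * a"
      using c a Fa F0 by (intro mult_mono) auto
    moreover have "2 * exp a * \<tau> * a \<le> 2 * exp a * (exp (- 5/4 * a) / 10000) * a"
      using tau a by (intro mult_right_mono mult_left_mono) auto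
    moreover have "exp a * (exp (- 5/4 * a) / 1000) * a = (exp a * exp (- 5/4 * a) * a) / 1000"
      "2 * exp a * (exp (- 5/4 * a) / 10000) * a = (exp a * exp (- 5/4 * a) * a) / 5000" by simp_all
    \<comment> \<open>The share 1/1000 comes from c and 1/5000 from \<tau>; after
      \<open>mult_exp_minus_quarter_le\<close> the total is 18/10000.\<close>
    ultimately have "2 * exp a * \<tau> * a + exp a * c * F a \<le> (12/10000) * (exp a * exp (- 5/4 * a) * a)"
      by linarith
    also have "\<dots> \<le> (12/10000) * ((3/2) * min 1 a)" unfolding Ea using mult_exp_minus_quarter_le[OF a] by simp
    also have "\<dots> \<le> (3/1000) * min 1 a" using a by simp
    finally show "2 * exp a * \<tau> * a + exp a * c * F a \<le> (3/1000) * min 1 a" .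
  qed (use a th be be12 F in auto)
  finally show ?thesis .
qed

section \<open>The Verlet recursion\<close>

text \<open>The second component is the velocity at the midpoint following the grid point. The force may
  depend on the step index, so that the first and second variation of the scheme are again
  instances of the same recursion.\<close>

primrec vstate :: "(nat \<Rightarrow> 'a \<Rightarrow> 'a) \<Rightarrow> real \<Rightarrow> 'a \<Rightarrow> 'a \<Rightarrow> nat \<Rightarrow> 'a \<times> 'a::real_vector"
  where
    "vstate g h x v 0 = (x, v - (h / 2) *\<^sub>R g 0 x)"
  | "vstate g h x v (Suc j) =
      (let q = fst (vstate g h x v j) + h *\<^sub>R snd (vstate g h x v j)
       in (q, snd (vstate g h x v j) - h *\<^sub>R g (Suc j) q))"

definition vpos :: "(nat \<Rightarrow> 'a \<Rightarrow> 'a) \<Rightarrow> real \<Rightarrow> 'a \<Rightarrow> 'a \<Rightarrow> nat \<Rightarrow> 'a::real_vector"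
  where "vpos g h x v j = fst (vstate g h x v j)"

definition vmid :: "(nat \<Rightarrow> 'a \<Rightarrow> 'a) \<Rightarrow> real \<Rightarrow> 'a \<Rightarrow> 'a \<Rightarrow> nat \<Rightarrow> 'a::real_vector"
  where "vmid g h x v j = snd (vstate g h x v j)"

lemma vpos_simps:
  "vpos g h x v 0 = x" "vpos g h x v (Suc j) = vpos g h x v j + h *\<^sub>R vmid g h x v j"
  "vmid g h x v 0 = v - (h / 2) *\<^sub>R g 0 x"
  "vmid g h x v (Suc j) = vmid g h x v j - h *\<^sub>R g (Suc j) (vpos g h x v (Suc j))"
  by (simp_all add: vpos_def vmid_def Let_def)

text \<open>Weights of the discrete variation-of-constants formula: the force at step l acts for j -
  l steps, and the force at time 0 with half weight because the scheme opens with a half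
  kick.\<close>

definition vwt :: "nat \<Rightarrow> nat \<Rightarrow> real"
  where "vwt j l = (if l = 0 then real j / 2 else real j - real l)"

lemma vwt_nonneg: "l \<le> j \<Longrightarrow> vwt j l \<ge> 0"
  by (simp add: vwt_def)

text \<open>The half weight makes this the exact value of the corresponding double time integral, so
  the estimates below carry no correction in the step size.\<close>

lemma sum_vwt: "(\<Sum>l<j. vwt j l) = (real j)\<^sup>2 / 2"
proof -
  have "(\<Sum>l<j. vwt j l) = (\<Sum>l<j. (real j - real l)) - real j / 2"
  proof (cases j)
    case (Suc m)
    have "(\<Sum>l<Suc m. vwt (Suc m) l) = real (Suc m) / 2 + (\<Sum>l<m. vwt (Suc m) (Suc l))"
      by (subst sum.lessThan_Suc_shift) (simp add: vwt_def)
    moreover have "(\<Sum>l<Suc m. (real (Suc m) - real l)) = real (Suc m) + (\<Sum>l<m. vwt (Suc m) (Suc l))"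
      by (subst sum.lessThan_Suc_shift) (simp add: vwt_def)
    ultimately show ?thesis unfolding Suc by simp
  qed simp
  moreover have "2 * (\<Sum>l<j. (real j - real l)) = real j * (real j + 1)"
    by (induction j) (simp_all add: algebra_simps sum.distrib sum_subtractf)
  ultimately show ?thesis by (simp add: power2_eq_square algebra_simps)
qed

lemma vmid_volterra:
  "vmid g h x v j = v - h *\<^sub>R (\<Sum>l\<le>j. (if l = 0 then 1/2 else 1) *\<^sub>R g l (vpos g h x v l))"
  by (induction j) (simp_all add: vpos_simps scaleR_add_right algebra_simps)

lemma vpos_volterra:
  "vpos g h x v j = x + (real j * h) *\<^sub>R v - h\<^sup>2 *\<^sub>R (\<Sum>l<j. vwt j l *\<^sub>R g l (vpos g h x v l))"
proof (induction j)
  case (Suc j)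
  let ?G = "\<lambda>l. g l (vpos g h x v l)"
  have w: "vwt (Suc j) l = vwt j l + (if l = 0 then 1/2 else 1)" if "l \<le> j" for l
    by (simp add: vwt_def add_divide_distrib)
  have "(\<Sum>l<Suc j. vwt (Suc j) l *\<^sub>R ?G l) = (\<Sum>l\<le>j. vwt j l *\<^sub>R ?G l + (if l = 0 then 1/2 else 1) *\<^sub>R ?G l)"
    unfolding lessThan_Suc_atMost
    by (intro sum.cong refl) (simp only: w atMost_iff scaleR_add_left)
  also have "\<dots> = (\<Sum>l\<le>j. vwt j l *\<^sub>R ?G l) + (\<Sum>l\<le>j. (if l = 0 then 1/2 else 1) *\<^sub>R ?G l)"
    by (rule sum.distrib)
  also have "(\<Sum>l\<le>j. vwt j l *\<^sub>R ?G l) = (\<Sum>l<j. vwt j l *\<^sub>R ?G l)"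
    by (simp add: lessThan_Suc_atMost[symmetric] vwt_def)
  finally have s: "(\<Sum>l<Suc j. vwt (Suc j) l *\<^sub>R ?G l)
    = (\<Sum>l<j. vwt j l *\<^sub>R ?G l) + (\<Sum>l\<le>j. (if l = 0 then 1/2 else 1) *\<^sub>R ?G l)" .
  have "vpos g h x v (Suc j) = vpos g h x v j + h *\<^sub>R vmid g h x v j" by (simp add: vpos_simps)
  also have "\<dots> = x + (real (Suc j) * h) *\<^sub>R v - h\<^sup>2 *\<^sub>R (\<Sum>l<Suc j. vwt (Suc j) l *\<^sub>R ?G l)"
    unfolding s by (subst Suc, subst vmid_volterra)
      (simp add: algebra_simps power2_eq_square)
  finally show ?case .
qed (simp add: vpos_simps)

text \<open>Since forces may depend on the step, the difference of two trajectories is itself an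
  instance of the recursion, driven by the recorded differences of the forces. One a priori bound
  then serves for differences and for variations.\<close>

lemma vpos_diff:
  "vpos g h x v j - vpos g' h x' v' j
    = vpos (\<lambda>l _. g l (vpos g h x v l) - g' l (vpos g' h x' v' l)) h (x - x') (v - v') j"
proof -
  have "vpos g h x v j - vpos g' h x' v' j
    = vpos (\<lambda>l _. g l (vpos g h x v l) - g' l (vpos g' h x' v' l)) h (x - x') (v - v') j \<and>
    vmid g h x v j - vmid g' h x' v' j
    = vmid (\<lambda>l _. g l (vpos g h x v l) - g' l (vpos g' h x' v' l)) h (x - x') (v - v') j"
    by (induction j) (auto simp: vpos_simps algebra_simps)
  then show ?thesis by blast
qed

text \<open>Besides the Euclidean and the l1 norm, the sum over all particles but one has to be
  estimated, and that is only a seminorm.\<close>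

definition seminorm_on :: "('a::real_vector \<Rightarrow> real) \<Rightarrow> bool"
  where "seminorm_on \<nu> \<longleftrightarrow> (\<forall>x y. \<nu> (x + y) \<le> \<nu> x + \<nu> y) \<and> (\<forall>c x. \<nu> (c *\<^sub>R x) = \<bar>c\<bar> * \<nu> x)"

lemma seminorm_zero: "seminorm_on \<nu> \<Longrightarrow> \<nu> 0 = 0"
  unfolding seminorm_on_def by (metis abs_zero mult_zero_left scaleR_zero_left)

lemma seminorm_sum:
  assumes "seminorm_on \<nu>" shows "\<nu> (\<Sum>i\<in>I. f i) \<le> (\<Sum>i\<in>I. \<nu> (f i))"
proof (induction I rule: infinite_finite_induct)
  case (insert i I)
  have "\<nu> (f i + sum f I) \<le> \<nu> (f i) + \<nu> (sum f I)" using assms by (simp add: seminorm_on_def)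
  then show ?case using insert by simp
qed (use seminorm_zero[OF assms] in auto)

lemma seminorm_minus: "seminorm_on \<nu> \<Longrightarrow> \<nu> (- x) = \<nu> x"
  unfolding seminorm_on_def by (metis abs_minus_cancel abs_one mult_1 scaleR_minus1_left)

lemma seminorm_on_norm: "seminorm_on norm"
  by (simp add: seminorm_on_def norm_triangle_ineq)

text \<open>A constant S propagates along the induction if \<alpha> + (N h)^2 \<beta>/2 + S/12 \<le>
  S, where 1/12 is half of the smallness bound 1/6; equality gives the factor 12/11.\<close>

lemma volterra_bound:
  fixes s :: "nat \<Rightarrow> real"
  assumes s: "\<And>j. j \<le> N \<Longrightarrow> s j \<le> \<alpha> + h\<^sup>2 * (\<Sum>l<j. vwt j l * (\<Lambda> * s l + \<beta>))"
    and nn: "\<Lambda> \<ge> 0" "\<alpha> \<ge> 0" "\<beta> \<ge> 0" "h \<ge> 0" and small: "\<Lambda> * (real N * h)\<^sup>2 \<le> 1/6"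
    and j: "j \<le> N"
  shows "s j \<le> (12/11) * (\<alpha> + (real N * h)\<^sup>2 * \<beta> / 2)"
  using j
proof (induction j rule: less_induct)
  case (less j)
  define S where "S = (12/11) * (\<alpha> + (real N * h)\<^sup>2 * \<beta> / 2)"
  have S0: "S \<ge> 0" using nn by (simp add: S_def)
  have "(\<Sum>l<j. vwt j l * (\<Lambda> * s l + \<beta>)) \<le> (\<Sum>l<j. vwt j l * (\<Lambda> * S + \<beta>))"
    using less nn by (intro sum_mono mult_left_mono add_mono vwt_nonneg) (auto simp: S_def)
  also have "\<dots> = (real j)\<^sup>2 / 2 * (\<Lambda> * S + \<beta>)" by (simp add: sum_distrib_right[symmetric] sum_vwt)
  also have "\<dots> \<le> (real N)\<^sup>2 / 2 * (\<Lambda> * S + \<beta>)"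
    using less.prems nn S0 by (intro mult_right_mono divide_right_mono power_mono) auto
  finally have "s j \<le> \<alpha> + h\<^sup>2 * ((real N)\<^sup>2 / 2 * (\<Lambda> * S + \<beta>))"
    using s[OF less.prems] by (smt (verit) mult_left_mono zero_le_power2)
  also have "\<dots> = \<alpha> + (real N * h)\<^sup>2 * \<beta> / 2 + (\<Lambda> * (real N * h)\<^sup>2) * S / 2"
    by (simp add: power_mult_distrib algebra_simps)
  also have "\<dots> \<le> \<alpha> + (real N * h)\<^sup>2 * \<beta> / 2 + (1/6) * S / 2"
    using small S0 by (intro add_left_mono divide_right_mono mult_right_mono) auto
  also have "\<dots> = S" by (simp add: S_def field_simps)
  finally show ?case by (simp add: S_def)
qed

text \<open>The force is controlled only along the given trajectory. The second estimate measures
  the deviation from free flight, on which both regimes of the contraction argument rely.\<close>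

lemma vpos_bound:
  assumes \<nu>: "seminorm_on \<nu>"
    and F: "\<And>l. l < N \<Longrightarrow> \<nu> (g l (vpos g h x v l)) \<le> \<Lambda> * \<nu> (vpos g h x v l) + \<beta>"
    and lin: "\<And>j. j \<le> N \<Longrightarrow> \<nu> (x + (real j * h) *\<^sub>R v) \<le> \<alpha>"
    and nn: "\<Lambda> \<ge> 0" "\<alpha> \<ge> 0" "\<beta> \<ge> 0" "h \<ge> 0" and small: "\<Lambda> * (real N * h)\<^sup>2 \<le> 1/6"
    and j: "j \<le> N"
  shows "\<nu> (vpos g h x v j) \<le> (12/11) * (\<alpha> + (real N * h)\<^sup>2 * \<beta> / 2)" (is ?A)
    and "\<nu> (vpos g h x v j - (x + (real j * h) *\<^sub>R v))
      \<le> (real N * h)\<^sup>2 / 2 * (\<Lambda> * ((12/11) * (\<alpha> + (real N * h)\<^sup>2 * \<beta> / 2)) + \<beta>)" (is ?B)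
proof -
  have err: "\<nu> (vpos g h x v j - (x + (real j * h) *\<^sub>R v))
    \<le> h\<^sup>2 * (\<Sum>l<j. vwt j l * (\<Lambda> * \<nu> (vpos g h x v l) + \<beta>))" if "j \<le> N" for j
  proof -
    have "vpos g h x v j - (x + (real j * h) *\<^sub>R v) = - (h\<^sup>2 *\<^sub>R (\<Sum>l<j. vwt j l *\<^sub>R g l (vpos g h x v l)))"
      by (subst vpos_volterra) simp
    then have "\<nu> (vpos g h x v j - (x + (real j * h) *\<^sub>R v)) = h\<^sup>2 * \<nu> (\<Sum>l<j. vwt j l *\<^sub>R g l (vpos g h x v l))"
      using \<nu> by (simp add: seminorm_minus) (simp add: seminorm_on_def)
    also have "\<dots> \<le> h\<^sup>2 * (\<Sum>l<j. \<nu> (vwt j l *\<^sub>R g l (vpos g h x v l)))"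
      by (intro mult_left_mono seminorm_sum \<nu>) auto
    also have "\<dots> = h\<^sup>2 * (\<Sum>l<j. vwt j l * \<nu> (g l (vpos g h x v l)))"
      using \<nu> by (auto simp: seminorm_on_def vwt_nonneg intro!: sum.cong)
    also have "\<dots> \<le> h\<^sup>2 * (\<Sum>l<j. vwt j l * (\<Lambda> * \<nu> (vpos g h x v l) + \<beta>))"
      using that by (intro mult_left_mono sum_mono F vwt_nonneg) auto
    finally show ?thesis .
  qed
  have bound: "\<nu> (vpos g h x v j) \<le> (12/11) * (\<alpha> + (real N * h)\<^sup>2 * \<beta> / 2)" if "j \<le> N" for j
  proof (rule volterra_bound[OF _ nn small that])
    fix j assume j: "j \<le> N"
    have "\<nu> (vpos g h x v j) \<le> \<nu> (x + (real j * h) *\<^sub>R v) + \<nu> (vpos g h x v j - (x + (real j * h) *\<^sub>R v))"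
      using \<nu> unfolding seminorm_on_def by (metis add.commute diff_add_cancel)
    then show "\<nu> (vpos g h x v j) \<le> \<alpha> + h\<^sup>2 * (\<Sum>l<j. vwt j l * (\<Lambda> * \<nu> (vpos g h x v l) + \<beta>))"
      using lin[OF j] err[OF j] by linarith
  qed
  show ?A by (rule bound[OF j])
  define S where "S = (12/11) * (\<alpha> + (real N * h)\<^sup>2 * \<beta> / 2)"
  have S0: "S \<ge> 0" using nn by (simp add: S_def)
  have "(\<Sum>l<j. vwt j l * (\<Lambda> * \<nu> (vpos g h x v l) + \<beta>)) \<le> (\<Sum>l<j. vwt j l * (\<Lambda> * S + \<beta>))"
    using bound j nn by (intro sum_mono mult_left_mono add_mono vwt_nonneg) (auto simp: S_def)
  also have "\<dots> = (real j)\<^sup>2 / 2 * (\<Lambda> * S + \<beta>)" by (simp add: sum_distrib_right[symmetric] sum_vwt)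
  also have "\<dots> \<le> (real N)\<^sup>2 / 2 * (\<Lambda> * S + \<beta>)"
    using j nn S0 by (intro mult_right_mono divide_right_mono power_mono) auto
  finally have "h\<^sup>2 * (\<Sum>l<j. vwt j l * (\<Lambda> * \<nu> (vpos g h x v l) + \<beta>)) \<le> h\<^sup>2 * ((real N)\<^sup>2 / 2 * (\<Lambda> * S + \<beta>))"
    by (intro mult_left_mono) auto
  then show ?B using err[OF j] by (simp add: S_def power_mult_distrib mult_ac)
qed

section \<open>Velocity Verlet as a piecewise differential equation\<close>

context
  fixes U :: "'a::euclidean_space \<Rightarrow> real" and h :: real and x v :: 'a
  assumes h: "h > 0"
begin

private abbreviation (input) "g \<equiv> grad U"
private abbreviation (input) "Q j \<equiv> vpos (\<lambda>_. grad U) h x v j"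
text \<open>Undoes the half kick contained in \<open>vmid\<close> and so recovers the velocity at
  the grid point itself.\<close>

private definition "P j = vmid (\<lambda>_. grad U) h x v j + (h / 2) *\<^sub>R g (Q j)"

private lemma Q_Suc: "Q (Suc j) = Q j + h *\<^sub>R P j - (h\<^sup>2 / 2) *\<^sub>R g (Q j)"
  by (simp add: P_def vpos_simps algebra_simps power2_eq_square)

private lemma P_Suc: "P (Suc j) = P j - (h / 2) *\<^sub>R (g (Q j) + g (Q (Suc j)))"
proof -
  have "h *\<^sub>R y = (h/2) *\<^sub>R y + (h/2) *\<^sub>R y" for y :: 'a by (simp flip: scaleR_add_left)
  then show ?thesis unfolding P_def vpos_simps(4) by (simp add: algebra_simps)
qed

private lemma grid:
  assumes "real j * h < t" "t < real (Suc j) * h"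
  shows "t / h \<notin> \<int>" "grid_floor h t = real j * h" "grid_ceiling h t = real (Suc j) * h"
proof -
  have "real j < t / h" "t / h < real j + 1" using assms h by (simp_all add: field_simps)
  then have f: "\<lfloor>t / h\<rfloor> = int j" "\<lceil>t / h\<rceil> = int j + 1" by linarith+
  then show "grid_floor h t = real j * h" "grid_ceiling h t = real (Suc j) * h"
    by (simp_all add: grid_floor_def grid_ceiling_def mult.commute)
  show "t / h \<notin> \<int>"
  proof
    assume "t / h \<in> \<int>"
    then have "\<lceil>t / h\<rceil> = \<lfloor>t / h\<rfloor>" by (auto elim: Ints_cases)
    then show False using f by simp
  qed
qed

text \<open>Uniqueness on the grid. Inside a cell the right-hand sides are explicit in t and in grid
  values, so subtracting their antiderivative leaves a continuous function whose derivative vanishes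
  off the endpoints. Position precedes velocity because the velocity equation involves the position
  at the end of the cell.\<close>

private lemma solution_on_grid:
  assumes sol: "verlet_solution U h x v q p"
  shows "q (real j * h) = Q j \<and> p (real j * h) = P j"
proof (induction j)
  case 0
  then show ?case using sol by (simp add: verlet_solution_def vpos_simps P_def)
next
  case (Suc j)
  let ?a = "real j * h" and ?b = "real (Suc j) * h"
  have ab: "?a \<le> ?b" "0 \<le> ?a" using h by auto
  have cont: "continuous_on {?a..?b} q" "continuous_on {?a..?b} p"
    using sol ab by (auto simp: verlet_solution_def intro: continuous_on_subset)
  have der: "(q has_vector_derivative (p ?a - (t - ?a) *\<^sub>R g (q ?a))) (at t)"
    "(p has_vector_derivative (- (1/2) *\<^sub>R (g (q ?a) + g (q ?b)))) (at t)" if "?a < t" "t < ?b" for t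
  proof -
    have "t > 0" using ab that by linarith
    then show "(q has_vector_derivative (p ?a - (t - ?a) *\<^sub>R g (q ?a))) (at t)"
      "(p has_vector_derivative (- (1/2) *\<^sub>R (g (q ?a) + g (q ?b)))) (at t)"
      using sol grid[OF that] unfolding verlet_solution_def by metis+
  qed
  define D where "D t = q t - (t - ?a) *\<^sub>R p ?a + ((t - ?a)\<^sup>2 / 2) *\<^sub>R g (q ?a)" for t
  have "D ?b = D ?a"
  proof (rule has_derivative_zero_unique_strong_interval[of "{?a, ?b}" ?a ?b D])
    show "continuous_on {?a..?b} D" unfolding D_def by (intro continuous_intros cont) auto
    fix t assume t: "t \<in> {?a..?b} - {?a, ?b}"
    have "(D has_vector_derivative (p ?a - (t - ?a) *\<^sub>R g (q ?a)) - 1 *\<^sub>R p ?a + (t - ?a) *\<^sub>R g (q ?a)) (at t)"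
      unfolding D_def using der[of t] t
      by (auto intro!: derivative_eq_intros)
    then show "(D has_derivative (\<lambda>h. 0)) (at t within {?a..?b})"
      by (auto simp: has_vector_derivative_def intro: has_derivative_at_withinI)
  qed (use ab in auto)
  moreover have ba: "?b - ?a = h" by (simp add: algebra_simps)
  ultimately have q: "q ?b = Q (Suc j)" using Suc unfolding D_def Q_Suc by (simp add: algebra_simps)
  define D2 where "D2 t = p t + ((t - ?a) / 2) *\<^sub>R (g (q ?a) + g (q ?b))" for t
  have "D2 ?b = D2 ?a"
  proof (rule has_derivative_zero_unique_strong_interval[of "{?a, ?b}" ?a ?b D2])
    show "continuous_on {?a..?b} D2" unfolding D2_def by (intro continuous_intros cont) auto
    fix t assume t: "t \<in> {?a..?b} - {?a, ?b}"
    have "(D2 has_vector_derivative (- (1/2) *\<^sub>R (g (q ?a) + g (q ?b))) + (1/2) *\<^sub>R (g (q ?a) + g (q ?b))) (at t)"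
      unfolding D2_def using der[of t] t
      by (auto intro!: derivative_eq_intros)
    then show "(D2 has_derivative (\<lambda>h. 0)) (at t within {?a..?b})"
      by (auto simp: has_vector_derivative_def intro: has_derivative_at_withinI)
  qed (use ab in auto)
  then have "p ?b = P (Suc j)" using Suc ba q unfolding D2_def P_Suc by (simp add: algebra_simps)
  then show ?case using q by simp
qed

text \<open>The time spent in cell j up to t. Sums of clipped pieces are continuous on the whole
  line, grid points included, without any gluing.\<close>

private definition "clip j t = max 0 (min h (t - real j * h))"

private definition "qs J t = x + (\<Sum>j<J. clip j t *\<^sub>R P j - ((clip j t)\<^sup>2 / 2) *\<^sub>R g (Q j))"
private definition "ps J t = v - (\<Sum>j<J. (clip j t / 2) *\<^sub>R (g (Q j) + g (Q (Suc j))))"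

text \<open>Cells not yet entered at time t contribute nothing, so near any time \<open>qsol\<close>
  and \<open>psol\<close> agree with sums over a fixed number of cells.\<close>

private lemma qs_extend:
  assumes "J \<le> J'" "t \<le> real J * h" shows "qs J' t = qs J t" "ps J' t = ps J t"
proof -
  have z: "clip j t = 0" if "j \<ge> J" for j
  proof -
    have "real J * h \<le> real j * h" using that h by simp
    then have "t - real j * h \<le> 0" using assms by linarith
    then show ?thesis by (simp add: clip_def max_absorb1 min.coboundedI2)
  qed
  show "qs J' t = qs J t" unfolding qs_def using assms(1) z
    by (intro arg_cong2[where f="(+)"] refl sum.mono_neutral_right) auto
  show "ps J' t = ps J t" unfolding ps_def using assms(1) z
    by (intro arg_cong2[where f="(-)"] refl sum.mono_neutral_right) auto
qed

private definition "qsol t = qs (nat (\<lfloor>t / h\<rfloor> + 1)) t"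
private definition "psol t = ps (nat (\<lfloor>t / h\<rfloor> + 1)) t"

private lemma sol_eq:
  assumes "t < real J * h" shows "qsol t = qs J t" "psol t = ps J t"
proof -
  let ?N = "nat (\<lfloor>t / h\<rfloor> + 1)"
  have "t / h < real J" using assms h by (simp add: field_simps)
  then have "?N \<le> J" by linarith
  moreover have "t / h \<le> real ?N" by linarith
  then have "t \<le> real ?N * h" using h by (simp add: field_simps)
  ultimately show "qsol t = qs J t" "psol t = ps J t"
    unfolding qsol_def psol_def by (auto dest: qs_extend)
qed

private lemma sol_continuous: "continuous_on S qsol" "continuous_on S psol"
proof -
  have c: "isCont qsol t \<and> isCont psol t" for t
  proof -
    obtain J where J: "t < real J * h" using reals_Archimedean3[OF h] by blast
    have "isCont (qs J) t" "isCont (ps J) t"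
      unfolding qs_def ps_def clip_def by (intro continuous_intros; simp)+
    moreover have "eventually (\<lambda>s. s < real J * h) (nhds t)"
      using J by (rule eventually_nhds_in_open[of "{..<real J * h}", simplified])
    then have "eventually (\<lambda>s. qsol s = qs J s) (nhds t)" "eventually (\<lambda>s. psol s = ps J s) (nhds t)"
      by (auto elim!: eventually_mono simp: sol_eq)
    ultimately show ?thesis by (simp add: isCont_cong)
  qed
  then show "continuous_on S qsol" "continuous_on S psol"
    by (auto intro!: continuous_at_imp_continuous_on)
qed

private lemma clip_below: "real (Suc i) * h \<le> t \<Longrightarrow> clip i t = h"
  using h by (simp add: clip_def algebra_simps)

private lemma partial: "qs j (real j * h) = Q j" "ps j (real j * h) = P j"
proof -
  have "x + (\<Sum>i<j. h *\<^sub>R P i - (h\<^sup>2 / 2) *\<^sub>R g (Q i)) = Q j"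
    by (induction j) (simp_all add: Q_Suc vpos_simps(1))
  moreover have "(\<Sum>i<j. clip i (real j * h) *\<^sub>R P i - ((clip i (real j * h))\<^sup>2 / 2) *\<^sub>R g (Q i))
      = (\<Sum>i<j. h *\<^sub>R P i - (h\<^sup>2 / 2) *\<^sub>R g (Q i))"
    using h by (intro sum.cong refl) (simp add: clip_below)
  ultimately show "qs j (real j * h) = Q j" by (simp add: qs_def)
  have "v - (\<Sum>i<j. (h / 2) *\<^sub>R (g (Q i) + g (Q (Suc i)))) = P j"
  proof (induction j)
    case 0 then show ?case by (simp add: P_def vpos_simps)
  next
    case (Suc j)
    then show ?case by (simp add: P_Suc algebra_simps)
  qed
  moreover have "(\<Sum>i<j. (clip i (real j * h) / 2) *\<^sub>R (g (Q i) + g (Q (Suc i))))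
      = (\<Sum>i<j. (h / 2) *\<^sub>R (g (Q i) + g (Q (Suc i))))"
    using h by (intro sum.cong refl) (simp add: clip_below)
  ultimately show "ps j (real j * h) = P j" by (simp add: ps_def)
qed

private lemma sol_piece:
  assumes "real j * h \<le> t" "t < real (Suc j) * h"
  shows "qsol t = Q j + (t - real j * h) *\<^sub>R P j - ((t - real j * h)\<^sup>2 / 2) *\<^sub>R g (Q j)"
    and "psol t = P j - ((t - real j * h) / 2) *\<^sub>R (g (Q j) + g (Q (Suc j)))"
proof -
  have c: "clip i t = clip i (real j * h)" if "i < j" for i
  proof -
    have "real (Suc i) * h \<le> real j * h" using that h by (intro mult_right_mono) auto
    then show ?thesis using clip_below[of i t] clip_below[of i "real j * h"] assms(1) by linarith
  qed
  have cj: "clip j t = t - real j * h" using assms by (simp add: clip_def algebra_simps)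
  have "qsol t = qs (Suc j) t" using assms sol_eq by blast
  also have "\<dots> = qs j (real j * h) + (t - real j * h) *\<^sub>R P j - ((t - real j * h)\<^sup>2 / 2) *\<^sub>R g (Q j)"
    by (simp add: qs_def c cj)
  finally show "qsol t = Q j + (t - real j * h) *\<^sub>R P j - ((t - real j * h)\<^sup>2 / 2) *\<^sub>R g (Q j)"
    by (simp add: partial)
  have "psol t = ps (Suc j) t" using assms sol_eq by blast
  also have "\<dots> = ps j (real j * h) - ((t - real j * h) / 2) *\<^sub>R (g (Q j) + g (Q (Suc j)))"
    by (simp add: ps_def c cj)
  finally show "psol t = P j - ((t - real j * h) / 2) *\<^sub>R (g (Q j) + g (Q (Suc j)))"
    by (simp add: partial)
qed

private lemma sol_grid: "qsol (real j * h) = Q j" "psol (real j * h) = P j"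
  using sol_piece[of j "real j * h"] h by auto

private lemma sol_is_solution: "verlet_solution U h x v qsol psol"
  unfolding verlet_solution_def
proof (intro conjI allI impI sol_continuous)
  show "qsol 0 = x" "psol 0 = v" using sol_grid[of 0] by (simp_all add: vpos_simps P_def)
  fix t :: real assume t: "t > 0" "t / h \<notin> \<int>"
  define j where "j = nat \<lfloor>t / h\<rfloor>"
  have "t / h \<ge> 0" using t h by simp
  then have jj: "real j \<le> t / h" "t / h < real j + 1" by (auto simp: j_def)
  moreover have "real j \<noteq> t / h" using t(2) by (metis Ints_of_nat)
  ultimately have j: "real j * h < t" "t < real (Suc j) * h" using h by (auto simp: field_simps)
  note gr = grid[OF j]
  let ?S = "{real j * h<..<real (Suc j) * h}"
  have "((\<lambda>t. Q j + (t - real j * h) *\<^sub>R P j - ((t - real j * h)\<^sup>2 / 2) *\<^sub>R g (Q j)) has_vector_derivative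
      P j - (t - real j * h) *\<^sub>R g (Q j)) (at t)"
    by (auto intro!: derivative_eq_intros)
  then have "(qsol has_vector_derivative P j - (t - real j * h) *\<^sub>R g (Q j)) (at t)"
    by (rule has_vector_derivative_transform_within_open[where S="?S"]) (use j in \<open>auto simp: sol_piece(1)[of j]\<close>)
  then show "(qsol has_vector_derivative psol (grid_floor h t) - (t - grid_floor h t) *\<^sub>R g (qsol (grid_floor h t))) (at t)"
    by (simp add: gr sol_grid)
  have "((\<lambda>t. P j - ((t - real j * h) / 2) *\<^sub>R (g (Q j) + g (Q (Suc j)))) has_vector_derivative
      - (1/2) *\<^sub>R (g (Q j) + g (Q (Suc j)))) (at t)"
    by (auto intro!: derivative_eq_intros)
  then have "(psol has_vector_derivative - (1/2) *\<^sub>R (g (Q j) + g (Q (Suc j)))) (at t)"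
    by (rule has_vector_derivative_transform_within_open[where S="?S"]) (use j in \<open>auto simp: sol_piece(2)[of j]\<close>)
  then show "(psol has_vector_derivative - (1/2) *\<^sub>R (g (qsol (grid_floor h t)) + g (qsol (grid_ceiling h t)))) (at t)"
    unfolding gr sol_grid .
qed

text \<open>Grid times are enough for the kernel, as its duration is a multiple of the step size.
  There every solution takes the value of the recursion, which is the uniqueness that the definite
  description asks for.\<close>

lemma verlet_position_eq_vpos: "verlet_position U h x v (real N * h) = vpos (\<lambda>_. grad U) h x v N"
  unfolding verlet_position_def
proof (rule the_equality)
  show "\<exists>q p. verlet_solution U h x v q p \<and> Q N = q (real N * h)"
    using sol_is_solution sol_grid by metis
  show "\<And>y. \<exists>q p. verlet_solution U h x v q p \<and> y = q (real N * h) \<Longrightarrow> y = Q N"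
    using solution_on_grid by metis
qed

end

section \<open>Variations of the Verlet recursion\<close>

text \<open>The parameter may enter the force as well as the data: the second variation
  differentiates the linearised recursion, whose coefficients move along with the
  trajectory.\<close>

lemma vpos_has_vector_derivative:
  fixes g :: "real \<Rightarrow> nat \<Rightarrow> 'a::real_normed_vector \<Rightarrow> 'a"
  assumes X: "(X has_vector_derivative X') (at t0)" and V: "(V has_vector_derivative V') (at t0)"
    and g: "\<And>l y y'. (y has_vector_derivative y') (at t0) \<Longrightarrow>
      ((\<lambda>t. g t l (y t)) has_vector_derivative g' l (y t0) y') (at t0)"
  shows "((\<lambda>t. vpos (g t) h (X t) (V t) j) has_vector_derivative
    vpos (\<lambda>l. g' l (vpos (g t0) h (X t0) (V t0) l)) h X' V' j) (at t0)"
proof -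
  let ?G = "\<lambda>l. g' l (vpos (g t0) h (X t0) (V t0) l)"
  have "((\<lambda>t. vpos (g t) h (X t) (V t) j) has_vector_derivative vpos ?G h X' V' j) (at t0) \<and>
    ((\<lambda>t. vmid (g t) h (X t) (V t) j) has_vector_derivative vmid ?G h X' V' j) (at t0)"
  proof (induction j)
    case 0
    have "((\<lambda>t. V t - (h / 2) *\<^sub>R g t 0 (X t)) has_vector_derivative V' - (h / 2) *\<^sub>R g' 0 (X t0) X') (at t0)"
      using V g[OF X, of 0] by (auto intro!: derivative_eq_intros)
    then show ?case using X by (simp add: vpos_simps)
  next
    case (Suc j)
    have p: "((\<lambda>t. vpos (g t) h (X t) (V t) (Suc j)) has_vector_derivative vpos ?G h X' V' (Suc j)) (at t0)"
      unfolding vpos_simps using Suc by (auto intro!: derivative_eq_intros)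
    have "((\<lambda>t. vmid (g t) h (X t) (V t) j - h *\<^sub>R g t (Suc j) (vpos (g t) h (X t) (V t) (Suc j))) has_vector_derivative
       vmid ?G h X' V' j - h *\<^sub>R ?G (Suc j) (vpos ?G h X' V' (Suc j))) (at t0)"
      using Suc g[OF p, of "Suc j"] by (auto intro!: derivative_eq_intros)
    then show ?case using p by (simp only: vpos_simps(4))
  qed
  then show ?thesis by blast
qed

lemma vpos_continuous_on:
  fixes g :: "'s::topological_space \<Rightarrow> nat \<Rightarrow> 'a::real_normed_vector \<Rightarrow> 'a"
  assumes X: "continuous_on S X" and V: "continuous_on S V"
    and g: "\<And>l y. continuous_on S y \<Longrightarrow> continuous_on S (\<lambda>t. g t l (y t))"
  shows "continuous_on S (\<lambda>t. vpos (g t) h (X t) (V t) j)"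
proof -
  have "continuous_on S (\<lambda>t. vpos (g t) h (X t) (V t) j) \<and> continuous_on S (\<lambda>t. vmid (g t) h (X t) (V t) j)"
  proof (induction j)
    case 0
    have "continuous_on S (\<lambda>t. V t - (h / 2) *\<^sub>R g t 0 (X t))" by (intro continuous_intros V g X)
    then show ?case using X by (simp add: vpos_simps)
  next
    case (Suc j)
    have p: "continuous_on S (\<lambda>t. vpos (g t) h (X t) (V t) (Suc j))"
      unfolding vpos_simps using Suc by (intro continuous_intros) auto
    have "continuous_on S (\<lambda>t. vmid (g t) h (X t) (V t) j - h *\<^sub>R g t (Suc j) (vpos (g t) h (X t) (V t) (Suc j)))"
      using Suc by (intro continuous_intros g p) auto
    then show ?case using p by (simp only: vpos_simps(4))
  qed
  then show ?thesis by blast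
qed

lemma vpos_linear:
  assumes lin: "\<And>l. linear (g l)"
  shows "vpos g h (x + x') (v + v') j = vpos g h x v j + vpos g h x' v' j"
    and "vpos g h (c *\<^sub>R x) (c *\<^sub>R v) j = c *\<^sub>R vpos g h x v j"
proof -
  have "vpos g h (x + x') (v + v') j = vpos g h x v j + vpos g h x' v' j \<and>
    vmid g h (x + x') (v + v') j = vmid g h x v j + vmid g h x' v' j"
  proof (induction j)
    case 0
    show ?case by (simp add: vpos_simps linear_add[OF lin] algebra_simps)
  next
    case (Suc j)
    then have "vpos g h (x + x') (v + v') (Suc j) = vpos g h x v (Suc j) + vpos g h x' v' (Suc j)"
      by (simp add: vpos_simps algebra_simps)
    then show ?case using Suc by (simp add: vpos_simps(4) linear_add[OF lin] algebra_simps)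
  qed
  then show "vpos g h (x + x') (v + v') j = vpos g h x v j + vpos g h x' v' j" by blast
  have "vpos g h (c *\<^sub>R x) (c *\<^sub>R v) j = c *\<^sub>R vpos g h x v j \<and>
    vmid g h (c *\<^sub>R x) (c *\<^sub>R v) j = c *\<^sub>R vmid g h x v j"
  proof (induction j)
    case 0
    show ?case by (simp add: vpos_simps linear_scale[OF lin] algebra_simps)
  next
    case (Suc j)
    then have "vpos g h (c *\<^sub>R x) (c *\<^sub>R v) (Suc j) = c *\<^sub>R vpos g h x v (Suc j)"
      by (simp add: vpos_simps algebra_simps)
    then show ?case using Suc by (simp add: vpos_simps(4) linear_scale[OF lin] algebra_simps)
  qed
  then show "vpos g h (c *\<^sub>R x) (c *\<^sub>R v) j = c *\<^sub>R vpos g h x v j" by blast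
qed

section \<open>Mean-field forces\<close>

definition l1 :: "('b::real_normed_vector)^'n \<Rightarrow> real"
  where "l1 x = (\<Sum>i\<in>UNIV. norm (x $ i))"

lemma l1_dist_eq_l1: "l1_dist x y = l1 (x - y)"
  by (simp add: l1_dist_def l1_def)

lemma l1_nonneg[simp]: "l1 x \<ge> 0"
  by (simp add: l1_def sum_nonneg)

lemma seminorm_on_l1: "seminorm_on l1"
  unfolding seminorm_on_def l1_def
  by (auto simp: sum.distrib[symmetric] sum_distrib_left intro!: sum_mono norm_triangle_ineq)

lemma l1_add: "l1 (x + y) \<le> l1 x + l1 y" and l1_scaleR: "l1 (c *\<^sub>R x) = \<bar>c\<bar> * l1 x"
  using seminorm_on_l1 by (auto simp: seminorm_on_def)

lemma l1_minus_commute: "l1 (x - y) = l1 (y - x)"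
  by (simp add: l1_def norm_minus_commute)

lemma norm_component_le_l1: "norm (x $ i) \<le> l1 x"
  unfolding l1_def by (rule member_le_sum) auto

lemma norm_le_l1_vec: "norm x \<le> l1 x"
  unfolding norm_vec_def l1_def by (rule L2_set_le_sum) auto

lemma l1_le_sqrt_norm: "l1 (x :: ('b::real_normed_vector)^'n) \<le> sqrt (real CARD('n)) * norm x"
  unfolding norm_vec_def l1_def
  using L2_set_mult_ineq[of "\<lambda>i. norm (x $ i)" "\<lambda>_. 1" UNIV]
  by (simp add: L2_set_constant mult.commute)

section \<open>Mean-field forces with bounds uniform in the number of particles\<close>

definition mf_force :: "(real^'k \<Rightarrow> real^'k) \<Rightarrow> (real^'k \<Rightarrow> real^'k) \<Rightarrow> (real^'k)^'n \<Rightarrow> (real^'k)^'n"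
  where "mf_force G H x = (\<chi> i. G (x$i) + (1 / real CARD('n)) *\<^sub>R (\<Sum>l\<in>UNIV - {i}. H (x$i - x$l)))"

definition mf_d1 :: "(real^'k \<Rightarrow> (real^'k) \<Rightarrow>\<^sub>L (real^'k)) \<Rightarrow> (real^'k \<Rightarrow> (real^'k) \<Rightarrow>\<^sub>L (real^'k))
    \<Rightarrow> (real^'k)^'n \<Rightarrow> (real^'k)^'n \<Rightarrow> (real^'k)^'n"
  where "mf_d1 G1 H1 x w = (\<chi> i. G1 (x$i) (w$i)
    + (1 / real CARD('n)) *\<^sub>R (\<Sum>l\<in>UNIV - {i}. H1 (x$i - x$l) (w$i - w$l)))"

definition mf_d2 :: "(real^'k \<Rightarrow> (real^'k) \<Rightarrow>\<^sub>L (real^'k) \<Rightarrow>\<^sub>L (real^'k)) \<Rightarrow> (real^'k \<Rightarrow> (real^'k) \<Rightarrow>\<^sub>L (real^'k) \<Rightarrow>\<^sub>L (real^'k))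
    \<Rightarrow> (real^'k)^'n \<Rightarrow> (real^'k)^'n \<Rightarrow> (real^'k)^'n \<Rightarrow> (real^'k)^'n"
  where "mf_d2 G2 H2 x b w = (\<chi> i. G2 (x$i) (b$i) (w$i)
    + (1 / real CARD('n)) *\<^sub>R (\<Sum>l\<in>UNIV - {i}. H2 (x$i - x$l) (b$i - b$l) (w$i - w$l)))"

text \<open>The common form of force differences and of first and second derivatives of the force.
  The average over the other particles costs B for the particle itself and B/n times the l1 norm, so
  that summation over i gives A + 2 B independently of n.\<close>

lemma interaction_bound:
  fixes z :: "('b::real_normed_vector)^'n" and c :: "'n \<Rightarrow> 'c::real_normed_vector"
  assumes a: "norm a \<le> A * norm (z$i)" and c: "\<And>l. l \<noteq> i \<Longrightarrow> norm (c l) \<le> B * norm (z$i - z$l)" and B: "B \<ge> 0"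
  shows "norm (a + (1 / real CARD('n)) *\<^sub>R (\<Sum>l\<in>UNIV - {i}. c l))
    \<le> (A + B) * norm (z$i) + B / real CARD('n) * l1 z"
proof -
  let ?n = "real CARD('n)"
  have n: "?n > 0" by simp
  have "norm (\<Sum>l\<in>UNIV - {i}. c l) \<le> (\<Sum>l\<in>UNIV - {i}. B * (norm (z$i) + norm (z$l)))"
  proof (rule sum_norm_le)
    fix l assume "l \<in> UNIV - {i}"
    then have "norm (c l) \<le> B * norm (z$i - z$l)" using c by auto
    also have "\<dots> \<le> B * (norm (z$i) + norm (z$l))" using B by (intro mult_left_mono norm_triangle_ineq4)
    finally show "norm (c l) \<le> B * (norm (z$i) + norm (z$l))" .
  qed
  also have "\<dots> \<le> (\<Sum>l\<in>UNIV. B * (norm (z$i) + norm (z$l)))"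
    using B by (intro sum_mono2) auto
  also have "\<dots> = B * (?n * norm (z$i) + l1 z)"
    by (simp add: sum_distrib_left[symmetric] sum.distrib l1_def)
  finally have "norm ((1 / ?n) *\<^sub>R (\<Sum>l\<in>UNIV - {i}. c l)) \<le> (1 / ?n) * (B * (?n * norm (z$i) + l1 z))"
    using n by (simp add: divide_right_mono)
  also have "\<dots> = B * norm (z$i) + B / ?n * l1 z" using n by (simp add: field_simps)
  finally show ?thesis using a norm_triangle_ineq[of a "(1 / ?n) *\<^sub>R (\<Sum>l\<in>UNIV - {i}. c l)"]
    by (simp add: algebra_simps)
qed

lemma l1_bound_of_components:
  fixes y z :: "('b::real_normed_vector)^'n"
  assumes "\<And>i. norm (y$i) \<le> (A + B) * norm (z$i) + B / real CARD('n) * l1 z"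
  shows "l1 y \<le> (A + 2 * B) * l1 z"
proof -
  have "l1 y \<le> (\<Sum>i\<in>(UNIV::'n set). (A + B) * norm (z$i) + B / real CARD('n) * l1 z)"
    unfolding l1_def[of y] by (intro sum_mono assms)
  also have "\<dots> = (A + 2 * B) * l1 z"
    by (simp add: sum.distrib sum_distrib_left[symmetric] l1_def[symmetric] algebra_simps)
  finally show ?thesis .
qed

text \<open>If z is concentrated in particle i0, the first sum on the right vanishes and only the
  interaction remains. This measures how a displaced particle is felt by all the others.\<close>

lemma l1_bound_except:
  fixes y z :: "('b::real_normed_vector)^'n"
  assumes "\<And>i. norm (y$i) \<le> (A + B) * norm (z$i) + B / real CARD('n) * l1 z" and B: "B \<ge> 0"
  shows "(\<Sum>i\<in>UNIV-{i0}. norm (y$i)) \<le> (A + B) * (\<Sum>i\<in>UNIV-{i0}. norm (z$i)) + B * l1 z"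
proof -
  have "(\<Sum>i\<in>UNIV-{i0}. norm (y$i)) \<le> (\<Sum>i\<in>UNIV-{i0}. (A + B) * norm (z$i) + B / real CARD('n) * l1 z)"
    by (intro sum_mono assms)
  also have "\<dots> = (A + B) * (\<Sum>i\<in>UNIV-{i0}. norm (z$i)) + (\<Sum>i\<in>UNIV-{i0}. B / real CARD('n) * l1 z)"
    by (simp add: sum.distrib sum_distrib_left)
  also have "(\<Sum>i\<in>UNIV-{i0}. B / real CARD('n) * l1 z) \<le> (\<Sum>i\<in>(UNIV::'n set). B / real CARD('n) * l1 z)"
    using B by (intro sum_mono2) auto
  finally show ?thesis by simp
qed

text \<open>The factor sqrt n from the norm of a constant vector and the one from comparing l1 with
  the Euclidean norm together cancel the 1/n of the interaction.\<close>

lemma norm_bound_of_components: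
  fixes y z :: "('b::real_normed_vector)^'n"
  assumes "\<And>i. norm (y$i) \<le> (A + B) * norm (z$i) + B / real CARD('n) * l1 z" and "A \<ge> 0" "B \<ge> 0"
  shows "norm y \<le> (A + 2 * B) * norm z"
proof -
  let ?n = "real CARD('n)"
  have n: "?n > 0" by simp
  have "norm y \<le> L2_set (\<lambda>i. (A + B) * norm (z$i) + B / ?n * l1 z) UNIV"
    unfolding norm_vec_def[of y] by (intro L2_set_mono assms) auto
  also have "\<dots> \<le> L2_set (\<lambda>i. (A + B) * norm (z$i)) UNIV + L2_set (\<lambda>i::'n. B / ?n * l1 z) UNIV"
    by (rule L2_set_triangle_ineq)
  also have "L2_set (\<lambda>i. (A + B) * norm (z$i)) UNIV = (A + B) * norm z"
    using assms unfolding norm_vec_def by (subst L2_set_right_distrib) auto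
  also have "L2_set (\<lambda>i::'n. B / ?n * l1 z) UNIV = sqrt ?n * (B / ?n * l1 z)"
    using assms by (subst L2_set_constant) auto
  also have "\<dots> \<le> sqrt ?n * (B / ?n * (sqrt ?n * norm z))"
    using assms by (intro mult_left_mono l1_le_sqrt_norm) auto
  also have "\<dots> = (sqrt ?n * sqrt ?n) * (B / ?n * norm z)" by (simp only: mult_ac)
  also have "\<dots> = B * norm z" using n by simp
  finally show ?thesis by (simp add: algebra_simps)
qed

lemma vec_eq_sum_axis:
  fixes f :: "'n::finite \<Rightarrow> 'b::real_normed_vector"
  shows "(\<chi> i. f i) = (\<Sum>i\<in>UNIV. axis i (f i))"
  by (simp add: vec_eq_iff axis_def)

lemma bounded_linear_axis: "bounded_linear (axis i :: 'b::real_normed_vector \<Rightarrow> 'b^'n)"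
proof (rule bounded_linear_intro[where K=1])
  show "norm (axis i x :: 'b^'n) \<le> norm x * 1" for x :: 'b
    using norm_le_l1_vec[of "axis i x :: 'b^'n"] by (simp add: l1_def axis_def if_distrib[of norm] cong: if_cong)
qed (auto simp: vec_eq_iff axis_def)

lemma has_vector_derivative_vec_lambda:
  fixes f' :: "'n::finite \<Rightarrow> 'b::real_normed_vector"
  assumes "\<And>i. ((\<lambda>t. f i t) has_vector_derivative f' i) F"
  shows "((\<lambda>t. \<chi> i. f i t) has_vector_derivative (\<chi> i. f' i)) F"
  unfolding vec_eq_sum_axis
  by (intro has_vector_derivative_sum bounded_linear.has_vector_derivative[OF bounded_linear_axis] assms)

lemma has_vector_derivative_nth:
  fixes f' :: "'b::real_normed_vector^'n"
  shows "(f has_vector_derivative f') F \<Longrightarrow> ((\<lambda>t. f t $ i) has_vector_derivative f' $ i) F"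
  by (rule bounded_linear.has_vector_derivative[OF bounded_linear_vec_nth])

lemma has_vector_derivative_compose:
  assumes "(f has_vector_derivative f') (at t)" "(G has_derivative G') (at (f t))"
  shows "((\<lambda>t. G (f t)) has_vector_derivative G' f') (at t)"
proof -
  have lin: "linear G'" using assms(2) has_derivative_linear by blast
  have "((G \<circ> f) has_derivative G' \<circ> (\<lambda>x. x *\<^sub>R f')) (at t)"
    using assms unfolding has_vector_derivative_def by (intro diff_chain_at)
  moreover have "G' \<circ> (\<lambda>x. x *\<^sub>R f') = (\<lambda>x. x *\<^sub>R G' f')" using lin by (auto simp: linear_scale)
  ultimately show ?thesis by (simp add: has_vector_derivative_def o_def)
qed

text \<open>The bounds \<open>l\<close> and \<open>lH\<close> contain \<epsilon> and count both
  orientations of a pair. They become 2 \<epsilon> Lt and 2 \<epsilon> LHt, so that L + 2 l is the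
  quantity L + 4 \<epsilon> Lt of the theorem.\<close>

locale mean_field =
  fixes G H :: "real^'k \<Rightarrow> real^'k" and G1 H1 :: "real^'k \<Rightarrow> (real^'k) \<Rightarrow>\<^sub>L (real^'k)"
    and G2 H2 :: "real^'k \<Rightarrow> (real^'k) \<Rightarrow>\<^sub>L (real^'k) \<Rightarrow>\<^sub>L (real^'k)" and L l LH lH :: real
  assumes G_deriv: "(G has_derivative blinfun_apply (G1 a)) (at a)"
    and H_deriv: "(H has_derivative blinfun_apply (H1 a)) (at a)"
    and G1_deriv: "(G1 has_derivative blinfun_apply (G2 a)) (at a)"
    and H1_deriv: "(H1 has_derivative blinfun_apply (H2 a)) (at a)"
    and G2_cont: "continuous_on UNIV G2" and H2_cont: "continuous_on UNIV H2"
    and G1_le: "norm (G1 a) \<le> L" and H1_le: "norm (H1 a) \<le> l"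
    and G2_le: "norm (G2 a) \<le> LH" and H2_le: "norm (H2 a) \<le> lH"
begin

lemma consts_nonneg: "L \<ge> 0" "l \<ge> 0" "LH \<ge> 0" "lH \<ge> 0"
  using G1_le[of 0] H1_le[of 0] G2_le[of 0] H2_le[of 0] norm_ge_zero order_trans by blast+

abbreviation "g \<equiv> mf_force G H"
abbreviation "g1 \<equiv> mf_d1 G1 H1"
abbreviation "g2 \<equiv> mf_d2 G2 H2"

lemma G_lipschitz: "norm (G a - G b) \<le> L * norm (a - b)"
  by (rule differentiable_bound[where S=UNIV and f'="\<lambda>a. blinfun_apply (G1 a)"])
    (auto simp: G_deriv norm_blinfun.rep_eq[symmetric] G1_le)

lemma H_lipschitz: "norm (H a - H b) \<le> l * norm (a - b)"
  by (rule differentiable_bound[where S=UNIV and f'="\<lambda>a. blinfun_apply (H1 a)"])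
    (auto simp: H_deriv norm_blinfun.rep_eq[symmetric] H1_le)

lemma g_diff_component:
  fixes x y :: "(real^'k)^'n"
  shows "norm ((g x - g y) $ i) \<le> (L + l) * norm ((x - y) $ i) + l / real CARD('n) * l1 (x - y)"
proof -
  have "(g x - g y) $ i = (G (x$i) - G (y$i)) + (1 / real CARD('n)) *\<^sub>R
      (\<Sum>m\<in>UNIV - {i}. H (x$i - x$m) - H (y$i - y$m))"
    by (simp add: mf_force_def sum_subtractf algebra_simps)
  also have "norm \<dots> \<le> (L + l) * norm ((x - y) $ i) + l / real CARD('n) * l1 (x - y)"
  proof (rule interaction_bound)
    show "norm (G (x$i) - G (y$i)) \<le> L * norm ((x - y) $ i)" using G_lipschitz by simp
    show "norm (H (x$i - x$m) - H (y$i - y$m)) \<le> l * norm ((x - y) $ i - (x - y) $ m)" for m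
      using H_lipschitz[of "x$i - x$m" "y$i - y$m"] by (simp add: algebra_simps)
  qed (rule consts_nonneg)
  finally show ?thesis .
qed

lemma g1_component:
  fixes x w :: "(real^'k)^'n"
  shows "norm (g1 x w $ i) \<le> (L + l) * norm (w $ i) + l / real CARD('n) * l1 w"
proof -
  have "norm (G1 (x$i) (w$i) + (1 / real CARD('n)) *\<^sub>R (\<Sum>m\<in>UNIV - {i}. H1 (x$i - x$m) (w$i - w$m)))
    \<le> (L + l) * norm (w $ i) + l / real CARD('n) * l1 w"
  proof (rule interaction_bound)
    show "norm (G1 (x$i) (w$i)) \<le> L * norm (w $ i)"
      by (rule order_trans[OF norm_blinfun]) (simp add: mult_right_mono G1_le)
    show "norm (H1 (x$i - x$m) (w$i - w$m)) \<le> l * norm (w $ i - w $ m)" for m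
      by (rule order_trans[OF norm_blinfun]) (simp add: mult_right_mono H1_le)
  qed (rule consts_nonneg)
  then show ?thesis by (simp add: mf_d1_def)
qed

lemma l1_g_diff: "l1 (g x - g y) \<le> (L + 2 * l) * l1 (x - y)"
  by (rule l1_bound_of_components) (rule g_diff_component)

lemma l1_g1: "l1 (g1 x w) \<le> (L + 2 * l) * l1 w"
  by (rule l1_bound_of_components) (rule g1_component)

lemma norm_g1: "norm (g1 x w) \<le> (L + 2 * l) * norm w"
  by (rule norm_bound_of_components[OF g1_component consts_nonneg(1,2)])

lemma linear_g1: "linear (g1 x)"
  by (rule linearI)
    (simp_all add: mf_d1_def vec_eq_iff blinfun.add_right blinfun.diff_right blinfun.scaleR_right algebra_simps
      sum.distrib sum_subtractf scaleR_sum_right)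

lemma g2_linear: "linear (\<lambda>b. g2 x b w)" "linear (g2 x b)"
  by (rule linearI; simp add: mf_d2_def vec_eq_iff blinfun.add_right blinfun.diff_right blinfun.scaleR_right
      blinfun.add_left blinfun.diff_left blinfun.scaleR_left algebra_simps
      sum.distrib sum_subtractf scaleR_sum_right)+

lemma g_has_vector_derivative:
  assumes y: "(y has_vector_derivative y') (at t)"
  shows "((\<lambda>t. g (y t)) has_vector_derivative g1 (y t) y') (at t)"
  unfolding mf_force_def mf_d1_def
  by (intro has_vector_derivative_vec_lambda has_vector_derivative_add has_vector_derivative_sum
    bounded_linear.has_vector_derivative[OF bounded_linear_scaleR_right]
    has_vector_derivative_compose[OF _ G_deriv] has_vector_derivative_compose[OF _ H_deriv]
    has_vector_derivative_diff has_vector_derivative_nth y)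

lemma g1_has_vector_derivative:
  fixes y w :: "real \<Rightarrow> (real^'k)^'n"
  assumes y: "(y has_vector_derivative y') (at t)" and w: "(w has_vector_derivative w') (at t)"
  shows "((\<lambda>t. g1 (y t) (w t)) has_vector_derivative g2 (y t) y' (w t) + g1 (y t) w') (at t)"
proof -
  have "((\<lambda>t. g1 (y t) (w t)) has_vector_derivative
      (\<chi> i. (G1 (y t $ i) (w' $ i) + G2 (y t $ i) (y' $ i) (w t $ i)) + (1 / real CARD('n)) *\<^sub>R
        (\<Sum>m\<in>UNIV - {i}. H1 (y t $ i - y t $ m) (w' $ i - w' $ m) + H2 (y t $ i - y t $ m) (y' $ i - y' $ m) (w t $ i - w t $ m)))) (at t)"
    unfolding mf_d1_def
    by (intro has_vector_derivative_vec_lambda has_vector_derivative_add has_vector_derivative_sum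
      bounded_linear.has_vector_derivative[OF bounded_linear_scaleR_right]
      bounded_bilinear.has_vector_derivative[OF bounded_bilinear_blinfun_apply]
      has_vector_derivative_compose[OF _ G1_deriv] has_vector_derivative_compose[OF _ H1_deriv]
      has_vector_derivative_diff has_vector_derivative_nth y w)
  also have "(\<chi> i. (G1 (y t $ i) (w' $ i) + G2 (y t $ i) (y' $ i) (w t $ i)) + (1 / real CARD('n)) *\<^sub>R
        (\<Sum>m\<in>UNIV - {i}. H1 (y t $ i - y t $ m) (w' $ i - w' $ m) + H2 (y t $ i - y t $ m) (y' $ i - y' $ m) (w t $ i - w t $ m)))
     = g2 (y t) y' (w t) + g1 (y t) w'"
    by (simp add: mf_d1_def mf_d2_def vec_eq_iff sum.distrib scaleR_add_right)
  finally show ?thesis .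
qed

lemma continuous_on_G: "continuous_on S G" "continuous_on S H" "continuous_on S G1" "continuous_on S H1"
  using G_deriv H_deriv G1_deriv H1_deriv
  by (meson continuous_at_imp_continuous_on has_derivative_continuous)+

lemma continuous_on_g:
  assumes y: "continuous_on S y" shows "continuous_on S (\<lambda>s. g (y s))"
  unfolding mf_force_def
  by (intro continuous_intros continuous_on_compose2[OF continuous_on_G(1)[of UNIV]]
    continuous_on_compose2[OF continuous_on_G(2)[of UNIV]] y) auto

lemma continuous_on_g1:
  assumes y: "continuous_on S y" "continuous_on S w" shows "continuous_on S (\<lambda>s. g1 (y s) (w s))"
  unfolding mf_d1_def
  by (intro continuous_intros continuous_on_compose2[OF continuous_on_G(3)[of UNIV]]
    continuous_on_compose2[OF continuous_on_G(4)[of UNIV]] y) auto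

lemma continuous_on_g2:
  assumes y: "continuous_on S y" "continuous_on S b" "continuous_on S w"
  shows "continuous_on S (\<lambda>s. g2 (y s) (b s) (w s))"
  unfolding mf_d2_def
  by (intro continuous_intros continuous_on_compose2[OF G2_cont]
    continuous_on_compose2[OF H2_cont] y) auto

text \<open>The Hilbert-Schmidt norm over all particles costs only the factor \<open>\<surd>k\<close>: the derivative
  of the force on one particle in the direction of another one is of order \<open>1/n\<close>.\<close>

lemma g2_hilbert_schmidt:
  fixes x w :: "(real^'k)^'n"
  shows "L2_set (\<lambda>b. norm (g2 x b w)) Basis \<le> sqrt (real CARD('k)) * ((LH + 4 * lH) * l1 w)"
proof -
  let ?n = "real CARD('n)"
  \<comment> \<open>A bound for the response to a unit displacement of particle m: its own component
    by \<open>interaction_bound\<close>, each other component through the single pair term that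
    involves m.\<close>
  define \<beta> where "\<beta> m = (LH + 2 * lH) * norm (w$m) + 2 * lH / ?n * l1 w" for m
  have \<beta>0: "\<beta> m \<ge> 0" for m using consts_nonneg by (simp add: \<beta>_def)
  have bound: "norm (g2 x (axis m u) w) \<le> \<beta> m" if u: "norm u = 1" for m u
  proof -
    have diag: "norm (g2 x (axis m u) w $ m) \<le> (LH + lH) * norm (w$m) + lH / ?n * l1 w"
    proof -
      have "norm (G2 (x$m) u (w$m) + (1 / ?n) *\<^sub>R (\<Sum>j\<in>UNIV - {m}. H2 (x$m - x$j) u (w$m - w$j)))
        \<le> (LH + lH) * norm (w$m) + lH / ?n * l1 w"
      proof (rule interaction_bound)
        have "norm (G2 (x$m) u) \<le> LH"
          using norm_blinfun[of "G2 (x$m)" u] G2_le[of "x$m"] u by simp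
        then show "norm (G2 (x$m) u (w$m)) \<le> LH * norm (w$m)"
          by (intro order_trans[OF norm_blinfun[of "G2 (x$m) u" "w$m"]] mult_right_mono) auto
        show "norm (H2 (x$m - x$j) u (w$m - w$j)) \<le> lH * norm (w$m - w$j)" for j
        proof -
          have "norm (H2 (x$m - x$j) u) \<le> lH"
            using norm_blinfun[of "H2 (x$m - x$j)" u] H2_le[of "x$m - x$j"] u by simp
          then show ?thesis
            by (intro order_trans[OF norm_blinfun[of "H2 (x$m - x$j) u" "w$m - w$j"]] mult_right_mono) auto
        qed
      qed (rule consts_nonneg)
      moreover have "(\<Sum>j\<in>UNIV - {m}. H2 (x$m - x$j) (axis m u $ m - axis m u $ j) (w$m - w$j))
          = (\<Sum>j\<in>UNIV - {m}. H2 (x$m - x$j) u (w$m - w$j))"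
        by (intro sum.cong refl) (simp add: axis_def)
      ultimately show ?thesis by (simp add: mf_d2_def)
    qed
    have off: "norm (g2 x (axis m u) w $ i) \<le> lH / ?n * (norm (w$i) + norm (w$m))" if "i \<noteq> m" for i
    proof -
      have "(\<Sum>j\<in>UNIV - {i}. H2 (x$i - x$j) (axis m u $ i - axis m u $ j) (w$i - w$j))
          = (\<Sum>j\<in>{m}. H2 (x$i - x$j) (axis m u $ i - axis m u $ j) (w$i - w$j))"
        using that by (intro sum.mono_neutral_right) (auto simp: axis_def)
      then have "g2 x (axis m u) w $ i = (1 / ?n) *\<^sub>R H2 (x$i - x$m) (- u) (w$i - w$m)"
        using that by (simp add: mf_d2_def axis_def)
      moreover have "norm (H2 (x$i - x$m) (- u) (w$i - w$m)) \<le> lH * (norm (w$i) + norm (w$m))"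
      proof -
        have "norm (H2 (x$i - x$m) (-u)) \<le> lH"
          using norm_blinfun[of "H2 (x$i - x$m)" "-u"] H2_le[of "x$i - x$m"] u by simp
        then show ?thesis
          by (intro order_trans[OF norm_blinfun[of "H2 (x$i - x$m) (-u)" "w$i - w$m"]] mult_mono norm_triangle_ineq4)
            (auto simp: consts_nonneg)
      qed
      ultimately show ?thesis by (simp add: divide_right_mono)
    qed
    have "norm (g2 x (axis m u) w) \<le> (\<Sum>i\<in>UNIV. norm (g2 x (axis m u) w $ i))"
      using norm_le_l1_vec by (simp add: l1_def)
    also have "\<dots> = norm (g2 x (axis m u) w $ m) + (\<Sum>i\<in>UNIV - {m}. norm (g2 x (axis m u) w $ i))"
      by (simp add: sum.remove)
    also have "(\<Sum>i\<in>UNIV - {m}. norm (g2 x (axis m u) w $ i)) \<le> (\<Sum>i\<in>UNIV - {m}. lH / ?n * (norm (w$i) + norm (w$m)))"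
      by (intro sum_mono off) auto
    also have "\<dots> \<le> (\<Sum>i\<in>UNIV. lH / ?n * (norm (w$i) + norm (w$m)))"
      using consts_nonneg by (intro sum_mono2) auto
    also have "\<dots> = lH / ?n * l1 w + lH * norm (w$m)"
      unfolding sum_distrib_left[symmetric] sum.distrib l1_def[symmetric] by (simp add: field_simps)
    finally have "norm (g2 x (axis m u) w) \<le> norm (g2 x (axis m u) w $ m) + (lH / ?n * l1 w + lH * norm (w$m))"
      by simp
    moreover have "\<beta> m = ((LH + lH) * norm (w$m) + lH / ?n * l1 w) + (lH / ?n * l1 w + lH * norm (w$m))"
      by (simp add: \<beta>_def field_simps)
    ultimately show ?thesis using diag by linarith
  qed
  have Basis_eq: "(Basis :: ((real^'k)^'n) set) = (\<lambda>(m, u). axis m u) ` (UNIV \<times> Basis)"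
    by (auto simp: Basis_vec_def)
  have inj: "inj_on (\<lambda>(m, u). axis m u :: (real^'k)^'n) (UNIV \<times> Basis)"
    by (auto simp: inj_on_def axis_eq_axis)
  have "(\<Sum>b\<in>Basis. (norm (g2 x b w))\<^sup>2) = (\<Sum>m\<in>UNIV. \<Sum>u\<in>(Basis::(real^'k) set). (norm (g2 x (axis m u) w))\<^sup>2)"
    unfolding Basis_eq by (subst sum.reindex[OF inj]) (simp add: sum.cartesian_product split_def)
  \<comment> \<open>The k directions of one particle are merely counted, which is the factor sqrt k;
    over the particles the l2 norm is bounded by the l1 norm, and n does not enter.\<close>
  also have "\<dots> \<le> (\<Sum>m\<in>UNIV. \<Sum>u\<in>(Basis::(real^'k) set). (\<beta> m)\<^sup>2)"
    by (intro sum_mono power_mono bound) auto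
  also have "\<dots> = real CARD('k) * (\<Sum>m\<in>UNIV. (\<beta> m)\<^sup>2)" by (simp add: sum_distrib_left)
  finally have "(\<Sum>b\<in>Basis. (norm (g2 x b w))\<^sup>2) \<le> real CARD('k) * (\<Sum>m\<in>UNIV. (\<beta> m)\<^sup>2)" .
  then have "L2_set (\<lambda>b. norm (g2 x b w)) Basis \<le> sqrt (real CARD('k)) * L2_set \<beta> UNIV"
    unfolding L2_set_def by (simp add: real_sqrt_mult[symmetric])
  also have "L2_set \<beta> UNIV \<le> sum \<beta> UNIV" using \<beta>0 by (intro L2_set_le_sum) auto
  also have "sum \<beta> UNIV = (LH + 4 * lH) * l1 w"
    by (simp add: \<beta>_def sum.distrib sum_distrib_left[symmetric] l1_def[symmetric] algebra_simps)
  finally show ?thesis by (simp add: mult_left_mono)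
qed

end

section \<open>First and second variation of the mean-field flow\<close>

text \<open>A factor on the right is treated by adjoints: a linear map and its adjoint have the same
  Hilbert-Schmidt norm, and the adjoint of B inherits the operator bound of B.\<close>

lemma hilbert_schmidt_compose:
  fixes A B :: "'a::euclidean_space \<Rightarrow> 'a"
  assumes A: "linear A" and B: "linear B" and \<kappa>: "\<And>v. norm (B v) \<le> \<kappa> * norm v" "\<kappa> \<ge> 0"
  shows "L2_set (\<lambda>b. norm (A (B b))) Basis \<le> \<kappa> * L2_set (\<lambda>b. norm (A b)) Basis"
proof -
  have adj: "(\<Sum>b\<in>Basis. (norm (D b))\<^sup>2) = (\<Sum>c\<in>Basis. (norm (adjoint D c))\<^sup>2)"
    if D: "linear D" for D :: "'a \<Rightarrow> 'a"
  proof -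
    have n: "(norm y)\<^sup>2 = (\<Sum>c\<in>Basis. (y \<bullet> c)\<^sup>2)" for y :: 'a
      unfolding power2_norm_eq_inner by (subst euclidean_inner) (simp add: power2_eq_square)
    have "(\<Sum>b\<in>Basis. (norm (D b))\<^sup>2) = (\<Sum>b\<in>Basis. \<Sum>c\<in>Basis. (adjoint D c \<bullet> b)\<^sup>2)"
      unfolding n by (simp add: adjoint_works[OF D] inner_commute)
    also have "\<dots> = (\<Sum>c\<in>Basis. \<Sum>b\<in>Basis. (adjoint D c \<bullet> b)\<^sup>2)" by (rule sum.swap)
    finally show ?thesis unfolding n .
  qed
  have B_adj: "norm (adjoint B v) \<le> \<kappa> * norm v" for v
  proof -
    have "(norm (adjoint B v))\<^sup>2 = v \<bullet> B (adjoint B v)"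
      by (simp add: power2_norm_eq_inner adjoint_works[OF B] inner_commute)
    also have "\<dots> \<le> norm v * (\<kappa> * norm (adjoint B v))"
      by (rule order_trans[OF norm_cauchy_schwarz]) (intro mult_left_mono \<kappa>; simp)
    finally have "norm (adjoint B v) * norm (adjoint B v) \<le> (\<kappa> * norm v) * norm (adjoint B v)"
      by (simp add: power2_eq_square mult_ac)
    then show ?thesis
      by (cases "norm (adjoint B v) = 0") (use \<kappa>(2) in \<open>auto simp: mult_le_cancel_right\<close>)
  qed
  have AB: "linear (\<lambda>b. A (B b))" using linear_compose[OF B A] by (simp add: o_def)
  have "adjoint (\<lambda>b. A (B b)) = (\<lambda>c. adjoint B (adjoint A c))"
    by (rule adjoint_unique) (simp add: adjoint_works A B)
  then have "(\<Sum>b\<in>Basis. (norm (A (B b)))\<^sup>2) = (\<Sum>c\<in>Basis. (norm (adjoint B (adjoint A c)))\<^sup>2)"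
    using adj[OF AB] by simp
  also have "\<dots> \<le> (\<Sum>c\<in>Basis. (\<kappa> * norm (adjoint A c))\<^sup>2)"
    by (intro sum_mono power_mono B_adj) auto
  also have "\<dots> = \<kappa>\<^sup>2 * (\<Sum>b\<in>Basis. (norm (A b))\<^sup>2)"
    by (simp add: adj[OF A] power_mult_distrib sum_distrib_left)
  finally have "sqrt (\<Sum>b\<in>Basis. (norm (A (B b)))\<^sup>2) \<le> sqrt (\<kappa>\<^sup>2 * (\<Sum>b\<in>Basis. (norm (A b))\<^sup>2))"
    by (rule real_sqrt_le_mono)
  then show ?thesis using \<kappa>(2) by (simp add: L2_set_def real_sqrt_mult)
qed

lemma L2_set_norm_sum:
  fixes F :: "'m \<Rightarrow> 'b \<Rightarrow> 'c::real_normed_vector"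
  assumes "finite I"
  shows "L2_set (\<lambda>b. norm (\<Sum>m\<in>I. F m b)) S \<le> (\<Sum>m\<in>I. L2_set (\<lambda>b. norm (F m b)) S)"
  using assms
proof (induction I rule: finite_induct)
  case (insert m I)
  have "L2_set (\<lambda>b. norm (F m b + (\<Sum>m\<in>I. F m b))) S
      \<le> L2_set (\<lambda>b. norm (F m b) + norm (\<Sum>m\<in>I. F m b)) S"
    by (intro L2_set_mono norm_triangle_ineq) auto
  also have "\<dots> \<le> L2_set (\<lambda>b. norm (F m b)) S + L2_set (\<lambda>b. norm (\<Sum>m\<in>I. F m b)) S"
    by (rule L2_set_triangle_ineq)
  finally show ?case using insert by simp
qed (simp add: L2_set_def)

text \<open>Continuity of the inverses of a family of linear maps follows from a lower bound that is
  uniform over the family, without a formula for the inverse.\<close>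

lemma inverse_family_tendsto:
  fixes M :: "'s \<Rightarrow> 'a::real_normed_vector \<Rightarrow> 'b::real_normed_vector"
  assumes lin: "\<And>s. linear (M s)" and \<kappa>: "\<And>s w. \<kappa> * norm w \<le> norm (M s w)" "\<kappa> > 0"
    and M: "((\<lambda>s. M s w0) \<longlongrightarrow> y0) F" and y: "((\<lambda>s. M s (w s)) \<longlongrightarrow> y0) F"
  shows "(w \<longlongrightarrow> w0) F"
proof -
  have "((\<lambda>s. norm (M s (w s) - M s w0) / \<kappa>) \<longlongrightarrow> norm (y0 - y0) / \<kappa>) F"
    using \<kappa>(2) by (intro tendsto_intros M y) auto
  then have l: "((\<lambda>s. norm (M s (w s) - M s w0) / \<kappa>) \<longlongrightarrow> 0) F" by simp
  have "((\<lambda>s. w s - w0) \<longlongrightarrow> 0) F"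
  proof (rule Lim_null_comparison[OF _ l], rule always_eventually, rule allI)
    fix s
    have "\<kappa> * norm (w s - w0) \<le> norm (M s (w s) - M s w0)"
      using \<kappa>(1)[of "w s - w0" s] by (simp add: linear_diff[OF lin])
    then show "norm (w s - w0) \<le> norm (M s (w s) - M s w0) / \<kappa>"
      using \<kappa>(2) by (simp add: field_simps)
  qed
  then show ?thesis by (simp add: LIM_zero_iff)
qed

section \<open>Jacobi fields and the compensating velocity field\<close>

locale mean_field_verlet = mean_field G H G1 H1 G2 H2 L l LH lH
  for G H :: "real^'k \<Rightarrow> real^'k" and G1 H1 G2 H2 L l LH lH +
  fixes h T :: real and N :: nat
  assumes h: "h > 0" and N: "N > 0" and T: "T = real N * h" and small: "(L + 2 * l) * T\<^sup>2 \<le> 1/6"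
begin

lemma T_pos: "T > 0" using h N by (simp add: T)

lemma time_le: "j \<le> N \<Longrightarrow> real j * h \<le> T"
  using h by (simp add: T)

abbreviation "\<Lambda> \<equiv> L + 2 * l"

lemma \<Lambda>_nonneg: "\<Lambda> \<ge> 0" using consts_nonneg by simp

lemma small': "\<Lambda> * (real N * h)\<^sup>2 \<le> 1/6" using small by (simp add: T)

definition q :: "(real^'k)^'n \<Rightarrow> (real^'k)^'n \<Rightarrow> nat \<Rightarrow> (real^'k)^'n"
  where "q x v j = vpos (\<lambda>_. g) h x v j"

definition var :: "(real^'k)^'n \<Rightarrow> (real^'k)^'n \<Rightarrow> (real^'k)^'n \<Rightarrow> (real^'k)^'n \<Rightarrow> nat \<Rightarrow> (real^'k)^'n"
  where "var x v z w j = vpos (\<lambda>m. g1 (q x v m)) h z w j"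

text \<open>The derivative of \<open>var x v z w\<close> as v moves along b. Its data at time 0
  vanish because z and w stay fixed; it is driven by the second derivative of the force, applied to
  the two first variations.\<close>

definition svar :: "(real^'k)^'n \<Rightarrow> (real^'k)^'n \<Rightarrow> (real^'k)^'n \<Rightarrow> (real^'k)^'n \<Rightarrow> (real^'k)^'n \<Rightarrow> nat \<Rightarrow> (real^'k)^'n"
  where "svar x v b z w j =
    vpos (\<lambda>m y. g2 (q x v m) (var x v 0 b m) (var x v z w m) + g1 (q x v m) y) h 0 0 j"

lemma q_has_vector_derivative:
  "((\<lambda>t. q (x + t *\<^sub>R z) (v + t *\<^sub>R w) j) has_vector_derivative
    var (x + t0 *\<^sub>R z) (v + t0 *\<^sub>R w) z w j) (at t0)"
  unfolding q_def var_def
  by (rule vpos_has_vector_derivative[where g'="\<lambda>_. g1"])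
    (auto intro!: derivative_eq_intros g_has_vector_derivative)

lemma var_has_vector_derivative:
  "((\<lambda>t. var x (v + t *\<^sub>R b) z w j) has_vector_derivative svar x (v + t0 *\<^sub>R b) b z w j) (at t0)"
proof -
  have q': "((\<lambda>t. q x (v + t *\<^sub>R b) m) has_vector_derivative var x (v + t0 *\<^sub>R b) 0 b m) (at t0)" for m
    using q_has_vector_derivative[of x 0 v b m t0] by simp
  show ?thesis
    unfolding svar_def var_def[of x _ z w]
    by (rule vpos_has_vector_derivative[where
      g'="\<lambda>m y y'. g2 (q x (v + t0 *\<^sub>R b) m) (var x (v + t0 *\<^sub>R b) 0 b m) y + g1 (q x (v + t0 *\<^sub>R b) m) y'"])
      (auto intro!: derivative_eq_intros g1_has_vector_derivative q')
qed

lemma continuous_on_q: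
  assumes "continuous_on S X" "continuous_on S V"
  shows "continuous_on S (\<lambda>s. q (X s) (V s) j)"
  unfolding q_def by (intro vpos_continuous_on assms continuous_on_g)

lemma continuous_on_var:
  assumes "continuous_on S X" "continuous_on S V" "continuous_on S Z" "continuous_on S W"
  shows "continuous_on S (\<lambda>s. var (X s) (V s) (Z s) (W s) j)"
  unfolding var_def by (intro vpos_continuous_on assms continuous_on_g1 continuous_on_q)

lemma continuous_on_svar:
  assumes "continuous_on S X" "continuous_on S V" "continuous_on S B" "continuous_on S Z" "continuous_on S W"
  shows "continuous_on S (\<lambda>s. svar (X s) (V s) (B s) (Z s) (W s) j)"
  unfolding svar_def
  by (intro vpos_continuous_on continuous_on_const continuous_on_add continuous_on_g2 assms continuous_on_g1 continuous_on_q continuous_on_var)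

lemma var_add: "var x v (z + z') (w + w') j = var x v z w j + var x v z' w' j"
  unfolding var_def by (rule vpos_linear) (rule linear_g1)

lemma var_scale: "var x v (c *\<^sub>R z) (c *\<^sub>R w) j = c *\<^sub>R var x v z w j"
  unfolding var_def by (rule vpos_linear) (rule linear_g1)

lemma linear_var_velocity: "linear (\<lambda>w. var x v 0 w j)"
  using var_add[of x v 0 0] var_scale[of x v _ 0] by (intro linearI) auto

lemma var_split: "var x v z (- w) j = var x v z 0 j - var x v 0 w j"
  using var_add[of x v z 0 0 "- w" j] linear_neg[OF linear_var_velocity, of x v w j] by simp

text \<open>\<alpha> bounds the free flight on the grid. The deviation from it is at most (\<Lambda>
  T^2 / 2) (12/11) \<alpha>, and half of 1/6 times 12/11 is 1/11.\<close>

lemma var_bound: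
  assumes \<nu>: "seminorm_on \<nu>" and g1: "\<And>x w. \<nu> (g1 x w) \<le> \<Lambda> * \<nu> w"
    and lin: "\<And>j. j \<le> N \<Longrightarrow> \<nu> (z + (real j * h) *\<^sub>R w) \<le> \<alpha>" and \<alpha>: "\<alpha> \<ge> 0" and j: "j \<le> N"
  shows "\<nu> (var x v z w j) \<le> (12/11) * \<alpha>"
    and "\<nu> (var x v z w j - (z + (real j * h) *\<^sub>R w)) \<le> \<alpha> / 11"
proof -
  note b = vpos_bound[OF \<nu>, where N=N and \<beta>=0 and \<Lambda>=\<Lambda> and \<alpha>=\<alpha>, OF _ lin \<Lambda>_nonneg \<alpha> _ _ small' j]
  show "\<nu> (var x v z w j) \<le> (12/11) * \<alpha>"
    unfolding var_def using b(1) h g1 by auto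
  have "\<nu> (var x v z w j - (z + (real j * h) *\<^sub>R w)) \<le> T\<^sup>2 / 2 * (\<Lambda> * ((12/11) * \<alpha>))"
    unfolding var_def T using b(2) h g1 by auto
  also have "\<dots> = (\<Lambda> * T\<^sup>2) * ((6/11) * \<alpha>)" by simp
  also have "\<dots> \<le> (1/6) * ((6/11) * \<alpha>)" using small \<alpha> by (intro mult_right_mono) auto
  finally show "\<nu> (var x v z w j - (z + (real j * h) *\<^sub>R w)) \<le> \<alpha> / 11" by simp
qed

text \<open>Free flight with zero displacement and velocity w ends at T w; a deviation of one
  eleventh leaves the factor 10/11. This lower bound makes the map from initial velocity to final
  position invertible.\<close>

lemma var_velocity_bound:
  assumes \<nu>: "seminorm_on \<nu>" and g1: "\<And>x w. \<nu> (g1 x w) \<le> \<Lambda> * \<nu> w" and nn: "\<And>w. \<nu> w \<ge> 0"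
  shows "j \<le> N \<Longrightarrow> \<nu> (var x v 0 w j) \<le> (12/11) * (T * \<nu> w)"
    and "(10/11) * T * \<nu> w \<le> \<nu> (var x v 0 w N)"
proof -
  have lin: "\<nu> (0 + (real j * h) *\<^sub>R w) \<le> T * \<nu> w" if "j \<le> N" for j
    using \<nu> h time_le[OF that] nn by (auto simp: seminorm_on_def mult_right_mono)
  note b = var_bound[OF \<nu> g1 lin]
  have T\<nu>: "T * \<nu> w \<ge> 0" using T_pos nn by simp
  show "j \<le> N \<Longrightarrow> \<nu> (var x v 0 w j) \<le> (12/11) * (T * \<nu> w)" using b(1)[OF _ T\<nu>] by simp
  have e: "\<nu> (var x v 0 w N - T *\<^sub>R w) \<le> T * \<nu> w / 11" using b(2)[OF _ T\<nu>, of N] by (simp add: T)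
  have "\<nu> (T *\<^sub>R w) \<le> \<nu> (var x v 0 w N) + \<nu> (T *\<^sub>R w - var x v 0 w N)"
    using \<nu> unfolding seminorm_on_def by (metis add.commute diff_add_cancel)
  also have "\<nu> (T *\<^sub>R w - var x v 0 w N) = \<nu> (var x v 0 w N - T *\<^sub>R w)"
    using seminorm_minus[OF \<nu>, of "var x v 0 w N - T *\<^sub>R w"] by simp
  finally have "T * \<nu> w \<le> \<nu> (var x v 0 w N) + T * \<nu> w / 11"
    using e \<nu> T_pos by (simp add: seminorm_on_def)
  then show "(10/11) * T * \<nu> w \<le> \<nu> (var x v 0 w N)" by simp
qed

lemmas var_velocity_norm = var_velocity_bound[OF seminorm_on_norm norm_g1 norm_ge_zero]

lemma var_velocity_bij: "\<exists>!w. var x v 0 w N = y"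
proof -
  have inj: "inj (\<lambda>w. var x v 0 w N)"
  proof (rule linear_injective_0[THEN iffD2, OF linear_var_velocity], intro allI impI)
    fix w assume "var x v 0 w N = 0"
    then show "w = 0" using var_velocity_norm(2)[of w x v] T_pos by (simp add: mult_le_0_iff)
  qed
  have "surj (\<lambda>w. var x v 0 w N)"
    by (rule linear_inj_imp_surj[OF linear_var_velocity inj])
  then obtain w where w: "y = var x v 0 w N" by (rule surjE)
  show ?thesis
  proof (rule ex1I)
    show "var x v 0 w N = y" using w by simp
    show "w' = w" if "var x v 0 w' N = y" for w' using inj that w by (auto dest: injD)
  qed
qed

definition vinv :: "(real^'k)^'n \<Rightarrow> (real^'k)^'n \<Rightarrow> (real^'k)^'n \<Rightarrow> (real^'k)^'n"
  where "vinv x v y = (THE w. var x v 0 w N = y)"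

lemma var_vinv: "var x v 0 (vinv x v y) N = y"
  unfolding vinv_def by (rule theI'[OF var_velocity_bij])

lemma norm_vinv: "norm (vinv x v y) \<le> 11 / (10 * T) * norm y"
  using var_velocity_norm(2)[of "vinv x v y" x v] T_pos by (simp add: var_vinv field_simps)

lemma continuous_on_vinv:
  fixes x :: "(real^'k)^'n"
  assumes Y: "continuous_on UNIV Y" shows "continuous_on UNIV (\<lambda>v. vinv x v (Y v))"
  unfolding continuous_on_def
proof
  fix v0 :: "(real^'k)^'n"
  show "((\<lambda>v. vinv x v (Y v)) \<longlongrightarrow> vinv x v0 (Y v0)) (at v0 within UNIV)"
  proof (rule inverse_family_tendsto[where M="\<lambda>v w. var x v 0 w N" and \<kappa>="(10/11) * T"])
    have "continuous_on UNIV (\<lambda>v. var x v 0 (vinv x v0 (Y v0)) N)"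
      by (intro continuous_on_var continuous_intros)
    then show "((\<lambda>v. var x v 0 (vinv x v0 (Y v0)) N) \<longlongrightarrow> Y v0) (at v0 within UNIV)"
      unfolding continuous_on_def by (metis UNIV_I var_vinv)
    show "((\<lambda>v. var x v 0 (vinv x v (Y v)) N) \<longlongrightarrow> Y v0) (at v0 within UNIV)"
      using Y by (simp add: var_vinv continuous_on_def)
    show "(10/11) * T * norm w \<le> norm (var x s 0 w N)" for s w by (rule var_velocity_norm)
  qed (auto intro: linear_var_velocity T_pos)
qed

text \<open>A shift of the initial velocity by \<open>- u x v z\<close> compensates, to first order and at the final time,
  a shift of the initial position by \<open>z\<close>.\<close>

definition u :: "(real^'k)^'n \<Rightarrow> (real^'k)^'n \<Rightarrow> (real^'k)^'n \<Rightarrow> (real^'k)^'n"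
  where "u x z v = vinv x v (var x v z 0 N)"

text \<open>Implicit differentiation of \<open>var x v z (- u x z v) N = 0\<close> along b: the term
  from the moving base point is \<open>svar x v b z (- u x z v) N\<close>, and the velocity
  variation of \<open>du x z b v\<close> has to compensate it.\<close>

definition du :: "(real^'k)^'n \<Rightarrow> (real^'k)^'n \<Rightarrow> (real^'k)^'n \<Rightarrow> (real^'k)^'n \<Rightarrow> (real^'k)^'n"
  where "du x z b v = vinv x v (svar x v b z (- u x z v) N)"

lemma var_u: "var x v 0 (u x z v) N = var x v z 0 N"
  by (simp add: u_def var_vinv)

lemma continuous_on_u: "continuous_on UNIV (u x z)"
  unfolding u_def by (intro continuous_on_vinv continuous_on_var continuous_intros)

lemma continuous_on_du: "continuous_on UNIV (du x z b)"
  unfolding du_def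
  by (intro continuous_on_vinv continuous_on_svar continuous_intros continuous_on_u)

text \<open>An implicit function theorem by hand. With \<open>u\<close> frozen at its value for t0,
  the residual \<open>?R\<close> vanishes at t0 and has derivative \<open>?S\<close>. The variation
  map at time t sends the increment of \<open>u\<close> exactly to \<open>?R t\<close>, and its
  lower bound carries the first-order expansion of \<open>?R\<close> over to
  \<open>u\<close>.\<close>

lemma u_has_vector_derivative:
  "((\<lambda>t. u x z (v + t *\<^sub>R b)) has_vector_derivative du x z b (v + t0 *\<^sub>R b)) (at t0)"
proof -
  let ?v = "\<lambda>t. v + t *\<^sub>R b"
  let ?u0 = "u x z (?v t0)"
  let ?R = "\<lambda>t. var x (?v t) z (- ?u0) N"
  have R0: "?R t0 = 0" by (simp add: var_split var_u)
  have R: "var x (?v t) 0 (u x z (?v t) - ?u0) N = ?R t" for t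
    by (simp add: var_split linear_diff[OF linear_var_velocity] var_u)
  let ?S = "svar x (?v t0) b z (- ?u0) N" and ?D = "du x z b (?v t0)"
  have "(?R has_vector_derivative ?S) (at t0)"
    by (rule var_has_vector_derivative)
  then have l1: "((\<lambda>t. norm (?R t - (t - t0) *\<^sub>R ?S) / norm (t - t0)) \<longlongrightarrow> 0) (at t0)"
    by (simp add: has_vector_derivative_def has_derivative_iff_norm R0)
  have "continuous_on UNIV (\<lambda>t. var x (?v t) 0 ?D N)"
    by (intro continuous_on_var continuous_intros)
  then have "((\<lambda>t. var x (?v t) 0 ?D N) \<longlongrightarrow> var x (?v t0) 0 ?D N) (at t0)"
    by (simp add: continuous_on_def)
  then have "((\<lambda>t. norm (?S - var x (?v t) 0 ?D N)) \<longlongrightarrow> norm (?S - var x (?v t0) 0 ?D N)) (at t0)"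
    by (intro tendsto_intros)
  then have l2: "((\<lambda>t. norm (?S - var x (?v t) 0 ?D N)) \<longlongrightarrow> 0) (at t0)"
    by (simp add: du_def var_vinv)
  have "((\<lambda>t. (norm (?R t - (t - t0) *\<^sub>R ?S) / norm (t - t0) + norm (?S - var x (?v t) 0 ?D N)) / ((10/11) * T))
      \<longlongrightarrow> (0 + 0) / ((10/11) * T)) (at t0)"
    using T_pos by (intro tendsto_intros l1 l2) auto
  then have lim: "((\<lambda>t. (norm (?R t - (t - t0) *\<^sub>R ?S) / norm (t - t0) + norm (?S - var x (?v t) 0 ?D N)) / ((10/11) * T))
      \<longlongrightarrow> 0) (at t0)" by simp
  have "((\<lambda>t. norm (u x z (?v t) - ?u0 - (t - t0) *\<^sub>R ?D) / norm (t - t0)) \<longlongrightarrow> 0) (at t0)"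
  proof (rule Lim_null_comparison[OF _ lim])
    show "eventually (\<lambda>t. norm (norm (u x z (?v t) - ?u0 - (t - t0) *\<^sub>R ?D) / norm (t - t0))
      \<le> (norm (?R t - (t - t0) *\<^sub>R ?S) / norm (t - t0) + norm (?S - var x (?v t) 0 ?D N)) / ((10/11) * T)) (at t0)"
      unfolding eventually_at_filter
    proof (intro always_eventually allI impI)
      fix t assume t: "t \<noteq> t0"
      let ?w = "u x z (?v t) - ?u0 - (t - t0) *\<^sub>R ?D"
      let ?A = "?R t - (t - t0) *\<^sub>R ?S" and ?B = "?S - var x (?v t) 0 ?D N"
      have "var x (?v t) 0 ?w N = ?A + (t - t0) *\<^sub>R ?B"
      proof -
        have "var x (?v t) 0 ?w N = var x (?v t) 0 (u x z (?v t) - ?u0) N - (t - t0) *\<^sub>R var x (?v t) 0 ?D N"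
          by (simp only: linear_diff[OF linear_var_velocity] linear_scale[OF linear_var_velocity])
        then show ?thesis unfolding R by (simp add: algebra_simps)
      qed
      then have "norm (var x (?v t) 0 ?w N) \<le> norm ?A + norm ((t - t0) *\<^sub>R ?B)"
        using norm_triangle_ineq[of ?A "(t - t0) *\<^sub>R ?B"] by (simp only:)
      then have "(10/11) * T * norm ?w \<le> norm ?A + \<bar>t - t0\<bar> * norm ?B"
        using var_velocity_norm(2)[of ?w x "?v t"] by simp
      then have "((10/11) * T * norm ?w) / \<bar>t - t0\<bar> \<le> (norm ?A + \<bar>t - t0\<bar> * norm ?B) / \<bar>t - t0\<bar>"
        by (rule divide_right_mono) simp
      also have "\<dots> = norm ?A / \<bar>t - t0\<bar> + norm ?B" using t by (simp add: add_divide_distrib)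
      finally have "(norm ?w / \<bar>t - t0\<bar>) * ((10/11) * T) \<le> norm ?A / \<bar>t - t0\<bar> + norm ?B"
        by (simp only: mult.commute[of _ "(10/11) * T"] times_divide_eq_right)
      then have "norm ?w / \<bar>t - t0\<bar> \<le> (norm ?A / \<bar>t - t0\<bar> + norm ?B) / ((10/11) * T)"
        using T_pos by (subst pos_le_divide_eq) auto
      then show "norm (norm ?w / norm (t - t0)) \<le> (norm ?A / norm (t - t0) + norm ?B) / ((10/11) * T)"
        by simp
    qed
  qed
  then show ?thesis
    unfolding has_vector_derivative_def has_derivative_iff_norm
    by (auto simp: bounded_linear_scaleR_left)
qed

lemma jacobi_bounds:
  shows "l1 (u x z v) \<le> 12 / (11 * T) * l1 z"
    and "j \<le> N \<Longrightarrow> l1 (var x v z (- u x z v) j) \<le> (12/11) * l1 z"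
proof -
  let ?u = "u x z v"
  \<comment> \<open>Free flight with velocity \<open>- ?u\<close> runs along the segment from z to z
    - T u, so its norm is bounded by that of the endpoints. The true final variation is 0, hence the
    second endpoint is at most \<alpha>/11 and the maximum must be \<open>l1 z\<close>.\<close>
  define \<alpha> where "\<alpha> = max (l1 z) (l1 (z - T *\<^sub>R ?u))"
  have \<alpha>: "\<alpha> \<ge> 0" by (simp add: \<alpha>_def le_max_iff_disj)
  have lin: "l1 (z + (real j * h) *\<^sub>R (- ?u)) \<le> \<alpha>" if "j \<le> N" for j
  proof -
    define s where "s = real j * h / T"
    have s: "0 \<le> s" "s \<le> 1" using h time_le[OF that] T_pos by (auto simp: s_def)
    have "real j * h = s * T" using T_pos by (simp add: s_def)
    then have "z + (real j * h) *\<^sub>R (- ?u) = (1 - s) *\<^sub>R z + s *\<^sub>R (z - T *\<^sub>R ?u)"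
      by (simp add: algebra_simps)
    then have "l1 (z + (real j * h) *\<^sub>R (- ?u)) \<le> (1 - s) * l1 z + s * l1 (z - T *\<^sub>R ?u)"
      using l1_add[of "(1 - s) *\<^sub>R z" "s *\<^sub>R (z - T *\<^sub>R ?u)"] s by (simp only: l1_scaleR)
    also have "\<dots> \<le> (1 - s) * \<alpha> + s * \<alpha>"
      using s by (intro add_mono mult_left_mono) (auto simp: \<alpha>_def)
    finally show ?thesis by (simp add: algebra_simps)
  qed
  note b = var_bound[OF seminorm_on_l1 l1_g1 lin \<alpha>]
  have "l1 (var x v z (- ?u) N - (z - T *\<^sub>R ?u)) \<le> \<alpha> / 11" using b(2)[of N] by (simp add: T)
  moreover have "var x v z (- ?u) N = 0" by (simp add: var_split var_u)
  ultimately have e: "l1 (z - T *\<^sub>R ?u) \<le> \<alpha> / 11"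
    using l1_minus_commute[of 0 "z - T *\<^sub>R ?u"] by simp
  then have \<alpha>z: "\<alpha> = l1 z" using l1_nonneg[of z] l1_nonneg[of "z - T *\<^sub>R ?u"] unfolding \<alpha>_def by linarith
  show "j \<le> N \<Longrightarrow> l1 (var x v z (- ?u) j) \<le> (12/11) * l1 z" using b(1) \<alpha>z by simp
  have "T * l1 ?u = l1 (T *\<^sub>R ?u)"
    using T_pos by (simp add: l1_scaleR)
  also have "\<dots> \<le> l1 z + l1 (T *\<^sub>R ?u - z)"
    using l1_add[of z "T *\<^sub>R ?u - z"] by simp
  also have "l1 (T *\<^sub>R ?u - z) = l1 (z - T *\<^sub>R ?u)"
    by (rule l1_minus_commute)
  finally have "T * l1 ?u \<le> (12/11) * l1 z" using e \<alpha>z by simp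
  then show "l1 ?u \<le> 12 / (11 * T) * l1 z" using T_pos by (simp add: field_simps)
qed

text \<open>The Volterra inequality is run for the Hilbert-Schmidt norm of \<open>svar\<close> in b
  rather than for each b, since the basis has n k elements. The forcing is \<open>g2\<close>
  composed with the velocity variation, of size 12/11 T, and evaluated on the Jacobi field, of size
  12/11 \<open>l1 z\<close>.\<close>

lemma du_hilbert_schmidt:
  fixes x z v :: "(real^'k)^'n"
  shows "L2_set (\<lambda>b. norm (du x z b v)) Basis \<le> T\<^sup>2 * sqrt (real CARD('k)) * (LH + 4 * lH) * l1 z"
proof -
  let ?w = "- u x z v" and ?k = "sqrt (real CARD('k))"
  define \<gamma> where "\<gamma> = (12/11) * T * (?k * ((LH + 4 * lH) * ((12/11) * l1 z)))"
  have \<gamma>0: "\<gamma> \<ge> 0" using T_pos consts_nonneg by (simp add: \<gamma>_def)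
  define F where "F m b = g2 (q x v m) (var x v 0 b m) (var x v z ?w m) + g1 (q x v m) (svar x v b z ?w m)" for m b
  have F: "L2_set (\<lambda>b. norm (F m b)) Basis \<le> \<Lambda> * L2_set (\<lambda>b. norm (svar x v b z ?w m)) Basis + \<gamma>"
    if m: "m \<le> N" for m
  proof -
    have "L2_set (\<lambda>b. norm (F m b)) Basis
        \<le> L2_set (\<lambda>b. norm (g2 (q x v m) (var x v 0 b m) (var x v z ?w m)) + norm (g1 (q x v m) (svar x v b z ?w m))) Basis"
      unfolding F_def by (intro L2_set_mono norm_triangle_ineq) auto
    also have "\<dots> \<le> L2_set (\<lambda>b. norm (g2 (q x v m) (var x v 0 b m) (var x v z ?w m))) Basis
        + L2_set (\<lambda>b. norm (g1 (q x v m) (svar x v b z ?w m))) Basis" by (rule L2_set_triangle_ineq)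
    also have "L2_set (\<lambda>b. norm (g1 (q x v m) (svar x v b z ?w m))) Basis
        \<le> L2_set (\<lambda>b. \<Lambda> * norm (svar x v b z ?w m)) Basis"
      by (intro L2_set_mono norm_g1) auto
    also have "\<dots> = \<Lambda> * L2_set (\<lambda>b. norm (svar x v b z ?w m)) Basis"
      using \<Lambda>_nonneg by (simp add: L2_set_right_distrib)
    also have "L2_set (\<lambda>b. norm (g2 (q x v m) (var x v 0 b m) (var x v z ?w m))) Basis
        \<le> ((12/11) * T) * L2_set (\<lambda>b. norm (g2 (q x v m) b (var x v z ?w m))) Basis"
      using var_velocity_norm(1)[OF m, of x v] T_pos
      by (intro hilbert_schmidt_compose g2_linear linear_var_velocity) (auto simp: mult.assoc)
    also have "\<dots> \<le> ((12/11) * T) * (?k * ((LH + 4 * lH) * l1 (var x v z ?w m)))"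
      using T_pos by (intro mult_left_mono g2_hilbert_schmidt) auto
    also have "\<dots> \<le> \<gamma>" unfolding \<gamma>_def
      using T_pos consts_nonneg jacobi_bounds(2)[OF m, of x v z] by (intro mult_left_mono) auto
    finally show ?thesis by simp
  qed
  have svar_eq: "svar x v b z ?w j = - (h\<^sup>2 *\<^sub>R (\<Sum>m<j. vwt j m *\<^sub>R F m b))" for b j
    unfolding svar_def[of x v b z ?w j] by (subst vpos_volterra) (simp add: F_def svar_def)
  have "L2_set (\<lambda>b. norm (svar x v b z ?w N)) Basis \<le> (12/11) * (0 + (real N * h)\<^sup>2 * \<gamma> / 2)"
  proof (rule volterra_bound[where N=N and \<Lambda>=\<Lambda> and s="\<lambda>j. L2_set (\<lambda>b. norm (svar x v b z ?w j)) Basis"])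
    fix j assume j: "j \<le> N"
    have "L2_set (\<lambda>b. norm (svar x v b z ?w j)) Basis = L2_set (\<lambda>b. h\<^sup>2 * norm (\<Sum>m<j. vwt j m *\<^sub>R F m b)) Basis"
      by (simp add: svar_eq)
    also have "\<dots> = h\<^sup>2 * L2_set (\<lambda>b. norm (\<Sum>m<j. vwt j m *\<^sub>R F m b)) Basis"
      by (simp add: L2_set_right_distrib)
    also have "\<dots> \<le> h\<^sup>2 * (\<Sum>m<j. L2_set (\<lambda>b. norm (vwt j m *\<^sub>R F m b)) Basis)"
      by (intro mult_left_mono L2_set_norm_sum) auto
    also have "\<dots> = h\<^sup>2 * (\<Sum>m<j. vwt j m * L2_set (\<lambda>b. norm (F m b)) Basis)"
      by (auto simp: L2_set_right_distrib vwt_nonneg intro!: sum.cong)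
    also have "\<dots> \<le> h\<^sup>2 * (\<Sum>m<j. vwt j m * (\<Lambda> * L2_set (\<lambda>b. norm (svar x v b z ?w m)) Basis + \<gamma>))"
      using j by (intro mult_left_mono sum_mono F vwt_nonneg) auto
    finally show "L2_set (\<lambda>b. norm (svar x v b z ?w j)) Basis
      \<le> 0 + h\<^sup>2 * (\<Sum>m<j. vwt j m * (\<Lambda> * L2_set (\<lambda>b. norm (svar x v b z ?w m)) Basis + \<gamma>))" by simp
  qed (use \<Lambda>_nonneg \<gamma>0 h small' in auto)
  then have sN: "L2_set (\<lambda>b. norm (svar x v b z ?w N)) Basis \<le> (6/11) * T\<^sup>2 * \<gamma>"
    by (simp add: T mult_ac)
  have "L2_set (\<lambda>b. norm (du x z b v)) Basis \<le> L2_set (\<lambda>b. 11 / (10 * T) * norm (svar x v b z ?w N)) Basis"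
    unfolding du_def by (intro L2_set_mono norm_vinv) auto
  also have "\<dots> = 11 / (10 * T) * L2_set (\<lambda>b. norm (svar x v b z ?w N)) Basis"
    using T_pos by (subst L2_set_right_distrib) auto
  also have "\<dots> \<le> 11 / (10 * T) * ((6/11) * T\<^sup>2 * \<gamma>)"
    using sN T_pos by (intro mult_left_mono) auto
  \<comment> \<open>(11/10) (6/11) (12/11)^2: the inverse, the Volterra constant and the two first
    variations.\<close>
  also have "\<dots> = (864/1210) * (T\<^sup>2 * ?k * (LH + 4 * lH) * l1 z)"
    using T_pos by (simp add: \<gamma>_def power2_eq_square field_simps)
  also have "\<dots> \<le> 1 * (T\<^sup>2 * ?k * (LH + 4 * lH) * l1 z)"
    using consts_nonneg by (intro mult_right_mono) auto
  finally show ?thesis by simp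
qed

end

section \<open>Total variation through smooth test functions\<close>

text \<open>The class is closed under products and complements, rich enough to approximate open
  sets, and smooth enough for the chain rule through the flow.\<close>

definition smooth_test :: "('a::euclidean_space \<Rightarrow> real) \<Rightarrow> bool"
  where "smooth_test f \<longleftrightarrow> (\<forall>x. 0 \<le> f x \<and> f x \<le> 1) \<and>
    (\<exists>f' C. (\<forall>x. (f has_derivative blinfun_apply (f' x)) (at x)) \<and> continuous_on UNIV f' \<and> (\<forall>x. norm (f' x) \<le> C))"

lemma smooth_testI:
  assumes "\<And>x. (f has_derivative blinfun_apply (f' x)) (at x)" "continuous_on UNIV f'" "\<And>x. norm (f' x) \<le> C"
    "\<And>x. 0 \<le> f x \<and> f x \<le> 1"
  shows "smooth_test f"
  using assms unfolding smooth_test_def by blast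

lemma smooth_testE:
  assumes "smooth_test f"
  obtains f' C where "\<And>x. (f has_derivative blinfun_apply (f' x)) (at x)" "continuous_on UNIV f'" "\<And>x. norm (f' x) \<le> C"
    "continuous_on UNIV f" "\<And>x. 0 \<le> f x" "\<And>x. f x \<le> 1"
proof -
  obtain f' C where *: "\<And>x. (f has_derivative blinfun_apply (f' x)) (at x)" "continuous_on UNIV f'" "\<And>x. norm (f' x) \<le> C"
    "\<And>x. 0 \<le> f x" "\<And>x. f x \<le> 1"
    using assms unfolding smooth_test_def by metis
  moreover have "continuous_on UNIV f"
    using *(1) by (meson continuous_at_imp_continuous_on has_derivative_continuous)
  ultimately show thesis using that by blast
qed

lemma smooth_test_mult:
  assumes "smooth_test f" "smooth_test k" shows "smooth_test (\<lambda>x. f x * k x)"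
proof -
  obtain f' C where f: "\<And>x. (f has_derivative blinfun_apply (f' x)) (at x)" "continuous_on UNIV f'" "\<And>x. norm (f' x) \<le> C"
    "continuous_on UNIV f" "\<And>x. 0 \<le> f x" "\<And>x. f x \<le> 1" using assms(1) by (elim smooth_testE) (rule that)
  obtain k' D where k: "\<And>x. (k has_derivative blinfun_apply (k' x)) (at x)" "continuous_on UNIV k'" "\<And>x. norm (k' x) \<le> D"
    "continuous_on UNIV k" "\<And>x. 0 \<le> k x" "\<And>x. k x \<le> 1" using assms(2) by (elim smooth_testE) (rule that)
  let ?d = "\<lambda>x. f x *\<^sub>R k' x + k x *\<^sub>R f' x"
  have "((\<lambda>x. f x * k x) has_derivative blinfun_apply (?d x)) (at x)" for x
    by (rule has_derivative_eq_rhs[OF has_derivative_mult[OF f(1) k(1)]])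
      (simp add: fun_eq_iff blinfun.add_left blinfun.scaleR_left mult.commute)
  moreover have "continuous_on UNIV ?d" by (intro continuous_intros f k)
  moreover have "norm (?d x) \<le> D + C" for x
  proof -
    have "norm (?d x) \<le> norm (f x *\<^sub>R k' x) + norm (k x *\<^sub>R f' x)" by (rule norm_triangle_ineq)
    also have "\<dots> \<le> 1 * D + 1 * C"
      unfolding norm_scaleR using f(5,6)[of x] k(5,6)[of x]
      by (intro add_mono mult_mono f k) auto
    finally show ?thesis by simp
  qed
  moreover have "0 \<le> f x * k x \<and> f x * k x \<le> 1" for x
    using f(5,6)[of x] k(5,6)[of x] by (simp add: mult_le_one)
  ultimately show ?thesis by (rule smooth_testI)
qed

lemma smooth_test_one_minus:
  assumes "smooth_test f" shows "smooth_test (\<lambda>x. 1 - f x)"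
proof -
  obtain f' C where f: "\<And>x. (f has_derivative blinfun_apply (f' x)) (at x)" "continuous_on UNIV f'" "\<And>x. norm (f' x) \<le> C"
    "continuous_on UNIV f" "\<And>x. 0 \<le> f x" "\<And>x. f x \<le> 1" using assms(1) by (elim smooth_testE) (rule that)
  have "((\<lambda>x. 1 - f x) has_derivative blinfun_apply (- f' x)) (at x)" for x
    by (rule has_derivative_eq_rhs[OF has_derivative_diff[OF has_derivative_const f(1)]])
      (simp add: fun_eq_iff blinfun.minus_left)
  moreover have "continuous_on UNIV (\<lambda>x. - f' x)" by (intro continuous_intros f)
  moreover have "norm (- f' x) \<le> C" for x using f(3) by simp
  moreover have "0 \<le> 1 - f x \<and> 1 - f x \<le> 1" for x using f(5,6)[of x] by simp
  ultimately show ?thesis by (rule smooth_testI)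
qed

lemma smooth_test_one: "smooth_test (\<lambda>x. 1)"
  unfolding smooth_test_def
  by (intro conjI exI[of _ "\<lambda>x. 0"] exI[of _ 0]) (auto simp: continuous_on_const zero_blinfun.rep_eq)

lemma smooth_test_prod:
  "finite I \<Longrightarrow> (\<And>i. i \<in> I \<Longrightarrow> smooth_test (f i)) \<Longrightarrow> smooth_test (\<lambda>x. \<Prod>i\<in>I. f i x)"
  by (induction I rule: finite_induct) (auto intro: smooth_test_one smooth_test_mult)

text \<open>Squaring the positive part makes the step continuously differentiable at 0. As m grows
  it tends to the indicator of the open half-line, vanishing at 0, which suits open boxes.\<close>

definition soft_step :: "nat \<Rightarrow> real \<Rightarrow> real"
  where "soft_step m t = 1 - exp (- real m * (max 0 t)\<^sup>2)"

lemma DERIV_pos_part_square: "((\<lambda>t. (max 0 t)\<^sup>2) has_real_derivative 2 * max 0 t) (at (t::real))"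
proof (cases t "0::real" rule: linorder_cases)
  case less
  have "((\<lambda>t::real. 0) has_real_derivative 2 * max 0 t) (at t)" using less by simp
  then show ?thesis
    by (rule has_field_derivative_transform_within_open[where S="{..<0}"]) (use less in auto)
next
  case greater
  have "((\<lambda>t::real. t\<^sup>2) has_real_derivative 2 * max 0 t) (at t)"
    using greater by (auto intro!: derivative_eq_intros)
  then show ?thesis
    by (rule has_field_derivative_transform_within_open[where S="{0<..}"]) (use greater in auto)
next
  case equal
  have "((\<lambda>h. (max 0 (0 + h))\<^sup>2 / h) \<longlongrightarrow> 0) (at (0::real))"
  proof (rule Lim_null_comparison)
    show "((\<lambda>h::real. \<bar>h\<bar>) \<longlongrightarrow> 0) (at 0)" by (rule tendsto_rabs_zero) (rule tendsto_ident_at)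
    show "\<forall>\<^sub>F h in at (0::real). norm ((max 0 (0 + h))\<^sup>2 / h) \<le> \<bar>h\<bar>"
      by (rule always_eventually) (auto simp: max_def power2_eq_square)
  qed
  then show ?thesis using equal by (simp add: DERIV_def)
qed

lemma smooth_test_soft_step:
  fixes b :: "'a::euclidean_space"
  shows "smooth_test (\<lambda>x. soft_step m (x \<bullet> b + c))"
proof -
  let ?p = "\<lambda>t::real. max 0 t"
  define d where "d t = exp (- real m * (?p t)\<^sup>2) * (real m * (2 * ?p t))" for t
  have der: "(soft_step m has_real_derivative d t) (at t)" for t
  proof -
    have "((\<lambda>t. 1 - exp (- real m * (?p t)\<^sup>2)) has_real_derivative
        0 - exp (- real m * (?p t)\<^sup>2) * (- real m * (2 * ?p t))) (at t)"
      by (intro DERIV_diff DERIV_const DERIV_fun_exp DERIV_cmult DERIV_pos_part_square)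
    then show ?thesis by (simp add: soft_step_def[abs_def] d_def)
  qed
  have dc: "continuous_on UNIV d" unfolding d_def by (intro continuous_intros)
  have db: "\<bar>d t\<bar> \<le> 2 * real m + 2" for t
  proof -
    define s where "s = ?p t"
    have s: "s \<ge> 0" by (simp add: s_def)
    have ms: "real m * s\<^sup>2 \<ge> 0" by simp
    have "exp (- real m * s\<^sup>2) \<le> 1 / (1 + real m * s\<^sup>2)"
      using exp_ge_add_one_self[of "real m * s\<^sup>2"] ms
      by (auto simp: exp_minus inverse_eq_divide intro!: frac_le add_pos_nonneg)
    then have "d t \<le> (1 / (1 + real m * s\<^sup>2)) * (real m * (2 * s))"
      unfolding d_def s_def[symmetric] using s by (intro mult_right_mono) auto
    also have "\<dots> \<le> 2 * real m + 2"
    proof -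
      have "real m * (2 * s) \<le> (2 * real m + 2) * (1 + real m * s\<^sup>2)"
      proof -
        have "0 \<le> real m * (s - 1)\<^sup>2" by simp
        then have "real m * (2 * s) \<le> real m + real m * s\<^sup>2" by (simp add: power2_eq_square algebra_simps)
        also have "\<dots> \<le> 2 * real m + 2 * (real m * s\<^sup>2) + 2 + 2 * real m * (real m * s\<^sup>2)" using ms by simp
        finally show ?thesis by (simp add: algebra_simps)
      qed
      then show ?thesis using ms by (simp add: pos_divide_le_eq add_pos_nonneg)
    qed
    finally show ?thesis using s by (simp add: d_def)
  qed
  let ?d = "\<lambda>x. d (x \<bullet> b + c) *\<^sub>R blinfun_inner_left b"
  have "((\<lambda>x. soft_step m (x \<bullet> b + c)) has_derivative blinfun_apply (?d x)) (at x)" for x :: 'a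
  proof -
    have "((\<lambda>x. x \<bullet> b + c) has_derivative (\<lambda>y. y \<bullet> b)) (at x)"
      by (auto intro!: derivative_eq_intros)
    moreover have "(soft_step m has_derivative (\<lambda>y. d (x \<bullet> b + c) * y)) (at (x \<bullet> b + c))"
      using der by (simp add: has_field_derivative_def)
    ultimately have "((soft_step m \<circ> (\<lambda>x. x \<bullet> b + c)) has_derivative (\<lambda>y. d (x \<bullet> b + c) * y) \<circ> (\<lambda>y. y \<bullet> b)) (at x)"
      by (rule diff_chain_at)
    then have "((\<lambda>x. soft_step m (x \<bullet> b + c)) has_derivative (\<lambda>y. d (x \<bullet> b + c) * (y \<bullet> b))) (at x)"
      by (simp add: o_def)
    then show ?thesis
      by (rule has_derivative_eq_rhs) (simp add: fun_eq_iff blinfun.scaleR_left inner_commute)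
  qed
  moreover have "continuous_on UNIV ?d"
    by (intro continuous_intros continuous_on_compose2[OF dc]) auto
  moreover have "norm (?d x) \<le> (2 * real m + 2) * norm (blinfun_inner_left b)" for x
    using db by (simp add: mult_right_mono)
  moreover have "0 \<le> soft_step m t \<and> soft_step m t \<le> 1" for t by (simp add: soft_step_def)
  ultimately show ?thesis by (rule smooth_testI)
qed

lemma soft_step_tendsto: "(\<lambda>m. soft_step m t) \<longlonglongrightarrow> (if t > 0 then 1 else 0)"
proof (cases "t > 0")
  case True
  have "filterlim (\<lambda>m. t\<^sup>2 * real m) at_top sequentially"
    using True by (intro filterlim_tendsto_pos_mult_at_top[OF tendsto_const _ filterlim_real_sequentially]) auto
  then have "filterlim (\<lambda>m. - (t\<^sup>2 * real m)) at_bot sequentially"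
    by (simp add: filterlim_uminus_at_top)
  then have "(\<lambda>m. exp (- (real m * t\<^sup>2))) \<longlonglongrightarrow> 0"
    using filterlim_compose[OF exp_at_bot] by (simp add: mult.commute)
  then have "(\<lambda>m. 1 - exp (- (real m * t\<^sup>2))) \<longlonglongrightarrow> 1 - 0" by (intro tendsto_intros)
  then show ?thesis using True by (simp add: soft_step_def)
qed (simp add: soft_step_def max_def)

definition soft_box :: "nat \<Rightarrow> 'a::euclidean_space \<Rightarrow> 'a \<Rightarrow> 'a \<Rightarrow> real"
  where "soft_box m a c x = (\<Prod>b\<in>Basis. soft_step m (x \<bullet> b + - (a \<bullet> b)) * soft_step m (x \<bullet> (- b) + c \<bullet> b))"

lemma smooth_test_soft_box: "smooth_test (soft_box m a c)"
  unfolding soft_box_def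
  by (intro smooth_test_prod smooth_test_mult smooth_test_soft_step) auto

lemma soft_box_tendsto: "x \<in> box a c \<Longrightarrow> (\<lambda>m. soft_box m a c x) \<longlonglongrightarrow> 1"
proof -
  assume x: "x \<in> box a c"
  have "(\<lambda>m. soft_box m a c x) \<longlonglongrightarrow> (\<Prod>b\<in>(Basis::'a set). (if x \<bullet> b + - (a \<bullet> b) > 0 then 1 else 0) * (if x \<bullet> (- b) + c \<bullet> b > 0 then 1 else 0))"
    unfolding soft_box_def by (intro tendsto_prod tendsto_mult soft_step_tendsto)
  also have "(\<Prod>b\<in>(Basis::'a set). (if x \<bullet> b + - (a \<bullet> b) > 0 then 1 else 0) * (if x \<bullet> (- b) + c \<bullet> b > 0 then 1 else 0)) = (1::real)"
    using x by (intro prod.neutral) (auto simp: mem_box)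
  finally show ?thesis .
qed

lemma soft_box_eq_0: "x \<notin> box a c \<Longrightarrow> soft_box m a c x = 0"
proof -
  assume "x \<notin> box a c"
  then obtain i where i: "i \<in> Basis" "x \<bullet> i \<le> a \<bullet> i \<or> c \<bullet> i \<le> x \<bullet> i" by (auto simp: mem_box not_less)
  then have "soft_step m (x \<bullet> i + - (a \<bullet> i)) * soft_step m (x \<bullet> (- i) + c \<bullet> i) = 0"
    by (auto simp: soft_step_def max_def)
  then show ?thesis unfolding soft_box_def using i by (intro prod_zero) auto
qed

text \<open>An open set is a countable union of open boxes. One index m governs both the number of
  boxes taken into account and the sharpness of their edges: outside S every factor of
  \<open>k\<close> is 1, and inside a box the product is squeezed to 0 by the factor of that
  box.\<close>

lemma smooth_tests_of_open:
  fixes S :: "'a::euclidean_space set"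
  assumes "open S"
  obtains f where "\<And>m::nat. smooth_test (f m)" "\<And>x. (\<lambda>m. f m x) \<longlonglongrightarrow> indicator S x"
proof (cases "S = {}")
  case True
  have "smooth_test (\<lambda>x::'a. 0)" using smooth_test_one_minus[OF smooth_test_one] by simp
  then show thesis using that[of "\<lambda>m x. 0"] True by simp
next
  case False
  obtain D where D: "countable D" "D \<subseteq> Pow S" "\<And>X. X \<in> D \<Longrightarrow> \<exists>a b. X = box a b" "\<Union>D = S"
    using open_countable_Union_open_box[OF assms] by metis
  have "D \<noteq> {}" using D(4) False by auto
  then have rng: "range (from_nat_into D) = D" using D(1) by (rule range_from_nat_into)
  have "\<forall>i. \<exists>a c. from_nat_into D i = box a c" using D(3) rng by (metis rangeI)
  then obtain a c where ac: "\<And>i. from_nat_into D i = box (a i) (c i)" by metis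
  have SU: "S = (\<Union>i. box (a i) (c i))" using D(4) rng ac by (metis (mono_tags, lifting) image_cong)
  define k where "k m x = (\<Prod>i<m. 1 - soft_box m (a i) (c i) x)" for m x
  have k01: "0 \<le> soft_box m (a i) (c i) x \<and> soft_box m (a i) (c i) x \<le> 1" for m i x
    using smooth_test_soft_box unfolding smooth_test_def by blast
  show thesis
  proof (rule that[of "\<lambda>m x. 1 - k m x"])
    show "smooth_test (\<lambda>x. 1 - k m x)" for m
      unfolding k_def by (intro smooth_test_one_minus smooth_test_prod smooth_test_soft_box) auto
    fix x
    show "(\<lambda>m. 1 - k m x) \<longlonglongrightarrow> indicator S x"
    proof (cases "x \<in> S")
      case True
      then obtain i where i: "x \<in> box (a i) (c i)" using SU by auto
      have "(\<lambda>m. 1 - soft_box m (a i) (c i) x) \<longlonglongrightarrow> 1 - 1" by (intro tendsto_intros soft_box_tendsto i)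
      then have lim: "(\<lambda>m. 1 - soft_box m (a i) (c i) x) \<longlonglongrightarrow> 0" by simp
      have "(\<lambda>m. k m x) \<longlonglongrightarrow> 0"
      proof (rule Lim_null_comparison[OF _ lim])
        show "\<forall>\<^sub>F m in sequentially. norm (k m x) \<le> 1 - soft_box m (a i) (c i) x"
        proof (rule eventually_sequentiallyI[of "Suc i"])
          fix m assume "Suc i \<le> m"
          then have "k m x = (1 - soft_box m (a i) (c i) x) * (\<Prod>j\<in>{..<m} - {i}. 1 - soft_box m (a j) (c j) x)"
            unfolding k_def by (subst prod.remove[of _ i]) auto
          moreover have "0 \<le> (\<Prod>j\<in>{..<m} - {i}. 1 - soft_box m (a j) (c j) x)" "(\<Prod>j\<in>{..<m} - {i}. 1 - soft_box m (a j) (c j) x) \<le> 1"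
            using k01 by (auto intro!: prod_nonneg prod_le_1)
          ultimately show "norm (k m x) \<le> 1 - soft_box m (a i) (c i) x"
            using k01[of m i x] by (simp add: abs_mult mult_left_le)
        qed
      qed
      then have "(\<lambda>m. 1 - k m x) \<longlonglongrightarrow> 1 - 0" by (intro tendsto_intros)
      then show ?thesis using True by simp
    next
      case False
      then have "soft_box m (a i) (c i) x = 0" for m i using SU by (intro soft_box_eq_0) auto
      then show ?thesis using False by (simp add: k_def)
    qed
  qed
qed

text \<open>Smooth tests reach open sets by dominated convergence, and Borel sets by outer
  regularity. The intersection of the two outer approximations is one open set that is good for both
  measures.\<close>

lemma measure_diff_le_of_smooth_tests:
  fixes P Q :: "'a::euclidean_space measure"
  assumes P: "prob_space P" "sets P = sets borel" and Q: "prob_space Q" "sets Q = sets borel"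
    and test: "\<And>f. smooth_test f \<Longrightarrow> \<bar>(\<integral>x. f x \<partial>P) - (\<integral>x. f x \<partial>Q)\<bar> \<le> B"
    and A: "A \<in> sets borel"
  shows "\<bar>measure P A - measure Q A\<bar> \<le> B"
proof -
  interpret P: prob_space P by (rule P)
  interpret Q: prob_space Q by (rule Q)
  have op: "\<bar>measure P S - measure Q S\<bar> \<le> B" if S: "open S" for S
  proof -
    obtain f where f: "\<And>m::nat. smooth_test (f m)" "\<And>x. (\<lambda>m. f m x) \<longlonglongrightarrow> indicator S x"
      using smooth_tests_of_open[OF S] by metis
    have fb: "\<bar>f m x\<bar> \<le> 1" for m x using f(1)[of m] unfolding smooth_test_def by (auto simp: abs_le_iff intro: order_trans[of _ 0])
    have fm: "f m \<in> borel_measurable borel" for m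
      using smooth_testE[OF f(1)[of m]] borel_measurable_continuous_onI by metis
    have lim: "(\<lambda>m. \<integral>x. f m x \<partial>R) \<longlonglongrightarrow> measure R S" if "prob_space R" and R: "sets R = sets borel" for R
    proof -
      interpret R: prob_space R by fact
      have [measurable]: "f m \<in> borel_measurable R" for m using fm R by (simp cong: measurable_cong_sets)
      have [measurable]: "S \<in> sets R" using S R by simp
      have "(\<lambda>m. \<integral>x. f m x \<partial>R) \<longlonglongrightarrow> (\<integral>x. indicator S x \<partial>R)"
        by (rule integral_dominated_convergence[where w="\<lambda>_. 1"]) (use fb f(2) in auto)
      then show ?thesis by simp
    qed
    have "(\<lambda>m. \<bar>(\<integral>x. f m x \<partial>P) - (\<integral>x. f m x \<partial>Q)\<bar>) \<longlonglongrightarrow> \<bar>measure P S - measure Q S\<bar>"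
      by (intro tendsto_intros lim P Q)
    then show ?thesis by (rule Lim_bounded) (use test f(1) in auto)
  qed
  have outer: "\<exists>S. open S \<and> A \<subseteq> S \<and> measure R S \<le> measure R A + e"
    if "prob_space R" and R: "sets R = sets borel" and e: "e > 0" for R e
  proof -
    interpret R: prob_space R by fact
    have "emeasure R A = (INF U\<in>{U. A \<subseteq> U \<and> open U}. emeasure R U)"
      by (rule outer_regular) (use R A in auto)
    moreover have "emeasure R A < ennreal (measure R A + e)"
      using e by (simp add: R.emeasure_eq_measure ennreal_less_iff)
    ultimately obtain U where U: "A \<subseteq> U" "open U" "emeasure R U < ennreal (measure R A + e)"
      by (auto simp: INF_less_iff)
    then have "measure R U < measure R A + e"
      by (simp add: R.emeasure_eq_measure ennreal_less_iff)
    then show ?thesis using U by force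
  qed
  show ?thesis
  proof (rule field_le_epsilon)
    fix e :: real assume e: "e > 0"
    obtain S1 where S1: "open S1" "A \<subseteq> S1" "measure P S1 \<le> measure P A + e" using outer[OF P e] by blast
    obtain S2 where S2: "open S2" "A \<subseteq> S2" "measure Q S2 \<le> measure Q A + e" using outer[OF Q e] by blast
    let ?S = "S1 \<inter> S2"
    have 1: "measure P ?S \<le> measure P S1" "measure P A \<le> measure P ?S"
      using S1 S2 A P by (auto intro!: P.finite_measure_mono)
    have 2: "measure Q ?S \<le> measure Q S2" "measure Q A \<le> measure Q ?S"
      using S1 S2 A Q by (auto intro!: Q.finite_measure_mono)
    have "\<bar>measure P ?S - measure Q ?S\<bar> \<le> B" using S1 S2 by (intro op) auto
    then show "\<bar>measure P A - measure Q A\<bar> \<le> B + e" using 1 2 S1(3) S2(3) by linarith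
  qed
qed

lemma has_real_derivative_std_gaussian_integral:
  fixes \<phi> \<phi>' :: "real \<Rightarrow> 'a::euclidean_space \<Rightarrow> real"
  assumes [measurable]: "\<And>s. \<phi> s \<in> borel_measurable borel" "\<And>s. \<phi>' s \<in> borel_measurable borel"
    and int: "\<And>s. integrable std_gaussian (\<phi> s)"
    and deriv: "\<And>s v. ((\<lambda>s. \<phi> s v) has_real_derivative \<phi>' s v) (at s)"
    and C: "\<And>s v. \<bar>\<phi>' s v\<bar> \<le> C"
  shows "((\<lambda>s. \<integral>v. \<phi> s v \<partial>std_gaussian) has_real_derivative (\<integral>v. \<phi>' s0 v \<partial>std_gaussian)) (at s0)"
  unfolding DERIV_def tendsto_at_iff_sequentially
proof (intro allI impI)
  fix X :: "nat \<Rightarrow> real" assume X: "\<forall>i. X i \<in> UNIV - {0}" "X \<longlonglongrightarrow> 0"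
  have lim: "(\<lambda>n. \<integral>v. (\<phi> (s0 + X n) v - \<phi> s0 v) / X n \<partial>std_gaussian) \<longlonglongrightarrow> (\<integral>v. \<phi>' s0 v \<partial>std_gaussian)"
  proof (rule integral_dominated_convergence)
    show "integrable std_gaussian (\<lambda>v::'a. C)" by simp
    show "AE v in std_gaussian. (\<lambda>n. (\<phi> (s0 + X n) v - \<phi> s0 v) / X n) \<longlonglongrightarrow> \<phi>' s0 v"
    proof (rule AE_I2)
      fix v
      have "((\<lambda>h. (\<phi> (s0 + h) v - \<phi> s0 v) / h) \<longlongrightarrow> \<phi>' s0 v) (at 0)"
        using deriv[of v s0] by (simp add: DERIV_def)
      then show "(\<lambda>n. (\<phi> (s0 + X n) v - \<phi> s0 v) / X n) \<longlonglongrightarrow> \<phi>' s0 v"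
        unfolding tendsto_at_iff_sequentially using X by (auto simp: o_def)
    qed
    show "AE v in std_gaussian. norm ((\<phi> (s0 + X n) v - \<phi> s0 v) / X n) \<le> C" for n
    proof (rule AE_I2)
      fix v
      have "norm (\<phi> (s0 + X n) v - \<phi> s0 v) \<le> C * norm ((s0 + X n) - s0)"
        by (rule field_differentiable_bound[where S=UNIV and f'="\<lambda>s. \<phi>' s v"])
          (use deriv C in auto)
      then show "norm ((\<phi> (s0 + X n) v - \<phi> s0 v) / X n) \<le> C"
        using X(1) by (auto simp: field_simps)
    qed
  qed auto
  have eq: "(\<integral>v. (\<phi> (s0 + X n) v - \<phi> s0 v) / X n \<partial>std_gaussian)
      = ((\<integral>v. \<phi> (s0 + X n) v \<partial>std_gaussian) - (\<integral>v. \<phi> s0 v \<partial>std_gaussian)) / X n" for n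
    using int by simp
  show "((\<lambda>h. ((\<integral>v. \<phi> (s0 + h) v \<partial>std_gaussian) - (\<integral>v. \<phi> s0 v \<partial>std_gaussian)) / h) \<circ> X)
      \<longlonglongrightarrow> (\<integral>v. \<phi>' s0 v \<partial>std_gaussian)"
    using lim unfolding eq o_def .
qed

lemma integrable_std_gaussian_bounded:
  fixes F :: "'a::euclidean_space \<Rightarrow> real"
  assumes [measurable]: "F \<in> borel_measurable borel" and "\<And>v. \<bar>F v\<bar> \<le> B"
  shows "integrable std_gaussian F"
  by (rule integrable_std_gaussian_exp_bound[where C=B and c=0]) (use assms in auto)

section \<open>Regularisation in total variation\<close>

context mean_field_verlet
begin

definition div_u :: "(real^'k)^'n \<Rightarrow> (real^'k)^'n \<Rightarrow> (real^'k)^'n \<Rightarrow> real"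
  where "div_u x z v = (\<Sum>b\<in>Basis. (u x z v \<bullet> b) * (v \<bullet> b) - du x z b v \<bullet> b)"

definition u_bound :: "(real^'k)^'n \<Rightarrow> real"
  where "u_bound z = 12 / (11 * T) * l1 z"

definition du_bound :: "(real^'k)^'n \<Rightarrow> real"
  where "du_bound z = T\<^sup>2 * sqrt (real CARD('k)) * (LH + 4 * lH) * l1 z"

lemma u_bounds_nonneg: "u_bound z \<ge> 0" "du_bound z \<ge> 0"
  using T_pos consts_nonneg by (auto simp: u_bound_def du_bound_def)

lemma norm_u: "norm (u x z v) \<le> u_bound z"
  unfolding u_bound_def by (rule order_trans[OF norm_le_l1_vec jacobi_bounds(1)])

lemma norm_du: "b \<in> Basis \<Longrightarrow> norm (du x z b v) \<le> du_bound z"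
  unfolding du_bound_def
  by (rule order_trans[OF _ du_hilbert_schmidt]) (rule member_le_L2_set[where f="\<lambda>b. norm (du x z b v)"]; simp)

lemma measurable_u[measurable]: "u x z \<in> borel_measurable borel" "du x z b \<in> borel_measurable borel"
  by (auto intro!: borel_measurable_continuous_onI continuous_on_u continuous_on_du)

lemma measurable_div_u[measurable]: "div_u x z \<in> borel_measurable borel"
  unfolding div_u_def by measurable

lemma u_component_derivative:
  "((\<lambda>t. u x z (v + t *\<^sub>R b) \<bullet> a) has_real_derivative du x z b (v + t *\<^sub>R b) \<bullet> a) (at t)"
  unfolding has_real_derivative_iff_has_vector_derivative
  using bounded_linear.has_vector_derivative[OF bounded_linear_inner_left u_has_vector_derivative] .

lemma u_component_bounds:
  assumes "a \<in> Basis" "b \<in> Basis"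
  shows "\<bar>u x z v \<bullet> a\<bar> \<le> u_bound z + du_bound z" "\<bar>du x z b v \<bullet> a\<bar> \<le> u_bound z + du_bound z"
proof -
  have "\<bar>y \<bullet> a\<bar> \<le> norm y" for y using Basis_le_norm[OF assms(1)] .
  then show "\<bar>u x z v \<bullet> a\<bar> \<le> u_bound z + du_bound z" "\<bar>du x z b v \<bullet> a\<bar> \<le> u_bound z + du_bound z"
    using norm_u[of x z v] norm_du[OF assms(2), of x z v] u_bounds_nonneg[of z] by (meson add_increasing add_increasing2 order_trans)+
qed

text \<open>Estimating the coordinates one by one would give a bound growing with the dimension n k.
  Summing the exact identity \<open>gauss_div_pairing\<close> over all pairs of coordinates keeps
  only the norm of \<open>u\<close> and the trace of Du Du.\<close>

lemma integral_div_u_square: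
  fixes x z :: "(real^'k)^'n"
  shows "integrable std_gaussian (\<lambda>v. (div_u x z v)\<^sup>2)"
    and "(\<integral>v. (div_u x z v)\<^sup>2 \<partial>std_gaussian) \<le> (u_bound z)\<^sup>2 + (du_bound z)\<^sup>2"
proof -
  define C where "C = u_bound z + du_bound z"
  have C0: "C \<ge> 0" using u_bounds_nonneg[of z] by (simp add: C_def)
  define D where "D b v = (u x z v \<bullet> b) * (v \<bullet> b) - du x z b v \<bullet> b" for b v
  have [measurable]: "D b \<in> borel_measurable borel" for b unfolding D_def by measurable
  have D: "\<bar>D b v\<bar> \<le> C * exp (norm v)" if b: "b \<in> Basis" for b v
  proof -
    have "\<bar>D b v\<bar> \<le> \<bar>u x z v \<bullet> b\<bar> * \<bar>v \<bullet> b\<bar> + \<bar>du x z b v \<bullet> b\<bar>"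
      unfolding D_def by (simp add: abs_mult[symmetric])
    also have "\<dots> \<le> C * norm v + C"
      using b C0 unfolding C_def by (intro add_mono mult_mono u_component_bounds Basis_le_norm) auto
    also have "\<dots> = C * (1 + norm v)" by (simp add: algebra_simps)
    also have "\<dots> \<le> C * exp (norm v)" using C0 by (intro mult_left_mono exp_ge_add_one_self)
    finally show ?thesis .
  qed
  have Dint: "integrable std_gaussian (\<lambda>v. D a v * D b v)" if "a \<in> Basis" "b \<in> Basis" for a b
  proof (rule integrable_std_gaussian_exp_bound[where C="C * C" and c=2])
    fix v
    have "\<bar>D a v * D b v\<bar> \<le> (C * exp (norm v)) * (C * exp (norm v))"
      unfolding abs_mult using that C0 by (intro mult_mono D) auto
    moreover have "exp (2 * norm v) = exp (norm v) * exp (norm v)" by (simp flip: exp_add)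
    ultimately show "\<bar>D a v * D b v\<bar> \<le> C * C * exp (2 * norm v)" by (simp only: mult_ac)
  qed simp
  have sq: "(div_u x z v)\<^sup>2 = (\<Sum>a\<in>Basis. \<Sum>b\<in>Basis. D a v * D b v)" for v
    unfolding div_u_def D_def[symmetric] power2_eq_square by (simp add: sum_product)
  show "integrable std_gaussian (\<lambda>v. (div_u x z v)\<^sup>2)"
    unfolding sq by (intro Bochner_Integration.integrable_sum Dint)
  let ?R = "\<lambda>a b v. (a \<bullet> b) * ((u x z v \<bullet> a) * (u x z v \<bullet> b)) + (du x z b v \<bullet> a) * (du x z a v \<bullet> b)"
  have int2: "integrable std_gaussian (\<lambda>v. (u x z v \<bullet> a) * (u x z v \<bullet> b))"
    "integrable std_gaussian (\<lambda>v. (du x z b v \<bullet> a) * (du x z a v \<bullet> b))" if "a \<in> Basis" "b \<in> Basis" for a b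
    using that C0 by (auto intro!: integrable_std_gaussian_bounded[where B="C * C"] mult_mono u_component_bounds simp: abs_mult C_def)
  have pair: "(\<integral>v. D a v * D b v \<partial>std_gaussian) = (\<integral>v. ?R a b v \<partial>std_gaussian)"
    if "a \<in> Basis" "b \<in> Basis" for a b
  proof -
    have "(\<integral>v. D a v * D b v \<partial>std_gaussian) = (a \<bullet> b) * (\<integral>v. (u x z v \<bullet> a) * (u x z v \<bullet> b) \<partial>std_gaussian)
        + (\<integral>v. (du x z b v \<bullet> a) * (du x z a v \<bullet> b) \<partial>std_gaussian)"
      unfolding D_def
      by (rule gauss_div_pairing[where C=C]) (use that in \<open>auto intro!: u_component_derivative u_component_bounds simp: C_def\<close>)
    also have "\<dots> = (\<integral>v. ?R a b v \<partial>std_gaussian)" using int2[OF that] by simp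
    finally show ?thesis .
  qed
  have "(\<integral>v. (div_u x z v)\<^sup>2 \<partial>std_gaussian) = (\<Sum>a\<in>Basis. \<Sum>b\<in>Basis. (\<integral>v. D a v * D b v \<partial>std_gaussian))"
    unfolding sq by (simp add: Bochner_Integration.integral_sum Bochner_Integration.integrable_sum Dint)
  also have "\<dots> = (\<Sum>a\<in>Basis. \<Sum>b\<in>Basis. (\<integral>v. ?R a b v \<partial>std_gaussian))"
    by (intro sum.cong refl pair)
  also have "\<dots> = (\<integral>v. (\<Sum>a\<in>Basis. \<Sum>b\<in>Basis. ?R a b v) \<partial>std_gaussian)"
    using int2 by (simp add: Bochner_Integration.integral_sum Bochner_Integration.integrable_sum)
  also have "\<dots> \<le> (\<integral>(v::(real^'k)^'n). (u_bound z)\<^sup>2 + (du_bound z)\<^sup>2 \<partial>std_gaussian)"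
  proof (rule integral_mono)
    show "integrable std_gaussian (\<lambda>v. \<Sum>a\<in>Basis. \<Sum>b\<in>Basis. ?R a b v)"
      using int2 by (intro Bochner_Integration.integrable_sum Bochner_Integration.integrable_add integrable_mult_right) auto
    fix v
    have "(\<Sum>a\<in>Basis. \<Sum>b\<in>Basis. (a \<bullet> b) * ((u x z v \<bullet> a) * (u x z v \<bullet> b))) = (\<Sum>a\<in>Basis. (u x z v \<bullet> a) * (u x z v \<bullet> a))"
      by (intro sum.cong refl) (simp add: inner_Basis if_distrib[of "\<lambda>c. c * _"] cong: if_cong)
    also have "\<dots> = (norm (u x z v))\<^sup>2" by (simp add: power2_norm_eq_inner euclidean_inner[symmetric])
    also have "\<dots> \<le> (u_bound z)\<^sup>2" by (intro power_mono norm_u) auto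
    finally have 1: "(\<Sum>a\<in>Basis. \<Sum>b\<in>Basis. (a \<bullet> b) * ((u x z v \<bullet> a) * (u x z v \<bullet> b))) \<le> (u_bound z)\<^sup>2" .
    let ?m = "\<lambda>a b. du x z b v \<bullet> a"
    \<comment> \<open>The trace of Du Du is at most the squared Hilbert-Schmidt norm, by 2 x y \<le>
      x^2 + y^2 and the symmetry of the double sum.\<close>
    have "(\<Sum>a\<in>Basis. \<Sum>b\<in>Basis. ?m a b * ?m b a) \<le> (\<Sum>a\<in>Basis. \<Sum>b\<in>Basis. ((?m a b)\<^sup>2 + (?m b a)\<^sup>2) / 2)"
    proof (intro sum_mono)
      fix a b :: "(real^'k)^'n"
      show "?m a b * ?m b a \<le> ((?m a b)\<^sup>2 + (?m b a)\<^sup>2) / 2"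
        using sum_squares_bound[of "?m a b" "?m b a"] by simp
    qed
    also have "\<dots> = ((\<Sum>a\<in>Basis. \<Sum>b\<in>Basis. (?m a b)\<^sup>2) + (\<Sum>a\<in>Basis. \<Sum>b\<in>Basis. (?m b a)\<^sup>2)) / 2"
      by (simp add: sum_divide_distrib[symmetric] sum.distrib)
    also have "(\<Sum>a\<in>Basis. \<Sum>b\<in>Basis. (?m a b)\<^sup>2) = (\<Sum>a\<in>Basis. \<Sum>b\<in>Basis. (?m b a)\<^sup>2)" by (rule sum.swap)
    also have "(\<Sum>a\<in>Basis. \<Sum>b\<in>Basis. (?m b a)\<^sup>2) = (\<Sum>a\<in>Basis. (norm (du x z a v))\<^sup>2)"
      by (intro sum.cong refl) (simp add: power2_norm_eq_inner, subst (2) euclidean_inner, simp add: power2_eq_square)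
    also have "\<dots> = (L2_set (\<lambda>b. norm (du x z b v)) Basis)\<^sup>2"
      by (simp add: L2_set_def sum_nonneg)
    also have "((L2_set (\<lambda>b. norm (du x z b v)) Basis)\<^sup>2 + (L2_set (\<lambda>b. norm (du x z b v)) Basis)\<^sup>2) / 2
        = (L2_set (\<lambda>b. norm (du x z b v)) Basis)\<^sup>2" by simp
    also have "\<dots> \<le> (du_bound z)\<^sup>2"
      unfolding du_bound_def by (intro power_mono du_hilbert_schmidt) auto
    finally have 2: "(\<Sum>a\<in>Basis. \<Sum>b\<in>Basis. ?m a b * ?m b a) \<le> (du_bound z)\<^sup>2" .
    show "(\<Sum>a\<in>Basis. \<Sum>b\<in>Basis. ?R a b v) \<le> (u_bound z)\<^sup>2 + (du_bound z)\<^sup>2"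
      using add_mono[OF 1 2] by (simp add: sum.distrib)
  qed simp
  finally show "(\<integral>v. (div_u x z v)\<^sup>2 \<partial>std_gaussian) \<le> (u_bound z)\<^sup>2 + (du_bound z)\<^sup>2" by simp
qed

text \<open>Jensen's inequality in the form \<bar>y\<bar> \<le> (c^2 + y^2) / (2 c), applied for
  every c above the claimed bound; this also covers the case where the bound is 0.\<close>

lemma integral_abs_div_u:
  fixes x z :: "(real^'k)^'n"
  shows "integrable std_gaussian (div_u x z)"
    and "(\<integral>v. \<bar>div_u x z v\<bar> \<partial>std_gaussian) \<le> sqrt ((u_bound z)\<^sup>2 + (du_bound z)\<^sup>2)"
proof -
  define s where "s = sqrt ((u_bound z)\<^sup>2 + (du_bound z)\<^sup>2)"
  have s0: "s \<ge> 0" by (simp add: s_def)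
  note sq = integral_div_u_square[of x z]
  have sq': "(\<integral>v. (div_u x z v)\<^sup>2 \<partial>std_gaussian) \<le> s\<^sup>2" using sq(2) by (simp add: s_def)
  have am: "\<bar>y\<bar> \<le> (c\<^sup>2 + y\<^sup>2) / (2 * c)" if "c > 0" for c y :: real
    using sum_squares_bound[of c "\<bar>y\<bar>"] that by (simp add: field_simps)
  show int: "integrable std_gaussian (div_u x z)"
    by (rule Bochner_Integration.integrable_bound[where f="\<lambda>v. (1\<^sup>2 + (div_u x z v)\<^sup>2) / (2 * 1)"])
      (use sq(1) am[of 1] in \<open>auto intro!: AE_I2\<close>)
  have le: "(\<integral>v. \<bar>div_u x z v\<bar> \<partial>std_gaussian) \<le> c" if c: "c > s" for c
  proof -
    have c0: "c > 0" using c s0 by simp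
    have "(\<integral>v. \<bar>div_u x z v\<bar> \<partial>std_gaussian) \<le> (\<integral>v. (c\<^sup>2 + (div_u x z v)\<^sup>2) / (2 * c) \<partial>std_gaussian)"
      using int sq(1) am[OF c0] by (intro integral_mono) auto
    also have "\<dots> = (c\<^sup>2 + (\<integral>v. (div_u x z v)\<^sup>2 \<partial>std_gaussian)) / (2 * c)" using sq(1) by simp
    also have "\<dots> \<le> (c\<^sup>2 + c\<^sup>2) / (2 * c)"
    proof -
      have "s\<^sup>2 \<le> c\<^sup>2" using c s0 by (intro power_mono) auto
      then show ?thesis using sq' c0 by (intro divide_right_mono) auto
    qed
    also have "\<dots> = c" using c0 by (simp add: power2_eq_square field_simps)
    finally show ?thesis .
  qed
  show "(\<integral>v. \<bar>div_u x z v\<bar> \<partial>std_gaussian) \<le> sqrt ((u_bound z)\<^sup>2 + (du_bound z)\<^sup>2)"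
    unfolding s_def[symmetric] by (rule dense_ge) (use le in auto)
qed

lemma measurable_q[measurable]: "(\<lambda>v. q x v N) \<in> borel_measurable borel"
  by (intro borel_measurable_continuous_onI continuous_on_q continuous_intros)

text \<open>Neither the derivative of f nor its bound enters the result: they only justify
  differentiation under the integral and integration by parts. This uniformity is what lets the
  estimate pass to indicators.\<close>

lemma smooth_test_integral_diff:
  fixes x y :: "(real^'k)^'n"
  assumes f: "smooth_test f"
  shows "\<bar>(\<integral>v. f (q x v N) \<partial>std_gaussian) - (\<integral>v. f (q y v N) \<partial>std_gaussian)\<bar>
    \<le> sqrt ((u_bound (x - y))\<^sup>2 + (du_bound (x - y))\<^sup>2)"
proof -
  obtain f' C where f': "\<And>x. (f has_derivative blinfun_apply (f' x)) (at x)" "continuous_on UNIV f'" "\<And>x. norm (f' x) \<le> C"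
    "continuous_on UNIV f" "\<And>x. 0 \<le> f x" "\<And>x. f x \<le> 1" using f by (elim smooth_testE) (rule that)
  have C0: "C \<ge> 0" using f'(3)[of 0] norm_ge_zero order_trans by blast
  define z where "z = x - y"
  let ?x = "\<lambda>s. y + s *\<^sub>R z"
  have f01: "\<bar>f w\<bar> \<le> 1" for w using f'(5,6)[of w] by simp
  have [measurable]: "f \<in> borel_measurable borel" by (rule borel_measurable_continuous_onI[OF f'(4)])
  define \<phi>' where "\<phi>' s v = f' (q (?x s) v N) (var (?x s) v z 0 N)" for s v
  have cont_f': "continuous_on UNIV (\<lambda>v. f' (q (?x s) v N) (var (?x s) v z' w N))" for s z' w
    by (intro continuous_intros continuous_on_compose2[OF f'(2)] continuous_on_q continuous_on_var) auto
  have [measurable]: "\<phi>' s \<in> borel_measurable borel" for s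
    unfolding \<phi>'_def by (intro borel_measurable_continuous_onI cont_f')
  have chain: "((\<lambda>s. f (q (a + s *\<^sub>R b) (v + s *\<^sub>R w) N)) has_real_derivative
      f' (q (a + s *\<^sub>R b) (v + s *\<^sub>R w) N) (var (a + s *\<^sub>R b) (v + s *\<^sub>R w) b w N)) (at s)" for a b v w s
    unfolding has_real_derivative_iff_has_vector_derivative
    by (rule has_vector_derivative_compose[OF q_has_vector_derivative f'(1)])
  have D: "((\<lambda>s. \<integral>v. f (q (?x s) v N) \<partial>std_gaussian) has_real_derivative (\<integral>v. \<phi>' s v \<partial>std_gaussian)) (at s)" for s
  proof (rule has_real_derivative_std_gaussian_integral[where C="C * ((12/11) * norm z)"])
    show "integrable std_gaussian (\<lambda>v. f (q (?x s) v N))" for s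
      by (rule integrable_std_gaussian_bounded[where B=1]) (auto simp: f01)
    show "((\<lambda>s. f (q (?x s) v N)) has_real_derivative \<phi>' s v) (at s)" for s v
      using chain[of y z v 0 s] by (simp add: \<phi>'_def)
    show "\<bar>\<phi>' s v\<bar> \<le> C * ((12/11) * norm z)" for s v
    proof -
      have "norm (var (?x s) v z 0 N) \<le> (12/11) * norm z"
        by (rule var_bound(1)[OF seminorm_on_norm norm_g1]) auto
      then have "norm (f' (q (?x s) v N)) * norm (var (?x s) v z 0 N) \<le> C * ((12/11) * norm z)"
        using f'(3) C0 by (intro mult_mono) auto
      then show ?thesis unfolding \<phi>'_def using norm_blinfun[of "f' (q (?x s) v N)" "var (?x s) v z 0 N"] by simp
    qed
  qed auto
  have bound: "\<bar>\<integral>v. \<phi>' s v \<partial>std_gaussian\<bar> \<le> sqrt ((u_bound z)\<^sup>2 + (du_bound z)\<^sup>2)" for s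
  proof -
    let ?U = "u (?x s) z" and ?dU = "du (?x s) z" and ?Q = "\<lambda>v. q (?x s) v N"
    define E where "E = u_bound z + du_bound z"
    have E0: "E \<ge> 0" using u_bounds_nonneg[of z] by (simp add: E_def)
    define V where "V b v = f' (?Q v) (var (?x s) v 0 b N)" for b v
    have [measurable]: "V b \<in> borel_measurable borel" for b
      unfolding V_def by (intro borel_measurable_continuous_onI cont_f')
    have Vb: "\<bar>V b v\<bar> \<le> C * ((12/11) * (T * norm b))" for b v
    proof -
      have "norm (f' (?Q v)) * norm (var (?x s) v 0 b N) \<le> C * ((12/11) * (T * norm b))"
        using f'(3) C0 var_velocity_norm(1)[of N "?x s" v b] by (intro mult_mono) auto
      then show ?thesis unfolding V_def using norm_blinfun[of "f' (?Q v)" "var (?x s) v 0 b N"] by simp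
    qed
    have i1: "integrable std_gaussian (\<lambda>v. V b v * (?U v \<bullet> b))" if "b \<in> Basis" for b
    proof (rule integrable_std_gaussian_bounded[where B="C * ((12/11) * (T * norm b)) * E"])
      show "\<bar>V b v * (?U v \<bullet> b)\<bar> \<le> C * ((12/11) * (T * norm b)) * E" for v
        unfolding abs_mult using that E0 C0 T_pos unfolding E_def by (intro mult_mono Vb u_component_bounds) auto
    qed simp
    have i2: "integrable std_gaussian (\<lambda>v. f (?Q v) * (?dU b v \<bullet> b))" if "b \<in> Basis" for b
    proof (rule integrable_std_gaussian_bounded[where B="1 * E"])
      show "\<bar>f (?Q v) * (?dU b v \<bullet> b)\<bar> \<le> 1 * E" for v
        unfolding abs_mult using that E0 unfolding E_def by (intro mult_mono f01 u_component_bounds) auto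
    qed simp
    have i3: "integrable std_gaussian (\<lambda>v. f (?Q v) * (?U v \<bullet> b) * (v \<bullet> b))" if "b \<in> Basis" for b
    proof (rule integrable_std_gaussian_exp_bound[where C="1 * E" and c=1])
      fix v
      have "\<bar>v \<bullet> b\<bar> \<le> exp (1 * norm v)" using that by (intro abs_inner_unit_le) simp
      then show "\<bar>f (?Q v) * (?U v \<bullet> b) * (v \<bullet> b)\<bar> \<le> 1 * E * exp (1 * norm v)"
        unfolding abs_mult using that E0 unfolding E_def by (intro mult_mono f01 u_component_bounds) auto
    qed simp
    have ibp: "(\<integral>v. V b v * (?U v \<bullet> b) + f (?Q v) * (?dU b v \<bullet> b) \<partial>std_gaussian)
        = (\<integral>v. f (?Q v) * (?U v \<bullet> b) * (v \<bullet> b) \<partial>std_gaussian)" if b: "b \<in> Basis" for b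
    proof (rule gauss_ibp[where c=0 and C="C * ((12/11) * (T * norm b)) * E + 1 * E"])
      fix v t
      have q: "((\<lambda>t. f (?Q (v + t *\<^sub>R b))) has_real_derivative V b (v + t *\<^sub>R b)) (at t)"
        using chain[of "?x s" 0 v b t] by (simp add: V_def)
      show "((\<lambda>t. f (?Q (v + t *\<^sub>R b)) * (?U (v + t *\<^sub>R b) \<bullet> b)) has_real_derivative
        V b (v + t *\<^sub>R b) * (?U (v + t *\<^sub>R b) \<bullet> b) + f (?Q (v + t *\<^sub>R b)) * (?dU b (v + t *\<^sub>R b) \<bullet> b)) (at t)"
        using DERIV_mult[OF q u_component_derivative[of "?x s" z v b b t]] by (simp add: mult.commute)
    next
      fix v
      have 1: "\<bar>V b v * (?U v \<bullet> b)\<bar> \<le> C * ((12/11) * (T * norm b)) * E"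
        unfolding abs_mult using b E0 C0 T_pos unfolding E_def by (intro mult_mono Vb u_component_bounds) auto
      have 2: "\<bar>f (?Q v) * (?U v \<bullet> b)\<bar> \<le> 1 * E" "\<bar>f (?Q v) * (?dU b v \<bullet> b)\<bar> \<le> 1 * E"
        unfolding abs_mult using b E0 unfolding E_def by (intro mult_mono f01 u_component_bounds; simp)+
      show "\<bar>f (?Q v) * (?U v \<bullet> b)\<bar> \<le> (C * ((12/11) * (T * norm b)) * E + 1 * E) * exp (0 * norm v)"
        using 1 2(1) abs_ge_zero[of "V b v * (?U v \<bullet> b)"] unfolding mult_zero_left exp_zero mult_1_right by linarith
      show "\<bar>V b v * (?U v \<bullet> b) + f (?Q v) * (?dU b v \<bullet> b)\<bar> \<le> (C * ((12/11) * (T * norm b)) * E + 1 * E) * exp (0 * norm v)"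
        using 1 2(2) unfolding mult_zero_left exp_zero mult_1_right by linarith
    qed auto
    have "\<phi>' s v = (\<Sum>b\<in>Basis. V b v * (?U v \<bullet> b))" for v
    proof -
      \<comment> \<open>At the final time, displacing the position by z acts to first order like
        changing the velocity by \<open>u\<close>. In coordinates this is a sum of directional
        derivatives in v, to each of which \<open>gauss_ibp\<close> applies.\<close>
      have "var (?x s) v z 0 N = var (?x s) v 0 (?U v) N" by (simp add: var_u)
      also have "\<dots> = var (?x s) v 0 (\<Sum>b\<in>Basis. (?U v \<bullet> b) *\<^sub>R b) N" by (simp add: euclidean_representation)
      also have "\<dots> = (\<Sum>b\<in>Basis. (?U v \<bullet> b) *\<^sub>R var (?x s) v 0 b N)"
        by (simp only: linear_sum[OF linear_var_velocity] linear_scale[OF linear_var_velocity])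
      finally show ?thesis unfolding \<phi>'_def V_def
        by (simp only: blinfun.sum_right blinfun.scaleR_right) (simp add: mult.commute)
    qed
    then have "(\<integral>v. \<phi>' s v \<partial>std_gaussian) = (\<Sum>b\<in>Basis. \<integral>v. V b v * (?U v \<bullet> b) \<partial>std_gaussian)"
      using i1 by (simp add: Bochner_Integration.integral_sum)
    also have "\<dots> = (\<Sum>b\<in>Basis. \<integral>v. f (?Q v) * (?U v \<bullet> b) * (v \<bullet> b) - f (?Q v) * (?dU b v \<bullet> b) \<partial>std_gaussian)"
    proof (intro sum.cong refl)
      fix b :: "(real^'k)^'n" assume b: "b \<in> Basis"
      show "(\<integral>v. V b v * (?U v \<bullet> b) \<partial>std_gaussian)
        = (\<integral>v. f (?Q v) * (?U v \<bullet> b) * (v \<bullet> b) - f (?Q v) * (?dU b v \<bullet> b) \<partial>std_gaussian)"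
        using ibp[OF b] i1[OF b] i2[OF b] i3[OF b] by simp
    qed
    also have "\<dots> = (\<integral>v. (\<Sum>b\<in>Basis. f (?Q v) * (?U v \<bullet> b) * (v \<bullet> b) - f (?Q v) * (?dU b v \<bullet> b)) \<partial>std_gaussian)"
      using i2 i3 by (subst Bochner_Integration.integral_sum) auto
    also have "\<dots> = (\<integral>v. f (?Q v) * div_u (?x s) z v \<partial>std_gaussian)"
      by (intro Bochner_Integration.integral_cong refl) (simp add: div_u_def sum_distrib_left algebra_simps)
    finally have "\<bar>\<integral>v. \<phi>' s v \<partial>std_gaussian\<bar> \<le> (\<integral>v. \<bar>f (?Q v) * div_u (?x s) z v\<bar> \<partial>std_gaussian)"
      by simp
    also have "\<dots> \<le> (\<integral>v. \<bar>div_u (?x s) z v\<bar> \<partial>std_gaussian)"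
    proof (rule integral_mono)
      have le: "\<bar>f (?Q v) * div_u (?x s) z v\<bar> \<le> \<bar>div_u (?x s) z v\<bar>" for v
        using f01[of "?Q v"] by (simp add: abs_mult mult_left_le_one_le)
      show "\<bar>f (?Q v) * div_u (?x s) z v\<bar> \<le> \<bar>div_u (?x s) z v\<bar>" for v by (rule le)
      show "integrable std_gaussian (\<lambda>v. \<bar>f (?Q v) * div_u (?x s) z v\<bar>)"
        by (rule Bochner_Integration.integrable_bound[OF integral_abs_div_u(1)]) (use le in auto)
    qed (use integral_abs_div_u(1) in auto)
    also have "\<dots> \<le> sqrt ((u_bound z)\<^sup>2 + (du_bound z)\<^sup>2)" by (rule integral_abs_div_u)
    finally show ?thesis .
  qed
  have "\<exists>s. 0 < s \<and> s < 1 \<and> (\<integral>v. f (q (?x 1) v N) \<partial>std_gaussian) - (\<integral>v. f (q (?x 0) v N) \<partial>std_gaussian)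
      = (1 - 0) * (\<integral>v. \<phi>' s v \<partial>std_gaussian)"
    by (rule MVT2) (use D in auto)
  then show ?thesis using bound unfolding z_def by auto
qed

lemma verlet_law_diff:
  fixes x y :: "(real^'k)^'n"
  assumes A: "A \<in> sets borel"
  shows "\<bar>measure std_gaussian {v. q x v N \<in> A} - measure std_gaussian {v. q y v N \<in> A}\<bar>
    \<le> sqrt ((u_bound (x - y))\<^sup>2 + (du_bound (x - y))\<^sup>2)"
proof -
  let ?P = "\<lambda>x. distr std_gaussian borel (\<lambda>v. q x v N)"
  have "\<bar>measure (?P x) A - measure (?P y) A\<bar> \<le> sqrt ((u_bound (x - y))\<^sup>2 + (du_bound (x - y))\<^sup>2)"
  proof (rule measure_diff_le_of_smooth_tests[OF _ _ _ _ _ A])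
    show "prob_space (?P x)" "prob_space (?P y)" by (auto intro!: std_gaussian.prob_space_distr)
    fix f :: "(real^'k)^'n \<Rightarrow> real" assume f: "smooth_test f"
    have [measurable]: "f \<in> borel_measurable borel"
      using smooth_testE[OF f] borel_measurable_continuous_onI by metis
    show "\<bar>(\<integral>w. f w \<partial>?P x) - (\<integral>w. f w \<partial>?P y)\<bar> \<le> sqrt ((u_bound (x - y))\<^sup>2 + (du_bound (x - y))\<^sup>2)"
      using smooth_test_integral_diff[OF f, of x y] by (simp add: integral_distr)
  qed auto
  then show ?thesis using A by (simp add: measure_distr vimage_def)
qed

end

section \<open>Contraction\<close>

text \<open>With \<open>\<beta> = 1 / M\<close> the cost is concave and lies between \<open>r / M\<close> and \<open>r\<close>; this is where the
  constant \<open>M\<close> of the theorem comes from.\<close>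

definition cost :: "real \<Rightarrow> real \<Rightarrow> real"
  where "cost \<beta> r = (1 - \<beta>) * (1 - exp (- r)) + \<beta> * r"

lemma cost_le: "0 \<le> \<beta> \<Longrightarrow> \<beta> \<le> 1 \<Longrightarrow> cost \<beta> r \<le> r"
proof -
  assume b: "0 \<le> \<beta>" "\<beta> \<le> 1"
  have "1 - exp (- r) \<le> r" using exp_ge_add_one_self[of "- r"] by linarith
  then have "(1 - \<beta>) * (1 - exp (- r)) \<le> (1 - \<beta>) * r" using b by (intro mult_left_mono) auto
  then show ?thesis by (simp add: cost_def algebra_simps)
qed

lemma cost_ge: "\<beta> \<le> 1 \<Longrightarrow> r \<ge> 0 \<Longrightarrow> \<beta> * r \<le> cost \<beta> r"
  by (simp add: cost_def)

lemma cost_mono: "0 \<le> \<beta> \<Longrightarrow> \<beta> \<le> 1 \<Longrightarrow> r \<le> r' \<Longrightarrow> cost \<beta> r \<le> cost \<beta> r'"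
  unfolding cost_def by (intro add_mono mult_left_mono) auto

lemma cost_decrease: "\<beta> \<le> 1 \<Longrightarrow> r' \<le> r \<Longrightarrow> cost \<beta> r' \<le> cost \<beta> r - \<beta> * (r - r')"
proof -
  assume "\<beta> \<le> 1" "r' \<le> r"
  then have "(1 - \<beta>) * (1 - exp (- r')) \<le> (1 - \<beta>) * (1 - exp (- r))" by (intro mult_left_mono) auto
  then show ?thesis by (simp add: cost_def algebra_simps)
qed

text \<open>Concavity: the tangent at r lies above the graph. A deviation d is thus priced at the
  slope at r, which falls towards \<beta> for large r.\<close>

lemma cost_tangent: "0 \<le> \<beta> \<Longrightarrow> \<beta> \<le> 1 \<Longrightarrow> cost \<beta> (r + d) \<le> cost \<beta> r + ((1 - \<beta>) * exp (- r) + \<beta>) * d"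
proof -
  assume b: "0 \<le> \<beta>" "\<beta> \<le> 1"
  have "exp (- r) * (1 - d) \<le> exp (- r) * exp (- d)"
    using exp_ge_add_one_self[of "- d"] by (intro mult_left_mono) auto
  then have "(1 - \<beta>) * (1 - exp (- (r + d))) \<le> (1 - \<beta>) * (1 - exp (- r) * (1 - d))"
    using b by (intro mult_left_mono) (auto simp: exp_add[symmetric])
  then show ?thesis by (simp add: cost_def algebra_simps)
qed

text \<open>Distances are measured in units of T, the distance covered by a unit velocity in one
  duration; the prefactor T restores the dimension and makes the cost comparable with
  \<open>l1\<close>.\<close>

definition particle_cost :: "real \<Rightarrow> real \<Rightarrow> ('b::real_normed_vector)^'n \<Rightarrow> 'b^'n \<Rightarrow> real"
  where "particle_cost \<beta> T x y = (\<Sum>i\<in>UNIV. T * cost \<beta> (norm (x$i - y$i) / T))"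

lemma particle_cost_le_l1:
  assumes "0 \<le> \<beta>" "\<beta> \<le> 1" "T > 0" shows "particle_cost \<beta> T x y \<le> l1 (x - y)"
  unfolding particle_cost_def l1_def
proof (intro sum_mono)
  fix i
  have "T * cost \<beta> (norm (x$i - y$i) / T) \<le> T * (norm (x$i - y$i) / T)"
    using assms by (intro mult_left_mono cost_le) auto
  then show "T * cost \<beta> (norm (x$i - y$i) / T) \<le> norm ((x - y)$i)" using assms by simp
qed

lemma particle_cost_ge_l1:
  assumes "\<beta> \<le> 1" "T > 0" shows "\<beta> * l1 (x - y) \<le> particle_cost \<beta> T x y"
  unfolding particle_cost_def l1_def sum_distrib_left
proof (intro sum_mono)
  fix i
  have "T * (\<beta> * (norm (x$i - y$i) / T)) \<le> T * cost \<beta> (norm (x$i - y$i) / T)"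
    using assms by (intro mult_left_mono cost_ge) auto
  then show "\<beta> * norm ((x - y)$i) \<le> T * cost \<beta> (norm (x$i - y$i) / T)" using assms by simp
qed

text \<open>Concavity is exploited only for the displaced particle; the others are charged their
  full distance, which is small.\<close>

lemma particle_cost_single:
  assumes "0 \<le> \<beta>" "\<beta> \<le> 1" "T > 0"
  shows "particle_cost \<beta> T x y \<le> T * cost \<beta> (norm ((x - y)$i) / T) + (\<Sum>l\<in>UNIV-{i}. norm ((x - y)$l))"
proof -
  have "particle_cost \<beta> T x y = T * cost \<beta> (norm ((x - y)$i) / T) + (\<Sum>l\<in>UNIV-{i}. T * cost \<beta> (norm ((x - y)$l) / T))"
    unfolding particle_cost_def by (simp add: sum.remove)
  also have "(\<Sum>l\<in>UNIV-{i}. T * cost \<beta> (norm ((x - y)$l) / T)) \<le> (\<Sum>l\<in>UNIV-{i}. norm ((x - y)$l))"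
  proof (intro sum_mono)
    fix l
    have "T * cost \<beta> (norm ((x - y)$l) / T) \<le> T * (norm ((x - y)$l) / T)"
      using assms by (intro mult_left_mono cost_le) auto
    then show "T * cost \<beta> (norm ((x - y)$l) / T) \<le> norm ((x - y)$l)" using assms by simp
  qed
  finally show ?thesis by simp
qed

text \<open>The cost is additive over particles, so it suffices to move one particle at a time.\<close>

lemma lipschitz_by_particles:
  fixes P :: "('b::real_normed_vector)^'n \<Rightarrow> real"
  assumes "\<And>x y i. (\<And>l. l \<noteq> i \<Longrightarrow> x$l = y$l) \<Longrightarrow> \<bar>P x - P y\<bar> \<le> C * (T * cost \<beta> (norm (x$i - y$i) / T))"
  shows "\<bar>P x - P y\<bar> \<le> C * particle_cost \<beta> T x y"
proof -
  \<comment> \<open>Interpolating configurations: the particles in S already sit at y, and enlarging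
    S by one element moves one particle.\<close>
  let ?m = "\<lambda>S. (\<chi> i. if i \<in> S then y$i else x$i)"
  have "\<bar>P x - P (?m S)\<bar> \<le> C * (\<Sum>i\<in>S. T * cost \<beta> (norm (x$i - y$i) / T))" if "finite S" for S
    using that
  proof (induction S rule: finite_induct)
    case empty
    have "?m {} = x" by (simp add: vec_eq_iff)
    then show ?case by simp
  next
    case (insert i S)
    have "\<bar>P (?m S) - P (?m (insert i S))\<bar> \<le> C * (T * cost \<beta> (norm (?m S $ i - ?m (insert i S) $ i) / T))"
      by (rule assms) auto
    then have "\<bar>P (?m S) - P (?m (insert i S))\<bar> \<le> C * (T * cost \<beta> (norm (x$i - y$i) / T))"
      using insert by simp
    then show ?case using insert by (simp add: distrib_left)
  qed
  from this[of UNIV] show ?thesis by (simp add: particle_cost_def)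
qed

section \<open>Comparing two trajectories over one duration\<close>

context mean_field_verlet
begin

text \<open>The relative deviation of a difference of trajectories from free flight: \<Lambda> T^2 /
  2 times the growth factor 12/11.\<close>

definition \<theta> :: real where "\<theta> = (6/11) * (\<Lambda> * T\<^sup>2)"

lemma flow_diff:
  fixes x y v w :: "(real^'k)^'n"
  assumes lin: "\<And>j. j \<le> N \<Longrightarrow> l1 ((x - y) + (real j * h) *\<^sub>R (v - w)) \<le> m" and j: "j \<le> N"
  shows "l1 (q x v j - q y w j) \<le> (12/11) * m"
    and "l1 ((q x v j - q y w j) - ((x - y) + (real j * h) *\<^sub>R (v - w))) \<le> \<theta> * m"
proof -
  have m: "m \<ge> 0" using lin[of 0] l1_nonneg order_trans by blast
  have d: "q x v j - q y w j = vpos (\<lambda>l _. g (q x v l) - g (q y w l)) h (x - y) (v - w) j" for j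
    unfolding q_def by (rule vpos_diff)
  have F: "l1 ((\<lambda>l _. g (q x v l) - g (q y w l)) l (vpos (\<lambda>l _. g (q x v l) - g (q y w l)) h (x - y) (v - w) l))
      \<le> \<Lambda> * l1 (vpos (\<lambda>l _. g (q x v l) - g (q y w l)) h (x - y) (v - w) l) + 0" for l
    unfolding d[symmetric] using l1_g_diff by simp
  have h0: "h \<ge> 0" using h by simp
  note b = vpos_bound[OF seminorm_on_l1, where N=N and \<beta>=0 and \<Lambda>=\<Lambda> and \<alpha>=m, OF F lin \<Lambda>_nonneg m order_refl h0 small' j]
  show "l1 (q x v j - q y w j) \<le> (12/11) * m" unfolding d using b(1) by simp
  have "l1 ((q x v j - q y w j) - ((x - y) + (real j * h) *\<^sub>R (v - w))) \<le> T\<^sup>2 / 2 * (\<Lambda> * ((12/11) * m))"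
    unfolding d T using b(2) by simp
  also have "\<dots> = \<theta> * m" by (simp add: \<theta>_def)
  finally show "l1 ((q x v j - q y w j) - ((x - y) + (real j * h) *\<^sub>R (v - w))) \<le> \<theta> * m" .
qed

text \<open>A displacement of particle i reaches the others only through the pair force. One factor
  12/11 bounds the difference that drives them, the other their response; half the product is
  72/121.\<close>

lemma flow_diff_others:
  fixes x y v w :: "(real^'k)^'n"
  assumes lin: "\<And>j. j \<le> N \<Longrightarrow> l1 ((x - y) + (real j * h) *\<^sub>R (v - w)) \<le> m"
    and off: "\<And>l. l \<noteq> i \<Longrightarrow> (x - y)$l = 0" "\<And>l. l \<noteq> i \<Longrightarrow> (v - w)$l = 0"
  shows "(\<Sum>k\<in>UNIV-{i}. norm ((q x v N - q y w N)$k)) \<le> (72/121) * (l * T\<^sup>2) * m"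
proof -
  have m: "m \<ge> 0" using lin[of 0] l1_nonneg order_trans by blast
  define \<nu> where "\<nu> z = (\<Sum>k\<in>UNIV-{i}. norm (z$k))" for z :: "(real^'k)^'n"
  have \<nu>: "seminorm_on \<nu>" unfolding seminorm_on_def \<nu>_def
    by (auto simp: sum.distrib[symmetric] sum_distrib_left intro!: sum_mono norm_triangle_ineq)
  have \<nu>0: "\<nu> z \<ge> 0" for z by (simp add: \<nu>_def sum_nonneg)
  have d: "q x v j - q y w j = vpos (\<lambda>l _. g (q x v l) - g (q y w l)) h (x - y) (v - w) j" for j
    unfolding q_def by (rule vpos_diff)
  have F: "\<nu> ((\<lambda>l _. g (q x v l) - g (q y w l)) j (vpos (\<lambda>l _. g (q x v l) - g (q y w l)) h (x - y) (v - w) j))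
      \<le> \<Lambda> * \<nu> (vpos (\<lambda>l _. g (q x v l) - g (q y w l)) h (x - y) (v - w) j) + l * ((12/11) * m)" if "j < N" for j
  proof -
    have "\<nu> (g (q x v j) - g (q y w j)) \<le> (L + l) * \<nu> (q x v j - q y w j) + l * l1 (q x v j - q y w j)"
      unfolding \<nu>_def by (rule l1_bound_except[OF g_diff_component consts_nonneg(2)])
    also have "\<dots> \<le> \<Lambda> * \<nu> (q x v j - q y w j) + l * ((12/11) * m)"
      using flow_diff(1)[OF lin, of j] that consts_nonneg \<nu>0
      by (intro add_mono mult_right_mono mult_left_mono) auto
    finally show ?thesis unfolding d .
  qed
  have lin\<nu>: "\<nu> ((x - y) + (real j * h) *\<^sub>R (v - w)) \<le> 0" for j
  proof -
    have "((x - y) + (real j * h) *\<^sub>R (v - w)) $ k = 0" if "k \<noteq> i" for k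
      using off that by (simp only: vector_add_component vector_scaleR_component) simp
    then show ?thesis unfolding \<nu>_def by (intro sum_nonpos) auto
  qed
  have h0: "h \<ge> 0" using h by simp
  have b0: "l * ((12/11) * m) \<ge> 0" using consts_nonneg m by simp
  have "\<nu> (q x v N - q y w N) \<le> (12/11) * (0 + (real N * h)\<^sup>2 * (l * ((12/11) * m)) / 2)"
    unfolding d
    by (rule vpos_bound(1)[OF \<nu>, where N=N and \<beta>="l * ((12/11) * m)" and \<Lambda>=\<Lambda> and \<alpha>=0, OF F lin\<nu> \<Lambda>_nonneg order_refl b0 h0 small' order_refl])
  also have "\<dots> = (72/121) * (l * T\<^sup>2) * m" by (simp add: T)
  finally show ?thesis by (simp add: \<nu>_def)
qed

end

text \<open>\<open>Rt\<close> separates the two regimes and becomes 8 R sqrt ((L + K) / K). In this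
  notation the exponent of M is 5/2 + 5/4 Rt/T, that of c is - 5/4 Rt/T, and \<beta> = 1/M. The
  interaction bound \<open>l\<close> is small compared with K times the same exponential, so it can
  be absorbed in both regimes.\<close>

locale mean_field_contraction = mean_field_verlet G H G1 H1 G2 H2 L l LH lH h T N
  for G H :: "real^'k \<Rightarrow> real^'k" and G1 H1 G2 H2 L l LH lH h T N +
  fixes K R Rt \<beta> c :: real
  assumes K: "K > 0" "K \<le> L" and \<Lambda>L: "\<Lambda> \<le> (101/100) * L"
    and LT: "L * T\<^sup>2 \<le> 3/20" "L\<^sup>2 * T\<^sup>2 \<le> (9/50) * K"
    and l_le: "l \<le> K * exp (- 5/4 * (Rt / T)) / 10000"
    and LTR: "L * T * Rt \<le> 3/80"
    and R: "R \<ge> 0" "2 * R \<le> Rt"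
    and \<beta>: "\<beta> = exp (- 5/2 - 5/4 * (Rt / T))"
    and c: "c = K * T\<^sup>2 / 156 * exp (- 5/4 * (Rt / T))"
    and convex_far: "\<And>a b. norm (a - b) \<ge> R \<Longrightarrow> (a - b) \<bullet> (G a - G b) \<ge> K * (norm (a - b))\<^sup>2"
begin

lemma KT: "K * T\<^sup>2 \<le> 3/20" "K * T\<^sup>2 > 0"
proof -
  have "K * T\<^sup>2 \<le> L * T\<^sup>2" using K by (intro mult_right_mono) auto
  then show "K * T\<^sup>2 \<le> 3/20" using LT(1) by linarith
  show "K * T\<^sup>2 > 0" using K T_pos by simp
qed

lemma Rt_nonneg: "Rt \<ge> 0" using R by simp

lemma \<beta>_bounds: "0 \<le> \<beta>" "\<beta> \<le> 1"
proof -
  have "Rt / T \<ge> 0" using Rt_nonneg T_pos by simp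
  then have "- 5/2 - 5/4 * (Rt / T) \<le> 0" by linarith
  then show "0 \<le> \<beta>" "\<beta> \<le> 1" unfolding \<beta> by (simp_all only: exp_ge_zero exp_le_one_iff)
qed

lemma \<theta>_bounds: "0 \<le> \<theta>" "\<theta> \<le> 1/12" "\<theta> \<le> (303/550) * (L * T\<^sup>2)"
proof -
  show "0 \<le> \<theta>" using \<Lambda>_nonneg by (simp add: \<theta>_def)
  have "\<Lambda> * T\<^sup>2 \<le> (101/100) * L * T\<^sup>2" using \<Lambda>L by (intro mult_right_mono) auto
  then show "\<theta> \<le> (303/550) * (L * T\<^sup>2)" unfolding \<theta>_def mult.assoc by linarith
  then show "\<theta> \<le> 1/12" using LT(1) by simp
qed

lemma l_small: "l * T\<^sup>2 \<le> K * T\<^sup>2 * exp (- 5/4 * (Rt / T)) / 10000"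
  using mult_right_mono[OF l_le, of "T\<^sup>2"] by (simp add: mult_ac)

lemma exp_five_halves_le: "exp (5/2) \<le> (13::real)"
proof -
  have "exp (5/2::real) ^ 2 = exp 1 ^ 5" by (simp flip: exp_of_nat_mult)
  also have "\<dots> \<le> (272/100) ^ 5" using e_less_272 by (intro power_mono) auto
  also have "\<dots> \<le> (13::real) ^ 2" by (simp add: power_divide)
  finally show ?thesis by (rule power2_le_imp_le) simp
qed

text \<open>At large distance only the linear part of the cost earns anything: its gain 32/100
  \<beta> K T^2 has to pay for the rate c and for the reaction of the other particles. As \<beta> is
  at least 1/13 of the exponential, the comparison is that of 32/1300 with 1/156 + 1/10000.\<close>

lemma c_\<beta>: "c + (72/121) * (l * T\<^sup>2) \<le> \<beta> * ((32/100) * (K * T\<^sup>2))"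
proof -
  define E where "E = exp (- 5/4 * (Rt / T))"
  have E: "E > 0" by (simp add: E_def)
  have "1 / 13 \<le> exp (- (5/2) :: real)"
    using exp_five_halves_le by (simp add: exp_minus inverse_eq_divide frac_le)
  then have "(1/13) * E \<le> exp (- (5/2)) * E" using E by (intro mult_right_mono) auto
  also have "\<dots> = \<beta>" unfolding \<beta> E_def exp_add[symmetric] by simp
  finally have b: "(1/13) * E * ((32/100) * (K * T\<^sup>2)) \<le> \<beta> * ((32/100) * (K * T\<^sup>2))"
    using KT by (intro mult_right_mono) auto
  have "c + (72/121) * (l * T\<^sup>2) \<le> (1/156 + 1/10000) * (K * T\<^sup>2 * E)"
  proof -
    have "k / 156 + (72/121) * t \<le> (1/156 + 1/10000) * k" if "k \<ge> 0" "t \<le> k / 10000" for k t :: real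
      using that by (simp add: field_simps)
    from this[OF _ l_small[folded E_def]] show ?thesis using KT E by (simp add: c E_def)
  qed
  also have "\<dots> \<le> (32/1300) * (K * T\<^sup>2 * E)" using KT E by (intro mult_right_mono) auto
  finally show ?thesis using b by (simp add: mult_ac)
qed

text \<open>Both copies get the same velocity. The displacement of particle i is tested against its
  initial value z$i. During the whole step it stays close to z$i and longer than R, so convexity of
  V pushes it inwards at every grid time, and the weights add up to T^2/2.\<close>

lemma far_contraction:
  fixes x y v :: "(real^'k)^'n"
  assumes off: "\<And>k. k \<noteq> i \<Longrightarrow> x$k = y$k" and far: "norm (x$i - y$i) \<ge> Rt"
  shows "particle_cost \<beta> T (q x v N) (q y v N) \<le> (1 - c) * (T * cost \<beta> (norm (x$i - y$i) / T))"
proof -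
  define z where "z = x - y"
  define r where "r = norm (z$i)"
  have r: "r \<ge> Rt" "r \<ge> 0" using far by (auto simp: r_def z_def)
  have z_off: "z$k = 0" if "k \<noteq> i" for k using off[OF that] by (simp add: z_def)
  have l1z: "l1 z = r"
  proof -
    have "l1 z = norm (z$i) + (\<Sum>k\<in>UNIV-{i}. norm (z$k))" unfolding l1_def by (simp add: sum.remove)
    also have "(\<Sum>k\<in>UNIV-{i}. norm (z$k)) = 0" by (intro sum.neutral) (auto simp: z_off)
    finally show ?thesis by (simp add: r_def)
  qed
  have lin: "l1 ((x - y) + (real j * h) *\<^sub>R (v - v)) \<le> r" for j using l1z by (simp add: z_def)
  define Z where "Z j = q x v j - q y v j" for j
  have Z1: "l1 (Z j) \<le> (12/11) * r" if "j \<le> N" for j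
    unfolding Z_def by (rule flow_diff(1)[OF lin that])
  have Z2: "norm (Z j $ i - z $ i) \<le> \<theta> * r" if "j \<le> N" for j
  proof -
    have "l1 (Z j - z) \<le> \<theta> * r" using flow_diff(2)[OF lin that] by (simp add: Z_def z_def)
    then show ?thesis using norm_component_le_l1[of "Z j - z" i] by simp
  qed
  have \<theta>r: "\<theta> * r \<le> r / 12" using \<theta>_bounds r mult_right_mono[of \<theta> "1/12" r] by simp
  \<comment> \<open>The price of testing with z$i instead of the current displacement is of order
    \<theta> L, which L^2 T^2 \<le> 9/50 K turns into about a tenth of K.\<close>
  have \<theta>L: "\<theta> * L \<le> (2727/27500) * K"
  proof -
    have "\<theta> * L \<le> (303/550) * (L * T\<^sup>2) * L" using \<theta>_bounds(3) consts_nonneg by (intro mult_right_mono) auto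
    also have "\<dots> = (303/550) * (L\<^sup>2 * T\<^sup>2)" by (simp add: power2_eq_square)
    also have "\<dots> \<le> (303/550) * ((9/50) * K)" using LT(2) by simp
    finally show ?thesis by simp
  qed
  have force: "z$i \<bullet> ((g (q x v j) - g (q y v j)) $ i) \<ge> (73/100) * K * r\<^sup>2 - (24/11) * l * r\<^sup>2" if j: "j \<le> N" for j
  proof -
    define X Y where "X = q x v j $ i" and "Y = q y v j $ i"
    have XY: "X - Y = Z j $ i" by (simp add: X_def Y_def Z_def)
    define I where "I = (1 / real CARD('n)) *\<^sub>R
      (\<Sum>m\<in>UNIV - {i}. H (q x v j$i - q x v j$m) - H (q y v j$i - q y v j$m))"
    have eq: "(g (q x v j) - g (q y v j)) $ i = (G X - G Y) + I"
      by (simp add: mf_force_def sum_subtractf algebra_simps I_def X_def Y_def)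
    have "norm (0 + I) \<le> (0 + l) * norm (Z j $ i) + l / real CARD('n) * l1 (Z j)"
      unfolding I_def
    proof (rule interaction_bound)
      show "norm (H (q x v j$i - q x v j$m) - H (q y v j$i - q y v j$m)) \<le> l * norm (Z j $ i - Z j $ m)" for m
        using H_lipschitz[of "q x v j$i - q x v j$m" "q y v j$i - q y v j$m"] by (simp add: Z_def algebra_simps)
    qed (auto simp: consts_nonneg)
    also have "\<dots> \<le> l * l1 (Z j) + l * l1 (Z j)"
    proof (intro add_mono)
      show "(0 + l) * norm (Z j $ i) \<le> l * l1 (Z j)"
        using consts_nonneg norm_component_le_l1 by (auto intro: mult_left_mono)
      have "1 \<le> real CARD('n)" by (simp add: Suc_le_eq)
      then have "l / real CARD('n) \<le> l" using consts_nonneg mult_left_mono[of 1 "real CARD('n)" l] by (simp add: divide_le_eq)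
      then show "l / real CARD('n) * l1 (Z j) \<le> l * l1 (Z j)" by (intro mult_right_mono) auto
    qed
    also have "\<dots> \<le> l * ((12/11) * r) + l * ((12/11) * r)"
      using Z1[OF j] consts_nonneg by (intro add_mono mult_left_mono) auto
    finally have I: "norm I \<le> (24/11) * l * r" by simp
    have lo: "norm (X - Y) \<ge> (11/12) * r"
      using Z2[OF j] \<theta>r norm_triangle_ineq2[of "z$i" "Z j $ i"] unfolding XY r_def
      by (simp add: norm_minus_commute)
    have hi: "norm (X - Y) \<le> (13/12) * r"
      using Z2[OF j] \<theta>r norm_triangle_ineq2[of "Z j $ i" "z$i"] unfolding XY r_def by simp
    \<comment> \<open>As r \<ge> Rt \<ge> 2 R, losing one twelfth of r keeps the particles at
      distance at least R, where convexity is available.\<close>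
    have "norm (X - Y) \<ge> R" using lo r R by linarith
    then have "(X - Y) \<bullet> (G X - G Y) \<ge> K * (norm (X - Y))\<^sup>2" by (rule convex_far)
    moreover have "K * (norm (X - Y))\<^sup>2 \<ge> K * ((11/12) * r)\<^sup>2"
      using lo r K by (intro mult_left_mono power_mono) auto
    ultimately have 1: "(X - Y) \<bullet> (G X - G Y) \<ge> K * ((11/12) * r)\<^sup>2" by linarith
    have "\<bar>(z$i - (X - Y)) \<bullet> (G X - G Y)\<bar> \<le> norm (z$i - (X - Y)) * norm (G X - G Y)"
      by (rule Cauchy_Schwarz_ineq2)
    also have "\<dots> \<le> (\<theta> * r) * (L * ((13/12) * r))"
    proof (rule mult_mono)
      show "norm (z$i - (X - Y)) \<le> \<theta> * r" using Z2[OF j] by (simp add: XY norm_minus_commute)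
      show "norm (G X - G Y) \<le> L * ((13/12) * r)"
        by (rule order_trans[OF G_lipschitz]) (intro mult_left_mono hi consts_nonneg)
    qed (use \<theta>_bounds r in auto)
    also have "\<dots> = (\<theta> * L) * ((13/12) * r\<^sup>2)" by (simp add: power2_eq_square)
    also have "\<dots> \<le> ((2727/27500) * K) * ((13/12) * r\<^sup>2)" by (intro mult_right_mono \<theta>L) auto
    finally have 2: "(z$i - (X - Y)) \<bullet> (G X - G Y) \<ge> - (((2727/27500) * K) * ((13/12) * r\<^sup>2))" by linarith
    have "\<bar>z$i \<bullet> I\<bar> \<le> r * ((24/11) * l * r)"
      by (rule order_trans[OF Cauchy_Schwarz_ineq2]) (simp only: r_def[symmetric], intro mult_left_mono I r(2))
    then have 3: "z$i \<bullet> I \<ge> - ((24/11) * l * r\<^sup>2)" by (simp add: power2_eq_square mult_ac)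
    have "z$i \<bullet> ((G X - G Y) + I) = (X - Y) \<bullet> (G X - G Y) + (z$i - (X - Y)) \<bullet> (G X - G Y) + z$i \<bullet> I"
      by (simp add: inner_diff_left inner_add_right)
    \<comment> \<open>(11/12)^2 - (2727/27500) (13/12) is about 0.7328.\<close>
    moreover have "K * ((11/12) * r)\<^sup>2 - ((2727/27500) * K) * ((13/12) * r\<^sup>2) \<ge> (73/100) * (K * r\<^sup>2)"
      using K by (simp add: power_mult_distrib power_divide)
    ultimately show ?thesis using 1 2 3 unfolding eq by linarith
  qed
  define S where "S = (73/100) * K * r\<^sup>2 - (24/11) * l * r\<^sup>2"
  have ZN: "Z N = z - h\<^sup>2 *\<^sub>R (\<Sum>m<N. vwt N m *\<^sub>R (g (q x v m) - g (q y v m)))"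
  proof -
    have "Z N = vpos (\<lambda>m _. g (q x v m) - g (q y v m)) h (x - y) (v - v) N"
      unfolding Z_def q_def by (rule vpos_diff)
    then show ?thesis by (subst (asm) vpos_volterra) (simp add: z_def)
  qed
  have "z$i \<bullet> (Z N $ i - z $ i) = - (h\<^sup>2 * (\<Sum>m<N. vwt N m * (z$i \<bullet> ((g (q x v m) - g (q y v m)) $ i))))"
    unfolding ZN by (simp add: inner_sum_right)
  also have "\<dots> \<le> - (h\<^sup>2 * (\<Sum>m<N. vwt N m * S))"
    using force unfolding S_def
    by (intro le_imp_neg_le mult_left_mono sum_mono vwt_nonneg) auto
  also have "(\<Sum>m<N. vwt N m * S) = (real N)\<^sup>2 / 2 * S" by (simp add: sum_distrib_right[symmetric] sum_vwt)
  also have "- (h\<^sup>2 * ((real N)\<^sup>2 / 2 * S)) = - (T\<^sup>2 / 2 * S)" by (simp add: T power_mult_distrib)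
  finally have zz: "2 * (z$i \<bullet> (Z N $ i - z $ i)) \<le> - (T\<^sup>2 * S)" by simp
  have KTr: "T\<^sup>2 * S \<ge> (72/100) * (K * T\<^sup>2) * r\<^sup>2"
  proof -
    have "exp (- 5/4 * (Rt / T)) \<le> 1" using Rt_nonneg T_pos by simp
    then have "K * T\<^sup>2 * exp (- 5/4 * (Rt / T)) \<le> K * T\<^sup>2 * 1" using KT by (intro mult_left_mono) auto
    then have "l * T\<^sup>2 \<le> K * T\<^sup>2 / 10000" using l_small by simp
    then have "(24/11) * (l * T\<^sup>2) \<le> (1/100) * (K * T\<^sup>2)" using KT by simp
    then have "((73/100) * (K * T\<^sup>2) - (24/11) * (l * T\<^sup>2)) * r\<^sup>2 \<ge> ((72/100) * (K * T\<^sup>2)) * r\<^sup>2"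
      by (intro mult_right_mono) auto
    then show ?thesis by (simp add: S_def algebra_simps)
  qed
  have th2: "(\<theta> * r)\<^sup>2 \<le> (6/100) * (K * T\<^sup>2) * r\<^sup>2"
  proof -
    have "\<theta>\<^sup>2 \<le> ((303/550) * (L * T\<^sup>2))\<^sup>2" using \<theta>_bounds by (intro power_mono) auto
    also have "\<dots> = (303/550)\<^sup>2 * ((L\<^sup>2 * T\<^sup>2) * T\<^sup>2)" by (simp add: power_mult_distrib power2_eq_square)
    also have "\<dots> \<le> (303/550)\<^sup>2 * (((9/50) * K) * T\<^sup>2)" using LT(2) by (intro mult_left_mono mult_right_mono) auto
    also have "\<dots> \<le> (6/100) * (K * T\<^sup>2)" using KT by (simp add: power_divide)
    finally show ?thesis unfolding power_mult_distrib by (intro mult_right_mono) auto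
  qed
  have "(norm (Z N $ i))\<^sup>2 = r\<^sup>2 + 2 * (z$i \<bullet> (Z N $ i - z $ i)) + (norm (Z N $ i - z $ i))\<^sup>2"
    unfolding r_def power2_norm_eq_inner by (simp add: inner_diff_left inner_diff_right inner_commute)
  also have "\<dots> \<le> r\<^sup>2 - (72/100) * (K * T\<^sup>2) * r\<^sup>2 + (6/100) * (K * T\<^sup>2) * r\<^sup>2"
  proof -
    have "(norm (Z N $ i - z $ i))\<^sup>2 \<le> (\<theta> * r)\<^sup>2" using Z2[of N] by (intro power_mono) auto
    then show ?thesis using zz KTr th2 by linarith
  qed
  \<comment> \<open>With \<kappa> = K T^2 the factor is 1 - 66/100 \<kappa>, which is at most (1 -
    32/100 \<kappa>)^2.\<close>
  also have "\<dots> \<le> (r * (1 - (32/100) * (K * T\<^sup>2)))\<^sup>2"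
  proof -
    define \<kappa> where "\<kappa> = K * T\<^sup>2"
    have "\<kappa> \<ge> 0" using KT by (simp add: \<kappa>_def)
    have "(r * (1 - (32/100) * \<kappa>))\<^sup>2 - (r\<^sup>2 - (72/100) * \<kappa> * r\<^sup>2 + (6/100) * \<kappa> * r\<^sup>2)
      = r\<^sup>2 * ((2/100) * \<kappa> + (32/100)\<^sup>2 * \<kappa>\<^sup>2)" by algebra
    moreover have "\<dots> \<ge> 0" using \<open>\<kappa> \<ge> 0\<close> by simp
    ultimately show ?thesis unfolding \<kappa>_def[symmetric] by linarith
  qed
  finally have ZNi: "norm (Z N $ i) \<le> r * (1 - (32/100) * (K * T\<^sup>2))"
    by (rule power2_le_imp_le) (use r KT in auto)
  have ZNr: "norm (Z N $ i) \<le> r"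
    using ZNi r KT mult_left_mono[of "1 - (32/100) * (K * T\<^sup>2)" 1 r] by simp
  have oth: "(\<Sum>k\<in>UNIV-{i}. norm (Z N $ k)) \<le> (72/121) * (l * T\<^sup>2) * r"
    unfolding Z_def by (rule flow_diff_others[OF lin]) (use z_off in \<open>auto simp: z_def\<close>)
  have "particle_cost \<beta> T (q x v N) (q y v N) \<le> T * cost \<beta> (norm (Z N $ i) / T) + (\<Sum>k\<in>UNIV-{i}. norm (Z N $ k))"
    unfolding Z_def by (rule particle_cost_single[OF \<beta>_bounds T_pos])
  \<comment> \<open>Only the linear part of the cost is credited with the decrease of the distance;
    the exponential part may be practically flat here.\<close>
  also have "T * cost \<beta> (norm (Z N $ i) / T) \<le> T * (cost \<beta> (r / T) - \<beta> * (r / T - norm (Z N $ i) / T))"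
    using \<beta>_bounds T_pos ZNr by (intro mult_left_mono cost_decrease divide_right_mono) auto
  also have "\<dots> = T * cost \<beta> (r / T) - \<beta> * (r - norm (Z N $ i))"
    using T_pos by (simp add: field_simps)
  also have "\<dots> \<le> T * cost \<beta> (r / T) - \<beta> * (r * ((32/100) * (K * T\<^sup>2)))"
  proof -
    have "r * ((32/100) * (K * T\<^sup>2)) \<le> r - norm (Z N $ i)" using ZNi by (simp add: algebra_simps)
    then show ?thesis using \<beta>_bounds by (intro diff_left_mono mult_left_mono) auto
  qed
  finally have "particle_cost \<beta> T (q x v N) (q y v N)
      \<le> T * cost \<beta> (r / T) - \<beta> * ((32/100) * (K * T\<^sup>2)) * r + (72/121) * (l * T\<^sup>2) * r"
    using oth by (simp add: mult_ac)
  also have "\<dots> \<le> T * cost \<beta> (r / T) - c * r"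
    using mult_right_mono[OF c_\<beta> r(2)] by (simp add: algebra_simps)
  also have "\<dots> \<le> T * cost \<beta> (r / T) - c * (T * cost \<beta> (r / T))"
  proof -
    have "T * cost \<beta> (r / T) \<le> T * (r / T)" using \<beta>_bounds T_pos by (intro mult_left_mono cost_le) auto
    then have "T * cost \<beta> (r / T) \<le> r" using T_pos by simp
    moreover have "c \<ge> 0" using KT by (simp add: c)
    ultimately show ?thesis by (intro diff_left_mono mult_left_mono) auto
  qed
  finally show ?thesis by (simp add: r_def z_def algebra_simps)
qed

text \<open>The velocity is coupled in the direction of x - y, which lives in particle i alone, so
  only the velocity of that particle is altered. The shift a = r/T makes the shifted free flights
  meet at time T.\<close>

lemma near_contraction:
  fixes x y :: "(real^'k)^'n" and \<phi> :: "(real^'k)^'n \<Rightarrow> real"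
  assumes off: "\<And>k. k \<noteq> i \<Longrightarrow> x$k = y$k" and near: "norm (x$i - y$i) < Rt" "x$i \<noteq> y$i"
    and [measurable]: "\<phi> \<in> borel_measurable borel" and \<phi>B: "\<And>a. \<bar>\<phi> a\<bar> \<le> B"
    and lip: "\<And>a b. \<bar>\<phi> a - \<phi> b\<bar> \<le> C * particle_cost \<beta> T a b" and C: "C > 0"
  shows "\<bar>(\<integral>v. \<phi> (q x v N) \<partial>std_gaussian) - (\<integral>v. \<phi> (q y v N) \<partial>std_gaussian)\<bar>
    \<le> C * ((1 - c) * (T * cost \<beta> (norm (x$i - y$i) / T)))"
proof -
  define z where "z = x - y"
  define r where "r = norm (z$i)"
  have r: "r < Rt" "r > 0" using near by (auto simp: r_def z_def)
  have z_off: "z$k = 0" if "k \<noteq> i" for k using off[OF that] by (simp add: z_def)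
  have l1z: "l1 z = r"
  proof -
    have "l1 z = norm (z$i) + (\<Sum>k\<in>UNIV-{i}. norm (z$k))" unfolding l1_def by (simp add: sum.remove)
    also have "(\<Sum>k\<in>UNIV-{i}. norm (z$k)) = 0" by (intro sum.neutral) (auto simp: z_off)
    finally show ?thesis by (simp add: r_def)
  qed
  have nz: "norm z = r" using norm_le_l1_vec[of z] Finite_Cartesian_Product.norm_nth_le[of z i] l1z by (simp add: r_def)
  define e where "e = (1 / r) *\<^sub>R z"
  have e: "norm e = 1" using nz r by (simp add: e_def)
  have ze: "z = r *\<^sub>R e" using r by (simp add: e_def)
  have e_off: "e$k = 0" if "k \<noteq> i" for k using z_off[OF that] by (simp add: e_def)
  have l1e: "l1 (s *\<^sub>R e) = \<bar>s\<bar>" for s using l1z r by (simp add: e_def l1_scaleR)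
  define a where "a = r / T"
  have a: "a > 0" using r T_pos by (simp add: a_def)
  have raT: "r = a * T" using T_pos by (simp add: a_def)
  define \<tau> where "\<tau> = (72/121) * (l * T\<^sup>2)"
  have as: "a \<le> Rt / T" using r T_pos by (simp add: a_def divide_right_mono)
  have exp_as: "exp (- 5/4 * (Rt / T)) \<le> exp (- 5/4 * a)" using as by simp
  have \<tau>: "0 \<le> \<tau>" "\<tau> \<le> exp (- 5/4 * a) / 10000"
  proof -
    show "0 \<le> \<tau>" using consts_nonneg by (simp add: \<tau>_def)
    have "K * T\<^sup>2 * exp (- 5/4 * (Rt / T)) \<le> 1 * exp (- 5/4 * a)" using KT exp_as by (intro mult_mono) auto
    then have "l * T\<^sup>2 \<le> exp (- 5/4 * a) / 10000" using l_small by simp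
    moreover have "\<tau> \<le> l * T\<^sup>2" using consts_nonneg unfolding \<tau>_def by simp
    ultimately show "\<tau> \<le> exp (- 5/4 * a) / 10000" by linarith
  qed
  have \<theta>a: "\<theta> * a \<le> 1/40"
  proof -
    have "\<theta> * a \<le> (303/550) * (L * T\<^sup>2) * a" using \<theta>_bounds a by (intro mult_right_mono) auto
    also have "\<dots> = (303/550) * (L * T * r)" using T_pos by (simp add: a_def power2_eq_square)
    also have "\<dots> \<le> (303/550) * (L * T * Rt)" using r consts_nonneg T_pos by (intro mult_left_mono) auto
    finally show ?thesis using LTR by simp
  qed
  have cb: "0 \<le> c" "c \<le> exp (- 5/4 * a) / 1000"
  proof -
    show "0 \<le> c" using KT by (simp add: c)
    have "c \<le> ((3/20) / 156) * exp (- 5/4 * a)" unfolding c using KT exp_as by (intro mult_mono divide_right_mono) auto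
    also have "\<dots> \<le> (1/1000) * exp (- 5/4 * a)" by (intro mult_right_mono) auto
    finally show "c \<le> exp (- 5/4 * a) / 1000" by simp
  qed
  have \<beta>a: "\<beta> \<le> exp (- 5/2 - 5/4 * a)" using as by (simp add: \<beta>)
  let ?w = "refl_weight a e"
  let ?d1 = "\<lambda>v. \<bar>\<phi> (q x v N) - \<phi> (q y (v + a *\<^sub>R e) N)\<bar>"
  let ?d2 = "\<lambda>v. \<bar>\<phi> (q x v N) - \<phi> (q y (reflect e v) N)\<bar>"
  \<comment> \<open>The coupled difference of \<phi> with the Lipschitz constant C and the length
    unit T divided out, as \<open>near_expectation\<close> expects it.\<close>
  define \<Gamma> where "\<Gamma> v = (1 / (C * T)) * (?d1 v * (1 - ?w v) + ?d2 v * ?w v)" for v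
  have CT: "C * T > 0" using C T_pos by simp
  have q_meas[measurable]: "(\<lambda>v. q x v N) \<in> borel_measurable borel" "(\<lambda>v. q y v N) \<in> borel_measurable borel"
    by (rule measurable_q)+
  have [measurable]: "(\<lambda>v. q y (v + a *\<^sub>R e) N) \<in> borel_measurable borel"
    "(\<lambda>v. q y (reflect e v) N) \<in> borel_measurable borel"
    using measurable_compose[of "\<lambda>v. v + a *\<^sub>R e" borel borel, OF _ q_meas(2)]
      measurable_compose[OF measurable_reflect q_meas(2)] by auto
  have B0: "B \<ge> 0" using \<phi>B[of 0] by simp
  have db: "\<bar>\<phi> a' - \<phi> b'\<bar> \<le> 2 * B" for a' b' using \<phi>B[of a'] \<phi>B[of b'] by linarith
  have w01: "0 \<le> ?w v" "?w v \<le> 1" for v by (rule refl_weight_bounds)+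
  have bounded_int: "integrable std_gaussian (\<lambda>v. F v * k v)"
    if [measurable]: "F \<in> borel_measurable borel" "k \<in> borel_measurable borel"
      and F: "\<And>v. \<bar>F v\<bar> \<le> 2 * B" and k: "\<And>v. \<bar>k v\<bar> \<le> 1" for F k :: "(real^'k)^'n \<Rightarrow> real"
  proof (rule integrable_std_gaussian_bounded[where B="2 * B * 1"])
    show "\<bar>F v * k v\<bar> \<le> 2 * B * 1" for v
      unfolding abs_mult using B0 by (intro mult_mono F k) auto
  qed measurable
  have w1: "\<bar>?w v\<bar> \<le> 1" "\<bar>1 - ?w v\<bar> \<le> 1" for v using w01[of v] by auto
  have [measurable]: "(\<lambda>v. \<phi> (q x v N)) \<in> borel_measurable borel"
    "(\<lambda>v. \<phi> (q y (v + a *\<^sub>R e) N)) \<in> borel_measurable borel"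
    "(\<lambda>v. \<phi> (q y (reflect e v) N)) \<in> borel_measurable borel" by measurable
  have [measurable]: "(\<lambda>v. 1 - ?w v) \<in> borel_measurable borel" by measurable
  have \<phi>2B: "\<bar>\<phi> a'\<bar> \<le> 2 * B" for a' using \<phi>B[of a'] by linarith
  have int1: "integrable std_gaussian (\<lambda>v. ?d1 v * (1 - ?w v))"
    by (rule bounded_int) (measurable, simp_all only: abs_abs db w1)
  have int2: "integrable std_gaussian (\<lambda>v. ?d2 v * ?w v)"
    by (rule bounded_int) (measurable, simp_all only: abs_abs db w1)
  have \<Gamma>_int: "integrable std_gaussian \<Gamma>" unfolding \<Gamma>_def using int1 int2 by (intro integrable_mult_right Bochner_Integration.integrable_add)
  have \<Gamma>: "(\<integral>v. \<Gamma> v \<partial>std_gaussian) \<le> (1 - c) * cost \<beta> a"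
  proof (rule near_expectation[OF e a \<theta>_bounds(1,2) \<theta>a \<beta>_bounds(1) \<beta>a cb \<tau> cost_def \<Gamma>_int])
    fix v
    define \<zeta> where "\<zeta> = v \<bullet> e"
    \<comment> \<open>Shifted branch: since a T = r the free flights coincide at time T, and only
      the deviation from free flight is left.\<close>
    have A: "?d1 v \<le> (C * T) * (\<theta> * a)"
    proof -
      have lin: "l1 ((x - y) + (real j * h) *\<^sub>R (v - (v + a *\<^sub>R e))) \<le> r" if "j \<le> N" for j
      proof -
        have "(x - y) + (real j * h) *\<^sub>R (v - (v + a *\<^sub>R e)) = (r - real j * h * a) *\<^sub>R e"
          using ze by (simp add: z_def[symmetric] algebra_simps)
        moreover have "0 \<le> real j * h * a" using h a by simp
        moreover have "real j * h * a \<le> T * a" using time_le[OF that] a by (intro mult_right_mono) auto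
        ultimately show ?thesis using l1e raT by (simp add: mult.commute)
      qed
      have "(x - y) + (real N * h) *\<^sub>R (v - (v + a *\<^sub>R e)) = 0"
        unfolding T[symmetric] z_def[symmetric] by (subst ze) (simp add: raT mult.commute)
      then have "l1 (q x v N - q y (v + a *\<^sub>R e) N) \<le> \<theta> * r"
        using flow_diff(2)[OF lin order_refl] by (metis diff_zero)
      then have "particle_cost \<beta> T (q x v N) (q y (v + a *\<^sub>R e) N) \<le> \<theta> * r"
        using particle_cost_le_l1[OF \<beta>_bounds T_pos] order_trans by blast
      then have "C * particle_cost \<beta> T (q x v N) (q y (v + a *\<^sub>R e) N) \<le> C * (\<theta> * r)"
        using C by (intro mult_left_mono) auto
      then show ?thesis using lip[of "q x v N" "q y (v + a *\<^sub>R e) N"] by (simp add: raT mult_ac)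
    qed
    define E where "E = \<theta> * (a + 2 * max 0 \<zeta>)"
    have Bn: "?d2 v \<le> (C * T) * (cost \<beta> (a + 2 * \<zeta>) + ((1 - \<beta>) * exp (- (a + 2 * \<zeta>)) + \<beta>) * E + \<tau> * (a + 2 * max 0 \<zeta>))"
      if "?w v \<noteq> 0"
    proof -
      have pos: "a + 2 * \<zeta> > 0" using refl_weight_support[OF a that] by (simp add: \<zeta>_def)
      define m where "m = T * (a + 2 * max 0 \<zeta>)"
      have vw: "v - reflect e v = (2 * \<zeta>) *\<^sub>R e" by (simp add: reflect_def \<zeta>_def)
      have seg: "(x - y) + (real j * h) *\<^sub>R (v - reflect e v) = (r + real j * h * (2 * \<zeta>)) *\<^sub>R e" for j
        unfolding vw using ze by (simp add: z_def[symmetric] algebra_simps)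
      \<comment> \<open>The separation r + 2 t \<zeta> of the free flights is monotone in t and
        nonnegative at both ends, hence bounded by its larger end value, which is m.\<close>
      have lin: "l1 ((x - y) + (real j * h) *\<^sub>R (v - reflect e v)) \<le> m" if j: "j \<le> N" for j
      proof -
        have t: "0 \<le> real j * h" "real j * h \<le> T" using h time_le[OF j] by auto
        have "\<bar>r + real j * h * (2 * \<zeta>)\<bar> \<le> m"
        proof (cases "\<zeta> \<ge> 0")
          case True
          then have "real j * h * (2 * \<zeta>) \<le> T * (2 * \<zeta>)"
            using t by (intro mult_right_mono) auto
          moreover have "0 \<le> real j * h * (2 * \<zeta>)" using h True by simp
          ultimately show ?thesis using True r by (simp add: m_def raT algebra_simps)
        next
          case False
          have "T * (2 * \<zeta>) \<le> real j * h * (2 * \<zeta>)" using t False by (intro mult_right_mono_neg) auto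
          moreover have "real j * h * (2 * \<zeta>) \<le> 0" using t False by (simp add: mult_nonneg_nonpos)
          moreover have "0 \<le> T * (a + 2 * \<zeta>)" using pos T_pos by simp
          then have "0 \<le> r + T * (2 * \<zeta>)" by (simp add: raT algebra_simps)
          moreover have "m = r" using False by (simp add: m_def raT mult.commute)
          moreover have "\<bar>r + s\<bar> \<le> r" if "s' \<le> s" "s \<le> 0" "0 \<le> r + s'" for s s' using that by linarith
          ultimately show ?thesis by metis
        qed
        then show ?thesis unfolding seg l1e .
      qed
      define Z where "Z = q x v N - q y (reflect e v) N"
      have "l1 (Z - (r + T * (2 * \<zeta>)) *\<^sub>R e) \<le> \<theta> * m"
        using flow_diff(2)[OF lin order_refl] unfolding seg Z_def T by simp
      then have d: "norm (Z $ i - ((r + T * (2 * \<zeta>)) *\<^sub>R e) $ i) \<le> \<theta> * m"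
        using norm_component_le_l1[of "Z - (r + T * (2 * \<zeta>)) *\<^sub>R e" i] by simp
      have rp: "r + T * (2 * \<zeta>) = T * (a + 2 * \<zeta>)" by (simp add: raT algebra_simps)
      have "norm (((r + T * (2 * \<zeta>)) *\<^sub>R e) $ i) \<le> l1 ((r + T * (2 * \<zeta>)) *\<^sub>R e)" by (rule norm_component_le_l1)
      also have "\<dots> = T * (a + 2 * \<zeta>)" unfolding l1e rp using pos T_pos by simp
      finally have "norm (Z $ i) \<le> T * (a + 2 * \<zeta>) + \<theta> * m"
        using d norm_triangle_ineq2[of "Z $ i" "((r + T * (2 * \<zeta>)) *\<^sub>R e) $ i"] by linarith
      then have Zi: "norm (Z $ i) / T \<le> (a + 2 * \<zeta>) + E"
        using T_pos by (simp add: m_def E_def field_simps)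
      have oth: "(\<Sum>k\<in>UNIV-{i}. norm (Z $ k)) \<le> (72/121) * (l * T\<^sup>2) * m"
        unfolding Z_def
      proof (rule flow_diff_others[OF lin])
        show "(x - y) $ k = 0" if "k \<noteq> i" for k using z_off[OF that] by (simp add: z_def)
        show "(v - reflect e v) $ k = 0" if "k \<noteq> i" for k unfolding vw using e_off[OF that] by simp
      qed
      have "particle_cost \<beta> T (q x v N) (q y (reflect e v) N) \<le> T * cost \<beta> (norm (Z $ i) / T) + (\<Sum>k\<in>UNIV-{i}. norm (Z $ k))"
        unfolding Z_def by (rule particle_cost_single[OF \<beta>_bounds T_pos])
      also have "\<dots> \<le> T * (cost \<beta> (a + 2 * \<zeta>) + ((1 - \<beta>) * exp (- (a + 2 * \<zeta>)) + \<beta>) * E) + \<tau> * m"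
      proof (intro add_mono mult_left_mono)
        show "cost \<beta> (norm (Z $ i) / T) \<le> cost \<beta> (a + 2 * \<zeta>) + ((1 - \<beta>) * exp (- (a + 2 * \<zeta>)) + \<beta>) * E"
          using cost_mono[OF \<beta>_bounds Zi] cost_tangent[OF \<beta>_bounds, of "a + 2 * \<zeta>" E] by linarith
      qed (use oth T_pos in \<open>auto simp: \<tau>_def\<close>)
      also have "\<dots> = T * (cost \<beta> (a + 2 * \<zeta>) + ((1 - \<beta>) * exp (- (a + 2 * \<zeta>)) + \<beta>) * E + \<tau> * (a + 2 * max 0 \<zeta>))"
        by (simp add: m_def algebra_simps)
      finally have "C * particle_cost \<beta> T (q x v N) (q y (reflect e v) N) \<le> C * \<dots>"
        using C by (intro mult_left_mono) auto
      then show ?thesis using lip[of "q x v N" "q y (reflect e v) N"] by (simp only: mult.assoc)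
    qed
    let ?rhs = "cost \<beta> (a + 2 * \<zeta>) + ((1 - \<beta>) * exp (- (a + 2 * \<zeta>)) + \<beta>) * E + \<tau> * (a + 2 * max 0 \<zeta>)"
    have "?d1 v * (1 - ?w v) + ?d2 v * ?w v \<le> (C * T) * (\<theta> * a) * (1 - ?w v) + (C * T) * ?rhs * ?w v"
    proof (intro add_mono)
      show "?d1 v * (1 - ?w v) \<le> (C * T) * (\<theta> * a) * (1 - ?w v)" using A w01 by (intro mult_right_mono) auto
      show "?d2 v * ?w v \<le> (C * T) * ?rhs * ?w v"
        using Bn w01 by (cases "?w v = 0") (auto intro: mult_right_mono)
    qed
    also have "\<dots> = (C * T) * ((1 - ?w v) * (\<theta> * a) + ?w v * ?rhs)" by (simp add: algebra_simps)
    finally have "\<Gamma> v \<le> (1 / (C * T)) * ((C * T) * ((1 - ?w v) * (\<theta> * a) + ?w v * ?rhs))"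
      unfolding \<Gamma>_def using CT by (intro mult_left_mono) auto
    also have "\<dots> = (1 - ?w v) * (\<theta> * a) + ?w v * ?rhs" using C T_pos by simp
    finally show "\<Gamma> v \<le> (1 - ?w v) * (\<theta> * a) + ?w v * (cost \<beta> (a + 2 * (v \<bullet> e))
        + ((1 - \<beta>) * exp (- (a + 2 * (v \<bullet> e))) + \<beta>) * (\<theta> * (a + 2 * max 0 (v \<bullet> e))) + \<tau> * (a + 2 * max 0 (v \<bullet> e)))"
      by (simp only: \<zeta>_def E_def)
  qed
  have ix: "integrable std_gaussian (\<lambda>v. \<phi> (q x v N) * (1 - ?w v))" "integrable std_gaussian (\<lambda>v. \<phi> (q x v N) * ?w v)"
    "integrable std_gaussian (\<lambda>v. \<phi> (q y (v + a *\<^sub>R e) N) * (1 - ?w v))" "integrable std_gaussian (\<lambda>v. \<phi> (q y (reflect e v) N) * ?w v)"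
    by (rule bounded_int[OF _ _ \<phi>2B w1(1)] bounded_int[OF _ _ \<phi>2B w1(2)]; measurable)+
  \<comment> \<open>The coupling formula rewrites only the second copy; the first is split with the
    same two weights, so that the integrands can be paired.\<close>
  have "(\<integral>v. \<phi> (q y v N) \<partial>std_gaussian) = (\<integral>v. \<phi> (q y (v + a *\<^sub>R e) N) * (1 - ?w v) \<partial>std_gaussian)
      + (\<integral>v. \<phi> (q y (reflect e v) N) * ?w v \<partial>std_gaussian)"
    by (rule reflection_coupling[OF e, where C=B and c=0]) (use \<phi>B in auto)
  moreover have "(\<integral>v. \<phi> (q x v N) \<partial>std_gaussian) = (\<integral>v. \<phi> (q x v N) * (1 - ?w v) + \<phi> (q x v N) * ?w v \<partial>std_gaussian)"
    by (intro Bochner_Integration.integral_cong refl) (simp add: algebra_simps)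
  ultimately have "(\<integral>v. \<phi> (q x v N) \<partial>std_gaussian) - (\<integral>v. \<phi> (q y v N) \<partial>std_gaussian)
      = (\<integral>v. (\<phi> (q x v N) * (1 - ?w v) - \<phi> (q y (v + a *\<^sub>R e) N) * (1 - ?w v))
          + (\<phi> (q x v N) * ?w v - \<phi> (q y (reflect e v) N) * ?w v) \<partial>std_gaussian)"
    using ix by simp
  also have "\<bar>\<dots>\<bar> \<le> (\<integral>v. (C * T) * \<Gamma> v \<partial>std_gaussian)"
  proof (rule order_trans[OF integral_abs_bound], rule integral_mono)
    show "integrable std_gaussian (\<lambda>v. \<bar>(\<phi> (q x v N) * (1 - ?w v) - \<phi> (q y (v + a *\<^sub>R e) N) * (1 - ?w v))
          + (\<phi> (q x v N) * ?w v - \<phi> (q y (reflect e v) N) * ?w v)\<bar>)"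
      using ix by (intro integrable_abs Bochner_Integration.integrable_add Bochner_Integration.integrable_diff)
    show "integrable std_gaussian (\<lambda>v. (C * T) * \<Gamma> v)" using \<Gamma>_int by simp
    fix v
    have "\<bar>(\<phi> (q x v N) * (1 - ?w v) - \<phi> (q y (v + a *\<^sub>R e) N) * (1 - ?w v))
          + (\<phi> (q x v N) * ?w v - \<phi> (q y (reflect e v) N) * ?w v)\<bar>
        \<le> \<bar>(\<phi> (q x v N) - \<phi> (q y (v + a *\<^sub>R e) N)) * (1 - ?w v)\<bar> + \<bar>(\<phi> (q x v N) - \<phi> (q y (reflect e v) N)) * ?w v\<bar>"
      by (simp only: left_diff_distrib abs_triangle_ineq)
    also have "\<dots> = ?d1 v * (1 - ?w v) + ?d2 v * ?w v" using w01 by (simp add: abs_mult)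
    also have "\<dots> = (C * T) * \<Gamma> v" using C T_pos by (simp add: \<Gamma>_def)
    finally show "\<bar>(\<phi> (q x v N) * (1 - ?w v) - \<phi> (q y (v + a *\<^sub>R e) N) * (1 - ?w v))
          + (\<phi> (q x v N) * ?w v - \<phi> (q y (reflect e v) N) * ?w v)\<bar> \<le> (C * T) * \<Gamma> v" .
  qed
  also have "\<dots> = (C * T) * (\<integral>v. \<Gamma> v \<partial>std_gaussian)" by simp
  also have "\<dots> \<le> (C * T) * ((1 - c) * cost \<beta> a)" using \<Gamma> CT by (intro mult_left_mono) auto
  also have "\<dots> = C * ((1 - c) * (T * cost \<beta> (norm (x$i - y$i) / T)))"
    by (simp add: a_def r_def z_def)
  finally show ?thesis .
qed

theorem contraction:
  fixes x y :: "(real^'k)^'n" and \<phi> :: "(real^'k)^'n \<Rightarrow> real"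
  assumes [measurable]: "\<phi> \<in> borel_measurable borel" and \<phi>B: "\<And>a. \<bar>\<phi> a\<bar> \<le> B"
    and lip: "\<And>a b. \<bar>\<phi> a - \<phi> b\<bar> \<le> C * particle_cost \<beta> T a b" and C: "C > 0"
  shows "\<bar>(\<integral>v. \<phi> (q x v N) \<partial>std_gaussian) - (\<integral>v. \<phi> (q y v N) \<partial>std_gaussian)\<bar>
    \<le> (C * (1 - c)) * particle_cost \<beta> T x y"
proof (rule lipschitz_by_particles)
  fix x y :: "(real^'k)^'n" and i assume off: "\<And>k. k \<noteq> i \<Longrightarrow> x$k = y$k"
  have int: "integrable std_gaussian (\<lambda>v. \<phi> (q x v N))" for x
    using measurable_q[of x] by (intro integrable_std_gaussian_bounded[where B=B]) (auto simp: \<phi>B)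
  \<comment> \<open>The near case divides by the distance, so coinciding positions form a case of
    their own.\<close>
  consider "norm (x$i - y$i) \<ge> Rt" | "x$i = y$i" | "norm (x$i - y$i) < Rt" "x$i \<noteq> y$i" by linarith
  then show "\<bar>(\<integral>v. \<phi> (q x v N) \<partial>std_gaussian) - (\<integral>v. \<phi> (q y v N) \<partial>std_gaussian)\<bar>
    \<le> (C * (1 - c)) * (T * cost \<beta> (norm (x$i - y$i) / T))"
  proof cases
    case 1
    have "\<bar>(\<integral>v. \<phi> (q x v N) \<partial>std_gaussian) - (\<integral>v. \<phi> (q y v N) \<partial>std_gaussian)\<bar>
        = \<bar>\<integral>v. \<phi> (q x v N) - \<phi> (q y v N) \<partial>std_gaussian\<bar>" using int by simp
    also have "\<dots> \<le> (\<integral>(v::(real^'k)^'n). (C * (1 - c)) * (T * cost \<beta> (norm (x$i - y$i) / T)) \<partial>std_gaussian)"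
    proof (rule order_trans[OF integral_abs_bound], rule integral_mono)
      fix v
      have "\<bar>\<phi> (q x v N) - \<phi> (q y v N)\<bar> \<le> C * particle_cost \<beta> T (q x v N) (q y v N)" by (rule lip)
      also have "\<dots> \<le> C * ((1 - c) * (T * cost \<beta> (norm (x$i - y$i) / T)))"
        using C far_contraction[OF off 1] by (intro mult_left_mono) auto
      finally show "\<bar>\<phi> (q x v N) - \<phi> (q y v N)\<bar> \<le> (C * (1 - c)) * (T * cost \<beta> (norm (x$i - y$i) / T))"
        by (simp only: mult.assoc)
    qed (use int in auto)
    finally show ?thesis by simp
  next
    case 2
    then have "x = y" using off by (metis vec_eq_iff)
    then show ?thesis by (simp add: cost_def)
  next
    case 3
    show ?thesis unfolding mult.assoc by (rule near_contraction[OF off 3 assms(1) \<phi>B lip C])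
  qed
qed

end

section \<open>Gradients of the mean-field potential\<close>

text \<open>Identifies functionals with vectors through the inner product. The map is linear of norm
  at most 1, so derivatives of the gradient inherit the operator norm bounds on derivatives of the
  potential.\<close>

definition riesz :: "('a::euclidean_space \<Rightarrow>\<^sub>L real) \<Rightarrow> 'a"
  where "riesz A = (\<Sum>b\<in>Basis. A b *\<^sub>R b)"

lemma riesz_inner: "w \<bullet> riesz A = A w"
proof -
  have "A w = A (\<Sum>b\<in>Basis. (w \<bullet> b) *\<^sub>R b)" by (simp add: euclidean_representation)
  also have "\<dots> = (\<Sum>b\<in>Basis. (w \<bullet> b) * A b)" by (simp only: blinfun.sum_right blinfun.scaleR_right) simp
  finally show ?thesis by (simp add: riesz_def inner_sum_right mult.commute)
qed

lemma norm_riesz_le: "norm (riesz A) \<le> norm A"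
proof -
  have "(norm (riesz A))\<^sup>2 = A (riesz A)" by (simp add: power2_norm_eq_inner riesz_inner)
  also have "\<dots> \<le> norm A * norm (riesz A)" using norm_blinfun[of A "riesz A"] by simp
  finally have "norm (riesz A) * norm (riesz A) \<le> norm A * norm (riesz A)" by (simp add: power2_eq_square)
  then show ?thesis by (cases "riesz A = 0") (auto simp: mult_le_cancel_right)
qed

lemma bounded_linear_riesz: "bounded_linear riesz"
  by (rule bounded_linear_intro[where K=1])
    (auto simp: riesz_def blinfun.add_left blinfun.scaleR_left scaleR_left_distrib sum.distrib scaleR_sum_right
      norm_riesz_le[unfolded riesz_def])

definition riesz_bl :: "('a::euclidean_space \<Rightarrow>\<^sub>L real) \<Rightarrow>\<^sub>L 'a"
  where "riesz_bl = Blinfun riesz"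

lemma riesz_bl_apply[simp]: "blinfun_apply riesz_bl A = riesz A"
  by (simp add: riesz_bl_def bounded_linear_Blinfun_apply bounded_linear_riesz)

lemma norm_riesz_bl: "norm (riesz_bl :: ('a::euclidean_space \<Rightarrow>\<^sub>L real) \<Rightarrow>\<^sub>L 'a) \<le> 1"
  by (rule norm_blinfun_bound) (auto simp: norm_riesz_le)

text \<open>The same identification one order up. As a bounded operator on nested linear maps it
  allows the Hessian to be differentiated by the chain rule.\<close>

definition riesz_comp :: "('a::euclidean_space \<Rightarrow>\<^sub>L 'a \<Rightarrow>\<^sub>L real) \<Rightarrow>\<^sub>L ('a \<Rightarrow>\<^sub>L 'a)"
  where "riesz_comp = Blinfun (\<lambda>A. riesz_bl o\<^sub>L A)"

lemma riesz_comp_apply[simp]: "blinfun_apply riesz_comp A = riesz_bl o\<^sub>L A"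
  unfolding riesz_comp_def
  by (subst bounded_linear_Blinfun_apply)
    (auto intro: bounded_bilinear.bounded_linear_right bounded_bilinear_blinfun_compose)

lemma norm_riesz_bl_compose:
  fixes A :: "'b::real_normed_vector \<Rightarrow>\<^sub>L 'a::euclidean_space \<Rightarrow>\<^sub>L real"
  shows "norm (riesz_bl o\<^sub>L A) \<le> norm A"
  using norm_blinfun_compose[of riesz_bl A] mult_right_mono[OF norm_riesz_bl[where 'a='a], of "norm A"] by simp

lemma norm_riesz_comp: "norm (riesz_comp :: ('a::euclidean_space \<Rightarrow>\<^sub>L 'a \<Rightarrow>\<^sub>L real) \<Rightarrow>\<^sub>L ('a \<Rightarrow>\<^sub>L 'a)) \<le> 1"
  by (rule norm_blinfun_bound) (auto simp: norm_riesz_bl_compose)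

lemma Dbl_has_derivative:
  assumes "f differentiable at x" shows "(f has_derivative blinfun_apply (Dbl f x)) (at x)"
proof -
  have f: "(f has_derivative frechet_derivative f (at x)) (at x)"
    using assms by (simp add: frechet_derivative_works)
  then show ?thesis
    unfolding Dbl_def by (simp add: bounded_linear_Blinfun_apply[OF has_derivative_bounded_linear[OF f]])
qed

lemma grad_eqI:
  assumes "(f has_derivative (\<lambda>w. w \<bullet> D)) (at x)" shows "grad f x = D"
proof -
  have uniq: "D' = D" if "GDERIV f x :> D'" for D'
  proof -
    have "(\<lambda>w. w \<bullet> D') = (\<lambda>w. w \<bullet> D)"
      using that assms by (intro has_derivative_unique) (simp_all add: gderiv_def)
    then have "(D' - D) \<bullet> (D' - D) = 0" by (metis inner_diff_right diff_self)
    then show ?thesis by simp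
  qed
  have "GDERIV f x :> D" using assms by (simp add: gderiv_def)
  then show ?thesis unfolding grad_def using uniq by (rule the_equality)
qed

definition hess :: "('a::euclidean_space \<Rightarrow> real) \<Rightarrow> 'a \<Rightarrow> 'a \<Rightarrow>\<^sub>L 'a"
  where "hess f x = riesz_bl o\<^sub>L Dbl (Dbl f) x"

definition hess' :: "('a::euclidean_space \<Rightarrow> real) \<Rightarrow> 'a \<Rightarrow> 'a \<Rightarrow>\<^sub>L 'a \<Rightarrow>\<^sub>L 'a"
  where "hess' f x = riesz_comp o\<^sub>L Dbl (Dbl (Dbl f)) x"

lemma C3_grad:
  fixes f :: "'a::euclidean_space \<Rightarrow> real"
  assumes "C3 f"
  shows "(f has_derivative (\<lambda>w. w \<bullet> grad f x)) (at x)"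
    and "(grad f has_derivative blinfun_apply (hess f x)) (at x)"
    and "(hess f has_derivative blinfun_apply (hess' f x)) (at x)"
    and "continuous_on UNIV (hess' f)"
    and "norm (hess f x) \<le> norm (Dbl (Dbl f) x)" "norm (hess' f x) \<le> norm (Dbl (Dbl (Dbl f)) x)"
proof -
  have d1: "(f has_derivative blinfun_apply (Dbl f x)) (at x)" for x using assms by (intro Dbl_has_derivative) (auto simp: C3_def)
  have d2: "(Dbl f has_derivative blinfun_apply (Dbl (Dbl f) x)) (at x)" for x using assms by (intro Dbl_has_derivative) (auto simp: C3_def)
  have d3: "(Dbl (Dbl f) has_derivative blinfun_apply (Dbl (Dbl (Dbl f)) x)) (at x)" for x
    using assms by (intro Dbl_has_derivative) (auto simp: C3_def)
  have g: "grad f x = riesz (Dbl f x)" for x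
    by (rule grad_eqI) (use d1[of x] in \<open>simp add: riesz_inner\<close>)
  show "(f has_derivative (\<lambda>w. w \<bullet> grad f x)) (at x)" unfolding g riesz_inner using d1 by simp
  have "((\<lambda>x. riesz (Dbl f x)) has_derivative (\<lambda>w. riesz (Dbl (Dbl f) x w))) (at x)"
    by (rule bounded_linear.has_derivative[OF bounded_linear_riesz d2])
  then show "(grad f has_derivative blinfun_apply (hess f x)) (at x)"
    unfolding g[abs_def] by (rule has_derivative_eq_rhs) (simp add: hess_def fun_eq_iff)
  have "((\<lambda>x. riesz_comp (Dbl (Dbl f) x)) has_derivative (\<lambda>w. riesz_comp (Dbl (Dbl (Dbl f)) x w))) (at x)"
    by (rule bounded_linear.has_derivative[OF blinfun.bounded_linear_right d3])
  then show "(hess f has_derivative blinfun_apply (hess' f x)) (at x)"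
    unfolding hess_def[abs_def] riesz_comp_apply
    by (rule has_derivative_eq_rhs) (simp add: hess'_def fun_eq_iff)
  show "continuous_on UNIV (hess' f)"
    unfolding hess'_def[abs_def] using assms
    by (intro bounded_bilinear.continuous_on[OF bounded_bilinear_blinfun_compose] continuous_on_const) (auto simp: C3_def)
  show "norm (hess f x) \<le> norm (Dbl (Dbl f) x)" unfolding hess_def by (rule norm_riesz_bl_compose)
  have "norm (riesz_comp o\<^sub>L Dbl (Dbl (Dbl f)) x) \<le> 1 * norm (Dbl (Dbl (Dbl f)) x)"
    by (rule order_trans[OF norm_blinfun_compose]) (intro mult_right_mono norm_riesz_comp norm_ge_zero)
  then show "norm (hess' f x) \<le> norm (Dbl (Dbl (Dbl f)) x)" by (simp add: hess'_def)
qed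

text \<open>The gradient in particle i acts both on W (x^i - x^l) and on W (x^l - x^i). As W is not
  assumed even, the two contributions are kept separately; their combination is an odd pair
  force.\<close>

definition odd_force :: "real \<Rightarrow> (real^'k \<Rightarrow> real) \<Rightarrow> real^'k \<Rightarrow> real^'k"
  where "odd_force \<epsilon> W a = \<epsilon> *\<^sub>R (grad W a - grad W (- a))"

text \<open>Differentiating through the reflection a to - a flips one sign per order, so the pair
  force is odd, its derivative even and its second derivative odd. The two terms are responsible for
  the factor 2 in both bounds.\<close>

lemma mean_field_of_C3:
  fixes V W :: "real^'k \<Rightarrow> real"
  assumes eps: "\<epsilon> \<ge> 0" and V: "C3 V" and W: "C3 W"
    and b: "\<And>a. norm (Dbl (Dbl V) a) \<le> L" "\<And>a. norm (Dbl (Dbl W) a) \<le> Lt"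
      "\<And>a. norm (Dbl (Dbl (Dbl V)) a) \<le> LH" "\<And>a. norm (Dbl (Dbl (Dbl W)) a) \<le> LHt"
  shows "mean_field (grad V) (odd_force \<epsilon> W) (hess V) (\<lambda>a. \<epsilon> *\<^sub>R (hess W a + hess W (- a)))
    (hess' V) (\<lambda>a. \<epsilon> *\<^sub>R (hess' W a - hess' W (- a))) L (2 * \<epsilon> * Lt) LH (2 * \<epsilon> * LHt)"
proof
  fix a :: "real^'k"
  show "(grad V has_derivative blinfun_apply (hess V a)) (at a)" "(hess V has_derivative blinfun_apply (hess' V a)) (at a)"
    "continuous_on UNIV (hess' V)" by (rule C3_grad[OF V])+
  show "norm (hess V a) \<le> L" "norm (hess' V a) \<le> LH"
    using C3_grad(5,6)[OF V, of a] b(1,3)[of a] by auto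
  have m: "(uminus has_derivative uminus) (at a)"
    using has_derivative_minus[OF has_derivative_ident] by simp
  have "((\<lambda>a. grad W (- a)) has_derivative (\<lambda>w. hess W (- a) (- w))) (at a)"
    using diff_chain_at[OF m C3_grad(2)[OF W]] by (simp add: o_def)
  then have "((\<lambda>a. \<epsilon> *\<^sub>R (grad W a - grad W (- a))) has_derivative (\<lambda>w. \<epsilon> *\<^sub>R (hess W a w - hess W (- a) (- w)))) (at a)"
    by (intro has_derivative_scaleR_right has_derivative_diff C3_grad(2)[OF W])
  then show "(odd_force \<epsilon> W has_derivative blinfun_apply (\<epsilon> *\<^sub>R (hess W a + hess W (- a)))) (at a)"
    unfolding odd_force_def[abs_def]
    by (rule has_derivative_eq_rhs) (simp add: fun_eq_iff blinfun.add_left blinfun.scaleR_left blinfun.minus_right)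
  have "((\<lambda>a. hess W (- a)) has_derivative (\<lambda>w. hess' W (- a) (- w))) (at a)"
    using diff_chain_at[OF m C3_grad(3)[OF W]] by (simp add: o_def)
  then have "((\<lambda>a. \<epsilon> *\<^sub>R (hess W a + hess W (- a))) has_derivative (\<lambda>w. \<epsilon> *\<^sub>R (hess' W a w + hess' W (- a) (- w)))) (at a)"
    by (intro has_derivative_scaleR_right has_derivative_add C3_grad(3)[OF W])
  then show "((\<lambda>a. \<epsilon> *\<^sub>R (hess W a + hess W (- a))) has_derivative blinfun_apply (\<epsilon> *\<^sub>R (hess' W a - hess' W (- a)))) (at a)"
    by (rule has_derivative_eq_rhs) (simp add: fun_eq_iff blinfun.diff_left blinfun.scaleR_left blinfun.minus_right)
  show "continuous_on UNIV (\<lambda>a. \<epsilon> *\<^sub>R (hess' W a - hess' W (- a)))"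
    by (intro continuous_intros continuous_on_compose2[OF C3_grad(4)[OF W]]) auto
  have "norm (hess W a + hess W (- a)) \<le> Lt + Lt"
    using C3_grad(5)[OF W, of a] C3_grad(5)[OF W, of "-a"] b(2)[of a] b(2)[of "- a"]
      norm_triangle_ineq[of "hess W a" "hess W (- a)"] by linarith
  then show "norm (\<epsilon> *\<^sub>R (hess W a + hess W (- a))) \<le> 2 * \<epsilon> * Lt"
    using eps mult_left_mono[of _ "Lt + Lt" \<epsilon>] by fastforce
  have "norm (hess' W a - hess' W (- a)) \<le> LHt + LHt"
    using C3_grad(6)[OF W, of a] C3_grad(6)[OF W, of "-a"] b(4)[of a] b(4)[of "- a"]
      norm_triangle_ineq4[of "hess' W a" "hess' W (- a)"] by linarith
  then show "norm (\<epsilon> *\<^sub>R (hess' W a - hess' W (- a))) \<le> 2 * \<epsilon> * LHt"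
    using eps mult_left_mono[of _ "LHt + LHt" \<epsilon>] by fastforce
qed

lemma grad_mean_field_potential:
  fixes V W :: "real^'k \<Rightarrow> real"
  assumes V: "C3 V" and W: "C3 W"
  shows "grad (mean_field_potential \<epsilon> V W :: (real^'k)^'n \<Rightarrow> real) = mf_force (grad V) (odd_force \<epsilon> W)"
proof
  fix x :: "(real^'k)^'n"
  let ?n = "real CARD('n)"
  let ?w = "\<lambda>i m. grad W (x$i - x$m)"
  have comp: "((\<lambda>x. f (A x)) has_derivative (\<lambda>w. A w \<bullet> grad f (A x))) (at x)"
    if f: "C3 f" and A: "bounded_linear A" for f :: "real^'k \<Rightarrow> real" and A :: "(real^'k)^'n \<Rightarrow> real^'k"
    using diff_chain_at[OF bounded_linear_imp_has_derivative[OF A] C3_grad(1)[OF f]] by (simp add: o_def)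
  have nth: "bounded_linear (\<lambda>x::(real^'k)^'n. x $ i)" for i by (rule bounded_linear_vec_nth)
  have nthd: "bounded_linear (\<lambda>x::(real^'k)^'n. x $ i - x $ m)" for i m
    by (intro bounded_linear_sub nth)
  have "((\<lambda>x. \<Sum>i\<in>UNIV. V (x$i) + \<epsilon> / ?n * (\<Sum>m\<in>UNIV - {i}. W (x$i - x$m))) has_derivative
     (\<lambda>w. \<Sum>i\<in>UNIV. w$i \<bullet> grad V (x$i) + \<epsilon> / ?n * (\<Sum>m\<in>UNIV - {i}. (w$i - w$m) \<bullet> ?w i m))) (at x)"
    by (intro has_derivative_sum has_derivative_add has_derivative_mult_right comp V W nth nthd)
  moreover have "(\<Sum>i\<in>UNIV. w$i \<bullet> grad V (x$i) + \<epsilon> / ?n * (\<Sum>m\<in>UNIV - {i}. (w$i - w$m) \<bullet> ?w i m))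
      = w \<bullet> mf_force (grad V) (odd_force \<epsilon> W) x" for w :: "(real^'k)^'n"
  proof -
    \<comment> \<open>Renaming the members of a pair moves the test vector from the second particle
      to the first and so collects everything that acts on particle i.\<close>
    have "(\<Sum>i\<in>UNIV. \<Sum>m\<in>UNIV - {i}. w$m \<bullet> ?w i m) = (\<Sum>i\<in>UNIV. \<Sum>m\<in>UNIV. if m = i then 0 else w$m \<bullet> ?w i m)"
      by (intro sum.cong refl sum.mono_neutral_cong_left) auto
    also have "\<dots> = (\<Sum>m\<in>UNIV. \<Sum>i\<in>UNIV. if m = i then 0 else w$m \<bullet> ?w i m)" by (rule sum.swap)
    also have "\<dots> = (\<Sum>i\<in>UNIV. \<Sum>m\<in>UNIV - {i}. w$i \<bullet> ?w m i)"
      by (intro sum.cong refl sum.mono_neutral_cong_right) auto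
    finally have sw: "(\<Sum>i\<in>UNIV. \<Sum>m\<in>UNIV - {i}. w$m \<bullet> ?w i m) = (\<Sum>i\<in>UNIV. \<Sum>m\<in>UNIV - {i}. w$i \<bullet> ?w m i)" .
    have "(\<Sum>i\<in>UNIV. w$i \<bullet> grad V (x$i) + \<epsilon> / ?n * (\<Sum>m\<in>UNIV - {i}. (w$i - w$m) \<bullet> ?w i m))
        = (\<Sum>i\<in>UNIV. w$i \<bullet> grad V (x$i)) + \<epsilon> / ?n * ((\<Sum>i\<in>UNIV. \<Sum>m\<in>UNIV - {i}. w$i \<bullet> ?w i m)
          - (\<Sum>i\<in>UNIV. \<Sum>m\<in>UNIV - {i}. w$m \<bullet> ?w i m))"
      by (simp only: sum.distrib sum_distrib_left[symmetric] sum_subtractf inner_diff_left)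
    also have "\<dots> = (\<Sum>i\<in>UNIV. w$i \<bullet> grad V (x$i) + \<epsilon> / ?n * (\<Sum>m\<in>UNIV - {i}. w$i \<bullet> (?w i m - ?w m i)))"
      unfolding sw by (simp only: sum.distrib sum_distrib_left[symmetric] sum_subtractf inner_diff_right)
    also have "\<dots> = w \<bullet> mf_force (grad V) (odd_force \<epsilon> W) x"
      unfolding inner_vec_def[of w]
    proof (intro sum.cong refl)
      fix i
      have "w$i \<bullet> (mf_force (grad V) (odd_force \<epsilon> W) x $ i)
        = w$i \<bullet> grad V (x$i) + (1 / ?n) * (\<Sum>m\<in>UNIV - {i}. \<epsilon> * (w$i \<bullet> (?w i m - ?w m i)))"
        unfolding mf_force_def odd_force_def vec_lambda_beta inner_add_right inner_scaleR_right inner_sum_right minus_diff_eq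
        by (rule refl)
      then show "w$i \<bullet> grad V (x$i) + \<epsilon> / ?n * (\<Sum>m\<in>UNIV - {i}. w$i \<bullet> (?w i m - ?w m i))
        = w$i \<bullet> (mf_force (grad V) (odd_force \<epsilon> W) x $ i)"
        by (simp only: sum_distrib_left[symmetric]) simp
    qed
    finally show ?thesis .
  qed
  ultimately show "grad (mean_field_potential \<epsilon> V W) x = mf_force (grad V) (odd_force \<epsilon> W) x"
    by (intro grad_eqI) (simp add: mean_field_potential_def[abs_def])
qed

section \<open>From Lipschitz contraction to mixing times\<close>

text \<open>A kernel driven by one Gaussian; joint continuity in position and velocity supplies all
  measurability that the iteration needs.\<close>

locale gaussian_kernel =
  fixes Q :: "'a::euclidean_space \<Rightarrow> 'a \<Rightarrow> 'a"
  assumes Q_cont: "continuous_on UNIV (\<lambda>p. Q (fst p) (snd p))"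
begin

definition ker :: "'a \<Rightarrow> 'a measure"
  where "ker x = distr std_gaussian borel (Q x)"

definition avg :: "('a \<Rightarrow> real) \<Rightarrow> 'a \<Rightarrow> real"
  where "avg \<phi> x = (\<integral>v. \<phi> (Q x v) \<partial>std_gaussian)"

lemma Q_measurable[measurable]: "(\<lambda>p. Q (fst p) (snd p)) \<in> borel_measurable (borel \<Otimes>\<^sub>M borel)"
  using borel_measurable_continuous_onI[OF Q_cont] by (simp add: borel_prod)

lemma Q_measurable2[measurable]: "Q x \<in> borel_measurable borel"
  using measurable_compose[OF measurable_Pair1'[of x borel borel] Q_measurable] by simp

lemma ker_measurable[measurable]: "ker \<in> measurable borel (subprob_algebra borel)"
  unfolding ker_def
proof (rule measurable_distr2)
  show "case_prod Q \<in> borel \<Otimes>\<^sub>M borel \<rightarrow>\<^sub>M borel" using Q_measurable by (simp add: split_def)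
  show "(\<lambda>x::'a. std_gaussian :: 'a measure) \<in> borel \<rightarrow>\<^sub>M subprob_algebra borel"
    by (intro measurable_const) (auto simp: space_subprob_algebra intro: std_gaussian.subprob_space_axioms)
qed

lemma kernel_power_measurable[measurable]: "kernel_power ker m \<in> measurable borel (subprob_algebra borel)"
  by (induction m) (auto intro: measurable_bind2 ker_measurable)

lemma avg_measurable[measurable]:
  assumes [measurable]: "\<phi> \<in> borel_measurable borel" shows "avg \<phi> \<in> borel_measurable borel"
proof -
  have "(\<lambda>p. \<phi> (Q (fst p) (snd p))) \<in> borel_measurable (borel \<Otimes>\<^sub>M std_gaussian)"
    using measurable_compose[OF Q_measurable assms] by (simp cong: measurable_cong_sets sets_pair_measure_cong)
  then have "(\<lambda>(x, v). \<phi> (Q x v)) \<in> borel_measurable (borel \<Otimes>\<^sub>M std_gaussian)" by (simp add: split_def)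
  then show ?thesis unfolding avg_def by (rule std_gaussian.borel_measurable_lebesgue_integral)
qed

lemma avg_bounds:
  assumes [measurable]: "\<phi> \<in> borel_measurable borel" and \<phi>: "\<And>x. 0 \<le> \<phi> x \<and> \<phi> x \<le> 1"
  shows "0 \<le> avg \<phi> x \<and> avg \<phi> x \<le> 1"
proof -
  have "integrable std_gaussian (\<lambda>v. \<phi> (Q x v))"
    by (rule integrable_std_gaussian_bounded[where B=1]) (use \<phi> in auto)
  then have "avg \<phi> x \<le> (\<integral>(v::'a). 1 \<partial>std_gaussian)"
    unfolding avg_def using \<phi> by (intro integral_mono) auto
  moreover have "0 \<le> avg \<phi> x" unfolding avg_def using \<phi> by (intro Bochner_Integration.integral_nonneg) auto
  ultimately show ?thesis by simp
qed

lemma nn_integral_bind_ker: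
  assumes [measurable]: "\<phi> \<in> borel_measurable borel" and \<phi>: "\<And>x. 0 \<le> \<phi> x \<and> \<phi> x \<le> 1"
    and \<nu>: "sets \<nu> = sets borel"
  shows "(\<integral>\<^sup>+x. ennreal (\<phi> x) \<partial>(\<nu> \<bind> ker)) = (\<integral>\<^sup>+x. ennreal (avg \<phi> x) \<partial>\<nu>)"
proof -
  have "ker \<in> measurable \<nu> (subprob_algebra borel)" using ker_measurable \<nu> by (simp cong: measurable_cong_sets)
  then have "(\<integral>\<^sup>+x. ennreal (\<phi> x) \<partial>(\<nu> \<bind> ker)) = (\<integral>\<^sup>+x. \<integral>\<^sup>+y. ennreal (\<phi> y) \<partial>ker x \<partial>\<nu>)"
    by (intro nn_integral_bind) auto
  also have "\<dots> = (\<integral>\<^sup>+x. ennreal (avg \<phi> x) \<partial>\<nu>)"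
  proof (rule nn_integral_cong)
    fix x
    have "(\<integral>\<^sup>+y. ennreal (\<phi> y) \<partial>ker x) = (\<integral>\<^sup>+v. ennreal (\<phi> (Q x v)) \<partial>std_gaussian)"
      unfolding ker_def by (subst nn_integral_distr) auto
    also have "\<dots> = ennreal (avg \<phi> x)"
      unfolding avg_def using \<phi>
      by (intro nn_integral_eq_integral integrable_std_gaussian_bounded[where B=1]) auto
    finally show "(\<integral>\<^sup>+y. ennreal (\<phi> y) \<partial>ker x) = ennreal (avg \<phi> x)" .
  qed
  finally show ?thesis .
qed

lemma bind_kernel_power_Suc:
  assumes "sets \<nu> = sets borel"
  shows "\<nu> \<bind> kernel_power ker (Suc m) = (\<nu> \<bind> kernel_power ker m) \<bind> ker"
proof -
  have "kernel_power ker m \<in> measurable \<nu> (subprob_algebra borel)"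
    using kernel_power_measurable assms by (simp cong: measurable_cong_sets)
  from bind_assoc[OF this ker_measurable] show ?thesis by simp
qed

lemma sets_bind_kernel_power:
  assumes "borel_prob \<nu>" shows "sets (\<nu> \<bind> kernel_power ker m) = sets borel"
proof -
  interpret prob_space \<nu> using assms by (simp add: borel_prob_def)
  have "kernel_power ker m \<in> measurable \<nu> (subprob_algebra borel)"
    using kernel_power_measurable assms by (simp add: borel_prob_def cong: measurable_cong_sets)
  from sets_bind[OF sets_kernel[OF this] not_empty] show ?thesis by simp
qed

text \<open>Kernel powers grow at the last step while the averages act on the test function, so the
  induction peels off the last kernel and generalises over \<phi>.\<close>

lemma nn_integral_kernel_power:
  assumes \<nu>: "borel_prob \<nu>"
    and "\<phi> \<in> borel_measurable borel" and "\<And>x. 0 \<le> \<phi> x \<and> \<phi> x \<le> 1"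
  shows "(\<integral>\<^sup>+x. ennreal (\<phi> x) \<partial>(\<nu> \<bind> kernel_power ker m)) = (\<integral>\<^sup>+x. ennreal ((avg ^^ m) \<phi> x) \<partial>\<nu>)"
  using assms(2,3)
proof (induction m arbitrary: \<phi>)
  case 0
  have "kernel_power ker 0 = return borel" by (simp add: fun_eq_iff)
  then show ?case using \<nu> by (simp add: bind_return'' borel_prob_def)
next
  case (Suc m)
  have "(\<integral>\<^sup>+x. ennreal (\<phi> x) \<partial>(\<nu> \<bind> kernel_power ker (Suc m))) = (\<integral>\<^sup>+x. ennreal (avg \<phi> x) \<partial>(\<nu> \<bind> kernel_power ker m))"
    using \<nu> Suc.prems by (simp add: bind_kernel_power_Suc borel_prob_def del: kernel_power.simps)
      (rule nn_integral_bind_ker, auto simp: sets_bind_kernel_power[OF \<nu>])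
  also have "\<dots> = (\<integral>\<^sup>+x. ennreal ((avg ^^ m) (avg \<phi>) x) \<partial>\<nu>)"
    using Suc.prems by (intro Suc.IH avg_bounds avg_measurable) auto
  finally show ?case by (simp add: funpow_swap1)
qed

lemma invariant_kernel_power:
  assumes "invariant_prob ker \<mu>" shows "\<mu> \<bind> kernel_power ker m = \<mu>"
proof (induction m)
  case 0
  have "kernel_power ker 0 = return borel" by (simp add: fun_eq_iff)
  then show ?case using assms by (simp add: bind_return'' invariant_prob_def borel_prob_def)
next
  case (Suc m)
  then show ?case using assms bind_kernel_power_Suc[of \<mu> m] by (simp add: invariant_prob_def borel_prob_def)
qed

text \<open>The constant 1 is fixed by the average, so total mass is preserved. Nonnegative
  integrals are used up to here because the Bochner integrals of bounded functions rest on this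
  fact.\<close>

lemma prob_bind_kernel_power:
  assumes "borel_prob \<nu>" shows "prob_space (\<nu> \<bind> kernel_power ker m)"
proof
  have "(avg ^^ m) (\<lambda>_. 1) = (\<lambda>_. 1)" by (induction m) (simp_all add: avg_def)
  then have "(\<integral>\<^sup>+x. ennreal 1 \<partial>(\<nu> \<bind> kernel_power ker m)) = (\<integral>\<^sup>+x. ennreal 1 \<partial>\<nu>)"
    using nn_integral_kernel_power[OF assms, of "\<lambda>_. 1" m] by simp
  then show "emeasure (\<nu> \<bind> kernel_power ker m) (space (\<nu> \<bind> kernel_power ker m)) = 1"
    using assms by (simp add: borel_prob_def prob_space.emeasure_space_1)
qed

text \<open>The innermost average is kept apart: it turns the indicator into a Lipschitz function,
  and only such functions are contracted by the remaining m averages.\<close>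

lemma measure_kernel_power:
  assumes \<nu>: "borel_prob \<nu>" and A: "A \<in> sets borel"
  shows "measure (\<nu> \<bind> kernel_power ker (Suc m)) A = (\<integral>x. (avg ^^ m) (avg (indicator A)) x \<partial>\<nu>)"
proof -
  interpret \<nu>: prob_space \<nu> using \<nu> by (simp add: borel_prob_def)
  interpret P: prob_space "\<nu> \<bind> kernel_power ker (Suc m)" by (rule prob_bind_kernel_power[OF \<nu>])
  have b: "(avg ^^ k) \<phi> \<in> borel_measurable borel \<and> (\<forall>x. 0 \<le> (avg ^^ k) \<phi> x \<and> (avg ^^ k) \<phi> x \<le> 1)"
    if "\<phi> \<in> borel_measurable borel" "\<And>x. 0 \<le> \<phi> x \<and> \<phi> x \<le> 1" for k \<phi>
    using that by (induction k) (auto simp: avg_bounds)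
  have i: "indicator A \<in> borel_measurable borel" using A by simp
  have b': "(avg ^^ Suc m) (indicator A) \<in> borel_measurable borel \<and>
    (\<forall>x. 0 \<le> (avg ^^ Suc m) (indicator A) x \<and> (avg ^^ Suc m) (indicator A) x \<le> 1)"
    by (rule b[OF i]) (auto simp: indicator_def)
  have "ennreal (measure (\<nu> \<bind> kernel_power ker (Suc m)) A) = (\<integral>\<^sup>+x. indicator A x \<partial>(\<nu> \<bind> kernel_power ker (Suc m)))"
    using A sets_bind_kernel_power[OF \<nu>, of "Suc m"] by (simp add: P.emeasure_eq_measure del: kernel_power.simps)
  also have "\<dots> = (\<integral>\<^sup>+x. ennreal (indicator A x) \<partial>(\<nu> \<bind> kernel_power ker (Suc m)))"
    by (simp only: ennreal_indicator)
  also have "\<dots> = (\<integral>\<^sup>+x. ennreal ((avg ^^ Suc m) (indicator A) x) \<partial>\<nu>)"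
    by (rule nn_integral_kernel_power[OF \<nu> i]) (auto simp: indicator_def)
  also have "\<dots> = ennreal (\<integral>x. (avg ^^ Suc m) (indicator A) x \<partial>\<nu>)"
  proof (rule nn_integral_eq_integral)
    show "integrable \<nu> ((avg ^^ Suc m) (indicator A))"
      by (rule \<nu>.integrable_const_bound[where B=1])
        (use b' \<nu> in \<open>auto simp: borel_prob_def abs_le_iff order_trans[of _ 0] simp del: funpow.simps cong: measurable_cong_sets intro!: AE_I2\<close>)
  qed (use b' in auto)
  finally have "measure (\<nu> \<bind> kernel_power ker (Suc m)) A = (\<integral>x. (avg ^^ Suc m) (indicator A) x \<partial>\<nu>)"
    by (subst (asm) ennreal_inj) (use b' in \<open>auto intro!: Bochner_Integration.integral_nonneg simp del: funpow.simps\<close>)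
  then show ?thesis by (simp add: funpow_swap1 del: kernel_power.simps)
qed

end
text \<open>Invariance writes both probabilities as integrals of one function. The comparison of the
  cost with \<beta> times \<open>l1\<close> is used once, for the regularised indicator, and costs
  1/\<beta>; the comparison with \<open>l1\<close> from above leads back to \<open>W1\<close> at the
  end.\<close>

lemma TV_kernel_power_le:
  fixes Q :: "(real^'k)^'n \<Rightarrow> (real^'k)^'n \<Rightarrow> (real^'k)^'n"
  assumes gk: "gaussian_kernel Q"
    and mu: "invariant_prob (gaussian_kernel.ker Q) \<mu>" and nu: "borel_prob \<nu>"
    and reg: "\<And>A x y. A \<in> sets borel \<Longrightarrow>
      \<bar>gaussian_kernel.avg Q (indicator A) x - gaussian_kernel.avg Q (indicator A) y\<bar> \<le> C0 * l1 (x - y)"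
    and contr: "\<And>\<phi> B C x y. \<phi> \<in> borel_measurable borel \<Longrightarrow> (\<And>a. \<bar>\<phi> a\<bar> \<le> B) \<Longrightarrow>
      (\<And>a b. \<bar>\<phi> a - \<phi> b\<bar> \<le> C * particle_cost \<beta> T a b) \<Longrightarrow> C > 0 \<Longrightarrow>
      \<bar>gaussian_kernel.avg Q \<phi> x - gaussian_kernel.avg Q \<phi> y\<bar> \<le> C * (1 - c) * particle_cost \<beta> T x y"
    and C0: "C0 > 0" and c: "c < 1" and \<beta>: "0 < \<beta>" "\<beta> \<le> 1" and T: "T > 0" and W: "W1 \<mu> \<nu> \<noteq> \<top>"
  shows "TV \<mu> (\<nu> \<bind> kernel_power (gaussian_kernel.ker Q) (Suc m)) \<le> C0 / \<beta> * (1 - c) ^ m * enn2real (W1 \<mu> \<nu>)"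
proof -
  interpret gaussian_kernel Q by (rule gk)
  have mu': "borel_prob \<mu>" using mu by (simp add: invariant_prob_def)
  interpret \<mu>: prob_space \<mu> using mu' by (simp add: borel_prob_def)
  interpret \<nu>: prob_space \<nu> using nu by (simp add: borel_prob_def)
  define D where "D = C0 / \<beta> * (1 - c) ^ m"
  have D: "D > 0" using C0 \<beta> c by (simp add: D_def)
  have main: "\<bar>measure \<mu> A - measure (\<nu> \<bind> kernel_power ker (Suc m)) A\<bar> \<le> D * enn2real (W1 \<mu> \<nu>)"
    if A: "A \<in> sets borel" for A
  proof -
    let ?F = "\<lambda>k. (avg ^^ k) (avg (indicator A))"
    have i: "avg (indicator A) \<in> borel_measurable borel" using A by simp
    \<comment> \<open>Lipschitz constants are measured in the concave cost during the iteration,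
      because that is the distance for which one step contracts.\<close>
    have F: "?F k \<in> borel_measurable borel \<and> (\<forall>x. 0 \<le> ?F k x \<and> ?F k x \<le> 1) \<and>
        (\<forall>x y. \<bar>?F k x - ?F k y\<bar> \<le> C0 / \<beta> * (1 - c) ^ k * particle_cost \<beta> T x y)" for k
    proof (induction k)
      case 0
      have "\<bar>avg (indicator A) x - avg (indicator A) y\<bar> \<le> C0 / \<beta> * particle_cost \<beta> T x y" for x y
      proof -
        have "C0 * l1 (x - y) = C0 / \<beta> * (\<beta> * l1 (x - y))" using \<beta> by simp
        also have "\<dots> \<le> C0 / \<beta> * particle_cost \<beta> T x y"
          using C0 \<beta> T by (intro mult_left_mono particle_cost_ge_l1) auto
        finally show ?thesis using reg[OF A, of x y] by linarith
      qed
      moreover have "0 \<le> avg (indicator A) x \<and> avg (indicator A) x \<le> 1" for x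
        using A by (intro avg_bounds) (auto simp: indicator_def)
      ultimately show ?case using i by simp
    next
      case (Suc k)
      have m: "?F k \<in> borel_measurable borel" and b: "\<And>x. 0 \<le> ?F k x \<and> ?F k x \<le> 1"
        and lip: "\<And>x y. \<bar>?F k x - ?F k y\<bar> \<le> C0 / \<beta> * (1 - c) ^ k * particle_cost \<beta> T x y" using Suc by auto
      have "\<bar>avg (?F k) x - avg (?F k) y\<bar> \<le> C0 / \<beta> * (1 - c) ^ k * (1 - c) * particle_cost \<beta> T x y" for x y
        by (rule contr[OF m _ lip, where B=1]) (use b C0 \<beta> c in auto)
      moreover have "avg (?F k) \<in> borel_measurable borel" using m by (rule avg_measurable)
      moreover have "0 \<le> avg (?F k) x \<and> avg (?F k) x \<le> 1" for x by (rule avg_bounds[OF m b])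
      ultimately show ?case by (simp add: mult.assoc mult.commute[of "1 - c"])
    qed
    have Fm: "?F m \<in> borel_measurable borel" and F01: "\<And>x. 0 \<le> ?F m x \<and> ?F m x \<le> 1"
      and Flip: "\<And>x y. \<bar>?F m x - ?F m y\<bar> \<le> D * particle_cost \<beta> T x y" using F[of m] by (auto simp: D_def)
    have "measure \<mu> A = (\<integral>x. ?F m x \<partial>\<mu>)"
      using measure_kernel_power[OF mu' A, of m] invariant_kernel_power[OF mu, of "Suc m"] by (simp del: kernel_power.simps)
    moreover have "measure (\<nu> \<bind> kernel_power ker (Suc m)) A = (\<integral>x. ?F m x \<partial>\<nu>)"
      by (rule measure_kernel_power[OF nu A])
    moreover have "\<bar>(\<integral>x. ?F m x \<partial>\<mu>) - (\<integral>x. ?F m x \<partial>\<nu>)\<bar> \<le> D * enn2real (W1 \<mu> \<nu>)"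
    proof -
      let ?d = "\<bar>(\<integral>x. ?F m x \<partial>\<mu>) - (\<integral>x. ?F m x \<partial>\<nu>)\<bar>"
      have "ennreal (?d / D) \<le> W1 \<mu> \<nu>"
        unfolding W1_def
      proof (rule INF_greatest)
        fix \<gamma> :: "(((real^'k)^'n) \<times> ((real^'k)^'n)) measure" assume "\<gamma> \<in> couplings \<mu> \<nu>"
        then have \<gamma>: "prob_space \<gamma>" "sets \<gamma> = sets (borel \<Otimes>\<^sub>M borel)" "distr \<gamma> borel fst = \<mu>" "distr \<gamma> borel snd = \<nu>"
          by (auto simp: couplings_def)
        interpret \<gamma>: prob_space \<gamma> by (rule \<gamma>)
        have [measurable_cong]: "sets \<gamma> = sets (borel \<Otimes>\<^sub>M borel)" by (rule \<gamma>)
        have [measurable]: "?F m \<in> borel_measurable borel" by (rule Fm)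
        have F1: "integrable \<gamma> (\<lambda>p. ?F m (fst p))" "integrable \<gamma> (\<lambda>p. ?F m (snd p))"
          by (rule \<gamma>.integrable_const_bound[where B=1]; use F01 in \<open>auto simp: abs_le_iff order_trans[of _ 0]\<close>)+
        have "(\<integral>x. ?F m x \<partial>\<mu>) = (\<integral>p. ?F m (fst p) \<partial>\<gamma>)" unfolding \<gamma>(3)[symmetric] by (rule integral_distr) auto
        moreover have "(\<integral>x. ?F m x \<partial>\<nu>) = (\<integral>p. ?F m (snd p) \<partial>\<gamma>)" unfolding \<gamma>(4)[symmetric] by (rule integral_distr) auto
        ultimately have "?d = \<bar>\<integral>p. ?F m (fst p) - ?F m (snd p) \<partial>\<gamma>\<bar>" using F1 by simp
        also have "\<dots> \<le> (\<integral>p. \<bar>?F m (fst p) - ?F m (snd p)\<bar> \<partial>\<gamma>)" by (rule integral_abs_bound)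
        finally have "ennreal ?d \<le> ennreal (\<integral>p. \<bar>?F m (fst p) - ?F m (snd p)\<bar> \<partial>\<gamma>)" by (rule ennreal_leI)
        also have "\<dots> = (\<integral>\<^sup>+p. ennreal \<bar>?F m (fst p) - ?F m (snd p)\<bar> \<partial>\<gamma>)"
          using F1 by (intro nn_integral_eq_integral[symmetric]) auto
        also have "\<dots> \<le> (\<integral>\<^sup>+p. ennreal D * ennreal (l1_dist (fst p) (snd p)) \<partial>\<gamma>)"
        proof (rule nn_integral_mono)
          fix p
          have "\<bar>?F m (fst p) - ?F m (snd p)\<bar> \<le> D * particle_cost \<beta> T (fst p) (snd p)" by (rule Flip)
          also have "\<dots> \<le> D * l1_dist (fst p) (snd p)"
            using D particle_cost_le_l1[of \<beta> T "fst p" "snd p"] \<beta> T by (intro mult_left_mono) (auto simp: l1_dist_eq_l1)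
          finally show "ennreal \<bar>?F m (fst p) - ?F m (snd p)\<bar> \<le> ennreal D * ennreal (l1_dist (fst p) (snd p))"
            using D by (simp add: ennreal_mult[symmetric] l1_dist_eq_l1 ennreal_leI)
        qed
        also have "\<dots> = ennreal D * (\<integral>\<^sup>+p. ennreal (l1_dist (fst p) (snd p)) \<partial>\<gamma>)"
        proof (rule nn_integral_cmult)
          have "continuous_on UNIV (\<lambda>p::((real^'k)^'n) \<times> ((real^'k)^'n). l1_dist (fst p) (snd p))"
            unfolding l1_dist_def by (intro continuous_intros)
          then have "(\<lambda>p::((real^'k)^'n) \<times> ((real^'k)^'n). l1_dist (fst p) (snd p)) \<in> borel_measurable (borel \<Otimes>\<^sub>M borel)"
            by (simp add: borel_prod borel_measurable_continuous_onI)
          then show "(\<lambda>p. ennreal (l1_dist (fst p) (snd p))) \<in> borel_measurable \<gamma>" by simp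
        qed
        finally have "ennreal (D * (?d / D)) \<le> ennreal D * (\<integral>\<^sup>+p. ennreal (l1_dist (fst p) (snd p)) \<partial>\<gamma>)" using D by simp
        then have "ennreal D * ennreal (?d / D) \<le> ennreal D * (\<integral>\<^sup>+p. ennreal (l1_dist (fst p) (snd p)) \<partial>\<gamma>)"
          using D by (simp only: ennreal_mult' less_imp_le)
        then show "ennreal (?d / D) \<le> (\<integral>\<^sup>+(x, y). ennreal (l1_dist x y) \<partial>\<gamma>)"
          using D by (subst (asm) ennreal_mult_le_mult_iff) (auto simp: split_def)
      qed
      then have "?d / D \<le> enn2real (W1 \<mu> \<nu>)"
        using W D enn2real_mono[of "ennreal (?d / D)" "W1 \<mu> \<nu>"] by (simp add: less_top)
      then show ?thesis using D by (simp add: field_simps)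
    qed
    ultimately show ?thesis by simp
  qed
  show ?thesis unfolding TV_def D_def[symmetric] by (rule cSUP_least) (use main in auto)
qed

text \<open>One consequence for each entry of the minimum, after h1 is dropped: 3/5 of 1/4 is 3/20,
  and 3/5 of 3/10 is 9/50. The last entry is multiplied by 64 L R^2 (L + K) / K to make the left
  side a square; the right side becomes 9 64 / (5 81920) = (3/80)^2.\<close>

lemma step_constants:
  fixes L K T R h1 :: real
  assumes L: "L > 0" and K: "K > 0" and T: "T > 0" and R: "R \<ge> 0" and h1: "h1 \<ge> 0"
    and T_h1: "ereal (L * (T + h1)\<^sup>2) \<le> ereal (3/5) *
          min (ereal (3 * K / (10 * L))) (min (ereal (1/4))
            (if R = 0 then \<infinity> else ereal (3 * K / (256 * 5 * 2^6 * L * R\<^sup>2 * (L + K)))))"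
  shows "L * T\<^sup>2 \<le> 3/20" "L\<^sup>2 * T\<^sup>2 \<le> (9/50) * K" "L * T * (8 * R * sqrt ((L + K) / K)) \<le> 3/80"
proof -
  have bound: "L * T\<^sup>2 \<le> (3/5) * y"
    if "min (ereal (3 * K / (10 * L))) (min (ereal (1/4))
            (if R = 0 then \<infinity> else ereal (3 * K / (256 * 5 * 2^6 * L * R\<^sup>2 * (L + K))))) \<le> ereal y" for y
  proof -
    have "ereal (L * (T + h1)\<^sup>2) \<le> ereal (3/5) * ereal y"
      by (rule order_trans[OF T_h1]) (intro ereal_mult_left_mono that; simp)
    then have "L * (T + h1)\<^sup>2 \<le> (3/5) * y" by simp
    moreover have "L * T\<^sup>2 \<le> L * (T + h1)\<^sup>2" using L T h1 by (intro mult_left_mono power_mono) auto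
    ultimately show ?thesis by linarith
  qed
  show "L * T\<^sup>2 \<le> 3/20" using bound[of "1/4"] by (simp add: min_le_iff_disj)
  have "L * T\<^sup>2 \<le> (3/5) * (3 * K / (10 * L))" by (rule bound) (simp add: min_le_iff_disj)
  then have "L * (L * T\<^sup>2) \<le> L * ((3/5) * (3 * K / (10 * L)))" using L by (intro mult_left_mono) auto
  then show "L\<^sup>2 * T\<^sup>2 \<le> (9/50) * K" using L by (simp add: power2_eq_square)
  show "L * T * (8 * R * sqrt ((L + K) / K)) \<le> 3/80"
  proof (cases "R = 0")
    case False
    then have R0: "R > 0" using R by simp
    have "L * T\<^sup>2 \<le> (3/5) * (3 * K / (256 * 5 * 2^6 * L * R\<^sup>2 * (L + K)))"
      using False by (intro bound) (simp add: min_le_iff_disj)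
    then have "(L * T\<^sup>2) * (64 * L * R\<^sup>2 * ((L + K) / K))
        \<le> ((3/5) * (3 * K / (256 * 5 * 2^6 * L * R\<^sup>2 * (L + K)))) * (64 * L * R\<^sup>2 * ((L + K) / K))"
      using L K by (intro mult_right_mono) auto
    also have "\<dots> = (3/80)\<^sup>2"
    proof -
      define D where "D = L * R\<^sup>2 * (L + K)"
      have "D \<noteq> 0" using L K R0 by (simp add: D_def)
      have "64 * L * R\<^sup>2 * ((L + K) / K) = 64 * (D / K)" "256 * 5 * 2^6 * L * R\<^sup>2 * (L + K) = 81920 * D"
        by (simp_all add: D_def)
      then show ?thesis using \<open>D \<noteq> 0\<close> K by (simp add: power_divide)
    qed
    also have "(L * T\<^sup>2) * (64 * L * R\<^sup>2 * ((L + K) / K)) = (L * T * (8 * R * sqrt ((L + K) / K)))\<^sup>2"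
      using L K by (simp add: power_mult_distrib) (simp add: power2_eq_square mult_ac)
    finally show ?thesis by (rule power2_le_imp_le) simp
  qed simp
qed

text \<open>With s = Rt/T one has (T + Rt)^2 = T^2 (1 + s)^2 and (1 + s)^2 \<le> exp (2 s); the
  factor exp (- 5 s) absorbs this and leaves exp (- 3 s) \<le> exp (- 5/4 s). The constant is small
  because K T^2 \<le> 3/20 is divided by 5364^2, where 5364 = 36 149.\<close>

lemma interaction_constant:
  fixes e K T Rt :: real
  assumes K: "K > 0" and T: "T > 0" and Rt: "Rt \<ge> 0" and KT: "K * T\<^sup>2 \<le> 3/20"
    and e: "e \<le> 1/2 * (K / (36 * 149))\<^sup>2 * (T + Rt)\<^sup>2 * exp (- 5 * (Rt / T))"
  shows "2 * e \<le> K * exp (- 5/4 * (Rt / T)) / 10000"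
proof -
  define s where "s = Rt / T"
  have s: "s \<ge> 0" using T Rt by (simp add: s_def)
  have "(1 + s)\<^sup>2 \<le> (exp s)\<^sup>2" using s by (intro power_mono exp_ge_add_one_self) auto
  also have "\<dots> = exp (2 * s)" by (simp flip: exp_of_nat_mult)
  finally have "(1 + s)\<^sup>2 * exp (- 5 * s) \<le> exp (2 * s) * exp (- 5 * s)" by (intro mult_right_mono) auto
  also have "\<dots> \<le> exp (- 5/4 * s)" using s by (simp flip: exp_add)
  finally have E: "(1 + s)\<^sup>2 * exp (- 5 * s) \<le> exp (- 5/4 * s)" .
  have Ts: "T + Rt = T * (1 + s)" using T by (simp add: s_def field_simps)
  have "2 * e \<le> (K / 5364)\<^sup>2 * (T + Rt)\<^sup>2 * exp (- 5 * s)" using e by (simp add: s_def)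
  also have "\<dots> = K * (K * T\<^sup>2) * ((1 + s)\<^sup>2 * exp (- 5 * s)) / 5364\<^sup>2"
    unfolding Ts by (simp add: power_mult_distrib power_divide) (simp add: power2_eq_square)
  also have "\<dots> \<le> K * (3/20) * exp (- 5/4 * s) / 5364\<^sup>2"
    using K KT E by (intro divide_right_mono mult_mono) auto
  also have "\<dots> \<le> K * exp (- 5/4 * s) / 10000"
    using K by (simp add: power2_eq_square)
  finally show ?thesis by (simp add: s_def)
qed

theorem corollary10:
  fixes V W :: "real^'k \<Rightarrow> real"
    and U :: "(real^'k)^'n \<Rightarrow> real"
    and \<epsilon> L Lt LH LHt R K T h1 h M c \<delta> :: real
    and \<mu> \<nu> :: "((real^'k)^'n) measure"
  assumes eps: "\<epsilon> \<ge> 0"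
    and U: "U = mean_field_potential \<epsilon> V W"
    and C3: "C3 V" "C3 W"
    and V_min: "\<forall>\<^sub>F a in nhds 0. V 0 \<le> V a"
    and V_0: "V 0 = 0"
    and L: "bdd_above (range (\<lambda>a. norm (Dbl (Dbl V) a)))" "L = (SUP a. norm (Dbl (Dbl V) a))"
    and Lt: "bdd_above (range (\<lambda>a. norm (Dbl (Dbl W) a)))" "Lt = (SUP a. norm (Dbl (Dbl W) a))"
    and LH: "bdd_above (range (\<lambda>a. norm (Dbl (Dbl (Dbl V)) a)))"
            "LH = (SUP a. norm (Dbl (Dbl (Dbl V)) a))"
    and LHt: "bdd_above (range (\<lambda>a. norm (Dbl (Dbl (Dbl W)) a)))"
             "LHt = (SUP a. norm (Dbl (Dbl (Dbl W)) a))"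
    and R: "R \<ge> 0"
    and K: "K > 0"
    and convex_far: "\<And>a b. norm (a - b) \<ge> R \<Longrightarrow>
          (a - b) \<bullet> (grad V a - grad V b) \<ge> K * (norm (a - b))\<^sup>2"
    and T: "T > 0"
    and h1: "h1 \<ge> 0"
    and T_h1: "ereal (L * (T + h1)\<^sup>2) \<le> ereal (3/5) *
          min (ereal (3 * K / (10 * L))) (min (ereal (1/4))
            (if R = 0 then \<infinity> else ereal (3 * K / (256 * 5 * 2^6 * L * R\<^sup>2 * (L + K)))))"
    and h1_le: "h1 \<le> K * T / (525 * L + 235 * K)"
    and eps_Lt: "\<bar>\<epsilon>\<bar> * Lt < min (K / 6)
          (1/2 * (K / (36 * 149))\<^sup>2 * (T + 8 * R * sqrt ((L + K) / K))\<^sup>2 *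
            exp (- 40 * (R / T) * sqrt ((L + K) / K)))"
    and h: "0 < h" "h \<le> h1"
    and T_h: "T / h \<in> \<nat>"
    and small: "(L + 4 * \<epsilon> * Lt) * (T\<^sup>2 + T * h) \<le> 1/6"
    and mu: "invariant_prob (uhmc_kernel U T h) \<mu>"
    and M: "M = exp (5/2 * (1 + 4 * R / T * sqrt ((L + K) / K)))"
    and c: "c = K * T\<^sup>2 / 156 * exp (- 10 * (R / T) * sqrt ((L + K) / K))"
    and delta: "\<delta> > 0"
    and nu: "borel_prob \<nu>"
  shows "ereal_of_enat (t_mix (uhmc_kernel U T h) \<mu> \<delta> \<nu>) \<le>
    max 1 (2 + ereal (1 / c) *
      ln_ext (ennreal (3 * sqrt (1 / T\<^sup>2 + 34 * real CARD('k) * (LH + 8 * \<epsilon> * LHt)\<^sup>2 * T^4) * M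
        / (2 * \<delta>)) * W1 \<mu> \<nu>))"
proof -
  have bV: "norm (Dbl (Dbl V) a) \<le> L" "norm (Dbl (Dbl (Dbl V)) a) \<le> LH" for a
    unfolding L(2) LH(2) by (rule cSUP_upper[OF UNIV_I L(1)], rule cSUP_upper[OF UNIV_I LH(1)])
  have bW: "norm (Dbl (Dbl W) a) \<le> Lt" "norm (Dbl (Dbl (Dbl W)) a) \<le> LHt" for a
    unfolding Lt(2) LHt(2) by (rule cSUP_upper[OF UNIV_I Lt(1)], rule cSUP_upper[OF UNIV_I LHt(1)])
  let ?G = "grad V" and ?H = "odd_force \<epsilon> W"
  let ?H1 = "\<lambda>a. \<epsilon> *\<^sub>R (hess W a + hess W (- a))" and ?H2 = "\<lambda>a. \<epsilon> *\<^sub>R (hess' W a - hess' W (- a))"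
  let ?l = "2 * \<epsilon> * Lt" and ?lH = "2 * \<epsilon> * LHt"
  interpret mean_field ?G ?H "hess V" ?H1 "hess' V" ?H2 L ?l LH ?lH
    by (rule mean_field_of_C3[OF eps C3 bV(1) bW(1) bV(2) bW(2)])
  have KL: "K \<le> L"
  proof -
    \<comment> \<open>Any nonzero vector of length at least R will do: along it the convexity of V
      and the Lipschitz bound on its gradient compare K with L.\<close>
    define a :: "real^'k" where "a = max R 1 *\<^sub>R axis undefined 1"
    have na: "norm a = max R 1" by (simp add: a_def)
    have "K * (norm (a - 0))\<^sup>2 \<le> (a - 0) \<bullet> (grad V a - grad V 0)" by (rule convex_far) (simp add: na)
    also have "\<dots> \<le> norm (a - 0) * norm (grad V a - grad V 0)" by (rule norm_cauchy_schwarz)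
    also have "\<dots> \<le> norm (a - 0) * (L * norm (a - 0))" by (intro mult_left_mono G_lipschitz) auto
    finally have "K * (norm a)\<^sup>2 \<le> L * (norm a)\<^sup>2" by (simp add: power2_eq_square mult_ac)
    moreover have "(norm a)\<^sup>2 > 0" by (simp add: na)
    ultimately show ?thesis by (rule mult_right_le_imp_le)
  qed
  have L0: "L > 0" using KL K by linarith
  note cs = step_constants[OF L0 K T R h1 T_h1]
  define Rt where "Rt = 8 * R * sqrt ((L + K) / K)"
  have sq1: "sqrt ((L + K) / K) \<ge> 1" using K L0 by simp
  have Rt: "Rt \<ge> 0" "2 * R \<le> Rt"
  proof -
    have "R * 1 \<le> R * sqrt ((L + K) / K)" using R sq1 by (intro mult_left_mono) auto
    then show "Rt \<ge> 0" "2 * R \<le> Rt" using R by (auto simp: Rt_def)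
  qed
  have KT: "K * T\<^sup>2 \<le> 3/20" using cs(1) mult_right_mono[OF KL, of "T\<^sup>2"] by simp
  have l_le: "?l \<le> K * exp (- 5/4 * (Rt / T)) / 10000"
  proof -
    have e40: "- 40 * (R / T) * sqrt ((L + K) / K) = - 5 * (Rt / T)" by (simp add: Rt_def)
    have "\<epsilon> * Lt \<le> 1/2 * (K / (36 * 149))\<^sup>2 * (T + Rt)\<^sup>2 * exp (- 5 * (Rt / T))"
      using eps_Lt unfolding min_less_iff_conj abs_of_nonneg[OF eps] e40 Rt_def[symmetric] by (intro less_imp_le) blast
    from interaction_constant[OF K T Rt(1) KT this] show ?thesis by simp
  qed
  have \<Lambda>L: "L + 2 * ?l \<le> (101/100) * L"
  proof -
    have "K * exp (- 5/4 * (Rt / T)) \<le> L * 1" using KL K Rt T L0 by (intro mult_mono) auto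
    then show ?thesis using l_le L0 by linarith
  qed
  obtain N where N: "T / h = real N" using T_h by (auto elim: Nats_cases)
  have TN: "T = real N * h" using N h(1) by (simp add: field_simps)
  have N0: "N > 0" using TN T by (cases N) auto
  have small': "(L + 2 * ?l) * T\<^sup>2 \<le> 1/6"
  proof -
    have "(L + 2 * ?l) * T\<^sup>2 \<le> (L + 2 * ?l) * (T\<^sup>2 + T * h)"
      using consts_nonneg T h(1) by (intro mult_left_mono) auto
    also have "\<dots> \<le> 1/6" using small by (simp add: mult.assoc)
    finally show ?thesis .
  qed
  define \<beta> where "\<beta> = exp (- 5/2 - 5/4 * (Rt / T))"
  have c': "c = K * T\<^sup>2 / 156 * exp (- 5/4 * (Rt / T))" by (simp add: c Rt_def)
  interpret C: mean_field_contraction ?G ?H "hess V" ?H1 "hess' V" ?H2 L ?l LH ?lH h T N K R Rt \<beta> c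
  proof unfold_locales
    show "L * T * Rt \<le> 3/80" using cs(3) by (simp add: Rt_def)
  qed (use h N0 TN small' K KL \<Lambda>L cs l_le R Rt convex_far in \<open>auto simp: \<beta>_def c'\<close>)
  let ?Q = "\<lambda>x v. C.q x v N :: (real^'k)^'n"
  have gk: "gaussian_kernel ?Q"
    by unfold_locales (intro C.continuous_on_q continuous_intros)
  have ker: "gaussian_kernel.ker ?Q = uhmc_kernel U T h"
  proof
    fix x :: "(real^'k)^'n"
    have "verlet_position U h x v T = C.q x v N" for v
      unfolding TN verlet_position_eq_vpos[OF h(1)] U grad_mean_field_potential[OF C3] C.q_def ..
    then show "gaussian_kernel.ker ?Q x = uhmc_kernel U T h x"
      unfolding gaussian_kernel.ker_def[OF gk] uhmc_kernel_def by simp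
  qed
  have avg: "gaussian_kernel.avg ?Q \<phi> x = (\<integral>v. \<phi> (C.q x v N) \<partial>std_gaussian)" for \<phi> x
    by (rule gaussian_kernel.avg_def[OF gk])
  define S where "S = sqrt (1 / T\<^sup>2 + 34 * real CARD('k) * (LH + 8 * \<epsilon> * LHt)\<^sup>2 * T^4)"
  have S: "S > 0" unfolding S_def using T by (intro real_sqrt_gt_zero add_pos_nonneg) auto
  have reg: "\<bar>gaussian_kernel.avg ?Q (indicator A) x - gaussian_kernel.avg ?Q (indicator A) y\<bar> \<le> (3/2 * S) * l1 (x - y)"
    if A: "A \<in> sets borel" for A x y
  proof -
    have "gaussian_kernel.avg ?Q (indicator A) x = measure std_gaussian {v. C.q x v N \<in> A}" for x
    proof -
      have "{v. C.q x v N \<in> A} \<in> sets borel" using measurable_sets_borel[OF C.measurable_q A] by (simp add: vimage_def)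
      moreover have "indicator A (C.q x v N) = (indicator {v. C.q x v N \<in> A} v :: real)" for v by (simp add: indicator_def)
      ultimately show ?thesis unfolding avg by simp
    qed
    then have "\<bar>gaussian_kernel.avg ?Q (indicator A) x - gaussian_kernel.avg ?Q (indicator A) y\<bar>
        \<le> sqrt ((C.u_bound (x - y))\<^sup>2 + (C.du_bound (x - y))\<^sup>2)"
      using C.verlet_law_diff[OF A, of x y] by simp
    also have "\<dots> \<le> sqrt ((3/2 * S * l1 (x - y))\<^sup>2)"
    proof (rule real_sqrt_le_mono)
      let ?z = "l1 (x - y)" and ?k = "real CARD('k)"
      have "(C.u_bound (x - y))\<^sup>2 = (144/121) * ((1 / T\<^sup>2) * ?z\<^sup>2)"
        by (simp add: C.u_bound_def power_mult_distrib power_divide)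
      moreover have "(C.du_bound (x - y))\<^sup>2 = ?k * (LH + 8 * \<epsilon> * LHt)\<^sup>2 * T^4 * ?z\<^sup>2"
      proof -
        have "LH + 4 * ?lH = LH + 8 * \<epsilon> * LHt" by simp
        then show ?thesis unfolding C.du_bound_def power_mult_distrib by (simp flip: power_mult add: mult.assoc)
      qed
      \<comment> \<open>The constants obtained are smaller than the stated ones: 144/121 \<le> 9/4,
        and 1 \<le> 153/2 = 34 9/4.\<close>
      moreover have "(3/2 * S * ?z)\<^sup>2 = (9/4) * ((1 / T\<^sup>2) * ?z\<^sup>2)
          + (153/2) * (?k * (LH + 8 * \<epsilon> * LHt)\<^sup>2 * T^4 * ?z\<^sup>2)"
      proof -
        have "S\<^sup>2 = 1 / T\<^sup>2 + 34 * ?k * (LH + 8 * \<epsilon> * LHt)\<^sup>2 * T^4"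
          unfolding S_def by (intro real_sqrt_pow2 add_nonneg_nonneg) auto
        then show ?thesis unfolding power_mult_distrib by (simp add: power2_eq_square algebra_simps)
      qed
      moreover have "0 \<le> (1 / T\<^sup>2) * ?z\<^sup>2" "0 \<le> ?k * (LH + 8 * \<epsilon> * LHt)\<^sup>2 * T^4 * ?z\<^sup>2" by auto
      ultimately show "(C.u_bound (x - y))\<^sup>2 + (C.du_bound (x - y))\<^sup>2 \<le> (3/2 * S * ?z)\<^sup>2" by linarith
    qed
    also have "\<dots> = (3/2 * S) * l1 (x - y)" using S by simp
    finally show ?thesis .
  qed
  have contr: "\<bar>gaussian_kernel.avg ?Q \<phi> x - gaussian_kernel.avg ?Q \<phi> y\<bar> \<le> C * (1 - c) * particle_cost \<beta> T x y"
    if "\<phi> \<in> borel_measurable borel" "\<And>a. \<bar>\<phi> a\<bar> \<le> B" "\<And>a b. \<bar>\<phi> a - \<phi> b\<bar> \<le> C * particle_cost \<beta> T a b" "C > 0"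
    for \<phi> B C x y
    unfolding avg by (rule C.contraction[OF that])
  have c0: "c > 0" using K T by (simp add: c)
  have c1: "c < 1"
  proof -
    have "c \<le> (3/20) / 156 * 1" unfolding c' using KT K T Rt by (intro mult_mono divide_right_mono) auto
    then show ?thesis by simp
  qed
  have M\<beta>: "M = 1 / \<beta>"
  proof -
    have e: "5/2 * (1 + 4 * R / T * sqrt ((L + K) / K)) = - (- 5/2 - 5/4 * (Rt / T))" by (simp add: Rt_def field_simps)
    show ?thesis unfolding M \<beta>_def e exp_minus inverse_eq_divide ..
  qed
  have \<beta>0: "\<beta> > 0" by (simp add: \<beta>_def)
  define W0 where "W0 = W1 \<mu> \<nu>"
  define C1 where "C1 = 3 * S * M / (2 * \<delta>)"
  have C1: "C1 > 0" using S delta \<beta>0 by (simp add: C1_def M\<beta>)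
  have goal: "ereal_of_enat (t_mix (uhmc_kernel U T h) \<mu> \<delta> \<nu>) \<le> max 1 (2 + ereal (1 / c) * ln_ext (ennreal C1 * W0))"
  proof (cases "W0 = \<top>")
    case True
    then have "ennreal C1 * W0 = \<top>" using C1 by (simp add: ennreal_mult_top)
    then show ?thesis using c0 by (simp add: ln_ext_def)
  next
    case False
    define w where "w = enn2real W0"
    have w0: "w \<ge> 0" by (simp add: w_def)
    have W0w: "W0 = ennreal w" using False by (simp add: w_def less_top)
    \<comment> \<open>The successor accounts for the regularising step, which comes in addition to
      the m contracting ones.\<close>
    have mix: "t_mix (uhmc_kernel U T h) \<mu> \<delta> \<nu> \<le> enat (Suc m)" if m: "C1 * w * exp (- c * real m) \<le> 1" for m
    proof -
      have "TV \<mu> (\<nu> \<bind> kernel_power (uhmc_kernel U T h) (Suc m)) \<le> (3/2 * S) / \<beta> * (1 - c) ^ m * w"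
        unfolding ker[symmetric] w_def W0_def
        by (rule TV_kernel_power_le[OF gk _ nu reg contr _ c1 \<beta>0 C.\<beta>_bounds(2) T])
          (use mu S False in \<open>auto simp: ker W0_def\<close>)
      also have "\<dots> \<le> (3/2 * S) / \<beta> * exp (- c * real m) * w"
      proof -
        have "(1 - c) ^ m \<le> exp (- c) ^ m"
          using exp_ge_add_one_self[of "- c"] c1 by (intro power_mono) auto
        also have "\<dots> = exp (- c * real m)" by (simp flip: exp_of_nat_mult add: mult.commute)
        finally show ?thesis using S \<beta>0 w0 by (intro mult_right_mono mult_left_mono) auto
      qed
      also have "\<dots> = \<delta> * (C1 * w * exp (- c * real m))"
        using delta by (simp add: C1_def M\<beta> mult_ac)
      also have "\<dots> \<le> \<delta> * 1" using m delta by (intro mult_left_mono) auto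
      finally have "TV \<mu> (\<nu> \<bind> kernel_power (uhmc_kernel U T h) (Suc m)) \<le> \<delta>" by simp
      then show ?thesis unfolding t_mix_def by (intro Inf_lower) blast
    qed
    show ?thesis
    proof (cases "w = 0")
      case True
      \<comment> \<open>At distance 0 the logarithm is -\<infinity>, while the regularising step is
        still counted; the maximum with 1 takes care of this.\<close>
      then have "t_mix (uhmc_kernel U T h) \<mu> \<delta> \<nu> \<le> enat (Suc 0)" by (intro mix) simp
      then have "ereal_of_enat (t_mix (uhmc_kernel U T h) \<mu> \<delta> \<nu>) \<le> ereal_of_enat (enat (Suc 0))"
        by (simp only: ereal_of_enat_le_iff)
      then have "ereal_of_enat (t_mix (uhmc_kernel U T h) \<mu> \<delta> \<nu>) \<le> 1" by (simp add: one_ereal_def)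
      then show ?thesis by (rule max.coboundedI1)
    next
      case False
      then have wp: "w > 0" using w0 by simp
      define A0 where "A0 = C1 * w"
      have A0: "A0 > 0" using C1 wp by (simp add: A0_def)
      \<comment> \<open>A negative logarithm gives m = 0 and the bound 1. Otherwise rounding up and
        the regularising step give m + 1 \<le> ln A0 / c + 2.\<close>
      define m where "m = nat \<lceil>ln A0 / c\<rceil>"
      have "ln A0 / c \<le> real m" unfolding m_def by linarith
      then have "ln A0 \<le> c * real m" using c0 by (simp add: field_simps)
      then have "A0 \<le> exp (c * real m)" using A0 by (metis exp_le_cancel_iff exp_ln)
      then have "A0 * exp (- c * real m) \<le> 1" by (simp add: exp_minus field_simps)
      then have "t_mix (uhmc_kernel U T h) \<mu> \<delta> \<nu> \<le> enat (Suc m)" unfolding A0_def by (rule mix)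
      then have "ereal_of_enat (t_mix (uhmc_kernel U T h) \<mu> \<delta> \<nu>) \<le> ereal_of_enat (enat (Suc m))"
        by (simp only: ereal_of_enat_le_iff)
      also have "\<dots> = ereal (real m + 1)" by simp
      also have "\<dots> \<le> max 1 (2 + ereal (1 / c) * ereal (ln A0))"
      proof -
        have "real m + 1 \<le> max 1 (2 + 1 / c * ln A0)" unfolding m_def by (simp add: max_def) linarith
        then show ?thesis by (auto simp: max_def one_ereal_def)
      qed
      also have "ereal (ln A0) = ln_ext (ennreal C1 * W0)"
      proof -
        have "ennreal C1 * W0 = ennreal A0" unfolding W0w A0_def using C1 w0 by (simp add: ennreal_mult)
        then show ?thesis using A0 by (simp add: ln_ext_def)
      qed
      finally show ?thesis .
    qed
  qed
  then show ?thesis unfolding C1_def S_def W0_def .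
qed

end
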